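(* Let $(R,\mathfrak{m})$ be a Cohen-Macaulay local ring with canonical module $\omega$ such that $\mathfrak{m}\subseteq\operatorname{tr}_R\omega$. Let $\mathbf{x}=x_1,\dots,x_r\in\mathfrak{m}$ be a regular sequence that is part of a witness to $g\ell\ell(R)$, and let $\overline{R}=R/\mathbf{x}R$. If $\operatorname{index}(R)=g\ell\ell(R)$, then \[ \operatorname{index}(R)=\operatorname{index}(\overline{R})=g\ell\ell(\overline{R}). \]
   Context: Local rings are commutative and Noetherian. For an $R$-module $M$, the trace $\operatorname{tr}_R M$ is the ideal of $R$ generated by all $R$-homomorphic images of $M$ in $R$. For a Cohen-Macaulay local ring $(S,\mathfrak{n})$ and a finitely generated $S$-module $M$, Auslander's invariant $\delta_S(M)$ is the smallest non-negative integer $n$ such that there is a surjective $S$-linear map $X\oplus S^n\to M$ with $X$ a maximal Cohen-Macaulay $S$-module having no free direct summand ($X=0$ allowed). One has $0\le\delta_S(S/\mathfrak{n}^n)\le\delta_S(S/\mathfrak{n}^{n+1})\le 1$ for all $n\ge1$, and $\operatorname{index}(S):=\inf\{n\ge 1 \mid \delta_S(S/\mathfrak{n}^n)=1\}$. The generalized Loewy length $g\ell\ell(S)$ is the smallest positive integer $n$ such that $\mathfrak{n}^n$ is contained in the ideal generated by some system of parameters of $S$. For a $d$-dimensional Cohen-Macaulay local ring $(R,\mathfrak{m})$ with $g=g\ell\ell(R)$, a maximal regular sequence $x_1,\dots,x_d\in\mathfrak{m}$ is a witness to $g\ell\ell(R)$ if $\mathfrak{m}^g\subseteq(x_1,\dots,x_d)R$.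 The sequence $x_1,\dots,x_r$ is part of a witness if it can be extended to a witness $x_1,\dots,x_r,x_{r+1},\dots,x_d$. *)

theory Defs
  imports "HOL-Algebra.Module" "HOL-Algebra.QuotRing" "HOL-Algebra.Ideal_Product"
    "HOL-Algebra.Ring_Divisibility" "HOL-Library.Extended_Nat"
begin

section \<open>Modules over a commutative ring\<close>

text \<open>
  A module record also carries the multiplicative ring fields; they play no role for modules and
  are filled arbitrarily below.
\<close>

definition reg_mod :: "('a, 'm) ring_scheme \<Rightarrow> ('a, 'a) module" where
  "reg_mod R = \<lparr>carrier = carrier R, monoid.mult = monoid.mult R, one = \<one>\<^bsub>R\<^esub>, zero = \<zero>\<^bsub>R\<^esub>,
     add = add R, smult = monoid.mult R\<rparr>"

text \<open>\<open>R\<^sup>n\<close>, as functions on \<open>{..<n}\<close> (extended by \<open>undefined\<close>).\<close>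

definition free_mod :: "('a, 'm) ring_scheme \<Rightarrow> nat \<Rightarrow> ('a, nat \<Rightarrow> 'a) module" where
  "free_mod R n = \<lparr>carrier = {..<n} \<rightarrow>\<^sub>E carrier R, monoid.mult = (\<lambda>v w. undefined), one = undefined,
     zero = (\<lambda>i\<in>{..<n}. \<zero>\<^bsub>R\<^esub>), add = (\<lambda>v w. \<lambda>i\<in>{..<n}. v i \<oplus>\<^bsub>R\<^esub> w i),
     smult = (\<lambda>a v. \<lambda>i\<in>{..<n}. a \<otimes>\<^bsub>R\<^esub> v i)\<rparr>"

definition dsum_mod ::
    "('a, 'b, 'm) module_scheme \<Rightarrow> ('a, 'c, 'n) module_scheme \<Rightarrow> ('a, 'b \<times> 'c) module" where
  "dsum_mod M N = \<lparr>carrier = carrier M \<times> carrier N, monoid.mult = (\<lambda>x y. undefined), one = undefined,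
     zero = (\<zero>\<^bsub>M\<^esub>, \<zero>\<^bsub>N\<^esub>),
     add = (\<lambda>(x, y) (x', y'). (x \<oplus>\<^bsub>M\<^esub> x', y \<oplus>\<^bsub>N\<^esub> y')),
     smult = (\<lambda>a (x, y). (a \<odot>\<^bsub>M\<^esub> x, a \<odot>\<^bsub>N\<^esub> y))\<rparr>"

definition quot_mod :: "('a, 'b, 'm) module_scheme \<Rightarrow> 'b set \<Rightarrow> ('a, 'b set) module" where
  "quot_mod M N = \<lparr>carrier = a_rcosets\<^bsub>M\<^esub> N, monoid.mult = (\<lambda>X Y. undefined), one = undefined,
     zero = N, add = set_add M,
     smult = (\<lambda>a X. \<Union>x\<in>X. N +>\<^bsub>M\<^esub> (a \<odot>\<^bsub>M\<^esub> x))\<rparr>"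

definition mod_hom :: "('a, 'm) ring_scheme \<Rightarrow> ('a, 'b, 'n) module_scheme \<Rightarrow>
    ('a, 'c, 'k) module_scheme \<Rightarrow> ('b \<Rightarrow> 'c) set" where
  "mod_hom R M N = {f \<in> carrier M \<rightarrow> carrier N.
     (\<forall>x\<in>carrier M. \<forall>y\<in>carrier M. f (x \<oplus>\<^bsub>M\<^esub> y) = f x \<oplus>\<^bsub>N\<^esub> f y) \<and>
     (\<forall>a\<in>carrier R. \<forall>x\<in>carrier M. f (a \<odot>\<^bsub>M\<^esub> x) = a \<odot>\<^bsub>N\<^esub> f x)}"

definition mod_iso :: "('a, 'm) ring_scheme \<Rightarrow> ('a, 'b, 'n) module_scheme \<Rightarrow>
    ('a, 'c, 'k) module_scheme \<Rightarrow> bool" where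
  "mod_iso R M N \<longleftrightarrow> (\<exists>f\<in>mod_hom R M N. bij_betw f (carrier M) (carrier N))"

text \<open>
  Homomorphisms are taken extensional, so that equality in the record is equality of maps.
\<close>

definition hom_mod :: "('a, 'm) ring_scheme \<Rightarrow> ('a, 'b, 'n) module_scheme \<Rightarrow>
    ('a, 'c, 'k) module_scheme \<Rightarrow> ('a, 'b \<Rightarrow> 'c) module" where
  "hom_mod R M N = \<lparr>carrier = mod_hom R M N \<inter> extensional (carrier M),
     monoid.mult = (\<lambda>f g. undefined), one = undefined,
     zero = (\<lambda>x\<in>carrier M. \<zero>\<^bsub>N\<^esub>),
     add = (\<lambda>f g. \<lambda>x\<in>carrier M. f x \<oplus>\<^bsub>N\<^esub> g x),
     smult = (\<lambda>a f. \<lambda>x\<in>carrier M. a \<odot>\<^bsub>N\<^esub> f x)\<rparr>"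

definition mod_span ::
    "('a, 'm) ring_scheme \<Rightarrow> ('a, 'b, 'n) module_scheme \<Rightarrow> 'b set \<Rightarrow> 'b set" where
  "mod_span R M A = \<Inter>{N. submodule N R M \<and> A \<subseteq> N}"

definition fin_gen_mod :: "('a, 'm) ring_scheme \<Rightarrow> ('a, 'b, 'n) module_scheme \<Rightarrow> bool" where
  "fin_gen_mod R M \<longleftrightarrow> module R M \<and>
     (\<exists>A. finite A \<and> A \<subseteq> carrier M \<and> mod_span R M A = carrier M)"

definition ideal_smult ::
    "('a, 'm) ring_scheme \<Rightarrow> 'a set \<Rightarrow> ('a, 'b, 'n) module_scheme \<Rightarrow> 'b set" where
  "ideal_smult R I M = mod_span R M {a \<odot>\<^bsub>M\<^esub> x | a x. a \<in> I \<and> x \<in> carrier M}"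

definition has_free_summand ::
    "('a, 'm) ring_scheme \<Rightarrow> ('a, 'b, 'n) module_scheme \<Rightarrow> bool" where
  "has_free_summand R X \<longleftrightarrow> (\<exists>Y Z n. submodule Y R X \<and> submodule Z R X \<and>
     Y \<inter> Z = {\<zero>\<^bsub>X\<^esub>} \<and> set_add X Y Z = carrier X \<and>
     n > 0 \<and> mod_iso R (X\<lparr>carrier := Z\<rparr>) (free_mod R n))"

definition trace_ideal :: "('a, 'm) ring_scheme \<Rightarrow> ('a, 'b, 'n) module_scheme \<Rightarrow> 'a set" where
  "trace_ideal R M = genideal R (\<Union>f\<in>mod_hom R M (reg_mod R). f ` carrier M)"


section \<open>Ext and injective dimension\<close>

text \<open>
  A resolution of \<open>N\<close> by free modules of finite rank:
  \<open>\<dots> \<rightarrow> R\<^bsup>b 1\<^esup> \<rightarrow> R\<^bsup>b 0\<^esup> \<rightarrow> N \<rightarrow> 0\<close>, with differentials \<open>D i\<close> out of \<open>R\<^bsup>b (i+1)\<^esup>\<close> and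
  augmentation \<open>e\<close>. It exists when \<open>R\<close> is Noetherian and \<open>N\<close> is finitely generated, and
  \<open>Ext_mod\<close> is meant to be used in that case only.
\<close>

definition free_resolution :: "('a, 'm) ring_scheme \<Rightarrow> ('a, 'b, 'n) module_scheme \<Rightarrow>
    (nat \<Rightarrow> nat) \<Rightarrow> (nat \<Rightarrow> (nat \<Rightarrow> 'a) \<Rightarrow> (nat \<Rightarrow> 'a)) \<Rightarrow> ((nat \<Rightarrow> 'a) \<Rightarrow> 'b) \<Rightarrow> bool" where
  "free_resolution R N b D e \<longleftrightarrow>
     (\<forall>i. D i \<in> mod_hom R (free_mod R (b (Suc i))) (free_mod R (b i))) \<and>
     e \<in> mod_hom R (free_mod R (b 0)) N \<and>
     e ` carrier (free_mod R (b 0)) = carrier N \<and>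
     D 0 ` carrier (free_mod R (b 1)) = a_kernel (free_mod R (b 0)) N e \<and>
     (\<forall>i. D (Suc i) ` carrier (free_mod R (b (Suc (Suc i)))) =
        a_kernel (free_mod R (b (Suc i))) (free_mod R (b i)) (D i))"

definition cocycles :: "('a, 'm) ring_scheme \<Rightarrow> ('a, 'c, 'k) module_scheme \<Rightarrow> (nat \<Rightarrow> nat) \<Rightarrow>
    (nat \<Rightarrow> (nat \<Rightarrow> 'a) \<Rightarrow> (nat \<Rightarrow> 'a)) \<Rightarrow> nat \<Rightarrow> ((nat \<Rightarrow> 'a) \<Rightarrow> 'c) set" where
  "cocycles R M b D i = {f \<in> carrier (hom_mod R (free_mod R (b i)) M).
     \<forall>v\<in>carrier (free_mod R (b (Suc i))). f (D i v) = \<zero>\<^bsub>M\<^esub>}"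

primrec coboundaries :: "('a, 'm) ring_scheme \<Rightarrow> ('a, 'c, 'k) module_scheme \<Rightarrow> (nat \<Rightarrow> nat) \<Rightarrow>
    (nat \<Rightarrow> (nat \<Rightarrow> 'a) \<Rightarrow> (nat \<Rightarrow> 'a)) \<Rightarrow> nat \<Rightarrow> ((nat \<Rightarrow> 'a) \<Rightarrow> 'c) set" where
  "coboundaries R M b D 0 = {\<zero>\<^bsub>hom_mod R (free_mod R (b 0)) M\<^esub>}"
| "coboundaries R M b D (Suc i) =
     (\<lambda>g. compose (carrier (free_mod R (b (Suc i)))) g (D i)) `
       carrier (hom_mod R (free_mod R (b i)) M)"

text \<open>
  \<open>Ext\<^sup>i(N, M)\<close>, computed from one chosen resolution of \<open>N\<close>; up to isomorphism the choice does
  not matter.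
\<close>

definition Ext_mod :: "('a, 'm) ring_scheme \<Rightarrow> nat \<Rightarrow> ('a, 'b, 'n) module_scheme \<Rightarrow>
    ('a, 'c, 'k) module_scheme \<Rightarrow> ('a, ((nat \<Rightarrow> 'a) \<Rightarrow> 'c) set) module" where
  "Ext_mod R i N M = (let (b, D, e) = (SOME (b, D, e). free_resolution R N b D e) in
     quot_mod ((hom_mod R (free_mod R (b i)) M)\<lparr>carrier := cocycles R M b D i\<rparr>)
       (coboundaries R M b D i))"

text \<open>
  The lifting property is tested on modules whose elements live in the element type of \<open>R\<close>. This
  includes \<open>R\<close> and all its ideals, so by Baer's criterion it is the lifting property for
  arbitrary modules.
\<close>

definition injective_mod :: "('a, 'm) ring_scheme \<Rightarrow> ('a, 'b, 'n) module_scheme \<Rightarrow> bool" where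
  "injective_mod R E \<longleftrightarrow> module R E \<and>
     (\<forall>(A :: ('a, 'a) module) (B :: ('a, 'a) module) i f. module R A \<longrightarrow> module R B \<longrightarrow>
        i \<in> mod_hom R A B \<longrightarrow> inj_on i (carrier A) \<longrightarrow> f \<in> mod_hom R A E \<longrightarrow>
        (\<exists>h\<in>mod_hom R B E. \<forall>x\<in>carrier A. h (i x) = f x))"

text \<open>
  \<open>M\<close> has a finite injective resolution whose terms have elements of type \<open>'e\<close>. HOL cannot
  quantify over \<open>'e\<close> inside the definition; where this occurs as a hypothesis with \<open>'e\<close> a free
  type variable, it says that there is a finite injective resolution with terms of some type.
\<close>

definition finite_inj_dim ::
    "'e itself \<Rightarrow> ('a, 'm) ring_scheme \<Rightarrow> ('a, 'b, 'n) module_scheme \<Rightarrow> bool" where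
  "finite_inj_dim T R M \<longleftrightarrow>
     (\<exists>n (E :: nat \<Rightarrow> ('a, 'e) module) (\<phi> :: nat \<Rightarrow> 'e \<Rightarrow> 'e) (\<epsilon> :: 'b \<Rightarrow> 'e).
        (\<forall>i. injective_mod R (E i)) \<and> (\<forall>i>n. carrier (E i) = {\<zero>\<^bsub>E i\<^esub>}) \<and>
        \<epsilon> \<in> mod_hom R M (E 0) \<and> inj_on \<epsilon> (carrier M) \<and>
        (\<forall>i. \<phi> i \<in> mod_hom R (E i) (E (Suc i))) \<and>
        \<epsilon> ` carrier M = a_kernel (E 0) (E 1) (\<phi> 0) \<and>
        (\<forall>i. \<phi> i ` carrier (E i) = a_kernel (E (Suc i)) (E (Suc (Suc i))) (\<phi> (Suc i))))"


section \<open>Local rings, depth and Cohen-Macaulay modules\<close>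

definition local_ring :: "('a, 'm) ring_scheme \<Rightarrow> bool" where
  "local_ring R \<longleftrightarrow> cring R \<and> noetherian_ring R \<and> (\<exists>!m. maximalideal m R)"

definition max_ideal :: "('a, 'm) ring_scheme \<Rightarrow> 'a set" where
  "max_ideal R = (THE m. maximalideal m R)"

abbreviation ideal_pow :: "('a, 'm) ring_scheme \<Rightarrow> 'a set \<Rightarrow> nat \<Rightarrow> 'a set" where
  "ideal_pow R I n \<equiv> I [^]\<^bsub>ideals_set R\<^esub> n"

definition residue_mod :: "('a, 'm) ring_scheme \<Rightarrow> ('a, 'a set) module" where
  "residue_mod R = quot_mod (reg_mod R) (max_ideal R)"

definition krull_dim :: "('a, 'm) ring_scheme \<Rightarrow> enat" where
  "krull_dim R = Sup {enat n | n. \<exists>P. (\<forall>i\<le>n. primeideal (P i) R) \<and> (\<forall>i<n. P i \<subset> P (Suc i))}"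

definition nonzerodivisor_on ::
    "('a, 'b, 'n) module_scheme \<Rightarrow> 'a \<Rightarrow> bool" where
  "nonzerodivisor_on M a \<longleftrightarrow> (\<forall>x\<in>carrier M. a \<odot>\<^bsub>M\<^esub> x = \<zero>\<^bsub>M\<^esub> \<longrightarrow> x = \<zero>\<^bsub>M\<^esub>)"

definition regular_seq ::
    "('a, 'm) ring_scheme \<Rightarrow> ('a, 'b, 'n) module_scheme \<Rightarrow> 'a list \<Rightarrow> bool" where
  "regular_seq R M xs \<longleftrightarrow> set xs \<subseteq> carrier R \<and>
     (\<forall>i<length xs. nonzerodivisor_on
        (quot_mod M (ideal_smult R (genideal R (set (take i xs))) M)) (xs ! i)) \<and>
     ideal_smult R (genideal R (set xs)) M \<noteq> carrier M"

definition depth_mod :: "('a, 'm) ring_scheme \<Rightarrow> ('a, 'b, 'n) module_scheme \<Rightarrow> enat" where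
  "depth_mod R M =
     Sup {enat (length xs) | xs. set xs \<subseteq> max_ideal R \<and> regular_seq R M xs}"

definition cohen_macaulay_local :: "('a, 'm) ring_scheme \<Rightarrow> bool" where
  "cohen_macaulay_local R \<longleftrightarrow> local_ring R \<and> depth_mod R (reg_mod R) = krull_dim R"

text \<open>Maximal Cohen-Macaulay modules are nonzero here; the zero module is treated separately.\<close>

definition maximal_cm :: "('a, 'm) ring_scheme \<Rightarrow> ('a, 'b, 'n) module_scheme \<Rightarrow> bool" where
  "maximal_cm R M \<longleftrightarrow> fin_gen_mod R M \<and> carrier M \<noteq> {\<zero>\<^bsub>M\<^esub>} \<and> depth_mod R M = krull_dim R"

text \<open>
  A canonical module is a maximal Cohen-Macaulay module of finite injective dimension and of
  type 1. The type is the dimension of \<open>Ext\<^sup>d(k, \<omega>)\<close> over the residue field \<open>k\<close>, where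
  \<open>d = dim R\<close>; that it is 1 means that \<open>Ext\<^sup>d(k, \<omega>)\<close> is isomorphic to \<open>k\<close>.
\<close>

definition canonical_module ::
    "'e itself \<Rightarrow> ('a, 'm) ring_scheme \<Rightarrow> ('a, 'b, 'n) module_scheme \<Rightarrow> bool" where
  "canonical_module T R \<omega> \<longleftrightarrow> maximal_cm R \<omega> \<and> finite_inj_dim T R \<omega> \<and>
     (\<exists>d. krull_dim R = enat d \<and>
        mod_iso R (Ext_mod R d (residue_mod R) \<omega>) (residue_mod R))"


section \<open>Auslander's invariant, index and generalized Loewy length\<close>

text \<open>
  The module \<open>X\<close> ranges over modules with elements of type \<open>(nat \<Rightarrow> 'a) set\<close>. This is no
  restriction: \<open>X\<close> is finitely generated, hence isomorphic to a quotient of some \<open>S\<^sup>n\<close>, whose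
  elements are cosets in \<open>free_mod S n\<close>.
\<close>

definition auslander_delta ::
    "('a, 'm) ring_scheme \<Rightarrow> ('a, 'b, 'n) module_scheme \<Rightarrow> nat" where
  "auslander_delta S M = (LEAST n. \<exists>X :: ('a, (nat \<Rightarrow> 'a) set) module.
     module S X \<and> (carrier X = {\<zero>\<^bsub>X\<^esub>} \<or> maximal_cm S X) \<and> \<not> has_free_summand S X \<and>
     (\<exists>f\<in>mod_hom S (dsum_mod X (free_mod S n)) M.
        f ` carrier (dsum_mod X (free_mod S n)) = carrier M))"

text \<open>The infimum of the empty set is \<open>\<infinity>\<close>.\<close>

definition auslander_index :: "('a, 'm) ring_scheme \<Rightarrow> enat" where
  "auslander_index S = Inf {enat n | n. n \<ge> 1 \<and>
     auslander_delta S (quot_mod (reg_mod S) (ideal_pow S (max_ideal S) n)) = 1}"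

text \<open>
  A system of parameters: \<open>dim R\<close> elements of the maximal ideal generating an ideal whose radical
  is the maximal ideal.
\<close>

definition system_of_parameters :: "('a, 'm) ring_scheme \<Rightarrow> 'a list \<Rightarrow> bool" where
  "system_of_parameters R xs \<longleftrightarrow> set xs \<subseteq> max_ideal R \<and> enat (length xs) = krull_dim R \<and>
     {a \<in> carrier R. \<exists>n::nat. a [^]\<^bsub>R\<^esub> n \<in> genideal R (set xs)} = max_ideal R"

definition gen_loewy_length :: "('a, 'm) ring_scheme \<Rightarrow> nat" where
  "gen_loewy_length S = (LEAST n. n \<ge> 1 \<and> (\<exists>xs. system_of_parameters S xs \<and>
     ideal_pow S (max_ideal S) n \<subseteq> genideal S (set xs)))"

text \<open>
  In a Cohen-Macaulay local ring a regular sequence in the maximal ideal is maximal exactly when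
  its length is the dimension.
\<close>

definition gll_witness :: "('a, 'm) ring_scheme \<Rightarrow> 'a list \<Rightarrow> bool" where
  "gll_witness R xs \<longleftrightarrow> set xs \<subseteq> max_ideal R \<and> regular_seq R (reg_mod R) xs \<and>
     enat (length xs) = krull_dim R \<and>
     ideal_pow R (max_ideal R) (gen_loewy_length R) \<subseteq> genideal R (set xs)"

definition part_of_gll_witness :: "('a, 'm) ring_scheme \<Rightarrow> 'a list \<Rightarrow> bool" where
  "part_of_gll_witness R xs \<longleftrightarrow> (\<exists>ys. gll_witness R (xs @ ys))"

end

theory Submission
  imports Defs
begin

text \<open>
  Write \<open>S = R/(x)\<close> and extend the part \<open>x\<close> of a witness to a witness \<open>z = (x, y)\<close>, a maximal regular
  sequence with \<open>\<mm>\<^sup>g \<subseteq> (z)\<close> and \<open>g = g\<ell>\<ell>(R)\<close>. Since systems of parameters of \<open>S\<close> lift to \<open>R\<close> and are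
  completed by \<open>x\<close>, \<open>g\<ell>\<ell>(S) = g\<close> (lemma \<open>gen_loewy_length_S\<close>). It remains to see that \<open>\<delta>(S/\<mm>\<^sup>gS) = 1\<close> and
  that \<open>\<delta>(R/\<mm>\<^sup>k) = 0\<close> implies \<open>\<delta>(S/\<mm>\<^sup>kS) = 0\<close>. Here \<open>\<delta> = 0\<close> means that the module is a homomorphic image
  of a maximal Cohen-Macaulay module \<open>X\<close> without free summand.

  Both claims follow from one lifting theorem, \<open>lift_surjection\<close>. Let \<open>I\<^sub>i = (z\<^sub>0, \<dots>, z\<^bsub>i-1\<^esub>)\<close> and let
  \<open>X\<close> be a maximal Cohen-Macaulay module over \<open>R/I\<^sub>r\<close>. If \<open>X\<close> maps onto \<open>R/I\<^bsub>r+k\<^esub>\<close>, then \<open>X\<close> maps onto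
  \<open>R/I\<^sub>r\<close>, and so has a free summand. If \<open>X\<close> over \<open>S\<close> maps onto \<open>S/\<mm>\<^sup>gS\<close>, then it maps onto the quotient
  \<open>R/(z)\<close> and the theorem shows that it has a free summand: the first claim. If \<open>X\<close> over \<open>R\<close> maps onto
  \<open>R/\<mm>\<^sup>k\<close> and has no free summand, then \<open>X/(x)X\<close> maps onto \<open>S/\<mm>\<^sup>kS\<close>, and by the theorem it has no free
  summand either: the second claim.

  A homomorphism \<open>X \<rightarrow> R/I\<^sub>i\<^sub>+\<^sub>1\<close> is lifted to \<open>R/I\<^sub>i\<close>, where \<open>I\<^sub>i\<close> kills \<open>X\<close>, as follows
  (\<open>lift_surjection_step\<close>). In a presentation \<open>X = F/N\<close> it comes from a map \<open>l : F \<rightarrow> R\<close> that on \<open>N\<close> equals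
  \<open>z\<^sub>i c\<close> modulo \<open>I\<^sub>i\<close>. As \<open>z\<^sub>i \<in> \<mm> \<subseteq> tr \<omega>\<close>, it is a combination of values \<open>h(w)\<close> of maps \<open>h : \<omega> \<rightarrow> \<mm>\<close>, and
  the maps \<open>c w : N \<rightarrow> \<omega>/I\<^sub>i\<omega>\<close> extend to \<open>F\<close> because \<open>Ext\<^sup>1(X, \<omega>/I\<^sub>i\<omega>) = 0\<close>. Hence \<open>z\<^sub>i c\<close> extends to a
  map \<open>\<mu> : F \<rightarrow> \<mm>\<close> modulo \<open>I\<^sub>i\<close>, and \<open>l - \<mu>\<close> induces a map \<open>X \<rightarrow> R/I\<^sub>i\<close>. It agrees with the given one
  only modulo \<open>\<mm>\<close>, but this suffices for surjectivity.

  The vanishing of \<open>Ext\<^sup>1\<close> holds over \<open>R/(z)\<close> because \<open>\<omega>/(z)\<omega>\<close> is injective there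
  (\<open>omega_reduction_injective\<close>), and it ascends from \<open>R/I\<^sub>i\<^sub>+\<^sub>1\<close> to \<open>R/I\<^sub>i\<close> by Nakayama's lemma
  (\<open>extends_step\<close>). For the injectivity, Bass's argument bounds the injective dimension of \<open>\<omega>\<close> on modules
  of finite length by \<open>d\<close> (\<open>ext_vanishes_finite_length\<close>), and the connecting maps
  \<open>\<omega>/I\<^sub>i\<omega> \<cong> Ext\<^sup>i(R/I\<^sub>i, \<omega>)\<close> are followed through a finite injective resolution
  (\<open>graph_correct_Suc\<close>). All this needs \<open>z\<close> to be regular on maximal Cohen-Macaulay modules
  (\<open>msum_regular\<close>), which is proved by counting primes: a depth argument gives chains above an associated
  prime, regularity on the ring gives chains below it.
\<close>

section \<open>Modules and linear combinations\<close>

text \<open>The module fields that only rings use are filled with \<open>undefined\<close>, as in \<open>free_mod\<close>.\<close>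

definition pow_mod :: "('a, 'b, 'k) module_scheme \<Rightarrow> nat \<Rightarrow> ('a, nat \<Rightarrow> 'b) module" where
  "pow_mod M n = \<lparr>carrier = {..<n} \<rightarrow>\<^sub>E carrier M, monoid.mult = (\<lambda>v w. undefined), one = undefined,
     zero = (\<lambda>i\<in>{..<n}. \<zero>\<^bsub>M\<^esub>), add = (\<lambda>v w. \<lambda>i\<in>{..<n}. v i \<oplus>\<^bsub>M\<^esub> w i),
     smult = (\<lambda>a v. \<lambda>i\<in>{..<n}. a \<odot>\<^bsub>M\<^esub> v i)\<rparr>"

definition acc_mod :: "('a, 'm) ring_scheme \<Rightarrow> ('a, 'b, 'k) module_scheme \<Rightarrow> bool" where
  "acc_mod R M \<longleftrightarrow> (\<forall>S :: nat \<Rightarrow> 'b set. (\<forall>k. submodule (S k) R M \<and> S k \<subseteq> S (Suc k)) \<longrightarrow>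
     (\<exists>k. \<forall>l\<ge>k. S l = S k))"

definition lin :: "('a, 'b, 'k) module_scheme \<Rightarrow> nat \<Rightarrow> (nat \<Rightarrow> 'a) \<Rightarrow> (nat \<Rightarrow> 'b) \<Rightarrow> 'b" where
  "lin M n v b = finsum M (\<lambda>l. v l \<odot>\<^bsub>M\<^esub> b l) {..<n}"

definition unitv :: "('a, 'm) ring_scheme \<Rightarrow> nat \<Rightarrow> nat \<Rightarrow> nat \<Rightarrow> 'a" where
  "unitv R n j = (\<lambda>i\<in>{..<n}. if i = j then \<one>\<^bsub>R\<^esub> else \<zero>\<^bsub>R\<^esub>)"

lemma free_mod_eq_pow_mod: "free_mod R n = pow_mod (reg_mod R) n"
  by (simp add: free_mod_def pow_mod_def reg_mod_def)

lemma reg_mod_simps [simp]: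
  "carrier (reg_mod R) = carrier R" "zero (reg_mod R) = zero R" "add (reg_mod R) = add R"
  "smult (reg_mod R) = monoid.mult R" "monoid.mult (reg_mod R) = monoid.mult R" "one (reg_mod R) = one R"
  by (auto simp: reg_mod_def)

lemma (in cring) reg_mod_module: "module R (reg_mod R)"
proof (rule moduleI)
  show "abelian_group (reg_mod R)"
    by (rule abelian_groupI) (auto simp: a_ac intro: bexI[of _ "\<ominus> x" for x] l_neg)
qed (auto simp: l_distr r_distr m_assoc is_cring)

lemma (in cring) reg_mod_a_inv:
  assumes "x \<in> carrier R" shows "\<ominus>\<^bsub>reg_mod R\<^esub> x = \<ominus> x"
proof -
  interpret G: module R "reg_mod R" by (rule reg_mod_module)
  show ?thesis using assms G.minus_equality[of "\<ominus> x" x] by (simp add: l_neg)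
qed

lemma (in cring) reg_mod_minus:
  "x \<in> carrier R \<Longrightarrow> y \<in> carrier R \<Longrightarrow> x \<ominus>\<^bsub>reg_mod R\<^esub> y = x \<ominus> y"
  by (simp add: a_minus_def reg_mod_a_inv)

context module
begin

lemma sub_carr: "submodule P R M \<Longrightarrow> x \<in> P \<Longrightarrow> x \<in> carrier M"
  using submoduleE(1) by blast
lemma sub_zero: "submodule P R M \<Longrightarrow> \<zero>\<^bsub>M\<^esub> \<in> P"
  by (metis submoduleE(1,2,4) R.zero_closed ex_in_conv smult_l_null subsetD)
lemma sub_add: "submodule P R M \<Longrightarrow> x \<in> P \<Longrightarrow> y \<in> P \<Longrightarrow> x \<oplus>\<^bsub>M\<^esub> y \<in> P"
  using submoduleE(5) by blast
lemma sub_neg: "submodule P R M \<Longrightarrow> x \<in> P \<Longrightarrow> \<ominus>\<^bsub>M\<^esub> x \<in> P"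
  using submoduleE(3) by blast
lemma sub_minus: "submodule P R M \<Longrightarrow> x \<in> P \<Longrightarrow> y \<in> P \<Longrightarrow> x \<ominus>\<^bsub>M\<^esub> y \<in> P"
  by (simp add: M.minus_eq sub_add sub_neg)
lemma sub_smult: "submodule P R M \<Longrightarrow> a \<in> carrier R \<Longrightarrow> x \<in> P \<Longrightarrow> a \<odot>\<^bsub>M\<^esub> x \<in> P"
  using submoduleE(4) by blast

lemmas sub_rules = sub_carr sub_zero sub_add sub_neg sub_minus sub_smult

lemma subI:
  assumes "H \<subseteq> carrier M" "\<zero>\<^bsub>M\<^esub> \<in> H"
    and "\<And>a b. a \<in> H \<Longrightarrow> b \<in> H \<Longrightarrow> a \<oplus>\<^bsub>M\<^esub> b \<in> H"
    and "\<And>a x. a \<in> carrier R \<Longrightarrow> x \<in> H \<Longrightarrow> a \<odot>\<^bsub>M\<^esub> x \<in> H"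
  shows "submodule H R M"
proof (rule submoduleI)
  fix a assume "a \<in> H"
  with assms(1) have "(\<ominus> \<one>) \<odot>\<^bsub>M\<^esub> a = \<ominus>\<^bsub>M\<^esub> a" by (subst smult_l_minus) auto
  with assms(4)[of "\<ominus> \<one>" a] \<open>a \<in> H\<close> show "\<ominus>\<^bsub>M\<^esub> a \<in> H" by simp
qed (use assms in auto)

lemma sub_zero_set: "submodule {\<zero>\<^bsub>M\<^esub>} R M"
  by (rule subI) auto

lemma smult_r_minus2: "a \<in> carrier R \<Longrightarrow> x \<in> carrier M \<Longrightarrow> y \<in> carrier M \<Longrightarrow>
   a \<odot>\<^bsub>M\<^esub> (x \<ominus>\<^bsub>M\<^esub> y) = a \<odot>\<^bsub>M\<^esub> x \<ominus>\<^bsub>M\<^esub> a \<odot>\<^bsub>M\<^esub> y"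
  by (simp add: M.minus_eq smult_r_distr smult_r_minus)
lemma smult_l_minus2: "a \<in> carrier R \<Longrightarrow> b \<in> carrier R \<Longrightarrow> x \<in> carrier M \<Longrightarrow>
   (a \<ominus> b) \<odot>\<^bsub>M\<^esub> x = a \<odot>\<^bsub>M\<^esub> x \<ominus>\<^bsub>M\<^esub> b \<odot>\<^bsub>M\<^esub> x"
  by (simp add: R.minus_eq M.minus_eq smult_l_distr smult_l_minus)
lemma smult_comm: "a \<in> carrier R \<Longrightarrow> b \<in> carrier R \<Longrightarrow> x \<in> carrier M \<Longrightarrow>
   a \<odot>\<^bsub>M\<^esub> (b \<odot>\<^bsub>M\<^esub> x) = b \<odot>\<^bsub>M\<^esub> (a \<odot>\<^bsub>M\<^esub> x)"
  by (metis smult_assoc1 R.m_comm)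

lemma add_minus_cancel: "x \<in> carrier M \<Longrightarrow> y \<in> carrier M \<Longrightarrow> (x \<ominus>\<^bsub>M\<^esub> y) \<oplus>\<^bsub>M\<^esub> y = x"
  by (simp add: M.minus_eq M.a_assoc M.l_neg)

lemma add_minus_cancel2: "x \<in> carrier M \<Longrightarrow> y \<in> carrier M \<Longrightarrow> (x \<oplus>\<^bsub>M\<^esub> y) \<ominus>\<^bsub>M\<^esub> y = x"
  by (simp add: M.minus_eq M.a_assoc M.r_neg)

lemma pow_mod_module: "module R (pow_mod M n)"
proof (rule moduleI)
  show "abelian_group (pow_mod M n)"
  proof (rule abelian_groupI)
    fix x assume "x \<in> carrier (pow_mod M n)"
    then show "\<exists>y\<in>carrier (pow_mod M n). y \<oplus>\<^bsub>pow_mod M n\<^esub> x = \<zero>\<^bsub>pow_mod M n\<^esub>"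
      by (intro bexI[of _ "\<lambda>i\<in>{..<n}. \<ominus>\<^bsub>M\<^esub> x i"])
         (auto simp: pow_mod_def M.l_neg PiE_iff intro!: ext)
  qed (auto simp: pow_mod_def PiE_iff M.a_ac extensional_def restrict_def intro!: ext)
qed (auto simp: pow_mod_def PiE_iff R.is_cring smult_l_distr smult_r_distr smult_assoc1
       extensional_def restrict_def intro!: ext)

end

lemma (in cring) free_mod_module: "module R (free_mod R n)"
  using module.pow_mod_module[OF reg_mod_module] by (simp add: free_mod_eq_pow_mod)

lemma (in cring) submodule_reg_iff: "submodule I R (reg_mod R) \<longleftrightarrow> ideal I R"
proof -
  interpret G: module R "reg_mod R" by (rule reg_mod_module)
  show ?thesis
  proof
    assume s: "submodule I R (reg_mod R)"
    note E = G.submoduleE[OF s]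
    have c: "x \<in> carrier R" if "x \<in> I" for x using E(1) that by auto
    have m: "a \<otimes> x \<in> I" if "a \<in> carrier R" "x \<in> I" for a x using E(4)[OF that] by simp
    obtain x where x: "x \<in> I" using E(2) by blast
    show "ideal I R"
    proof (rule idealI)
      show "ring R" by (rule ring_axioms)
      show "subgroup I (add_monoid R)"
      proof (rule add.subgroupI)
        show "I \<subseteq> carrier R" using c by blast
        show "I \<noteq> {}" using x by blast
        fix a b assume ab: "a \<in> I" "b \<in> I"
        have "\<ominus> a = \<ominus> \<one> \<otimes> a" using c[OF ab(1)] by (simp add: l_minus)
        then show "\<ominus> a \<in> I" using m[of "\<ominus> \<one>" a] ab by simp
        show "a \<oplus> b \<in> I" using E(5)[OF ab] by simp
      qed
      fix a x assume "a \<in> I" "x \<in> carrier R"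
      then show "x \<otimes> a \<in> I" "a \<otimes> x \<in> I" using m[of x a] c[of a] m_comm[of a x] by simp_all
    qed
  next
    assume i: "ideal I R"
    show "submodule I R (reg_mod R)"
    proof (rule G.subI)
      show "I \<subseteq> carrier (reg_mod R)" using ideal.Icarr[OF i] by auto
      show "\<zero>\<^bsub>reg_mod R\<^esub> \<in> I"
        using additive_subgroup.zero_closed[OF ideal.axioms(1)[OF i]] by simp
    qed (use additive_subgroup.a_closed[OF ideal.axioms(1)[OF i]] ideal.I_l_closed[OF i] in simp_all)
  qed
qed

context module
begin

lemma lin_0: "lin M 0 v b = \<zero>\<^bsub>M\<^esub>" by (simp add: lin_def)

lemma lin_Suc:
  assumes "v \<in> {..<Suc n} \<rightarrow> carrier R" "b \<in> {..<Suc n} \<rightarrow> carrier M"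
  shows "lin M (Suc n) v b = v n \<odot>\<^bsub>M\<^esub> b n \<oplus>\<^bsub>M\<^esub> lin M n v b"
  unfolding lin_def lessThan_Suc
  by (rule M.finsum_insert) (use assms in \<open>auto simp: Pi_iff\<close>)

lemma lin_closed:
  assumes "v \<in> {..<n} \<rightarrow> carrier R" "b \<in> {..<n} \<rightarrow> carrier M"
  shows "lin M n v b \<in> carrier M"
  unfolding lin_def by (rule M.finsum_closed) (use assms in \<open>auto simp: Pi_iff\<close>)

lemma lin_cong:
  assumes "v \<in> {..<n} \<rightarrow> carrier R" "b \<in> {..<n} \<rightarrow> carrier M"
    "\<And>i. i < n \<Longrightarrow> v i = v' i" "\<And>i. i < n \<Longrightarrow> b i = b' i"
  shows "lin M n v b = lin M n v' b'"
  unfolding lin_def by (rule M.finsum_cong') (use assms in \<open>auto simp: Pi_iff\<close>)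

lemma lin_in_sub:
  assumes "submodule P R M" "v \<in> {..<n} \<rightarrow> carrier R" "b \<in> {..<n} \<rightarrow> P"
  shows "lin M n v b \<in> P"
  using assms
proof (induction n)
  case 0 then show ?case by (simp add: lin_0 sub_zero)
next
  case (Suc n)
  have "b \<in> {..<Suc n} \<rightarrow> carrier M" using Suc.prems sub_carr by blast
  then have "lin M (Suc n) v b = v n \<odot>\<^bsub>M\<^esub> b n \<oplus>\<^bsub>M\<^esub> lin M n v b"
    using Suc.prems lin_Suc by blast
  then show ?case using Suc by (auto simp: Pi_iff intro!: sub_add sub_smult)
qed

lemma lin_add:
  assumes "v \<in> {..<n} \<rightarrow> carrier R" "w \<in> {..<n} \<rightarrow> carrier R" "b \<in> {..<n} \<rightarrow> carrier M"
    "\<And>i. i < n \<Longrightarrow> u i = v i \<oplus> w i"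
  shows "lin M n u b = lin M n v b \<oplus>\<^bsub>M\<^esub> lin M n w b"
proof -
  have "lin M n u b = finsum M (\<lambda>l. v l \<odot>\<^bsub>M\<^esub> b l \<oplus>\<^bsub>M\<^esub> w l \<odot>\<^bsub>M\<^esub> b l) {..<n}"
    unfolding lin_def
    by (rule M.finsum_cong') (use assms in \<open>auto simp: Pi_iff smult_l_distr\<close>)
  also have "\<dots> = lin M n v b \<oplus>\<^bsub>M\<^esub> lin M n w b"
    unfolding lin_def by (rule M.finsum_addf) (use assms in \<open>auto simp: Pi_iff\<close>)
  finally show ?thesis .
qed

lemma lin_smult:
  assumes "v \<in> {..<n} \<rightarrow> carrier R" "b \<in> {..<n} \<rightarrow> carrier M" "a \<in> carrier R"
    "\<And>i. i < n \<Longrightarrow> u i = a \<otimes> v i"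
  shows "lin M n u b = a \<odot>\<^bsub>M\<^esub> lin M n v b"
proof -
  have "a \<odot>\<^bsub>M\<^esub> lin M n v b = finsum M (\<lambda>l. a \<odot>\<^bsub>M\<^esub> (v l \<odot>\<^bsub>M\<^esub> b l)) {..<n}"
    unfolding lin_def by (rule finsum_smult_ldistr) (use assms in \<open>auto simp: Pi_iff\<close>)
  also have "\<dots> = lin M n u b"
    unfolding lin_def
    by (rule M.finsum_cong') (use assms in \<open>auto simp: Pi_iff smult_assoc1\<close>)
  finally show ?thesis by simp
qed

lemma lin_add_r:
  assumes "v \<in> {..<n} \<rightarrow> carrier R" "b \<in> {..<n} \<rightarrow> carrier M" "b' \<in> {..<n} \<rightarrow> carrier M"
    "\<And>i. i < n \<Longrightarrow> c i = b i \<oplus>\<^bsub>M\<^esub> b' i"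
  shows "lin M n v c = lin M n v b \<oplus>\<^bsub>M\<^esub> lin M n v b'"
proof -
  have "lin M n v c = finsum M (\<lambda>l. v l \<odot>\<^bsub>M\<^esub> b l \<oplus>\<^bsub>M\<^esub> v l \<odot>\<^bsub>M\<^esub> b' l) {..<n}"
    unfolding lin_def
    by (rule M.finsum_cong') (use assms in \<open>auto simp: Pi_iff smult_r_distr\<close>)
  also have "\<dots> = lin M n v b \<oplus>\<^bsub>M\<^esub> lin M n v b'"
    unfolding lin_def by (rule M.finsum_addf) (use assms in \<open>auto simp: Pi_iff\<close>)
  finally show ?thesis .
qed

lemma lin_smult_r:
  assumes "v \<in> {..<n} \<rightarrow> carrier R" "b \<in> {..<n} \<rightarrow> carrier M" "a \<in> carrier R"
    "\<And>i. i < n \<Longrightarrow> c i = a \<odot>\<^bsub>M\<^esub> b i"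
  shows "lin M n v c = a \<odot>\<^bsub>M\<^esub> lin M n v b"
proof -
  have "a \<odot>\<^bsub>M\<^esub> lin M n v b = finsum M (\<lambda>l. a \<odot>\<^bsub>M\<^esub> (v l \<odot>\<^bsub>M\<^esub> b l)) {..<n}"
    unfolding lin_def by (rule finsum_smult_ldistr) (use assms in \<open>auto simp: Pi_iff\<close>)
  also have "\<dots> = lin M n v c"
    unfolding lin_def
    by (rule M.finsum_cong') (use assms in \<open>auto simp: Pi_iff smult_comm\<close>)
  finally show ?thesis by simp
qed

lemma lin_zero_tail:
  assumes "v \<in> {..<n} \<rightarrow> carrier R" "b \<in> {..<n} \<rightarrow> carrier M" "m \<le> n"
    "\<And>i. m \<le> i \<Longrightarrow> i < n \<Longrightarrow> v i = \<zero>"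
  shows "lin M n v b = lin M m v b"
  using assms
proof (induction n)
  case (Suc n)
  show ?case
  proof (cases "m = Suc n")
    case False
    then have m: "m \<le> n" using Suc.prems by simp
    have "lin M (Suc n) v b = v n \<odot>\<^bsub>M\<^esub> b n \<oplus>\<^bsub>M\<^esub> lin M n v b"
      using Suc.prems by (intro lin_Suc) auto
    also have "\<dots> = lin M n v b"
      using Suc.prems m lin_closed[of v n b] by (simp add: Pi_iff)
    also have "\<dots> = lin M m v b" using Suc.prems m by (intro Suc.IH) auto
    finally show ?thesis .
  qed simp
qed simp

lemma unitv_carrier: "unitv R n j \<in> carrier (free_mod R n)"
  by (auto simp: unitv_def free_mod_def)

lemma unitv_Pi: "unitv R n j \<in> {..<n} \<rightarrow> carrier R"
  by (auto simp: unitv_def)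

lemma lin_unitv:
  assumes "j < n" "b \<in> {..<n} \<rightarrow> carrier M"
  shows "lin M n (unitv R n j) b = b j"
proof -
  have "lin M n (unitv R n j) b = finsum M (\<lambda>l. if j = l then b l else \<zero>\<^bsub>M\<^esub>) {..<n}"
    unfolding lin_def by (rule M.finsum_cong') (use assms in \<open>auto simp: Pi_iff unitv_def\<close>)
  also have "\<dots> = b j" using assms by (intro M.finsum_singleton) auto
  finally show ?thesis .
qed

end

lemma free_mod_carrier_iff: "v \<in> carrier (free_mod R n) \<longleftrightarrow> v \<in> {..<n} \<rightarrow>\<^sub>E carrier R"
  by (simp add: free_mod_def)

lemma free_mod_Pi: "v \<in> carrier (free_mod R n) \<Longrightarrow> v \<in> {..<n} \<rightarrow> carrier R"
  by (auto simp: free_mod_def)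

lemma free_mod_add_apply: "i < n \<Longrightarrow> (v \<oplus>\<^bsub>free_mod R n\<^esub> w) i = v i \<oplus>\<^bsub>R\<^esub> w i"
  by (simp add: free_mod_def)
lemma free_mod_smult_apply: "i < n \<Longrightarrow> (a \<odot>\<^bsub>free_mod R n\<^esub> w) i = a \<otimes>\<^bsub>R\<^esub> w i"
  by (simp add: free_mod_def)
lemma free_mod_zero_apply: "i < n \<Longrightarrow> \<zero>\<^bsub>free_mod R n\<^esub> i = \<zero>\<^bsub>R\<^esub>"
  by (simp add: free_mod_def)

lemmas free_mod_apply = free_mod_add_apply free_mod_smult_apply free_mod_zero_apply

lemma mod_homD:
  assumes "f \<in> mod_hom R M N"
  shows "x \<in> carrier M \<Longrightarrow> f x \<in> carrier N"
    "x \<in> carrier M \<Longrightarrow> y \<in> carrier M \<Longrightarrow> f (x \<oplus>\<^bsub>M\<^esub> y) = f x \<oplus>\<^bsub>N\<^esub> f y"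
    "a \<in> carrier R \<Longrightarrow> x \<in> carrier M \<Longrightarrow> f (a \<odot>\<^bsub>M\<^esub> x) = a \<odot>\<^bsub>N\<^esub> f x"
  using assms by (auto simp: mod_hom_def)

lemma mod_homI:
  assumes "\<And>x. x \<in> carrier M \<Longrightarrow> f x \<in> carrier N"
    "\<And>x y. x \<in> carrier M \<Longrightarrow> y \<in> carrier M \<Longrightarrow> f (x \<oplus>\<^bsub>M\<^esub> y) = f x \<oplus>\<^bsub>N\<^esub> f y"
    "\<And>a x. a \<in> carrier R \<Longrightarrow> x \<in> carrier M \<Longrightarrow> f (a \<odot>\<^bsub>M\<^esub> x) = a \<odot>\<^bsub>N\<^esub> f x"
  shows "f \<in> mod_hom R M N"
  using assms by (auto simp: mod_hom_def)

lemma mod_hom_zero_minus: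
  assumes "module R M" "module R N" "f \<in> mod_hom R M N"
  shows "f \<zero>\<^bsub>M\<^esub> = \<zero>\<^bsub>N\<^esub>"
    "x \<in> carrier M \<Longrightarrow> f (\<ominus>\<^bsub>M\<^esub> x) = \<ominus>\<^bsub>N\<^esub> f x"
    "x \<in> carrier M \<Longrightarrow> y \<in> carrier M \<Longrightarrow> f (x \<ominus>\<^bsub>M\<^esub> y) = f x \<ominus>\<^bsub>N\<^esub> f y"
proof -
  interpret M: module R M by fact
  interpret N: module R N by fact
  note h = mod_homD[OF assms(3)]
  show z: "f \<zero>\<^bsub>M\<^esub> = \<zero>\<^bsub>N\<^esub>"
    using h(3)[of "\<zero>\<^bsub>R\<^esub>" "\<zero>\<^bsub>M\<^esub>"] h(1)[of "\<zero>\<^bsub>M\<^esub>"] by simp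
  show m: "f (\<ominus>\<^bsub>M\<^esub> x) = \<ominus>\<^bsub>N\<^esub> f x" if "x \<in> carrier M" for x
  proof -
    have "f (\<ominus>\<^bsub>M\<^esub> x) \<oplus>\<^bsub>N\<^esub> f x = \<zero>\<^bsub>N\<^esub>"
      using h(2)[of "\<ominus>\<^bsub>M\<^esub> x" x] that z by (simp add: M.M.l_neg)
    then show ?thesis using that h(1) by (metis N.M.minus_equality M.M.a_inv_closed)
  qed
  show "f (x \<ominus>\<^bsub>M\<^esub> y) = f x \<ominus>\<^bsub>N\<^esub> f y" if "x \<in> carrier M" "y \<in> carrier M"
    using that by (simp add: M.M.minus_eq N.M.minus_eq h m)
qed

context module
begin

lemma lin_mod_hom:
  assumes "b \<in> {..<n} \<rightarrow> carrier M"
  shows "(\<lambda>v. lin M n v b) \<in> mod_hom R (free_mod R n) M"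
proof (rule mod_homI, goal_cases)
  case (1 x) then show ?case using assms free_mod_Pi by (blast intro: lin_closed)
next
  case (2 x y) then show ?case using assms
    by (intro lin_add) (auto simp: free_mod_apply dest: free_mod_Pi)
next
  case (3 a x) then show ?case using assms
    by (intro lin_smult) (auto simp: free_mod_apply dest: free_mod_Pi)
qed

end

lemma mod_hom_lin:
  assumes "module R M" "module R N" "f \<in> mod_hom R M N"
    "v \<in> {..<n} \<rightarrow> carrier R" "b \<in> {..<n} \<rightarrow> carrier M"
  shows "f (lin M n v b) = lin N n v (\<lambda>i. f (b i))"
proof -
  interpret M: module R M by fact
  interpret N: module R N by fact
  note h = mod_homD[OF assms(3)]
  show ?thesis using assms(4,5)
  proof (induction n)
    case 0 then show ?case by (simp add: M.lin_0 N.lin_0 mod_hom_zero_minus(1)[OF assms(1-3)])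
  next
    case (Suc n)
    have 1: "v n \<in> carrier R" "b n \<in> carrier M" "v \<in> {..<n} \<rightarrow> carrier R" "b \<in> {..<n} \<rightarrow> carrier M"
      using Suc.prems by auto
    have "lin N (Suc n) v (\<lambda>i. f (b i)) = v n \<odot>\<^bsub>N\<^esub> f (b n) \<oplus>\<^bsub>N\<^esub> lin N n v (\<lambda>i. f (b i))"
      using Suc.prems h by (intro N.lin_Suc) auto
    moreover have "lin M (Suc n) v b = v n \<odot>\<^bsub>M\<^esub> b n \<oplus>\<^bsub>M\<^esub> lin M n v b"
      using Suc.prems by (intro M.lin_Suc) auto
    ultimately show ?case
      using 1 Suc.IH M.lin_closed[OF 1(3,4)] by (simp add: h)
  qed
qed

lemma (in cring) lin_reg_unit:
  assumes "v \<in> carrier (free_mod R n)"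
  shows "lin (free_mod R n) n v (unitv R n) = v"
proof -
  interpret G: module R "reg_mod R" by (rule reg_mod_module)
  interpret F: module R "free_mod R n" by (rule free_mod_module)
  have c: "lin (free_mod R n) n v (unitv R n) \<in> carrier (free_mod R n)"
    using free_mod_Pi[OF assms] G.unitv_carrier by (intro F.lin_closed) auto
  show ?thesis
  proof (rule PiE_ext)
    show "lin (free_mod R n) n v (unitv R n) \<in> {..<n} \<rightarrow>\<^sub>E carrier R" using c by (simp add: free_mod_def)
    show "v \<in> {..<n} \<rightarrow>\<^sub>E carrier R" using assms by (simp add: free_mod_def)
    fix i assume i: "i \<in> {..<n}"
    have p: "(\<lambda>v. v i) \<in> mod_hom R (free_mod R n) (reg_mod R)"
      using i by (intro mod_homI) (auto simp: free_mod_def)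
    have "lin (free_mod R n) n v (unitv R n) i = lin (reg_mod R) n v (\<lambda>j. unitv R n j i)"
      using i free_mod_Pi[OF assms] G.unitv_carrier
      by (intro mod_hom_lin[OF F.module_axioms G.module_axioms p]) auto
    also have "\<dots> = lin (reg_mod R) n (unitv R n i) v"
      unfolding lin_def
      apply (rule G.M.finsum_cong')
      using i assms by (auto simp: unitv_def free_mod_def Pi_iff PiE_iff)
    also have "\<dots> = v i" using i free_mod_Pi[OF assms] by (intro G.lin_unitv) auto
    finally show "lin (free_mod R n) n v (unitv R n) i = v i" .
  qed
qed

section \<open>The ascending chain condition\<close>

lemma mono_chain: "(\<And>k. S k \<subseteq> S (Suc k)) \<Longrightarrow> i \<le> j \<Longrightarrow> S i \<subseteq> (S j :: 'z set)"
  using lift_Suc_mono_le[of S i j] by blast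

lemma (in cring) acc_reg_mod:
  assumes "noetherian_ring R"
  shows "acc_mod R (reg_mod R)"
  unfolding acc_mod_def submodule_reg_iff
proof safe
  interpret noetherian_ring R by fact
  fix S :: "nat \<Rightarrow> 'a set" assume S: "\<forall>k. ideal (S k) R \<and> S k \<subseteq> S (Suc k)"
  have mono: "i \<le> j \<Longrightarrow> S i \<subseteq> S j" for i j using mono_chain[of S i j] S by auto
  have "subset.chain {I. ideal I R} (range S)"
    unfolding subset_chain_def
  proof safe
    fix x i j assume "x \<in> S i" "x \<notin> S j"
    fix y assume "y \<in> S j"
    have "i \<le> j \<or> j \<le> i" by linarith
    then show "y \<in> S i" using mono[of i j] mono[of j i] \<open>x \<in> S i\<close> \<open>x \<notin> S j\<close> \<open>y \<in> S j\<close> by blast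
  qed (use S in auto)
  from ideal_chain_is_trivial[OF _ this] obtain k where k: "\<Union> (range S) = S k" by auto
  then have "\<forall>l\<ge>k. S l = S k" using mono by blast
  then show "\<exists>k. \<forall>l\<ge>k. S l = S k" by blast
qed

text \<open>
  Descend through the coordinates. The values at \<open>l\<close> of those members of the \<open>k\<close>-th submodule that
  vanish beyond \<open>l\<close> form a submodule of \<open>M\<close>; when these have become stationary for all \<open>l\<close>, every
  element of a later submodule is reduced to \<open>0\<close> by subtracting elements of the earlier one.
\<close>

lemma acc_mod_pow:
  assumes M: "module R M" and acc: "acc_mod R M"
  shows "acc_mod R (pow_mod M n)"
  unfolding acc_mod_def
proof safe
  interpret M: module R M by fact
  interpret P: module R "pow_mod M n" by (rule M.pow_mod_module)
  fix S assume S: "\<forall>k. submodule (S k) R (pow_mod M n) \<and> S k \<subseteq> S (Suc k)"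
  have mono: "i \<le> j \<Longrightarrow> S i \<subseteq> S j" for i j using mono_chain[of S i j] S by auto
  have sub: "submodule (S k) R (pow_mod M n)" for k using S by auto
  define L where "L l k = {v l | v. v \<in> S k \<and> (\<forall>i. l < i \<and> i < n \<longrightarrow> v i = \<zero>\<^bsub>M\<^esub>)}" for l k
  have "\<exists>k. \<forall>k'\<ge>k. L l k' = L l k" if l: "l < n" for l
  proof -
    have "submodule (L l k) R M" for k
    proof (rule M.subI)
      show "L l k \<subseteq> carrier M"
        using P.sub_carr[OF sub[of k]] l by (auto simp: L_def pow_mod_def PiE_iff)
      show "\<zero>\<^bsub>M\<^esub> \<in> L l k"
        unfolding L_def using P.sub_zero[OF sub[of k]] l
        by (intro CollectI exI[of _ "\<zero>\<^bsub>pow_mod M n\<^esub>"]) (auto simp: pow_mod_def)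
    next
      fix a b assume "a \<in> L l k" "b \<in> L l k"
      then obtain v w where vw: "v \<in> S k" "\<forall>i. l < i \<and> i < n \<longrightarrow> v i = \<zero>\<^bsub>M\<^esub>" "a = v l"
         "w \<in> S k" "\<forall>i. l < i \<and> i < n \<longrightarrow> w i = \<zero>\<^bsub>M\<^esub>" "b = w l" unfolding L_def by blast
      then show "a \<oplus>\<^bsub>M\<^esub> b \<in> L l k"
        unfolding L_def using P.sub_add[OF sub[of k], of v w] l
        by (intro CollectI exI[of _ "v \<oplus>\<^bsub>pow_mod M n\<^esub> w"]) (auto simp: pow_mod_def)
    next
      fix a x assume "a \<in> carrier R" "x \<in> L l k"
      then obtain v where vw: "v \<in> S k" "\<forall>i. l < i \<and> i < n \<longrightarrow> v i = \<zero>\<^bsub>M\<^esub>" "x = v l"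
        "a \<in> carrier R" unfolding L_def by blast
      then show "a \<odot>\<^bsub>M\<^esub> x \<in> L l k"
        unfolding L_def using P.sub_smult[OF sub[of k], of a v] l
        by (intro CollectI exI[of _ "a \<odot>\<^bsub>pow_mod M n\<^esub> v"]) (auto simp: pow_mod_def)
    qed
    moreover have "L l k \<subseteq> L l (Suc k)" for k using S unfolding L_def by blast
    ultimately show ?thesis using acc unfolding acc_mod_def by blast
  qed
  then obtain K where K: "\<And>l k'. l < n \<Longrightarrow> k' \<ge> K l \<Longrightarrow> L l k' = L l (K l)" by metis
  define k where "k = Max (insert 0 (K ` {..<n}))"
  have kK: "K l \<le> k" if "l < n" for l unfolding k_def using that by (intro Max_ge) auto
  have "S l = S k" if "k \<le> l" for l
  proof
    show "S k \<subseteq> S l" using mono that by blast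
    have *: "v \<in> S k" if "v \<in> S l" "m \<le> n" "\<forall>i. m \<le> i \<and> i < n \<longrightarrow> v i = \<zero>\<^bsub>M\<^esub>" for v m
      using that
    proof (induction m arbitrary: v)
      case 0
      then have "v = \<zero>\<^bsub>pow_mod M n\<^esub>"
        using P.sub_carr[OF sub[of l], of v] by (auto simp: pow_mod_def intro!: PiE_ext[of v "{..<n}"])
      then show ?case using P.sub_zero[OF sub[of k]] by simp
    next
      case (Suc m)
      then have m: "m < n" by simp
      have "v m \<in> L m l" unfolding L_def using Suc.prems by auto
      then have "v m \<in> L m k" using K[OF m, of l] K[OF m, of k] kK[OF m] \<open>k \<le> l\<close> by simp
      then obtain w where w: "w \<in> S k" "\<forall>i. m < i \<and> i < n \<longrightarrow> w i = \<zero>\<^bsub>M\<^esub>" "v m = w m"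
        unfolding L_def by auto
      have wl: "w \<in> S l" using w mono \<open>k \<le> l\<close> by blast
      have vc: "v \<in> carrier (pow_mod M n)" "w \<in> carrier (pow_mod M n)"
        using P.sub_carr[OF sub[of l]] Suc.prems(1) wl by auto
      let ?u = "v \<oplus>\<^bsub>pow_mod M n\<^esub> (\<ominus>\<^bsub>R\<^esub> \<one>\<^bsub>R\<^esub>) \<odot>\<^bsub>pow_mod M n\<^esub> w"
      have "?u \<in> S l" using Suc.prems(1) wl by (auto intro!: P.sub_add[OF sub] P.sub_smult[OF sub])
      moreover have "?u i = \<zero>\<^bsub>M\<^esub>" if "m \<le> i" "i < n" for i
      proof -
        have "v i = w i" using w Suc.prems(3) that by (cases "m = i") auto
        then show ?thesis using vc that
          by (auto simp: pow_mod_def PiE_iff M.smult_l_minus M.M.r_neg)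
      qed
      ultimately have "?u \<in> S k" using Suc.IH[of ?u] m by auto
      then have "?u \<oplus>\<^bsub>pow_mod M n\<^esub> w \<in> S k" using w(1) by (rule P.sub_add[OF sub[of k]])
      moreover have "?u \<oplus>\<^bsub>pow_mod M n\<^esub> w = v"
        using vc by (simp add: P.smult_l_minus P.M.a_assoc P.M.l_neg)
      ultimately show ?case by simp
    qed
    show "S l \<subseteq> S k" by (intro subsetI *[of _ n]) auto
  qed
  then show "\<exists>k. \<forall>l\<ge>k. S l = S k" by blast
qed

lemma (in cring) acc_free_mod: "noetherian_ring R \<Longrightarrow> acc_mod R (free_mod R n)"
  unfolding free_mod_eq_pow_mod by (rule acc_mod_pow[OF reg_mod_module acc_reg_mod])

lemma vimage_submodule:
  assumes "module R M" "module R N" "h \<in> mod_hom R M N" "submodule P R N"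
  shows "submodule {x \<in> carrier M. h x \<in> P} R M"
proof -
  interpret M: module R M by fact
  interpret N: module R N by fact
  show ?thesis
    by (rule M.subI) (auto simp: mod_homD[OF assms(3)] mod_hom_zero_minus[OF assms(1-3)]
        N.sub_zero[OF assms(4)] N.sub_add[OF assms(4)] N.sub_smult[OF assms(4)])
qed

lemma acc_mod_image:
  assumes "module R M" "module R N" "h \<in> mod_hom R M N" "h ` carrier M = carrier N" "acc_mod R M"
  shows "acc_mod R N"
  unfolding acc_mod_def
proof safe
  fix S assume S: "\<forall>k. submodule (S k) R N \<and> S k \<subseteq> S (Suc k)"
  let ?T = "\<lambda>k. {x \<in> carrier M. h x \<in> S k}"
  have "\<exists>k. \<forall>l\<ge>k. ?T l = ?T k"
    using assms(5)[unfolded acc_mod_def, rule_format, of ?T] vimage_submodule[OF assms(1-3)] S by blast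
  then obtain k where k: "\<forall>l\<ge>k. ?T l = ?T k" by blast
  have T: "h ` ?T l = S l" for l
  proof -
    have "S l \<subseteq> carrier N" using S module.sub_carr[OF assms(2)] by blast
    then show ?thesis using assms(4) by auto
  qed
  have "S l = S k" if "l \<ge> k" for l using T[of l] T[of k] k that by (metis (no_types, lifting))
  then show "\<exists>k. \<forall>l\<ge>k. S l = S k" by blast
qed

lemma acc_mod_maximal:
  assumes "acc_mod R M" "F \<noteq> {}" "\<And>S. S \<in> F \<Longrightarrow> submodule S R M"
  shows "\<exists>S\<in>F. \<forall>T\<in>F. S \<subseteq> T \<longrightarrow> T = S"
proof (rule ccontr)
  assume n: "\<not> ?thesis"
  obtain S0 where S0: "S0 \<in> F" using assms(2) by blast
  have "\<exists>f. f 0 \<in> F \<and> (\<forall>n. f n \<in> F \<and> f n \<subset> f (Suc n))"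
  proof -
    have "\<exists>f. \<forall>n. f n \<in> F \<and> f n \<subset> f (Suc n)"
      by (rule dependent_nat_choice) (use S0 n in blast)+
    then show ?thesis by blast
  qed
  then obtain f where f: "\<And>n. f n \<in> F \<and> f n \<subset> f (Suc n)" by blast
  then obtain k where "\<forall>l\<ge>k. f l = f k"
    using assms(1)[unfolded acc_mod_def, rule_format, of f] assms(3) by blast
  then have "f (Suc k) = f k" by (metis le_Suc_eq order_refl)
  with f show False by blast
qed

lemma lin_range_submodule:
  assumes "module R M" "b \<in> {..<n} \<rightarrow> carrier M"
  shows "submodule {lin M n c b | c. c \<in> carrier (free_mod R n)} R M"
proof -
  interpret M: module R M by fact
  interpret F: module R "free_mod R n" by (rule M.R.free_mod_module)
  note h = M.lin_mod_hom[OF assms(2)]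
  show ?thesis
  proof (rule M.subI)
    show "{lin M n c b | c. c \<in> carrier (free_mod R n)} \<subseteq> carrier M" using mod_homD(1)[OF h] by auto
    show "\<zero>\<^bsub>M\<^esub> \<in> {lin M n c b | c. c \<in> carrier (free_mod R n)}"
      using mod_hom_zero_minus(1)[OF F.module_axioms assms(1) h] F.zero_closed
      by (metis (mono_tags, lifting) mem_Collect_eq)
  next
    fix x y assume "x \<in> {lin M n c b | c. c \<in> carrier (free_mod R n)}"
       "y \<in> {lin M n c b | c. c \<in> carrier (free_mod R n)}"
    then obtain c d where "x = lin M n c b" "y = lin M n d b" "c \<in> carrier (free_mod R n)"
        "d \<in> carrier (free_mod R n)" by auto
    then show "x \<oplus>\<^bsub>M\<^esub> y \<in> {lin M n c b | c. c \<in> carrier (free_mod R n)}"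
      using mod_homD(2)[OF h, of c d] F.add.m_closed[of c d] by (metis (mono_tags, lifting) mem_Collect_eq)
  next
    fix a x assume "x \<in> {lin M n c b | c. c \<in> carrier (free_mod R n)}" and a: "a \<in> carrier R"
    then obtain c where "x = lin M n c b" "c \<in> carrier (free_mod R n)" by auto
    then show "a \<odot>\<^bsub>M\<^esub> x \<in> {lin M n c b | c. c \<in> carrier (free_mod R n)}"
      using mod_homD(3)[OF h a, of c] F.smult_closed[OF a, of c] by (metis (mono_tags, lifting) mem_Collect_eq)
  qed
qed

text \<open>A submodule that is maximal among the finitely generated submodules of \<open>N\<close> must be \<open>N\<close>.\<close>

lemma acc_mod_generators:
  assumes "module R M" "acc_mod R M" "submodule N R M"
  shows "\<exists>n b. b \<in> {..<n} \<rightarrow> N \<and> N = {lin M n c b | c. c \<in> carrier (free_mod R n)}"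
proof -
  interpret M: module R M by fact
  define F where "F = {{lin M n c b | c. c \<in> carrier (free_mod R n)} | n b. b \<in> {..<n::nat} \<rightarrow> N}"
  have NM: "N \<subseteq> carrier M" using M.sub_carr[OF assms(3)] by blast
  have ne: "F \<noteq> {}" unfolding F_def by (auto intro!: exI[of _ "0::nat"])
  have sm: "submodule S R M" if "S \<in> F" for S
  proof -
    from that obtain n b where b: "b \<in> {..<n::nat} \<rightarrow> N"
      and S: "S = {lin M n c b | c. c \<in> carrier (free_mod R n)}" unfolding F_def by blast
    have "b \<in> {..<n} \<rightarrow> carrier M" using b NM by (auto simp: Pi_iff)
    then show ?thesis unfolding S by (rule lin_range_submodule[OF assms(1)])
  qed
  have "\<exists>S\<in>F. \<forall>T\<in>F. S \<subseteq> T \<longrightarrow> T = S" using assms(2) ne sm by (rule acc_mod_maximal)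
  then obtain S where S: "S \<in> F" "\<forall>T\<in>F. S \<subseteq> T \<longrightarrow> T = S" by (rule bexE)
  then obtain n b where b: "b \<in> {..<n} \<rightarrow> N" "S = {lin M n c b | c. c \<in> carrier (free_mod R n)}" unfolding F_def by blast
  have bM: "b \<in> {..<n} \<rightarrow> carrier M" using b NM by auto
  have "N \<subseteq> S"
  proof
    fix x assume x: "x \<in> N"
    define b' where "b' = b(n := x)"
    have b': "b' \<in> {..<Suc n} \<rightarrow> N" using b x by (auto simp: b'_def less_Suc_eq)
    have b'M: "b' \<in> {..<Suc n} \<rightarrow> carrier M" using b' NM by auto
    define T where "T = {lin M (Suc n) c b' | c. c \<in> carrier (free_mod R (Suc n))}"
    have T: "T \<in> F" unfolding F_def T_def using b' by blast
    have "S \<subseteq> T"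
    proof
      fix y assume "y \<in> S"
      then obtain c where c: "y = lin M n c b" "c \<in> carrier (free_mod R n)" using b by blast
      define c' where "c' = c(n := \<zero>\<^bsub>R\<^esub>)"
      have c': "c' \<in> carrier (free_mod R (Suc n))"
        using c by (auto simp: c'_def free_mod_def PiE_iff extensional_def)
      have "lin M (Suc n) c' b' = lin M n c' b'"
        using M.lin_zero_tail[of c' "Suc n" b' n] free_mod_Pi[OF c'] b'M by (auto simp: c'_def)
      also have "\<dots> = y" unfolding c
        by (rule M.lin_cong[symmetric]) (use free_mod_Pi[OF c(2)] bM in \<open>auto simp: c'_def b'_def\<close>)
      finally show "y \<in> T" unfolding T_def using c' by blast
    qed
    then have "T = S" using S(2) T by blast
    moreover have "x \<in> T"
    proof -
      have "lin M (Suc n) (unitv R (Suc n) n) b' = x"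
        using M.lin_unitv[of n "Suc n" b'] b'M by (simp add: b'_def)
      then show ?thesis unfolding T_def using M.unitv_carrier by blast
    qed
    ultimately show "x \<in> S" by simp
  qed
  moreover have "S \<subseteq> N"
    using M.lin_in_sub[OF assms(3)] b free_mod_Pi by blast
  ultimately show ?thesis using b by blast
qed

lemma fin_gen_mod_generators:
  assumes "fin_gen_mod R M"
  shows "\<exists>n b. b \<in> {..<n} \<rightarrow> carrier M \<and> carrier M = {lin M n c b | c. c \<in> carrier (free_mod R n)}"
proof -
  interpret M: module R M using assms by (simp add: fin_gen_mod_def)
  obtain A where A: "finite A" "A \<subseteq> carrier M" "mod_span R M A = carrier M"
    using assms by (auto simp: fin_gen_mod_def)
  obtain f and n :: nat where f: "A = f ` {..<n}"
    using A(1) by (metis finite_imp_nat_seg_image_inj_on lessThan_def)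
  have fM: "f \<in> {..<n} \<rightarrow> carrier M" using A f by auto
  let ?S = "{lin M n c f | c. c \<in> carrier (free_mod R n)}"
  have sm: "submodule ?S R M" by (rule lin_range_submodule[OF M.module_axioms fM])
  have "A \<subseteq> ?S"
  proof
    fix x assume "x \<in> A"
    then obtain i where i: "i < n" "x = f i" using f by auto
    then have "lin M n (unitv R n i) f = x" using M.lin_unitv fM by blast
    then show "x \<in> ?S" using M.unitv_carrier by blast
  qed
  then have "mod_span R M A \<subseteq> ?S" unfolding mod_span_def using sm by blast
  moreover have "?S \<subseteq> carrier M" using M.sub_carr[OF sm] by blast
  ultimately show ?thesis using fM A(3) by blast
qed

lemma fin_gen_modI:
  assumes "module R M" "b \<in> {..<n::nat} \<rightarrow> carrier M"
    "carrier M \<subseteq> {lin M n c b | c. c \<in> carrier (free_mod R n)}"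
  shows "fin_gen_mod R M"
proof -
  interpret M: module R M by fact
  have "mod_span R M (b ` {..<n}) = carrier M"
  proof
    show "mod_span R M (b ` {..<n}) \<subseteq> carrier M"
      unfolding mod_span_def using M.carrier_is_submodule assms(2) by blast
    show "carrier M \<subseteq> mod_span R M (b ` {..<n})"
      unfolding mod_span_def
    proof safe
      fix x N assume "x \<in> carrier M" and N: "submodule N R M" "b ` {..<n} \<subseteq> N"
      then obtain c where "x = lin M n c b" "c \<in> carrier (free_mod R n)" using assms(3) by blast
      then show "x \<in> N" using M.lin_in_sub[OF N(1), of c n b] free_mod_Pi N(2) by blast
    qed
  qed
  then show ?thesis unfolding fin_gen_mod_def using assms(1,2)
    by (intro conjI exI[of _ "b ` {..<n}"]) auto
qed

lemma fin_gen_mod_acc: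
  assumes "noetherian_ring R" "fin_gen_mod R M"
  shows "acc_mod R M"
proof -
  interpret M: module R M using assms(2) by (simp add: fin_gen_mod_def)
  obtain n b where b: "b \<in> {..<n} \<rightarrow> carrier M"
     "carrier M = {lin M n c b | c. c \<in> carrier (free_mod R n)}"
    using fin_gen_mod_generators[OF assms(2)] by blast
  show ?thesis
  proof (rule acc_mod_image[OF M.R.free_mod_module M.module_axioms M.lin_mod_hom[OF b(1)]])
    show "(\<lambda>v. lin M n v b) ` carrier (free_mod R n) = carrier M" using b(2) by (auto simp: image_def)
  qed (rule M.R.acc_free_mod[OF assms(1)])
qed

section \<open>Local rings and Nakayama's lemma\<close>

locale noeth_local = cring R + noetherian_ring R for R (structure) +
  fixes \<mm> :: "'a set"
  assumes max: "maximalideal \<mm> R"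
    and uniq: "maximalideal n R \<Longrightarrow> n = \<mm>"
begin

lemma ideal_mm: "ideal \<mm> R" using max by (rule maximalideal.axioms)
lemma mm_carr: "a \<in> \<mm> \<Longrightarrow> a \<in> carrier R" using ideal.Icarr[OF ideal_mm] .
lemma one_notin: "\<one> \<notin> \<mm>"
  using maximalideal.I_notcarr[OF max] ideal.one_imp_carrier[OF ideal_mm] by blast

lemma ideal_le_mm:
  assumes "ideal J R" "J \<noteq> carrier R"
  shows "J \<subseteq> \<mm>"
proof -
  let ?F = "{I. ideal I R \<and> J \<subseteq> I \<and> I \<noteq> carrier R}"
  have "\<exists>S\<in>?F. \<forall>T\<in>?F. S \<subseteq> T \<longrightarrow> T = S"
    by (rule acc_mod_maximal[OF acc_reg_mod[OF noetherian_ring_axioms]])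
       (use assms in \<open>auto simp: submodule_reg_iff\<close>)
  then obtain S where S: "ideal S R" "J \<subseteq> S" "S \<noteq> carrier R"
      "\<And>T. ideal T R \<Longrightarrow> T \<noteq> carrier R \<Longrightarrow> S \<subseteq> T \<Longrightarrow> T = S" by (smt (verit) mem_Collect_eq order_trans)
  have "maximalideal S R"
    by (rule maximalidealI) (use S in auto)
  then have "S = \<mm>" by (rule uniq)
  then show ?thesis using S by simp
qed

lemma unit_iff:
  assumes "a \<in> carrier R" "a \<notin> \<mm>"
  shows "\<exists>b\<in>carrier R. b \<otimes> a = \<one>"
proof -
  have "PIdl a = carrier R"
    using ideal_le_mm[OF cgenideal_ideal[OF assms(1)]] cgenideal_self[OF assms(1)] assms(2) by blast
  then have "\<one> \<in> {x \<otimes> a | x. x \<in> carrier R}" using one_closed unfolding cgenideal_def by simp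
  then show ?thesis by auto
qed

lemma one_minus_unit:
  assumes "a \<in> \<mm>"
  shows "\<exists>b\<in>carrier R. b \<otimes> (\<one> \<ominus> a) = \<one>"
proof (rule unit_iff)
  show c: "\<one> \<ominus> a \<in> carrier R" using assms mm_carr by simp
  show "\<one> \<ominus> a \<notin> \<mm>"
  proof
    assume "\<one> \<ominus> a \<in> \<mm>"
    then have "(\<one> \<ominus> a) \<oplus> a \<in> \<mm>"
      using assms additive_subgroup.a_closed[OF ideal.axioms(1)[OF ideal_mm]] by blast
    moreover have "(\<one> \<ominus> a) \<oplus> a = \<one>" using mm_carr[OF assms] by (simp add: minus_eq a_assoc l_neg)
    ultimately show False using one_notin by simp
  qed
qed

text \<open>
  The submodules \<open>P + R f\<^sub>k\<close> increase, since \<open>f\<^sub>k \<equiv> z f\<^sub>k\<^sub>+\<^sub>1\<close>. Once they are stationary,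
  \<open>f\<^sub>k\<^sub>+\<^sub>1 \<equiv> a z f\<^sub>k\<^sub>+\<^sub>1\<close> modulo \<open>P\<close> for some \<open>a\<close>, and \<open>1 - a z\<close> is a unit. The sequence form of
  Nakayama's lemma fits successive approximations, where \<open>f\<^sub>k\<^sub>+\<^sub>1\<close> is found only after \<open>f\<^sub>k\<close>.
\<close>

lemma nakayama_sequence:
  assumes "module R M" "acc_mod R M" "submodule P R M" "z \<in> \<mm>"
    "\<And>k::nat. f k \<in> carrier M" "\<And>k. f k \<ominus>\<^bsub>M\<^esub> z \<odot>\<^bsub>M\<^esub> f (Suc k) \<in> P"
  shows "f 0 \<in> P"
proof -
  interpret M: module R M by fact
  note P = M.sub_rules[OF assms(3)]
  have z: "z \<in> carrier R" using assms(4) mm_carr by blast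
  define S where "S k = {p \<oplus>\<^bsub>M\<^esub> a \<odot>\<^bsub>M\<^esub> f k | p a. p \<in> P \<and> a \<in> carrier R}" for k
  have sub: "submodule (S k) R M" for k
  proof (rule M.subI)
    show "S k \<subseteq> carrier M" unfolding S_def using P assms(5) by auto
    show "\<zero>\<^bsub>M\<^esub> \<in> S k" unfolding S_def using P(2) assms(5)
      by (intro CollectI exI[of _ "\<zero>\<^bsub>M\<^esub>"] exI[of _ \<zero>]) auto
  next
    fix x y assume "x \<in> S k" "y \<in> S k"
    then obtain p q a b where 1: "x = p \<oplus>\<^bsub>M\<^esub> a \<odot>\<^bsub>M\<^esub> f k" "y = q \<oplus>\<^bsub>M\<^esub> b \<odot>\<^bsub>M\<^esub> f k" "p \<in> P" "q \<in> P"
      "a \<in> carrier R" "b \<in> carrier R" unfolding S_def by blast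
    then have "x \<oplus>\<^bsub>M\<^esub> y = (p \<oplus>\<^bsub>M\<^esub> q) \<oplus>\<^bsub>M\<^esub> (a \<oplus> b) \<odot>\<^bsub>M\<^esub> f k"
      using P(1) assms(5) by (simp add: M.smult_l_distr M.M.a_ac)
    then show "x \<oplus>\<^bsub>M\<^esub> y \<in> S k" unfolding S_def using 1 P(3)[OF 1(3,4)]
      by (intro CollectI exI[of _ "p \<oplus>\<^bsub>M\<^esub> q"] exI[of _ "a \<oplus> b"]) simp
  next
    fix c x assume "x \<in> S k" and c: "c \<in> carrier R"
    then obtain p a where 1: "x = p \<oplus>\<^bsub>M\<^esub> a \<odot>\<^bsub>M\<^esub> f k" "p \<in> P" "a \<in> carrier R" unfolding S_def by blast
    then have "c \<odot>\<^bsub>M\<^esub> x = c \<odot>\<^bsub>M\<^esub> p \<oplus>\<^bsub>M\<^esub> (c \<otimes> a) \<odot>\<^bsub>M\<^esub> f k"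
      using P(1) assms(5) c by (simp add: M.smult_r_distr M.smult_assoc1)
    then show "c \<odot>\<^bsub>M\<^esub> x \<in> S k" unfolding S_def using 1 P(6)[OF c 1(2)] c
      by (intro CollectI exI[of _ "c \<odot>\<^bsub>M\<^esub> p"] exI[of _ "c \<otimes> a"]) simp
  qed
  have fS: "f k \<in> S k" for k
    unfolding S_def using P(2) assms(5) by (intro CollectI exI[of _ "\<zero>\<^bsub>M\<^esub>"] exI[of _ \<one>]) auto
  have PS: "P \<subseteq> S k" for k
    unfolding S_def using P(1) assms(5) by (intro subsetI CollectI exI[of _ \<zero>] exI) auto
  have step: "f k = (f k \<ominus>\<^bsub>M\<^esub> z \<odot>\<^bsub>M\<^esub> f (Suc k)) \<oplus>\<^bsub>M\<^esub> z \<odot>\<^bsub>M\<^esub> f (Suc k)" for k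
    using assms(5) z by (simp add: M.add_minus_cancel)
  have "S k \<subseteq> S (Suc k)" for k
  proof
    fix x assume "x \<in> S k"
    then obtain p a where 1: "x = p \<oplus>\<^bsub>M\<^esub> a \<odot>\<^bsub>M\<^esub> f k" "p \<in> P" "a \<in> carrier R" unfolding S_def by blast
    have "f k \<in> S (Suc k)"
      by (subst step) (use assms(6) PS fS z in \<open>blast intro: M.sub_add[OF sub] M.sub_smult[OF sub]\<close>)
    then show "x \<in> S (Suc k)"
      unfolding 1 using 1 PS by (blast intro: M.sub_add[OF sub] M.sub_smult[OF sub])
  qed
  then obtain k where "\<forall>l\<ge>k. S l = S k"
    using assms(2)[unfolded acc_mod_def, rule_format, of S] sub by blast
  then have "f (Suc k) \<in> S k" using fS by (metis le_Suc_eq order_refl)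
  then obtain p a where pa: "f (Suc k) = p \<oplus>\<^bsub>M\<^esub> a \<odot>\<^bsub>M\<^esub> f k" "p \<in> P" "a \<in> carrier R"
    unfolding S_def by blast
  define r where "r = f k \<ominus>\<^bsub>M\<^esub> z \<odot>\<^bsub>M\<^esub> f (Suc k)"
  have r: "r \<in> P" "r \<in> carrier M" using assms(6) P(1) by (auto simp: r_def)
  have za: "z \<otimes> a \<in> \<mm>" using assms(4) pa ideal.I_r_closed[OF ideal_mm] by blast
  have "(\<one> \<ominus> z \<otimes> a) \<odot>\<^bsub>M\<^esub> f k = f k \<ominus>\<^bsub>M\<^esub> (z \<otimes> a) \<odot>\<^bsub>M\<^esub> f k"
    using pa z assms(5) by (simp add: M.smult_l_minus2)
  also have "\<dots> = r \<oplus>\<^bsub>M\<^esub> z \<odot>\<^bsub>M\<^esub> p"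
  proof -
    have "f k = r \<oplus>\<^bsub>M\<^esub> z \<odot>\<^bsub>M\<^esub> f (Suc k)" using step by (simp add: r_def)
    also have "\<dots> = (r \<oplus>\<^bsub>M\<^esub> z \<odot>\<^bsub>M\<^esub> p) \<oplus>\<^bsub>M\<^esub> (z \<otimes> a) \<odot>\<^bsub>M\<^esub> f k"
      using pa z assms(5) P(1) r by (simp add: M.smult_r_distr M.smult_assoc1 M.M.a_assoc)
    finally have "f k \<ominus>\<^bsub>M\<^esub> (z \<otimes> a) \<odot>\<^bsub>M\<^esub> f k =
      ((r \<oplus>\<^bsub>M\<^esub> z \<odot>\<^bsub>M\<^esub> p) \<oplus>\<^bsub>M\<^esub> (z \<otimes> a) \<odot>\<^bsub>M\<^esub> f k) \<ominus>\<^bsub>M\<^esub> (z \<otimes> a) \<odot>\<^bsub>M\<^esub> f k" by simp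
    also have "\<dots> = r \<oplus>\<^bsub>M\<^esub> z \<odot>\<^bsub>M\<^esub> p"
      using pa z assms(5) P(1) r by (intro M.add_minus_cancel2) auto
    finally show ?thesis .
  qed
  finally have *: "(\<one> \<ominus> z \<otimes> a) \<odot>\<^bsub>M\<^esub> f k \<in> P" using r pa z by (simp add: P)
  obtain b where b: "b \<in> carrier R" "b \<otimes> (\<one> \<ominus> z \<otimes> a) = \<one>" using one_minus_unit[OF za] by blast
  have "b \<odot>\<^bsub>M\<^esub> ((\<one> \<ominus> z \<otimes> a) \<odot>\<^bsub>M\<^esub> f k) = f k"
    using b pa z assms(5) by (simp flip: M.smult_assoc1)
  then have k: "f k \<in> P" using P(6)[OF b(1) *] by simp
  have "f (k - j) \<in> P" for j
  proof (induction j)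
    case (Suc j)
    show ?case
    proof (cases "j < k")
      case True
      then have e: "k - j = Suc (k - Suc j)" by simp
      have "z \<odot>\<^bsub>M\<^esub> f (Suc (k - Suc j)) \<in> P" using Suc z e P(6) by simp
      then show ?thesis using step[of "k - Suc j"] P(3)[OF assms(6)] by metis
    qed (use Suc in simp)
  qed (use k in simp)
  from this[of k] show ?thesis by simp
qed

lemma nakayama:
  assumes "module R M" "acc_mod R M" "submodule P R M" "z \<in> \<mm>" "U \<subseteq> carrier M"
    "\<And>u. u \<in> U \<Longrightarrow> \<exists>u'\<in>U. u \<ominus>\<^bsub>M\<^esub> z \<odot>\<^bsub>M\<^esub> u' \<in> P"
  shows "U \<subseteq> P"
proof
  fix u assume u: "u \<in> U"
  obtain g where g: "\<And>u. u \<in> U \<Longrightarrow> g u \<in> U \<and> u \<ominus>\<^bsub>M\<^esub> z \<odot>\<^bsub>M\<^esub> g u \<in> P" using assms(6) by metis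
  define f where "f k = (g ^^ k) u" for k
  have fU: "f k \<in> U" for k by (induction k) (use u g in \<open>auto simp: f_def\<close>)
  have "f 0 \<in> P"
    by (rule nakayama_sequence[OF assms(1-4)]) (use fU g assms(5) in \<open>auto simp: f_def\<close>)
  then show "u \<in> P" by (simp add: f_def)
qed

end


section \<open>Regular elements, associated primes and depth\<close>

text \<open>
  A quotient \<open>M/N\<close> is represented by the pair of \<open>M\<close> and \<open>N\<close>, here and below: the successive
  quotients by a regular sequence would all have elements of different types.
\<close>

definition reg_on :: "('a, 'b, 'k) module_scheme \<Rightarrow> 'a \<Rightarrow> 'b set \<Rightarrow> bool" where
  "reg_on M a N \<longleftrightarrow> (\<forall>u\<in>carrier M. a \<odot>\<^bsub>M\<^esub> u \<in> N \<longrightarrow> u \<in> N)"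

definition addm :: "('a, 'b, 'k) module_scheme \<Rightarrow> 'b set \<Rightarrow> 'a \<Rightarrow> 'b set" where
  "addm M N z = {n \<oplus>\<^bsub>M\<^esub> z \<odot>\<^bsub>M\<^esub> x | n x. n \<in> N \<and> x \<in> carrier M}"

definition ann :: "('a, 'm) ring_scheme \<Rightarrow> ('a, 'b, 'k) module_scheme \<Rightarrow> 'b set \<Rightarrow> 'b \<Rightarrow> 'a set" where
  "ann R M N u = {a \<in> carrier R. a \<odot>\<^bsub>M\<^esub> u \<in> N}"

definition annq :: "('a, 'm) ring_scheme \<Rightarrow> ('a, 'b, 'k) module_scheme \<Rightarrow> 'b set \<Rightarrow> 'a set" where
  "annq R M N = {a \<in> carrier R. \<forall>x\<in>carrier M. a \<odot>\<^bsub>M\<^esub> x \<in> N}"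

text \<open>
  The maximal ones among the annihilators of nonzero elements of \<open>M/N\<close>. They are associated primes of
  \<open>M/N\<close>, and their union already contains all zero divisors.
\<close>

definition maxann :: "('a, 'm) ring_scheme \<Rightarrow> ('a, 'b, 'k) module_scheme \<Rightarrow> 'b set \<Rightarrow> 'a set \<Rightarrow> bool" where
  "maxann R M N p \<longleftrightarrow> (\<exists>v\<in>carrier M - N. p = ann R M N v) \<and>
     (\<forall>v\<in>carrier M - N. p \<subseteq> ann R M N v \<longrightarrow> ann R M N v = p)"

text \<open>
  For finitely generated \<open>M\<close> over a noetherian local ring with maximal ideal \<open>m\<close>: the depth of \<open>M/N\<close>
  is at least \<open>t\<close>, where the zero module has infinite depth.
\<close>

primrec depth_ge :: "('a, 'b, 'k) module_scheme \<Rightarrow> 'a set \<Rightarrow> nat \<Rightarrow> 'b set \<Rightarrow> bool" where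
  "depth_ge M m 0 N = True"
| "depth_ge M m (Suc t) N = (\<exists>w\<in>m. reg_on M w N \<and> depth_ge M m t (addm M N w))"

text \<open>The submodule \<open>N + (z\<^sub>0, \<dots>, z\<^bsub>i-1\<^esub>)M\<close>, built up one element at a time.\<close>

primrec msum :: "('a, 'b, 'k) module_scheme \<Rightarrow> (nat \<Rightarrow> 'a) \<Rightarrow> 'b set \<Rightarrow> nat \<Rightarrow> 'b set" where
  "msum M z N 0 = N"
| "msum M z N (Suc i) = addm M (msum M z N i) (z i)"

lemma (in cring) idealI_ring:
  assumes "J \<subseteq> carrier R" "\<zero> \<in> J" "\<And>a b. a \<in> J \<Longrightarrow> b \<in> J \<Longrightarrow> a \<oplus> b \<in> J"
    "\<And>a x. a \<in> carrier R \<Longrightarrow> x \<in> J \<Longrightarrow> a \<otimes> x \<in> J"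
  shows "ideal J R"
  using module.subI[OF reg_mod_module, of J] assms by (simp add: submodule_reg_iff)

lemma (in cring) ideal_rules:
  assumes "ideal J R"
  shows "a \<in> J \<Longrightarrow> a \<in> carrier R" "\<zero> \<in> J" "a \<in> J \<Longrightarrow> b \<in> J \<Longrightarrow> a \<oplus> b \<in> J"
    "a \<in> J \<Longrightarrow> \<ominus> a \<in> J" "a \<in> J \<Longrightarrow> b \<in> J \<Longrightarrow> a \<ominus> b \<in> J"
    "a \<in> carrier R \<Longrightarrow> b \<in> J \<Longrightarrow> a \<otimes> b \<in> J" "a \<in> carrier R \<Longrightarrow> b \<in> J \<Longrightarrow> b \<otimes> a \<in> J"
proof -
  interpret ideal J R by fact
  show "a \<in> J \<Longrightarrow> a \<in> carrier R" "\<zero> \<in> J" "a \<in> J \<Longrightarrow> b \<in> J \<Longrightarrow> a \<oplus> b \<in> J"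
    "a \<in> J \<Longrightarrow> \<ominus> a \<in> J" "a \<in> J \<Longrightarrow> b \<in> J \<Longrightarrow> a \<ominus> b \<in> J"
    "a \<in> carrier R \<Longrightarrow> b \<in> J \<Longrightarrow> a \<otimes> b \<in> J" "a \<in> carrier R \<Longrightarrow> b \<in> J \<Longrightarrow> b \<otimes> a \<in> J"
    by (auto simp: I_l_closed I_r_closed minus_eq)
qed

context module
begin

lemma addm_sub:
  assumes N: "submodule N R M" and z: "z \<in> carrier R"
  shows "submodule (addm M N z) R M"
proof (rule subI)
  note P = sub_rules[OF N]
  show "addm M N z \<subseteq> carrier M" unfolding addm_def using P z by auto
  show "\<zero>\<^bsub>M\<^esub> \<in> addm M N z" unfolding addm_def using P z
    by (intro CollectI exI[of _ "\<zero>\<^bsub>M\<^esub>"]) auto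
next
  note P = sub_rules[OF N]
  fix x y assume "x \<in> addm M N z" "y \<in> addm M N z"
  then obtain n u m v where 1: "x = n \<oplus>\<^bsub>M\<^esub> z \<odot>\<^bsub>M\<^esub> u" "y = m \<oplus>\<^bsub>M\<^esub> z \<odot>\<^bsub>M\<^esub> v" "n \<in> N" "m \<in> N"
    "u \<in> carrier M" "v \<in> carrier M" unfolding addm_def by blast
  then have "x \<oplus>\<^bsub>M\<^esub> y = (n \<oplus>\<^bsub>M\<^esub> m) \<oplus>\<^bsub>M\<^esub> z \<odot>\<^bsub>M\<^esub> (u \<oplus>\<^bsub>M\<^esub> v)"
    using P(1) z by (simp add: smult_r_distr M.a_ac)
  then show "x \<oplus>\<^bsub>M\<^esub> y \<in> addm M N z" unfolding addm_def using 1 P(3)[OF 1(3,4)]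
    by (intro CollectI exI[of _ "n \<oplus>\<^bsub>M\<^esub> m"] exI[of _ "u \<oplus>\<^bsub>M\<^esub> v"]) simp
next
  note P = sub_rules[OF N]
  fix c x assume "x \<in> addm M N z" and c: "c \<in> carrier R"
  then obtain n u where 1: "x = n \<oplus>\<^bsub>M\<^esub> z \<odot>\<^bsub>M\<^esub> u" "n \<in> N" "u \<in> carrier M" unfolding addm_def by blast
  then have "c \<odot>\<^bsub>M\<^esub> x = c \<odot>\<^bsub>M\<^esub> n \<oplus>\<^bsub>M\<^esub> z \<odot>\<^bsub>M\<^esub> (c \<odot>\<^bsub>M\<^esub> u)"
    using P(1) z c by (simp add: smult_r_distr smult_comm)
  then show "c \<odot>\<^bsub>M\<^esub> x \<in> addm M N z" unfolding addm_def using 1 P(6)[OF c 1(2)] c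
    by (intro CollectI exI[of _ "c \<odot>\<^bsub>M\<^esub> n"] exI[of _ "c \<odot>\<^bsub>M\<^esub> u"]) simp
qed

lemma addmI:
  assumes "n \<in> N" "x \<in> carrier M" "y = n \<oplus>\<^bsub>M\<^esub> z \<odot>\<^bsub>M\<^esub> x" shows "y \<in> addm M N z"
  unfolding addm_def using assms by blast

lemma addmE:
  assumes "y \<in> addm M N z"
  obtains n x where "n \<in> N" "x \<in> carrier M" "y = n \<oplus>\<^bsub>M\<^esub> z \<odot>\<^bsub>M\<^esub> x"
  using assms unfolding addm_def by blast

lemma addm_le:
  assumes N: "submodule N R M" and z: "z \<in> carrier R"
  shows "N \<subseteq> addm M N z"
  using sub_carr[OF N] z by (auto intro!: addmI[of _ N "\<zero>\<^bsub>M\<^esub>"])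

lemma addm_mult:
  assumes N: "submodule N R M" and z: "z \<in> carrier R" and x: "x \<in> carrier M"
  shows "z \<odot>\<^bsub>M\<^esub> x \<in> addm M N z"
  using sub_zero[OF N] z x by (auto intro!: addmI[of "\<zero>\<^bsub>M\<^esub>" N x])

lemma addm_minimal:
  assumes "submodule P R M" "N \<subseteq> P" "\<And>x. x \<in> carrier M \<Longrightarrow> z \<odot>\<^bsub>M\<^esub> x \<in> P"
  shows "addm M N z \<subseteq> P"
  using assms by (auto elim!: addmE intro!: sub_add[OF assms(1)])

lemma addm_comm:
  assumes N: "submodule N R M" and z: "z \<in> carrier R" "w \<in> carrier R"
  shows "addm M (addm M N w) z = addm M (addm M N z) w"
proof -
  have *: "addm M (addm M N w) z \<subseteq> addm M (addm M N z) w" if "z \<in> carrier R" "w \<in> carrier R" for z w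
    using that addm_le[OF addm_sub[OF N that(1)] that(2)] addm_le[OF N that(1)]
      addm_mult[OF N that(1)] addm_mult[OF addm_sub[OF N that(1)] that(2)]
      addm_sub[OF addm_sub[OF N that(1)] that(2)]
    by (intro addm_minimal) auto
  show ?thesis using *[OF z] *[OF z(2,1)] by blast
qed

lemma msum_sub:
  assumes N: "submodule N R M" and z: "\<And>j. j < i \<Longrightarrow> z j \<in> carrier R"
  shows "submodule (msum M z N i) R M"
  using z by (induction i) (auto intro: addm_sub N)

lemma msum_mono:
  assumes N: "submodule N R M" and z: "\<And>k. k < j \<Longrightarrow> z k \<in> carrier R" and "i \<le> j"
  shows "msum M z N i \<subseteq> msum M z N j"
  using z \<open>i \<le> j\<close>
proof (induction j)
  case (Suc j)
  show ?case
  proof (cases "i = Suc j")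
    case False
    then have "msum M z N i \<subseteq> msum M z N j" using Suc by auto
    also have "\<dots> \<subseteq> msum M z N (Suc j)" using addm_le[OF msum_sub[OF N], of j z "z j"] Suc.prems by auto
    finally show ?thesis .
  qed simp
qed simp

lemma ann_ideal:
  assumes N: "submodule N R M" and u: "u \<in> carrier M"
  shows "ideal (ann R M N u) R"
proof (rule R.idealI_ring)
  note P = sub_rules[OF N]
qed (use u sub_rules[OF N] in \<open>auto simp: ann_def smult_l_distr smult_assoc1\<close>)

lemma annq_ideal:
  assumes N: "submodule N R M"
  shows "ideal (annq R M N) R"
  by (rule R.idealI_ring) (use sub_rules[OF N] in \<open>auto simp: annq_def smult_l_distr smult_assoc1\<close>)

end

context cring
begin

lemma prime_rules:
  assumes "primeideal p R"
  shows "ideal p R" "\<one> \<notin> p" "a \<in> carrier R \<Longrightarrow> b \<in> carrier R \<Longrightarrow> a \<otimes> b \<in> p \<Longrightarrow> a \<in> p \<or> b \<in> p"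
proof -
  interpret primeideal p R by fact
  show "ideal p R" by (rule is_ideal)
  show "\<one> \<notin> p" using one_imp_carrier I_notcarr by blast
  show "a \<in> carrier R \<Longrightarrow> b \<in> carrier R \<Longrightarrow> a \<otimes> b \<in> p \<Longrightarrow> a \<in> p \<or> b \<in> p" by (rule I_prime)
qed

lemma prime_avoids_intersection:
  assumes p: "primeideal p R" and "finite \<I>" "\<And>I. I \<in> \<I> \<Longrightarrow> ideal I R \<and> \<not> I \<subseteq> p"
  shows "\<exists>y\<in>carrier R. y \<notin> p \<and> (\<forall>I\<in>\<I>. y \<in> I)"
  using assms(2,3)
proof (induction rule: finite_induct)
  case empty then show ?case using prime_rules[OF p] by auto
next
  case (insert I \<I>)
  then obtain y where y: "y \<in> carrier R" "y \<notin> p" "\<forall>I\<in>\<I>. y \<in> I" by auto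
  obtain x where x: "x \<in> I" "x \<notin> p" using insert by auto
  have I: "ideal I R" using insert by auto
  have xc: "x \<in> carrier R" using ideal_rules(1)[OF I x(1)] .
  have "y \<otimes> x \<notin> p" using prime_rules(3)[OF p y(1) xc] x y by blast
  moreover have "y \<otimes> x \<in> J" if "J \<in> insert I \<I>" for J
    using that x y xc insert ideal_rules(6,7)[of J] by auto
  ultimately show ?case using y xc by auto
qed

lemma prime_avoidance:
  assumes "finite P" "\<And>p. p \<in> P \<Longrightarrow> primeideal p R" "ideal J R" "\<And>p. p \<in> P \<Longrightarrow> \<not> J \<subseteq> p"
  shows "\<exists>x\<in>J. \<forall>p\<in>P. x \<notin> p"
  using assms
proof (induction "card P" arbitrary: P rule: less_induct)
  case less
  consider "P = {}" | p q where "p \<in> P" "q \<in> P" "p \<noteq> q" "p \<subseteq> q"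
    | "P \<noteq> {}" "\<And>p q. p \<in> P \<Longrightarrow> q \<in> P \<Longrightarrow> p \<subseteq> q \<Longrightarrow> p = q" by blast
  then show ?case
  proof cases
    case 1 then show ?thesis using ideal_rules(2)[OF less.prems(3)] by auto
  next
    case 2
    have "card (P - {p}) < card P" using 2 less.prems(1) by (meson card_Diff1_less)
    then obtain x where "x \<in> J" "\<forall>r\<in>P - {p}. x \<notin> r"
      using less.hyps[of "P - {p}"] less.prems by auto
    then show ?thesis using 2 by blast
  next
    case 3
    then obtain q where q: "q \<in> P" by blast
    have "card (P - {q}) < card P" using q less.prems(1) by (meson card_Diff1_less)
    then obtain x where x: "x \<in> J" "\<forall>r\<in>P - {q}. x \<notin> r"
      using less.hyps[of "P - {q}"] less.prems by auto
    show ?thesis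
    proof (cases "x \<in> q")
      case False then show ?thesis using x by blast
    next
      case True
      have "\<exists>y\<in>carrier R. y \<notin> q \<and> (\<forall>I\<in>insert J (P - {q}). y \<in> I)"
        by (rule prime_avoids_intersection)
           (use less.prems q 3(2) prime_rules(1) in auto)
      then obtain y where y: "y \<in> carrier R" "y \<notin> q" "y \<in> J" "\<forall>I\<in>P - {q}. y \<in> I" by auto
      have xc: "x \<in> carrier R" using ideal_rules(1)[OF less.prems(3) x(1)] .
      have "x \<oplus> y \<in> J" using x y ideal_rules(3)[OF less.prems(3)] by auto
      moreover have "x \<oplus> y \<notin> r" if r: "r \<in> P" for r
      proof
        assume s: "x \<oplus> y \<in> r"
        have ir: "ideal r R" using less.prems(2)[OF r] prime_rules by blast
        show False
        proof (cases "r = q")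
          case True
          then have "(y \<oplus> x) \<ominus> x \<in> q" using s \<open>x \<in> q\<close> ideal_rules(5)[OF ir] xc y(1) a_comm by metis
          then show False using xc y by (simp add: minus_eq a_assoc r_neg)
        next
          case False
          then have "(x \<oplus> y) \<ominus> y \<in> r" using s y r ideal_rules(5)[OF ir] by auto
          then show False using xc y x r False by (simp add: minus_eq a_assoc r_neg)
        qed
      qed
      ultimately show ?thesis by blast
    qed
  qed
qed

end

locale nl_module = noeth_local R \<mm> + module R M for R (structure) and \<mm> and M (structure) +
  assumes acc: "acc_mod R M"
begin

lemma maxann_exists:
  assumes N: "submodule N R M" and u: "u \<in> carrier M" "u \<notin> N"
  shows "\<exists>p. maxann R M N p \<and> ann R M N u \<subseteq> p"
proof -
  let ?F = "{ann R M N v | v. v \<in> carrier M - N \<and> ann R M N u \<subseteq> ann R M N v}"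
  have "\<exists>S\<in>?F. \<forall>T\<in>?F. S \<subseteq> T \<longrightarrow> T = S"
  proof (rule acc_mod_maximal[OF acc_reg_mod[OF noetherian_ring_axioms]])
    show "?F \<noteq> {}" using u by blast
    show "submodule S R (reg_mod R)" if "S \<in> ?F" for S
      using that ann_ideal[OF N] by (auto simp: submodule_reg_iff)
  qed
  then obtain v where v: "v \<in> carrier M - N" "ann R M N u \<subseteq> ann R M N v"
    "\<forall>T\<in>?F. ann R M N v \<subseteq> T \<longrightarrow> T = ann R M N v" by auto
  have "maxann R M N (ann R M N v)" unfolding maxann_def
  proof (intro conjI ballI impI)
    show "\<exists>va\<in>carrier M - N. ann R M N v = ann R M N va" using v(1) by blast
    fix v' assume v': "v' \<in> carrier M - N" "ann R M N v \<subseteq> ann R M N v'"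
    then have "ann R M N v' \<in> ?F" using v(2) by blast
    with v(3) v'(2) show "ann R M N v' = ann R M N v" by blast
  qed
  with v show ?thesis by blast
qed

lemma maxann_prime:
  assumes N: "submodule N R M" and p: "maxann R M N p"
  shows "primeideal p R"
proof -
  note P = sub_rules[OF N]
  obtain v where v: "v \<in> carrier M" "v \<notin> N" "p = ann R M N v"
     "\<And>v'. v'\<in>carrier M \<Longrightarrow> v' \<notin> N \<Longrightarrow> p \<subseteq> ann R M N v' \<Longrightarrow> ann R M N v' = p"
    using p unfolding maxann_def by blast
  show ?thesis
  proof (rule primeidealI)
    show "ideal p R" unfolding v(3) by (rule ann_ideal[OF N v(1)])
    show "cring R" by (rule is_cring)
    have "\<one> \<notin> p" using v by (simp add: ann_def)
    then show "carrier R \<noteq> p" by auto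
    fix a b assume ab: "a \<in> carrier R" "b \<in> carrier R" "a \<otimes> b \<in> p"
    show "a \<in> p \<or> b \<in> p"
    proof (cases "a \<odot>\<^bsub>M\<^esub> v \<in> N")
      case True then show ?thesis using ab v by (simp add: ann_def)
    next
      case False
      have "p \<subseteq> ann R M N (a \<odot>\<^bsub>M\<^esub> v)"
        unfolding v(3) using ab v(1) P by (auto simp: ann_def smult_comm[of _ a])
      then have "ann R M N (a \<odot>\<^bsub>M\<^esub> v) = p" using v(4)[of "a \<odot>\<^bsub>M\<^esub> v"] False ab v(1) by auto
      moreover have "b \<in> ann R M N (a \<odot>\<^bsub>M\<^esub> v)"
        using ab v(1,3) by (simp add: ann_def smult_assoc1 smult_comm[of b a])
      ultimately show ?thesis by simp
    qed
  qed
qed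

text \<open>
  For infinitely many distinct \<open>p\<^sub>k = ann(v\<^sub>k)\<close>, the submodules annihilated modulo \<open>N\<close> by
  \<open>p\<^sub>0 \<inter> \<dots> \<inter> p\<^bsub>k-1\<^esub>\<close> ascend. When they stop, \<open>v\<^sub>k\<close> is annihilated by this intersection, so
  some \<open>p\<^sub>i\<close> with \<open>i < k\<close> is contained in the prime \<open>p\<^sub>k\<close>, against maximality.
\<close>

lemma finite_maxann:
  assumes N: "submodule N R M"
  shows "finite {p. maxann R M N p}"
proof (rule ccontr)
  note P = sub_rules[OF N]
  assume "infinite {p. maxann R M N p}"
  then obtain p :: "nat \<Rightarrow> 'a set" where p: "inj p" "range p \<subseteq> {p. maxann R M N p}"
    using infinite_countable_subset by blast
  have mp: "maxann R M N (p k)" for k using p by blast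
  then have "\<forall>k. \<exists>v. v \<in> carrier M \<and> v \<notin> N \<and> p k = ann R M N v" unfolding maxann_def by blast
  then obtain v where v: "\<And>k. v k \<in> carrier M" "\<And>k. v k \<notin> N" "\<And>k. p k = ann R M N (v k)" by metis
  define S where "S k = {x \<in> carrier M. \<forall>a\<in>carrier R. (\<forall>i<k. a \<in> p i) \<longrightarrow> a \<odot>\<^bsub>M\<^esub> x \<in> N}" for k
  have "submodule (S k) R M" for k
  proof (rule subI, goal_cases)
    case (4 a x)
    then have "b \<odot>\<^bsub>M\<^esub> (a \<odot>\<^bsub>M\<^esub> x) \<in> N" if "b \<in> carrier R" "\<forall>i<k. b \<in> p i" for b
      using P(6)[of a "b \<odot>\<^bsub>M\<^esub> x"] that by (auto simp: S_def smult_comm[of b a])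
    then show ?case using 4 by (auto simp: S_def)
  qed (use P in \<open>auto simp: S_def smult_r_distr\<close>)
  moreover have "S k \<subseteq> S (Suc k)" for k unfolding S_def by auto
  ultimately obtain k where "\<forall>l\<ge>k. S l = S k" using acc unfolding acc_mod_def by blast
  then have "S (Suc k) = S k" by (rule allE[of _ "Suc k"]) (erule impE, simp, assumption)
  moreover have "v k \<in> S (Suc k)" using v(1) v(3)[of k] by (auto simp: S_def ann_def)
  ultimately have vk: "v k \<in> S k" by simp
  have "\<exists>i<k. p i \<subseteq> p k"
  proof (rule ccontr)
    assume "\<not> (\<exists>i<k. p i \<subseteq> p k)"
    then have "\<exists>y\<in>carrier R. y \<notin> p k \<and> (\<forall>I\<in>p ` {..<k}. y \<in> I)"
      using maxann_prime[OF N mp] prime_rules(1) by (intro prime_avoids_intersection) auto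
    then obtain y where y: "y \<in> carrier R" "y \<notin> p k" "\<forall>i<k. y \<in> p i" by auto
    then have "y \<odot>\<^bsub>M\<^esub> v k \<in> N" using vk by (auto simp: S_def)
    then show False using y v(3)[of k] by (auto simp: ann_def)
  qed
  then obtain i where i: "i < k" "p i \<subseteq> p k" by blast
  then have "p k = p i" using mp[of i] v[of k] unfolding maxann_def by auto
  then show False using p(1) i(1) by (auto simp: inj_def)
qed

text \<open>\<open>Hom(R/\<mm>, M/N) = 0\<close>: the positivity of the depth without naming a regular element.\<close>

definition soc_free :: "'c set \<Rightarrow> bool" where
  "soc_free N \<longleftrightarrow> (\<forall>u\<in>carrier M. (\<forall>a\<in>\<mm>. a \<odot>\<^bsub>M\<^esub> u \<in> N) \<longrightarrow> u \<in> N)"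

text \<open>
  \<open>\<mm>\<close> is contained in none of the finitely many maximal annihilators of the two quotients, and prime
  avoidance finds an element outside all of them.
\<close>

lemma common_regular_element:
  assumes N: "submodule N1 R M" "submodule N2 R M" and s: "soc_free N1" "soc_free N2"
  shows "\<exists>y\<in>\<mm>. reg_on M y N1 \<and> reg_on M y N2"
proof -
  let ?P = "{p. maxann R M N1 p} \<union> {p. maxann R M N2 p}"
  have "\<not> \<mm> \<subseteq> p" if "maxann R M N p" "soc_free N" for p N
    using that unfolding maxann_def soc_free_def ann_def by blast
  then have "\<exists>x\<in>\<mm>. \<forall>p\<in>?P. x \<notin> p"
    using finite_maxann N maxann_prime ideal_mm s by (intro prime_avoidance) auto
  then obtain y where y: "y \<in> \<mm>" "\<forall>p\<in>?P. y \<notin> p" by blast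
  have "reg_on M y N" if N: "submodule N R M" and yp: "\<And>p. maxann R M N p \<Longrightarrow> y \<notin> p" for N
    unfolding reg_on_def
  proof (intro ballI impI, rule ccontr)
    fix u assume u: "u \<in> carrier M" "y \<odot>\<^bsub>M\<^esub> u \<in> N" "u \<notin> N"
    then obtain p where "maxann R M N p" "ann R M N u \<subseteq> p" using maxann_exists[OF N u(1,3)] by blast
    then show False using yp[of p] u mm_carr[OF y(1)] unfolding ann_def by auto
  qed
  then show ?thesis using y N by blast
qed

lemma soc_free_if_regular: "w \<in> \<mm> \<Longrightarrow> reg_on M w N \<Longrightarrow> soc_free N"
  unfolding soc_free_def reg_on_def by blast

text \<open>
  If \<open>w\<close> and \<open>z\<close> are regular on \<open>M/N\<close>, then the socles of \<open>M/(N + wM)\<close> and of \<open>M/(N + zM)\<close>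
  correspond under \<open>u \<leftrightarrow> v\<close> iff \<open>z u \<equiv> w v\<close> modulo \<open>N\<close>; both are \<open>Ext\<^sup>1(R/\<mm>, M/N)\<close>.
\<close>

lemma soc_free_exchange:
  assumes N: "submodule N R M" and w: "w \<in> \<mm>" "reg_on M w N" and z: "z \<in> \<mm>" "reg_on M z N"
    and s: "soc_free (addm M N w)"
  shows "soc_free (addm M N z)"
  unfolding soc_free_def
proof (intro ballI impI)
  note P = sub_rules[OF N]
  have c: "w \<in> carrier R" "z \<in> carrier R" using w z mm_carr by auto
  fix u assume u: "u \<in> carrier M" "\<forall>a\<in>\<mm>. a \<odot>\<^bsub>M\<^esub> u \<in> addm M N z"
  then obtain n v where nv: "n \<in> N" "v \<in> carrier M" "w \<odot>\<^bsub>M\<^esub> u = n \<oplus>\<^bsub>M\<^esub> z \<odot>\<^bsub>M\<^esub> v"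
    using w(1) by (metis addmE)
  have "a \<odot>\<^bsub>M\<^esub> v \<in> addm M N w" if a: "a \<in> \<mm>" for a
  proof -
    have ac: "a \<in> carrier R" using a mm_carr by auto
    obtain n' x where x: "n' \<in> N" "x \<in> carrier M" "a \<odot>\<^bsub>M\<^esub> u = n' \<oplus>\<^bsub>M\<^esub> z \<odot>\<^bsub>M\<^esub> x"
      using u(2) a by (metis addmE)
    have "z \<odot>\<^bsub>M\<^esub> (a \<odot>\<^bsub>M\<^esub> v) \<oplus>\<^bsub>M\<^esub> a \<odot>\<^bsub>M\<^esub> n = a \<odot>\<^bsub>M\<^esub> (w \<odot>\<^bsub>M\<^esub> u)"
      unfolding nv(3) using nv ac c P(1) by (simp add: smult_r_distr smult_comm M.a_ac)
    also have "\<dots> = w \<odot>\<^bsub>M\<^esub> n' \<oplus>\<^bsub>M\<^esub> z \<odot>\<^bsub>M\<^esub> (w \<odot>\<^bsub>M\<^esub> x)"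
      using x ac c P(1) u(1) by (simp add: smult_comm[of a w] smult_r_distr smult_comm[of z w])
    finally have e: "z \<odot>\<^bsub>M\<^esub> (a \<odot>\<^bsub>M\<^esub> v) \<oplus>\<^bsub>M\<^esub> a \<odot>\<^bsub>M\<^esub> n = w \<odot>\<^bsub>M\<^esub> n' \<oplus>\<^bsub>M\<^esub> z \<odot>\<^bsub>M\<^esub> (w \<odot>\<^bsub>M\<^esub> x)" .
    let ?p = "z \<odot>\<^bsub>M\<^esub> (a \<odot>\<^bsub>M\<^esub> v)" and ?q = "z \<odot>\<^bsub>M\<^esub> (w \<odot>\<^bsub>M\<^esub> x)"
    have cc: "?p \<in> carrier M" "?q \<in> carrier M" "a \<odot>\<^bsub>M\<^esub> n \<in> carrier M" "w \<odot>\<^bsub>M\<^esub> n' \<in> carrier M"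
      using x ac c nv P(1) by auto
    have "?p \<ominus>\<^bsub>M\<^esub> ?q = ((?p \<oplus>\<^bsub>M\<^esub> a \<odot>\<^bsub>M\<^esub> n) \<ominus>\<^bsub>M\<^esub> a \<odot>\<^bsub>M\<^esub> n) \<ominus>\<^bsub>M\<^esub> ?q" using cc by (simp add: add_minus_cancel2)
    also have "\<dots> = w \<odot>\<^bsub>M\<^esub> n' \<ominus>\<^bsub>M\<^esub> a \<odot>\<^bsub>M\<^esub> n"
      unfolding e using cc by (simp add: M.minus_eq M.a_ac M.r_neg2 M.r_neg)
    finally have "?p \<ominus>\<^bsub>M\<^esub> ?q \<in> N" using P x nv ac c by auto
    then have "z \<odot>\<^bsub>M\<^esub> (a \<odot>\<^bsub>M\<^esub> v \<ominus>\<^bsub>M\<^esub> w \<odot>\<^bsub>M\<^esub> x) \<in> N" using ac nv c x by (simp add: smult_r_minus2)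
    then have "a \<odot>\<^bsub>M\<^esub> v \<ominus>\<^bsub>M\<^esub> w \<odot>\<^bsub>M\<^esub> x \<in> N" using z(2) ac nv c x unfolding reg_on_def by auto
    then show ?thesis using ac nv c x by (intro addmI[of _ N x]) (auto simp: add_minus_cancel)
  qed
  then have "v \<in> addm M N w" using s nv(2) unfolding soc_free_def by blast
  then obtain n' x where x: "n' \<in> N" "x \<in> carrier M" "v = n' \<oplus>\<^bsub>M\<^esub> w \<odot>\<^bsub>M\<^esub> x" by (metis addmE)
  have "w \<odot>\<^bsub>M\<^esub> (u \<ominus>\<^bsub>M\<^esub> z \<odot>\<^bsub>M\<^esub> x) = w \<odot>\<^bsub>M\<^esub> u \<ominus>\<^bsub>M\<^esub> z \<odot>\<^bsub>M\<^esub> (w \<odot>\<^bsub>M\<^esub> x)"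
    using x u c by (simp add: smult_r_minus2 smult_comm[of w z])
  also have "\<dots> = n \<oplus>\<^bsub>M\<^esub> z \<odot>\<^bsub>M\<^esub> n'"
  proof -
    have "w \<odot>\<^bsub>M\<^esub> u = (n \<oplus>\<^bsub>M\<^esub> z \<odot>\<^bsub>M\<^esub> n') \<oplus>\<^bsub>M\<^esub> z \<odot>\<^bsub>M\<^esub> (w \<odot>\<^bsub>M\<^esub> x)"
      unfolding nv(3) x(3) using x nv c P(1) by (simp add: smult_r_distr M.a_assoc)
    then show ?thesis using x nv c P(1) by (simp add: add_minus_cancel2)
  qed
  finally have "w \<odot>\<^bsub>M\<^esub> (u \<ominus>\<^bsub>M\<^esub> z \<odot>\<^bsub>M\<^esub> x) \<in> N" using P nv x c by auto
  then have "u \<ominus>\<^bsub>M\<^esub> z \<odot>\<^bsub>M\<^esub> x \<in> N" using w(2) u c x unfolding reg_on_def by auto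
  then show "u \<in> addm M N z" using u c x by (intro addmI[of _ N x]) (auto simp: add_minus_cancel)
qed

text \<open>
  An element \<open>u\<close> with \<open>y u \<in> N\<close> is \<open>w u'\<close> modulo \<open>N\<close> with \<open>u'\<close> of the same kind, so Nakayama's
  lemma applies.
\<close>

lemma regular_permute:
  assumes N: "submodule N R M" and w: "w \<in> \<mm>" "reg_on M w N"
    and y: "y \<in> \<mm>" "reg_on M y (addm M N w)"
  shows "reg_on M y N" "reg_on M w (addm M N y)"
proof -
  note P = sub_rules[OF N]
  have c: "w \<in> carrier R" "y \<in> carrier R" using w y mm_carr by auto
  let ?U = "{u \<in> carrier M. y \<odot>\<^bsub>M\<^esub> u \<in> N}"
  have "?U \<subseteq> N"
  proof (rule nakayama[OF module_axioms acc N w(1)])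
    fix u assume "u \<in> ?U"
    then have u: "u \<in> carrier M" "y \<odot>\<^bsub>M\<^esub> u \<in> N" by auto
    then have "u \<in> addm M N w" using y(2) addm_le[OF N c(1)] unfolding reg_on_def by blast
    then obtain n x where x: "n \<in> N" "x \<in> carrier M" "u = n \<oplus>\<^bsub>M\<^esub> w \<odot>\<^bsub>M\<^esub> x" by (metis addmE)
    have "w \<odot>\<^bsub>M\<^esub> (y \<odot>\<^bsub>M\<^esub> x) = y \<odot>\<^bsub>M\<^esub> u \<ominus>\<^bsub>M\<^esub> y \<odot>\<^bsub>M\<^esub> n"
    proof -
      have "y \<odot>\<^bsub>M\<^esub> u = w \<odot>\<^bsub>M\<^esub> (y \<odot>\<^bsub>M\<^esub> x) \<oplus>\<^bsub>M\<^esub> y \<odot>\<^bsub>M\<^esub> n"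
        unfolding x(3) using x c P(1) by (simp add: smult_r_distr M.a_ac smult_comm[of y w])
      then show ?thesis using x c P(1) by (simp add: add_minus_cancel2)
    qed
    then have "w \<odot>\<^bsub>M\<^esub> (y \<odot>\<^bsub>M\<^esub> x) \<in> N" using u x c P by auto
    then have "y \<odot>\<^bsub>M\<^esub> x \<in> N" using w(2) c x unfolding reg_on_def by auto
    moreover have "u \<ominus>\<^bsub>M\<^esub> w \<odot>\<^bsub>M\<^esub> x = n" unfolding x(3) using x c P(1) by (simp add: add_minus_cancel2)
    ultimately show "\<exists>u'\<in>?U. u \<ominus>\<^bsub>M\<^esub> w \<odot>\<^bsub>M\<^esub> u' \<in> N" using x by auto
  qed auto
  then show "reg_on M y N" unfolding reg_on_def by blast
  show "reg_on M w (addm M N y)" unfolding reg_on_def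
  proof (intro ballI impI)
    fix u assume u: "u \<in> carrier M" "w \<odot>\<^bsub>M\<^esub> u \<in> addm M N y"
    then obtain n x where x: "n \<in> N" "x \<in> carrier M" "w \<odot>\<^bsub>M\<^esub> u = n \<oplus>\<^bsub>M\<^esub> y \<odot>\<^bsub>M\<^esub> x" by (metis addmE)
    have "y \<odot>\<^bsub>M\<^esub> x = \<ominus>\<^bsub>M\<^esub> n \<oplus>\<^bsub>M\<^esub> w \<odot>\<^bsub>M\<^esub> u"
      unfolding x(3) using x c P(1) by (simp add: M.r_neg1)
    then have "y \<odot>\<^bsub>M\<^esub> x \<in> addm M N w" using P(4)[OF x(1)] u by (intro addmI) auto
    then have "x \<in> addm M N w" using y(2) x unfolding reg_on_def by blast
    then obtain n' x' where x': "n' \<in> N" "x' \<in> carrier M" "x = n' \<oplus>\<^bsub>M\<^esub> w \<odot>\<^bsub>M\<^esub> x'" by (metis addmE)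
    have "w \<odot>\<^bsub>M\<^esub> u = (n \<oplus>\<^bsub>M\<^esub> y \<odot>\<^bsub>M\<^esub> n') \<oplus>\<^bsub>M\<^esub> w \<odot>\<^bsub>M\<^esub> (y \<odot>\<^bsub>M\<^esub> x')"
      unfolding x(3) x'(3) using x x' c P(1) by (simp add: smult_r_distr M.a_assoc smult_comm[of y w])
    then have "w \<odot>\<^bsub>M\<^esub> (u \<ominus>\<^bsub>M\<^esub> y \<odot>\<^bsub>M\<^esub> x') = n \<oplus>\<^bsub>M\<^esub> y \<odot>\<^bsub>M\<^esub> n'"
      using x x' c P(1) u by (simp add: smult_r_minus2 add_minus_cancel2)
    then have "w \<odot>\<^bsub>M\<^esub> (u \<ominus>\<^bsub>M\<^esub> y \<odot>\<^bsub>M\<^esub> x') \<in> N" using P x x' c by auto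
    then have "u \<ominus>\<^bsub>M\<^esub> y \<odot>\<^bsub>M\<^esub> x' \<in> N" using w(2) u c x' unfolding reg_on_def by auto
    then show "u \<in> addm M N y" using u c x' by (intro addmI[of _ N x']) (auto simp: add_minus_cancel)
  qed
qed

text \<open>
  All regular elements lower the depth by the same amount. Both elements are compared with a third
  one that is regular modulo each of them; it exists because both quotients have trivial socle.
\<close>

lemma dep_exchange:
  assumes "submodule N R M" "w \<in> \<mm>" "reg_on M w N" "z \<in> \<mm>" "reg_on M z N"
    "depth_ge M \<mm> t (addm M N w)"
  shows "depth_ge M \<mm> t (addm M N z)"
  using assms
proof (induction t arbitrary: N w z)
  case (Suc t)
  have c: "w \<in> carrier R" "z \<in> carrier R" using Suc.prems mm_carr by auto
  note Nw = addm_sub[OF Suc.prems(1) c(1)] and Nz = addm_sub[OF Suc.prems(1) c(2)]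
  obtain v where v: "v \<in> \<mm>" "reg_on M v (addm M N w)" "depth_ge M \<mm> t (addm M (addm M N w) v)"
    using Suc.prems(6) by auto
  have sw: "soc_free (addm M N w)" by (rule soc_free_if_regular[OF v(1,2)])
  have sz: "soc_free (addm M N z)" by (rule soc_free_exchange[OF Suc.prems(1-5) sw])
  obtain y where y: "y \<in> \<mm>" "reg_on M y (addm M N w)" "reg_on M y (addm M N z)"
    using common_regular_element[OF Nw Nz sw sz] by blast
  have yc: "y \<in> carrier R" using y mm_carr by auto
  note Ny = addm_sub[OF Suc.prems(1) yc]
  have 1: "depth_ge M \<mm> t (addm M (addm M N w) y)"
    by (rule Suc.IH[OF Nw v(1,2) y(1,2) v(3)])
  have 2: "reg_on M w (addm M N y)" "reg_on M z (addm M N y)"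
    using regular_permute(2)[OF Suc.prems(1)] Suc.prems y by auto
  have "depth_ge M \<mm> t (addm M (addm M N y) z)"
    using 1 by (intro Suc.IH[OF Ny Suc.prems(2) 2(1) Suc.prems(4) 2(2)])
       (simp add: addm_comm[OF Suc.prems(1) c(1) yc])
  then show ?case using y addm_comm[OF Suc.prems(1) c(2) yc] by auto
qed simp

text \<open>
  Each regular element lengthens the chain of primes above an associated prime \<open>p\<close>: by Nakayama's
  lemma some nonzero element of \<open>M/(N + wM)\<close> is killed by \<open>p\<close>, and a maximal annihilator above its
  annihilator contains \<open>p\<close> and \<open>w \<notin> p\<close>.
\<close>

lemma dep_imp_prime_chain:
  assumes "submodule N R M" "depth_ge M \<mm> t N" "u \<in> carrier M" "u \<notin> N" "primeideal p R"
    "p = ann R M N u"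
  shows "\<exists>P. P 0 = p \<and> (\<forall>i\<le>t. primeideal (P i) R) \<and> (\<forall>i<t. P i \<subset> P (Suc i))"
  using assms
proof (induction t arbitrary: N u p)
  case 0 then show ?case by (intro exI[of _ "\<lambda>_. p"]) auto
next
  case (Suc t)
  note P = sub_rules[OF Suc.prems(1)]
  obtain w where w: "w \<in> \<mm>" "reg_on M w N" "depth_ge M \<mm> t (addm M N w)" using Suc.prems(2) by auto
  have c: "w \<in> carrier R" using w mm_carr by auto
  have pc: "a \<in> carrier R" if "a \<in> p" for a using that Suc.prems(6) by (simp add: ann_def)
  note Nw = addm_sub[OF Suc.prems(1) c]
  let ?U = "{u \<in> carrier M. \<forall>a\<in>p. a \<odot>\<^bsub>M\<^esub> u \<in> N}"
  have "\<not> ?U \<subseteq> addm M N w"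
  proof
    assume U: "?U \<subseteq> addm M N w"
    have "?U \<subseteq> N"
    proof (rule nakayama[OF module_axioms acc Suc.prems(1) w(1)])
      fix v assume v: "v \<in> ?U"
      have "v \<in> addm M N w" using U v by (rule subsetD)
      then obtain n x where x: "n \<in> N" "x \<in> carrier M" "v = n \<oplus>\<^bsub>M\<^esub> w \<odot>\<^bsub>M\<^esub> x" by (rule addmE)
      have "a \<odot>\<^bsub>M\<^esub> x \<in> N" if a: "a \<in> p" for a
      proof -
        have "a \<odot>\<^bsub>M\<^esub> v = w \<odot>\<^bsub>M\<^esub> (a \<odot>\<^bsub>M\<^esub> x) \<oplus>\<^bsub>M\<^esub> a \<odot>\<^bsub>M\<^esub> n"
          unfolding x(3) using x c P(1) pc[OF a] by (simp add: smult_r_distr M.a_ac smult_comm[of a w])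
        then have "w \<odot>\<^bsub>M\<^esub> (a \<odot>\<^bsub>M\<^esub> x) = a \<odot>\<^bsub>M\<^esub> v \<ominus>\<^bsub>M\<^esub> a \<odot>\<^bsub>M\<^esub> n"
          using x c P(1) pc[OF a] by (simp add: add_minus_cancel2)
        then have "w \<odot>\<^bsub>M\<^esub> (a \<odot>\<^bsub>M\<^esub> x) \<in> N" using v x a pc[OF a] P by auto
        then show ?thesis using w(2) pc[OF a] x unfolding reg_on_def by auto
      qed
      moreover have "v \<ominus>\<^bsub>M\<^esub> w \<odot>\<^bsub>M\<^esub> x = n" unfolding x(3) using x c P(1) by (simp add: add_minus_cancel2)
      ultimately show "\<exists>u'\<in>?U. v \<ominus>\<^bsub>M\<^esub> w \<odot>\<^bsub>M\<^esub> u' \<in> N" using x by auto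
    qed auto
    moreover have "u \<in> ?U" using Suc.prems(3,6) by (auto simp: ann_def)
    ultimately show False using Suc.prems(4) by blast
  qed
  then obtain u' where u': "u' \<in> carrier M" "\<forall>a\<in>p. a \<odot>\<^bsub>M\<^esub> u' \<in> N" "u' \<notin> addm M N w" by blast
  obtain q where q: "maxann R M (addm M N w) q" "ann R M (addm M N w) u' \<subseteq> q"
    using maxann_exists[OF Nw u'(1,3)] by blast
  obtain v where v: "v \<in> carrier M" "v \<notin> addm M N w" "q = ann R M (addm M N w) v"
    using q(1) unfolding maxann_def by blast
  obtain Q where Q: "Q 0 = q" "\<forall>i\<le>t. primeideal (Q i) R" "\<forall>i<t. Q i \<subset> Q (Suc i)"
    using Suc.IH[OF Nw w(3) v(1,2) maxann_prime[OF Nw q(1)] v(3)] by blast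
  have "p \<subseteq> q" using q(2) u'(2) pc addm_le[OF Suc.prems(1) c] unfolding ann_def by blast
  moreover have "w \<in> q" using q(2) c addm_mult[OF Suc.prems(1) c u'(1)] by (auto simp: ann_def)
  moreover have "w \<notin> p" using w(2) Suc.prems(3,4,6) by (auto simp: ann_def reg_on_def)
  ultimately have "p \<subset> q" by blast
  then show ?case
    using Q Suc.prems(5)
    by (intro exI[of _ "\<lambda>i. case i of 0 \<Rightarrow> p | Suc j \<Rightarrow> Q j"]) (auto split: nat.split simp: less_Suc_eq_0_disj)
qed

end

text \<open>
  A prime containing the annihilator of \<open>M/(N + wM)\<close> is not minimal over the annihilator of
  \<open>M/N\<close> when \<open>w\<close> is regular on \<open>M/N\<close>: the multiplicative set generated by \<open>w\<close> and the
  complement of the prime avoids that annihilator.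
\<close>

lemma smaller_prime:
  assumes "noetherian_ring R" "module R M" "submodule N R M" "w \<in> carrier R" "reg_on M w N"
    "primeideal p R" "annq R M (addm M N w) \<subseteq> p"
  shows "\<exists>q. primeideal q R \<and> q \<subset> p \<and> annq R M N \<subseteq> q"
proof -
  interpret M: module R M by fact
  note P = M.sub_rules[OF assms(3)] and PP = M.R.prime_rules[OF assms(6)]
  define S where "S = {w [^]\<^bsub>R\<^esub> (k::nat) \<otimes>\<^bsub>R\<^esub> s | k s. s \<in> carrier R \<and> s \<notin> p}"
  have S1: "s \<in> S" if "s \<in> carrier R" "s \<notin> p" for s
    unfolding S_def using that by (intro CollectI exI[of _ "0::nat"] exI[of _ s]) auto
  have wS: "w \<in> S" unfolding S_def using PP assms(4)
    by (intro CollectI exI[of _ "1::nat"] exI[of _ "\<one>\<^bsub>R\<^esub>"]) auto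
  have SS: "a \<otimes>\<^bsub>R\<^esub> b \<in> S" if "a \<in> S" "b \<in> S" for a b
  proof -
    obtain k s l t where 1: "a = w [^]\<^bsub>R\<^esub> (k::nat) \<otimes>\<^bsub>R\<^esub> s" "b = w [^]\<^bsub>R\<^esub> (l::nat) \<otimes>\<^bsub>R\<^esub> t"
      "s \<in> carrier R" "s \<notin> p" "t \<in> carrier R" "t \<notin> p" using \<open>a \<in> S\<close> \<open>b \<in> S\<close> unfolding S_def by blast
    have "a \<otimes>\<^bsub>R\<^esub> b = w [^]\<^bsub>R\<^esub> (k + l) \<otimes>\<^bsub>R\<^esub> (s \<otimes>\<^bsub>R\<^esub> t)"
      using 1 assms(4) by (simp add: M.R.m_ac flip: M.R.nat_pow_mult)
    then show ?thesis unfolding S_def using 1 PP(3)[of s t] by blast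
  qed
  have powreg: "u \<in> N" if "u \<in> carrier M" "w [^]\<^bsub>R\<^esub> (k::nat) \<odot>\<^bsub>M\<^esub> u \<in> N" for u k
    using that
  proof (induction k arbitrary: u)
    case (Suc k)
    have "w [^]\<^bsub>R\<^esub> k \<odot>\<^bsub>M\<^esub> (w \<odot>\<^bsub>M\<^esub> u) \<in> N" using Suc.prems assms(4) by (simp add: M.smult_assoc1)
    then have "w \<odot>\<^bsub>M\<^esub> u \<in> N" using Suc.IH[of "w \<odot>\<^bsub>M\<^esub> u"] Suc.prems assms(4) by auto
    then show ?case using assms(5) Suc.prems unfolding reg_on_def by blast
  qed simp
  have disj: "a \<notin> annq R M N" if "a \<in> S" for a
  proof
    assume a: "a \<in> annq R M N"
    obtain k s where 1: "a = w [^]\<^bsub>R\<^esub> (k::nat) \<otimes>\<^bsub>R\<^esub> s" "s \<in> carrier R" "s \<notin> p"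
      using \<open>a \<in> S\<close> unfolding S_def by blast
    have "s \<odot>\<^bsub>M\<^esub> x \<in> N" if "x \<in> carrier M" for x
    proof (rule powreg)
      show "s \<odot>\<^bsub>M\<^esub> x \<in> carrier M" using that 1 by simp
      show "w [^]\<^bsub>R\<^esub> k \<odot>\<^bsub>M\<^esub> (s \<odot>\<^bsub>M\<^esub> x) \<in> N"
        using a that 1 assms(4) by (simp add: annq_def M.smult_assoc1)
    qed
    then have "s \<in> annq R M (addm M N w)"
      using 1 M.addm_le[OF assms(3,4)] unfolding annq_def by blast
    then show False using 1 assms(7) by blast
  qed
  let ?F = "{I. ideal I R \<and> annq R M N \<subseteq> I \<and> I \<inter> S = {}}"
  have "\<exists>q\<in>?F. \<forall>T\<in>?F. q \<subseteq> T \<longrightarrow> T = q"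
    by (rule acc_mod_maximal[OF M.R.acc_reg_mod[OF assms(1)]])
       (use disj M.annq_ideal[OF assms(3)] in \<open>auto simp: M.R.submodule_reg_iff\<close>)
  then obtain q where q: "ideal q R" "annq R M N \<subseteq> q" "q \<inter> S = {}"
    "\<And>T. ideal T R \<Longrightarrow> T \<inter> S = {} \<Longrightarrow> q \<subseteq> T \<Longrightarrow> T = q" by auto
  note Q = M.R.ideal_rules[OF q(1)]
  interpret G: module R "reg_mod R" by (rule M.R.reg_mod_module)
  have qs: "submodule q R (reg_mod R)" using q(1) by (simp add: M.R.submodule_reg_iff)
  have "primeideal q R"
  proof (rule primeidealI)
    show "ideal q R" "cring R" by (rule q(1), rule M.R.is_cring)
    show "carrier R \<noteq> q" using q(3) wS assms(4) by blast
    fix a b assume ab: "a \<in> carrier R" "b \<in> carrier R" "a \<otimes>\<^bsub>R\<^esub> b \<in> q"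
    show "a \<in> q \<or> b \<in> q"
    proof (rule ccontr)
      assume n: "\<not> (a \<in> q \<or> b \<in> q)"
      have ex: "\<exists>s\<in>S. \<exists>x\<in>q. \<exists>r\<in>carrier R. s = x \<oplus>\<^bsub>R\<^esub> c \<otimes>\<^bsub>R\<^esub> r" if c: "c \<in> carrier R" "c \<notin> q" for c
      proof -
        have "ideal (addm (reg_mod R) q c) R"
          using G.addm_sub[OF qs c(1)] by (simp add: M.R.submodule_reg_iff)
        moreover have "q \<subseteq> addm (reg_mod R) q c" by (rule G.addm_le[OF qs c(1)])
        moreover have "c \<in> addm (reg_mod R) q c"
          using G.addm_mult[OF qs c(1), of "\<one>\<^bsub>R\<^esub>"] c by simp
        ultimately have "addm (reg_mod R) q c \<inter> S \<noteq> {}" using q(4) c(2) by blast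
        then show ?thesis unfolding addm_def by auto
      qed
      obtain s x r where s: "s \<in> S" "x \<in> q" "r \<in> carrier R" "s = x \<oplus>\<^bsub>R\<^esub> a \<otimes>\<^bsub>R\<^esub> r" using ex[of a] ab n by blast
      obtain t y r' where t: "t \<in> S" "y \<in> q" "r' \<in> carrier R" "t = y \<oplus>\<^bsub>R\<^esub> b \<otimes>\<^bsub>R\<^esub> r'" using ex[of b] ab n by blast
      have "s \<otimes>\<^bsub>R\<^esub> t = x \<otimes>\<^bsub>R\<^esub> t \<oplus>\<^bsub>R\<^esub> ((a \<otimes>\<^bsub>R\<^esub> r) \<otimes>\<^bsub>R\<^esub> y \<oplus>\<^bsub>R\<^esub> (r \<otimes>\<^bsub>R\<^esub> r') \<otimes>\<^bsub>R\<^esub> (a \<otimes>\<^bsub>R\<^esub> b))"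
        unfolding s(4) t(4) using s(2,3) t(2,3) ab Q(1)
        by (simp add: M.R.l_distr M.R.r_distr M.R.m_ac M.R.a_ac)
      also have "\<dots> \<in> q"
      proof (intro Q(3))
        have "t \<in> carrier R" unfolding t(4) using t(2,3) ab Q(1) by simp
        then show "x \<otimes>\<^bsub>R\<^esub> t \<in> q" using s(2) by (rule Q(7))
      qed (use s t ab in \<open>auto intro!: Q(6)\<close>)
      finally show False using q(3) SS[OF s(1) t(1)] by blast
    qed
  qed
  moreover have "q \<subseteq> p" using q(3) S1 Q(1) by blast
  moreover have "w \<in> p" using assms(7,4) M.addm_mult[OF assms(3,4)] unfolding annq_def by blast
  moreover have "w \<notin> q" using q(3) wS by blast
  ultimately show ?thesis using q(2) by blast
qed

text \<open>
  The counterpart of \<open>dep_imp_prime_chain\<close> below a prime: \<open>smaller_prime\<close> adds one member for each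
  element of the regular sequence.
\<close>

lemma regular_imp_prime_chain:
  assumes "noetherian_ring R" "module R M" "submodule N R M" "\<And>i. i < t \<Longrightarrow> w i \<in> carrier R"
    "\<And>i. i < t \<Longrightarrow> reg_on M (w i) (msum M w N i)"
    "primeideal p R" "annq R M (msum M w N t) \<subseteq> p"
  shows "\<exists>P. P t = p \<and> (\<forall>i\<le>t. primeideal (P i) R) \<and> (\<forall>i<t. P i \<subset> P (Suc i)) \<and> annq R M N \<subseteq> P 0"
  using assms(4-)
proof (induction t arbitrary: p)
  case 0 then show ?case by (intro exI[of _ "\<lambda>_. p"]) auto
next
  case (Suc t)
  interpret M: module R M by fact
  have s: "submodule (msum M w N t) R M" using Suc.prems(1) by (intro M.msum_sub assms(3)) auto
  obtain q where q: "primeideal q R" "q \<subset> p" "annq R M (msum M w N t) \<subseteq> q"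
    using smaller_prime[OF assms(1,2) s, of "w t" p] Suc.prems by auto
  obtain P where P: "P t = q" "\<forall>i\<le>t. primeideal (P i) R" "\<forall>i<t. P i \<subset> P (Suc i)" "annq R M N \<subseteq> P 0"
    using Suc.IH[OF _ _ q(1,3)] Suc.prems by (auto simp: less_Suc_eq)
  show ?case
    by (intro exI[of _ "P(Suc t := p)"]) (use P q Suc.prems(3) in \<open>auto simp: less_Suc_eq le_Suc_eq\<close>)
qed

lemma prime_chain_le_krull_dim:
  assumes "\<forall>i\<le>n. primeideal (P i) R" "\<forall>i<n. P i \<subset> P (Suc i)"
  shows "enat n \<le> krull_dim R"
  unfolding krull_dim_def by (rule Sup_upper) (use assms in blast)


section \<open>Relative injectivity\<close>

text \<open>Equality of the classes of \<open>x\<close> and \<open>y\<close> in \<open>M/P\<close>.\<close>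

definition cg :: "('a, 'b, 'k) module_scheme \<Rightarrow> 'b set \<Rightarrow> 'b \<Rightarrow> 'b \<Rightarrow> bool" where
  "cg M P x y \<longleftrightarrow> x \<in> carrier M \<and> y \<in> carrier M \<and> x \<ominus>\<^bsub>M\<^esub> y \<in> P"

text \<open>A homomorphism \<open>A \<rightarrow> M/P\<close> on a submodule \<open>A\<close> of \<open>D\<close>, given by representatives in \<open>M\<close>.\<close>

definition qhom :: "('a, 'm) ring_scheme \<Rightarrow> ('a, 'c, 'l) module_scheme \<Rightarrow> 'c set \<Rightarrow>
    ('a, 'b, 'k) module_scheme \<Rightarrow> 'b set \<Rightarrow> ('c \<Rightarrow> 'b) \<Rightarrow> bool" where
  "qhom R D A M P f \<longleftrightarrow> (\<forall>x\<in>A. f x \<in> carrier M) \<and>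
     (\<forall>x\<in>A. \<forall>y\<in>A. cg M P (f (x \<oplus>\<^bsub>D\<^esub> y)) (f x \<oplus>\<^bsub>M\<^esub> f y)) \<and>
     (\<forall>a\<in>carrier R. \<forall>x\<in>A. cg M P (f (a \<odot>\<^bsub>D\<^esub> x)) (a \<odot>\<^bsub>M\<^esub> f x))"

text \<open>
  Baer's condition for \<open>S/P\<close> over the ring \<open>R/I\<close>: a homomorphism \<open>J/I \<rightarrow> S/P\<close> on an ideal is the
  multiplication with an element.
\<close>

definition rel_inj :: "('a, 'm) ring_scheme \<Rightarrow> 'a set \<Rightarrow> ('a, 'b, 'k) module_scheme \<Rightarrow> 'b set \<Rightarrow>
    'b set \<Rightarrow> bool" where
  "rel_inj R I M S P \<longleftrightarrow> (\<forall>J f. ideal J R \<and> I \<subseteq> J \<and> qhom R (reg_mod R) J M P f \<and> f ` J \<subseteq> S \<and>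
     (\<forall>a\<in>I. f a \<in> P) \<longrightarrow> (\<exists>m\<in>S. \<forall>a\<in>J. cg M P (f a) (a \<odot>\<^bsub>M\<^esub> m)))"

context module
begin

lemma cg_refl: "submodule P R M \<Longrightarrow> x \<in> carrier M \<Longrightarrow> cg M P x x"
  unfolding cg_def using sub_zero by (simp add: M.minus_eq M.r_neg)

lemma cg_sym: assumes "submodule P R M" "cg M P x y" shows "cg M P y x"
proof -
  have "\<ominus>\<^bsub>M\<^esub> (x \<ominus>\<^bsub>M\<^esub> y) = y \<ominus>\<^bsub>M\<^esub> x" using assms(2)
    by (simp add: cg_def M.minus_eq M.minus_add M.a_comm)
  then show ?thesis using assms sub_neg[OF assms(1), of "x \<ominus>\<^bsub>M\<^esub> y"] by (simp add: cg_def)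
qed

lemma cg_trans: assumes "submodule P R M" "cg M P x y" "cg M P y w" shows "cg M P x w"
proof -
  have c: "x \<in> carrier M" "y \<in> carrier M" "w \<in> carrier M" using assms by (auto simp: cg_def)
  have "(x \<ominus>\<^bsub>M\<^esub> y) \<oplus>\<^bsub>M\<^esub> (y \<ominus>\<^bsub>M\<^esub> w) = x \<ominus>\<^bsub>M\<^esub> w"
    using c by (simp add: M.minus_eq M.a_assoc M.r_neg1)
  then show ?thesis using assms c sub_add[OF assms(1)] by (metis cg_def)
qed

lemma cg_add: assumes "submodule P R M" "cg M P x y" "cg M P u v" shows "cg M P (x \<oplus>\<^bsub>M\<^esub> u) (y \<oplus>\<^bsub>M\<^esub> v)"
proof -
  have c: "x \<in> carrier M" "y \<in> carrier M" "u \<in> carrier M" "v \<in> carrier M" using assms by (auto simp: cg_def)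
  have "(x \<oplus>\<^bsub>M\<^esub> u) \<ominus>\<^bsub>M\<^esub> (y \<oplus>\<^bsub>M\<^esub> v) = (x \<ominus>\<^bsub>M\<^esub> y) \<oplus>\<^bsub>M\<^esub> (u \<ominus>\<^bsub>M\<^esub> v)"
    using c by (simp add: M.minus_eq M.minus_add M.a_ac)
  then show ?thesis using assms c sub_add[OF assms(1)] by (simp add: cg_def)
qed

lemma cg_smult: assumes "submodule P R M" "cg M P x y" "a \<in> carrier R"
  shows "cg M P (a \<odot>\<^bsub>M\<^esub> x) (a \<odot>\<^bsub>M\<^esub> y)"
  using assms sub_smult[OF assms(1,3), of "x \<ominus>\<^bsub>M\<^esub> y"] by (simp add: cg_def smult_r_minus2)

lemma cg_neg: assumes "submodule P R M" "cg M P x y"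
  shows "cg M P (\<ominus>\<^bsub>M\<^esub> x) (\<ominus>\<^bsub>M\<^esub> y)"
proof -
  have "\<ominus>\<^bsub>M\<^esub> (x \<ominus>\<^bsub>M\<^esub> y) = \<ominus>\<^bsub>M\<^esub> x \<ominus>\<^bsub>M\<^esub> \<ominus>\<^bsub>M\<^esub> y" using assms(2)
    by (simp add: cg_def M.minus_eq M.minus_add)
  then show ?thesis using assms sub_neg[OF assms(1), of "x \<ominus>\<^bsub>M\<^esub> y"] by (simp add: cg_def)
qed

lemma cg_minus: assumes "submodule P R M" "cg M P x y" "cg M P u v"
  shows "cg M P (x \<ominus>\<^bsub>M\<^esub> u) (y \<ominus>\<^bsub>M\<^esub> v)"
  using cg_add[OF assms(1,2) cg_neg[OF assms(1,3)]] assms by (simp add: M.minus_eq)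

lemma neg_zero: "\<ominus>\<^bsub>M\<^esub> \<zero>\<^bsub>M\<^esub> = \<zero>\<^bsub>M\<^esub>"
  using M.r_neg[of "\<zero>\<^bsub>M\<^esub>"] by simp

lemma minus_zero: "x \<in> carrier M \<Longrightarrow> x \<ominus>\<^bsub>M\<^esub> \<zero>\<^bsub>M\<^esub> = x"
  by (simp add: M.minus_eq neg_zero)

lemma minus_self: "x \<in> carrier M \<Longrightarrow> x \<ominus>\<^bsub>M\<^esub> x = \<zero>\<^bsub>M\<^esub>"
  by (simp add: M.minus_eq M.r_neg)

lemma cg_zero_iff: "submodule P R M \<Longrightarrow> cg M P x \<zero>\<^bsub>M\<^esub> \<longleftrightarrow> x \<in> P"
  using sub_carr by (auto simp: cg_def M.minus_eq neg_zero)

lemma cg_mem: assumes "submodule P R M" "submodule S R M" "P \<subseteq> S" "cg M P x y" "y \<in> S" shows "x \<in> S"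
proof -
  have "(x \<ominus>\<^bsub>M\<^esub> y) \<oplus>\<^bsub>M\<^esub> y \<in> S" using assms by (intro sub_add[OF assms(2)]) (auto simp: cg_def)
  then show ?thesis using assms(4) by (simp add: cg_def add_minus_cancel)
qed

lemma cg_singleton: "cg M {\<zero>\<^bsub>M\<^esub>} x y \<longleftrightarrow> x \<in> carrier M \<and> x = y"
proof
  assume c: "cg M {\<zero>\<^bsub>M\<^esub>} x y"
  then have xy: "x \<in> carrier M" "y \<in> carrier M" "x \<ominus>\<^bsub>M\<^esub> y = \<zero>\<^bsub>M\<^esub>" by (auto simp: cg_def)
  then show "x \<in> carrier M \<and> x = y" using add_minus_cancel[OF xy(1,2)] by auto
qed (metis cg_refl sub_zero_set)

lemma cg_mono: "P \<subseteq> Q \<Longrightarrow> cg M P x y \<Longrightarrow> cg M Q x y"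
  by (auto simp: cg_def)

lemma lin_minus_r:
  assumes "v \<in> {..<n} \<rightarrow> carrier R" "b \<in> {..<n} \<rightarrow> carrier M" "b' \<in> {..<n} \<rightarrow> carrier M"
    "\<And>i. i < n \<Longrightarrow> c i = b i \<ominus>\<^bsub>M\<^esub> b' i"
  shows "lin M n v c = lin M n v b \<ominus>\<^bsub>M\<^esub> lin M n v b'"
proof -
  have u: "c \<in> {..<n} \<rightarrow> carrier M" using assms(2,3,4) by (auto simp: Pi_iff)
  have "lin M n v b = lin M n v c \<oplus>\<^bsub>M\<^esub> lin M n v b'"
    using assms by (intro lin_add_r u) (auto simp: add_minus_cancel Pi_iff)
  then show ?thesis using lin_closed[OF assms(1) u] lin_closed[OF assms(1,3)]
    by (simp add: add_minus_cancel2)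
qed

end

lemma qhomI:
  assumes "\<And>x. x \<in> A \<Longrightarrow> f x \<in> carrier M"
    "\<And>x y. x \<in> A \<Longrightarrow> y \<in> A \<Longrightarrow> cg M P (f (x \<oplus>\<^bsub>D\<^esub> y)) (f x \<oplus>\<^bsub>M\<^esub> f y)"
    "\<And>a x. a \<in> carrier R \<Longrightarrow> x \<in> A \<Longrightarrow> cg M P (f (a \<odot>\<^bsub>D\<^esub> x)) (a \<odot>\<^bsub>M\<^esub> f x)"
  shows "qhom R D A M P f"
  using assms by (simp add: qhom_def)

lemma qhomD:
  assumes "qhom R D A M P f"
  shows "x \<in> A \<Longrightarrow> f x \<in> carrier M"
    "x \<in> A \<Longrightarrow> y \<in> A \<Longrightarrow> cg M P (f (x \<oplus>\<^bsub>D\<^esub> y)) (f x \<oplus>\<^bsub>M\<^esub> f y)"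
    "a \<in> carrier R \<Longrightarrow> x \<in> A \<Longrightarrow> cg M P (f (a \<odot>\<^bsub>D\<^esub> x)) (a \<odot>\<^bsub>M\<^esub> f x)"
  using assms by (simp_all add: qhom_def)

lemma qhom_minus:
  assumes D: "module R D" and M: "module R M" and A: "submodule A R D" and P: "submodule P R M"
    and f: "qhom R D A M P f" and xy: "x \<in> A" "y \<in> A"
  shows "cg M P (f (x \<ominus>\<^bsub>D\<^esub> y)) (f x \<ominus>\<^bsub>M\<^esub> f y)"
proof -
  interpret D: module R D by fact
  interpret M: module R M by fact
  note A' = D.sub_rules[OF A]
  have e: "x = (x \<ominus>\<^bsub>D\<^esub> y) \<oplus>\<^bsub>D\<^esub> y" using A'(1) xy by (simp add: D.add_minus_cancel)
  have m: "x \<ominus>\<^bsub>D\<^esub> y \<in> A" using A' xy by blast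
  have "cg M P (f x) (f (x \<ominus>\<^bsub>D\<^esub> y) \<oplus>\<^bsub>M\<^esub> f y)" using qhomD(2)[OF f m xy(2)] e by simp
  from M.cg_minus[OF P this M.cg_refl[OF P qhomD(1)[OF f xy(2)]]]
  have "cg M P (f x \<ominus>\<^bsub>M\<^esub> f y) (f (x \<ominus>\<^bsub>D\<^esub> y))"
    using qhomD(1)[OF f] m xy by (simp add: M.add_minus_cancel2)
  then show ?thesis by (rule M.cg_sym[OF P])
qed

lemma qhom_zero:
  assumes D: "module R D" and M: "module R M" and A: "submodule A R D" and P: "submodule P R M"
    and f: "qhom R D A M P f"
  shows "f \<zero>\<^bsub>D\<^esub> \<in> P"
proof -
  interpret D: module R D by fact
  interpret M: module R M by fact
  have z: "\<zero>\<^bsub>D\<^esub> \<in> A" by (rule D.sub_zero[OF A])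
  have "cg M P (f (\<zero>\<^bsub>R\<^esub> \<odot>\<^bsub>D\<^esub> \<zero>\<^bsub>D\<^esub>)) (\<zero>\<^bsub>R\<^esub> \<odot>\<^bsub>M\<^esub> f \<zero>\<^bsub>D\<^esub>)" by (rule qhomD(3)[OF f _ z]) simp
  then show ?thesis using qhomD(1)[OF f z] by (simp add: M.cg_zero_iff[OF P])
qed

lemma qhom_lin:
  assumes D: "module R D" and M: "module R M" and A: "submodule A R D" and P: "submodule P R M"
    and f: "qhom R D A M P f" and c: "c \<in> {..<n} \<rightarrow> carrier R" and x: "x \<in> {..<n} \<rightarrow> A"
  shows "cg M P (f (lin D n c x)) (lin M n c (\<lambda>i. f (x i)))"
  using c x
proof (induction n)
  case 0
  interpret D: module R D by fact
  interpret M: module R M by fact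
  show ?case using qhom_zero[OF D M A P f] by (simp add: D.lin_0 M.lin_0 M.cg_zero_iff[OF P])
next
  case (Suc n)
  interpret D: module R D by fact
  interpret M: module R M by fact
  have xc: "x \<in> {..<Suc n} \<rightarrow> carrier D" using Suc.prems D.sub_carr[OF A] by blast
  have fc: "(\<lambda>i. f (x i)) \<in> {..<Suc n} \<rightarrow> carrier M" using Suc.prems qhomD(1)[OF f] by blast
  have l: "lin D n c x \<in> A" using Suc.prems by (intro D.lin_in_sub[OF A]) auto
  have s: "c n \<odot>\<^bsub>D\<^esub> x n \<in> A" using Suc.prems by (intro D.sub_smult[OF A]) auto
  have "cg M P (f (lin D (Suc n) c x)) (f (c n \<odot>\<^bsub>D\<^esub> x n) \<oplus>\<^bsub>M\<^esub> f (lin D n c x))"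
    unfolding D.lin_Suc[OF Suc.prems(1) xc] by (rule qhomD(2)[OF f s l])
  moreover have "cg M P (f (c n \<odot>\<^bsub>D\<^esub> x n) \<oplus>\<^bsub>M\<^esub> f (lin D n c x))
     (c n \<odot>\<^bsub>M\<^esub> f (x n) \<oplus>\<^bsub>M\<^esub> lin M n c (\<lambda>i. f (x i)))"
    using Suc.prems by (intro M.cg_add[OF P] qhomD(3)[OF f] Suc.IH) auto
  ultimately show ?case
    unfolding M.lin_Suc[OF Suc.prems(1) fc] by (rule M.cg_trans[OF P])
qed

text \<open>
  Baer's criterion, for submodules of free modules over \<open>R/I\<close>: the coordinates are treated one at a
  time, and each step is an extension from an ideal containing \<open>I\<close>.
\<close>

lemma rel_inj_free:
  assumes M: "module R M" and S: "submodule S R M" and P: "submodule P R M" and PS: "P \<subseteq> S"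
    and inj: "rel_inj R I M S P" and A: "submodule A R (free_mod R n)"
    and IA: "\<And>a v. a \<in> I \<Longrightarrow> v \<in> carrier (free_mod R n) \<Longrightarrow> a \<odot>\<^bsub>free_mod R n\<^esub> v \<in> A"
    and Ic: "I \<subseteq> carrier R"
    and g: "qhom R (free_mod R n) A M P g" and gS: "g ` A \<subseteq> S"
    and gI: "\<And>a v. a \<in> I \<Longrightarrow> v \<in> carrier (free_mod R n) \<Longrightarrow> g (a \<odot>\<^bsub>free_mod R n\<^esub> v) \<in> P"
  shows "\<exists>b. b \<in> {..<n} \<rightarrow> S \<and> (\<forall>c\<in>A. cg M P (g c) (lin M n c b))"
proof -
  interpret M: module R M by fact
  interpret F: module R "free_mod R n" by (rule M.R.free_mod_module)
  let ?F = "free_mod R n"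
  note Sr = M.sub_rules[OF S] and Ar = F.sub_rules[OF A]
  have cP: "c \<in> {..<n} \<rightarrow> carrier R" if "c \<in> A" for c using Ar(1)[OF that] by (rule free_mod_Pi)
  define A' where "A' m = {c \<in> A. \<forall>i. m \<le> i \<and> i < n \<longrightarrow> c i = \<zero>\<^bsub>R\<^esub>}" for m
  have A's: "submodule (A' m) R ?F" for m
    by (rule F.subI) (use Ar in \<open>auto simp: A'_def free_mod_apply\<close>)
  have A'A: "A' m \<subseteq> A" for m by (auto simp: A'_def)
  have "\<exists>b. (\<forall>i. b i \<in> S) \<and> (\<forall>i\<ge>m. b i = \<zero>\<^bsub>M\<^esub>) \<and> (\<forall>c\<in>A' m. cg M P (g c) (lin M n c b))" if "m \<le> n" for m
    using that
  proof (induction m)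
    case 0
    have "lin M n c (\<lambda>_. \<zero>\<^bsub>M\<^esub>) = \<zero>\<^bsub>M\<^esub>" if "c \<in> A" for c
      using M.lin_in_sub[OF M.sub_zero_set cP[OF that]] by auto
    moreover have "g c \<in> P" if c: "c \<in> A' 0" for c
    proof -
      have "c = \<zero>\<^bsub>?F\<^esub>"
      proof (rule PiE_ext)
        show "c \<in> {..<n} \<rightarrow>\<^sub>E carrier R" using c Ar(1) by (auto simp: A'_def free_mod_def)
        show "\<zero>\<^bsub>?F\<^esub> \<in> {..<n} \<rightarrow>\<^sub>E carrier R" using F.zero_closed by (simp only: free_mod_carrier_iff)
      qed (use c in \<open>auto simp: A'_def free_mod_apply\<close>)
      then show ?thesis using qhom_zero[OF F.module_axioms M A P g] by simp
    qed
    ultimately have "cg M P (g c) (lin M n c (\<lambda>_. \<zero>\<^bsub>M\<^esub>))" if "c \<in> A' 0" for c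
      using subsetD[OF A'A that] that M.cg_zero_iff[OF P] by simp
    then show ?case using Sr(2) by (intro exI[of _ "\<lambda>_. \<zero>\<^bsub>M\<^esub>"]) auto
  next
    case (Suc m)
    then have m: "m < n" by simp
    obtain b where b: "\<And>i. b i \<in> S" "\<And>i. i \<ge> m \<Longrightarrow> b i = \<zero>\<^bsub>M\<^esub>" "\<And>c. c \<in> A' m \<Longrightarrow> cg M P (g c) (lin M n c b)"
      using Suc by auto
    have bS: "b \<in> {..<n} \<rightarrow> S" and bM: "b \<in> {..<n} \<rightarrow> carrier M" using b(1) Sr(1) by auto
    define g' where "g' c = g c \<ominus>\<^bsub>M\<^esub> lin M n c b" for c
    have lc: "lin M n c b \<in> S" if "c \<in> A" for c by (rule M.lin_in_sub[OF S cP[OF that] bS])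
    have g'S: "g' c \<in> S" if "c \<in> A" for c unfolding g'_def using lc gS that Sr by blast
    have g'M: "g' c \<in> carrier M" if "c \<in> A" for c using g'S[OF that] Sr(1) by blast
    have g': "qhom R ?F A M P g'"
    proof (rule qhomI)
      fix x y assume xy: "x \<in> A" "y \<in> A"
      have "lin M n (x \<oplus>\<^bsub>?F\<^esub> y) b = lin M n x b \<oplus>\<^bsub>M\<^esub> lin M n y b"
        using xy cP bM by (intro M.lin_add) (auto simp: free_mod_apply)
      moreover have "(g x \<oplus>\<^bsub>M\<^esub> g y) \<ominus>\<^bsub>M\<^esub> (lin M n x b \<oplus>\<^bsub>M\<^esub> lin M n y b) = g' x \<oplus>\<^bsub>M\<^esub> g' y"
        unfolding g'_def using qhomD(1)[OF g] xy lc Sr(1)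
        by (simp add: M.M.minus_eq M.M.minus_add M.M.a_ac)
      ultimately show "cg M P (g' (x \<oplus>\<^bsub>?F\<^esub> y)) (g' x \<oplus>\<^bsub>M\<^esub> g' y)"
        using M.cg_minus[OF P qhomD(2)[OF g xy] M.cg_refl[OF P]] lc xy Ar(3) Sr(1)
        unfolding g'_def by (metis M.M.add.m_closed)
    next
      fix a x assume ax: "a \<in> carrier R" "x \<in> A"
      have "lin M n (a \<odot>\<^bsub>?F\<^esub> x) b = a \<odot>\<^bsub>M\<^esub> lin M n x b"
        using ax cP bM by (intro M.lin_smult) (auto simp: free_mod_apply)
      moreover have "a \<odot>\<^bsub>M\<^esub> g x \<ominus>\<^bsub>M\<^esub> a \<odot>\<^bsub>M\<^esub> lin M n x b = a \<odot>\<^bsub>M\<^esub> g' x"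
        unfolding g'_def using qhomD(1)[OF g] ax lc Sr(1) by (simp add: M.smult_r_minus2)
      ultimately show "cg M P (g' (a \<odot>\<^bsub>?F\<^esub> x)) (a \<odot>\<^bsub>M\<^esub> g' x)"
        using M.cg_minus[OF P qhomD(3)[OF g ax] M.cg_refl[OF P]] lc ax Sr(1)
        unfolding g'_def by (metis M.smult_closed)
    qed (rule g'M)
    have wd: "cg M P (g' c) (g' c')" if c: "c \<in> A' (Suc m)" "c' \<in> A' (Suc m)" "c m = c' m" for c c'
    proof -
      have cA: "c \<in> A" "c' \<in> A" using c A'A by auto
      have cz: "c i = c' i" if "m \<le> i" "i < n" for i
        using c that by (cases "i = m") (auto simp: A'_def)
      have "(c \<ominus>\<^bsub>?F\<^esub> c') i = \<zero>\<^bsub>R\<^esub>" if "m \<le> i" "i < n" for i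
      proof -
        have "(c \<ominus>\<^bsub>?F\<^esub> c') \<oplus>\<^bsub>?F\<^esub> c' = c" using cA Ar(1) by (simp add: F.add_minus_cancel)
        then have "(c \<ominus>\<^bsub>?F\<^esub> c') i \<oplus>\<^bsub>R\<^esub> c' i = c' i" using cz[OF that] that by (metis free_mod_add_apply)
        moreover have "(c \<ominus>\<^bsub>?F\<^esub> c') i \<in> carrier R" "c' i \<in> carrier R"
          using cP[OF Ar(5)[OF cA]] cP[OF cA(2)] that by auto
        ultimately show ?thesis by (metis M.R.add.l_cancel_one' M.R.add.r_cancel_one')
      qed
      then have d: "c \<ominus>\<^bsub>?F\<^esub> c' \<in> A' m" using Ar(5)[OF cA] by (simp add: A'_def)
      have "cg M P (g' (c \<ominus>\<^bsub>?F\<^esub> c')) \<zero>\<^bsub>M\<^esub>"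
        using b(3)[OF d] Ar(5)[OF cA] g'M M.cg_zero_iff[OF P] by (auto simp: g'_def cg_def)
      from M.cg_trans[OF P M.cg_sym[OF P qhom_minus[OF F.module_axioms M A P g' cA]] this]
      show ?thesis using M.cg_zero_iff[OF P, of "g' c \<ominus>\<^bsub>M\<^esub> g' c'"] g'M cA by (simp only: cg_def) simp
    qed
    define J where "J = (\<lambda>c. c m) ` A' (Suc m)"
    note A'r = F.sub_rules[OF A's[of "Suc m"]]
    have J: "ideal J R"
    proof (rule M.R.idealI_ring)
      show "J \<subseteq> carrier R" unfolding J_def using cP A'A m by blast
      show "\<zero>\<^bsub>R\<^esub> \<in> J" unfolding J_def using A'r(2) m free_mod_zero_apply by (metis imageI)
    next
      fix a b assume "a \<in> J" "b \<in> J"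
      then obtain c c' where "c \<in> A' (Suc m)" "c' \<in> A' (Suc m)" "a = c m" "b = c' m" unfolding J_def by blast
      then show "a \<oplus>\<^bsub>R\<^esub> b \<in> J" unfolding J_def using A'r(3)[of c c'] m free_mod_add_apply[of m n R c c'] by (intro image_eqI[of _ _ "c \<oplus>\<^bsub>?F\<^esub> c'"]) auto
    next
      fix a x assume "a \<in> carrier R" "x \<in> J"
      then obtain c where "c \<in> A' (Suc m)" "x = c m" "a \<in> carrier R" unfolding J_def by blast
      then show "a \<otimes>\<^bsub>R\<^esub> x \<in> J" unfolding J_def using A'r(6)[of a c] m free_mod_smult_apply[of m n R a c] by (intro image_eqI[of _ _ "a \<odot>\<^bsub>?F\<^esub> c"]) auto
    qed
    have Iu: "a \<odot>\<^bsub>?F\<^esub> unitv R n m \<in> A' (Suc m)" "(a \<odot>\<^bsub>?F\<^esub> unitv R n m) m = a" if "a \<in> I" for a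
      using IA[OF that M.unitv_carrier] m that Ic by (auto simp: A'_def free_mod_def unitv_def)
    have IJ: "I \<subseteq> J"
    proof
      fix a assume "a \<in> I"
      then show "a \<in> J" unfolding J_def using Iu[of a] by (intro image_eqI[of _ _ "a \<odot>\<^bsub>?F\<^esub> unitv R n m"]) auto
    qed
    define h where "h x = g' (SOME c. c \<in> A' (Suc m) \<and> c m = x)" for x
    have hc: "\<exists>c. c \<in> A' (Suc m) \<and> c m = x \<and> h x = g' c" if "x \<in> J" for x
      unfolding h_def using someI_ex[of "\<lambda>c. c \<in> A' (Suc m) \<and> c m = x"] that unfolding J_def by blast
    have hg: "cg M P (h (c m)) (g' c)" if "c \<in> A' (Suc m)" for c
      using hc[of "c m"] wd that unfolding J_def by (metis imageI)
    have hS: "h x \<in> S" if "x \<in> J" for x using hc[OF that] g'S A'A by (metis subsetD)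
    have "qhom R (reg_mod R) J M P h"
    proof (rule qhomI)
      show "h x \<in> carrier M" if "x \<in> J" for x using hS[OF that] Sr(1) by blast
    next
      fix x y assume "x \<in> J" "y \<in> J"
      then obtain c c' where c: "c \<in> A' (Suc m)" "c' \<in> A' (Suc m)" "c m = x" "c' m = y" "h x = g' c" "h y = g' c'"
        using hc by metis
      have s: "c \<oplus>\<^bsub>?F\<^esub> c' \<in> A' (Suc m)" "(c \<oplus>\<^bsub>?F\<^esub> c') m = x \<oplus>\<^bsub>R\<^esub> y"
        using A'r(3)[OF c(1,2)] c(3,4) m by (auto simp: free_mod_apply)
      have "cg M P (h (x \<oplus>\<^bsub>R\<^esub> y)) (g' (c \<oplus>\<^bsub>?F\<^esub> c'))" using hg[OF s(1)] s(2) by simp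
      from M.cg_trans[OF P this qhomD(2)[OF g']] c A'A
      show "cg M P (h (x \<oplus>\<^bsub>reg_mod R\<^esub> y)) (h x \<oplus>\<^bsub>M\<^esub> h y)" by auto
    next
      fix a x assume a: "a \<in> carrier R" and "x \<in> J"
      then obtain c where c: "c \<in> A' (Suc m)" "c m = x" "h x = g' c" using hc by metis
      have s: "a \<odot>\<^bsub>?F\<^esub> c \<in> A' (Suc m)" "(a \<odot>\<^bsub>?F\<^esub> c) m = a \<otimes>\<^bsub>R\<^esub> x"
        using A'r(6)[OF a c(1)] c(2) m by (auto simp: free_mod_apply)
      have "cg M P (h (a \<otimes>\<^bsub>R\<^esub> x)) (g' (a \<odot>\<^bsub>?F\<^esub> c))" using hg[OF s(1)] s(2) by simp
      from M.cg_trans[OF P this qhomD(3)[OF g' a]] c A'A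
      show "cg M P (h (a \<odot>\<^bsub>reg_mod R\<^esub> x)) (a \<odot>\<^bsub>M\<^esub> h x)" by auto
    qed
    moreover have "h a \<in> P" if a: "a \<in> I" for a
    proof -
      have "lin M n (a \<odot>\<^bsub>?F\<^esub> unitv R n m) b = a \<odot>\<^bsub>M\<^esub> lin M n (unitv R n m) b"
        using a Ic bM M.unitv_Pi by (intro M.lin_smult) (auto simp: free_mod_apply)
      also have "\<dots> = \<zero>\<^bsub>M\<^esub>" using M.lin_unitv[OF m bM] b(2)[of m] a Ic by auto
      finally have "g' (a \<odot>\<^bsub>?F\<^esub> unitv R n m) \<in> P"
        unfolding g'_def using gI[OF a M.unitv_carrier] M.sub_minus[OF P] M.sub_zero[OF P] by metis
      then show ?thesis using M.cg_mem[OF P P subset_refl hg[OF Iu(1)[OF a]]] Iu(2)[OF a] by simp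
    qed
    ultimately obtain y where y: "y \<in> S" "\<And>a. a \<in> J \<Longrightarrow> cg M P (h a) (a \<odot>\<^bsub>M\<^esub> y)"
      using inj[unfolded rel_inj_def, rule_format, of J h] J IJ hS by blast
    have yM: "y \<in> carrier M" using y Sr by blast
    define b' where "b' = b(m := y)"
    have "cg M P (g c) (lin M n c b')" if c: "c \<in> A' (Suc m)" for c
    proof -
      have cA: "c \<in> A" using c A'A by auto
      have cm: "c m \<in> carrier R" using cP[OF cA] m by auto
      define e where "e i = (if i = m then y else \<zero>\<^bsub>M\<^esub>)" for i
      have eM: "e \<in> {..<n} \<rightarrow> carrier M" using yM by (auto simp: e_def)
      have "lin M n c e = finsum M (\<lambda>l. if m = l then c m \<odot>\<^bsub>M\<^esub> y else \<zero>\<^bsub>M\<^esub>) {..<n}"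
        unfolding lin_def
        by (rule M.M.finsum_cong') (use cP[OF cA] cm yM in \<open>auto simp: e_def Pi_iff\<close>)
      also have "\<dots> = c m \<odot>\<^bsub>M\<^esub> y"
        using m cm yM M.M.finsum_singleton[of m "{..<n}" "\<lambda>_. c m \<odot>\<^bsub>M\<^esub> y"] by simp
      finally have e: "lin M n c e = c m \<odot>\<^bsub>M\<^esub> y" .
      have "lin M n c b' = lin M n c b \<oplus>\<^bsub>M\<^esub> lin M n c e"
        using cP[OF cA] bM eM yM b(2)[of m] by (intro M.lin_add_r) (auto simp: b'_def e_def Pi_iff)
      then have l: "lin M n c b' = c m \<odot>\<^bsub>M\<^esub> y \<oplus>\<^bsub>M\<^esub> lin M n c b"
        using e lc[OF cA] Sr(1) cm yM by (simp add: M.M.a_comm)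
      have "cg M P (g' c) (c m \<odot>\<^bsub>M\<^esub> y)"
        using M.cg_trans[OF P M.cg_sym[OF P hg[OF c]] y(2)] c unfolding J_def by blast
      from M.cg_add[OF P this M.cg_refl[OF P]] lc[OF cA] Sr(1)
      have "cg M P (g' c \<oplus>\<^bsub>M\<^esub> lin M n c b) (lin M n c b')" unfolding l by blast
      then show ?thesis unfolding g'_def using qhomD(1)[OF g cA] lc[OF cA] Sr(1)
        by (simp add: M.add_minus_cancel)
    qed
    moreover have "b' i \<in> S" for i using b(1) y(1) by (simp add: b'_def)
    moreover have "b' i = \<zero>\<^bsub>M\<^esub>" if "Suc m \<le> i" for i using b(2) that by (simp add: b'_def)
    ultimately show ?case by blast
  qed
  from this[of n] obtain b where b: "\<And>i. b i \<in> S" "\<And>c. c \<in> A' n \<Longrightarrow> cg M P (g c) (lin M n c b)" by auto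
  have "A' n = A" by (auto simp: A'_def)
  then show ?thesis using b by (intro exI[of _ b]) auto
qed

text \<open>
  Injectivity passes to the quotient of an injective module \<open>SA\<close> by an injective submodule \<open>B\<close>. The
  isomorphism \<open>SA/B \<cong> SC/PC\<close> is given by its graph \<open>T\<close>. To lift a homomorphism \<open>J \<rightarrow> SC/PC\<close> to
  \<open>SA\<close>, choose preimages for the values at generators of \<open>J\<close>; on the relations of the generators
  the resulting map has values in \<open>B\<close>, and the injectivity of \<open>B\<close> yields the correction that makes
  it vanish there.
\<close>

lemma rel_inj_quotient:
  assumes MA: "module R MA" and MC: "module R MC" and noeth: "noetherian_ring R"
    and SA: "submodule SA R MA" and SC: "submodule SC R MC" and PC: "submodule PC R MC" "PC \<subseteq> SC"
    and I: "ideal I R" and IS: "\<And>a x. a \<in> I \<Longrightarrow> x \<in> SA \<Longrightarrow> a \<odot>\<^bsub>MA\<^esub> x = \<zero>\<^bsub>MA\<^esub>"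
    and T: "\<And>a c. (a, c) \<in> T \<Longrightarrow> a \<in> SA \<and> c \<in> SC" "(\<zero>\<^bsub>MA\<^esub>, \<zero>\<^bsub>MC\<^esub>) \<in> T"
      "\<And>a c a' c'. (a, c) \<in> T \<Longrightarrow> (a', c') \<in> T \<Longrightarrow> (a \<oplus>\<^bsub>MA\<^esub> a', c \<oplus>\<^bsub>MC\<^esub> c') \<in> T"
      "\<And>r a c. r \<in> carrier R \<Longrightarrow> (a, c) \<in> T \<Longrightarrow> (r \<odot>\<^bsub>MA\<^esub> a, r \<odot>\<^bsub>MC\<^esub> c) \<in> T"
    and total: "\<And>a. a \<in> SA \<Longrightarrow> \<exists>c. (a, c) \<in> T" "\<And>c. c \<in> SC \<Longrightarrow> \<exists>a. (a, c) \<in> T"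
    and T0: "\<And>c. (\<zero>\<^bsub>MA\<^esub>, c) \<in> T \<Longrightarrow> c \<in> PC"
    and B: "B = {a. \<exists>c\<in>PC. (a, c) \<in> T}"
    and injB: "rel_inj R I MA B {\<zero>\<^bsub>MA\<^esub>}" and injS: "rel_inj R I MA SA {\<zero>\<^bsub>MA\<^esub>}"
  shows "rel_inj R I MC SC PC"
  unfolding rel_inj_def
proof (intro allI impI, elim conjE)
  interpret MA: module R MA by fact
  interpret MC: module R MC by fact
  interpret G: module R "reg_mod R" by (rule MA.R.reg_mod_module)
  note PCr = MC.sub_rules[OF PC(1)] and SAr = MA.sub_rules[OF SA] and SCr = MC.sub_rules[OF SC]
  note Ir = MA.R.ideal_rules[OF I]
  note zA = MA.sub_zero_set
  have Tneg: "(\<ominus>\<^bsub>MA\<^esub> a, \<ominus>\<^bsub>MC\<^esub> c) \<in> T" if "(a, c) \<in> T" for a c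
    using T(4)[of "\<ominus>\<^bsub>R\<^esub> \<one>\<^bsub>R\<^esub>", OF _ that] T(1)[OF that] SAr(1) SCr(1)
    by (simp add: MA.smult_l_minus MC.smult_l_minus)
  have Tminus: "(a \<ominus>\<^bsub>MA\<^esub> a', c \<ominus>\<^bsub>MC\<^esub> c') \<in> T" if "(a, c) \<in> T" "(a', c') \<in> T" for a c a' c'
    using T(3)[OF that(1) Tneg[OF that(2)]] by (simp add: MA.M.minus_eq MC.M.minus_eq)
  have Tlin: "(lin MA n v x, lin MC n v y) \<in> T"
    if "v \<in> {..<n} \<rightarrow> carrier R" "\<And>i. i < n \<Longrightarrow> (x i, y i) \<in> T" for v n x y
    using that
  proof (induction n)
    case 0 then show ?case using T(2) by (simp add: MA.lin_0 MC.lin_0)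
  next
    case (Suc n)
    have "x \<in> {..<Suc n} \<rightarrow> carrier MA" "y \<in> {..<Suc n} \<rightarrow> carrier MC"
      using T(1)[OF Suc.prems(2)] SAr(1) SCr(1) by auto
    then have "lin MA (Suc n) v x = v n \<odot>\<^bsub>MA\<^esub> x n \<oplus>\<^bsub>MA\<^esub> lin MA n v x"
      "lin MC (Suc n) v y = v n \<odot>\<^bsub>MC\<^esub> y n \<oplus>\<^bsub>MC\<^esub> lin MC n v y"
      using MA.lin_Suc[OF Suc.prems(1)] MC.lin_Suc[OF Suc.prems(1)] by auto
    then show ?case using Suc.prems by (auto intro!: T(3) T(4) Suc.IH)
  qed
  have Bs: "submodule B R MA"
  proof (rule MA.subI)
    show "B \<subseteq> carrier MA" unfolding B using T(1) SAr(1) by blast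
    show "\<zero>\<^bsub>MA\<^esub> \<in> B" unfolding B using T(2) PCr(2) by blast
    show "a \<oplus>\<^bsub>MA\<^esub> b \<in> B" if "a \<in> B" "b \<in> B" for a b using that T(3) PCr(3) unfolding B by blast
    show "r \<odot>\<^bsub>MA\<^esub> b \<in> B" if "r \<in> carrier R" "b \<in> B" for r b using that T(4) PCr(6) unfolding B by blast
  qed
  have BS: "B \<subseteq> SA" unfolding B using T(1) by blast
  fix J f assume J: "ideal J R" "I \<subseteq> J" and f: "qhom R (reg_mod R) J MC PC f" "f ` J \<subseteq> SC" "\<forall>a\<in>I. f a \<in> PC"
  have Js: "submodule J R (reg_mod R)" using J(1) by (simp add: MA.R.submodule_reg_iff)
  note Jr = MA.R.ideal_rules[OF J(1)]
  obtain n \<alpha> where \<alpha>: "\<alpha> \<in> {..<n} \<rightarrow> J" "J = {lin (reg_mod R) n c \<alpha> | c. c \<in> carrier (free_mod R n)}"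
    using acc_mod_generators[OF G.module_axioms MA.R.acc_reg_mod[OF noeth] Js] by blast
  let ?F = "free_mod R n"
  interpret F: module R ?F by (rule MA.R.free_mod_module)
  have \<alpha>c: "\<alpha> \<in> {..<n} \<rightarrow> carrier (reg_mod R)" using \<alpha>(1) Jr(1) by auto
  let ?\<pi> = "\<lambda>c. lin (reg_mod R) n c \<alpha>"
  note \<pi> = mod_homD[OF G.lin_mod_hom[OF \<alpha>c]]
  note \<pi>m = mod_hom_zero_minus[OF F.module_axioms G.module_axioms G.lin_mod_hom[OF \<alpha>c]]
  have "\<forall>i. \<exists>e. i < n \<longrightarrow> (e, f (\<alpha> i)) \<in> T" using \<alpha>(1) f(2) total(2) by blast
  then obtain e where e: "\<And>i. i < n \<Longrightarrow> (e i, f (\<alpha> i)) \<in> T" by metis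
  have eS: "e \<in> {..<n} \<rightarrow> SA" using e T(1) by blast
  have eM: "e \<in> {..<n} \<rightarrow> carrier MA" using eS SAr(1) by blast
  define K where "K = {c \<in> carrier ?F. ?\<pi> c \<in> I}"
  have K: "submodule K R ?F" unfolding K_def
    by (rule vimage_submodule[OF F.module_axioms G.module_axioms G.lin_mod_hom[OF \<alpha>c]])
       (simp add: MA.R.submodule_reg_iff I)
  have cg1: "cg MC PC (f (?\<pi> c)) (lin MC n c (\<lambda>i. f (\<alpha> i)))" if "c \<in> carrier ?F" for c
    using qhom_lin[OF G.module_axioms MC Js PC(1) f(1) free_mod_Pi[OF that] \<alpha>(1)] .
  have lT: "(lin MA n c e, lin MC n c (\<lambda>i. f (\<alpha> i))) \<in> T" if "c \<in> carrier ?F" for c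
    by (rule Tlin[OF free_mod_Pi[OF that]]) (rule e)
  define g where "g c = lin MA n c e" for c
  note gh = mod_homD[OF MA.lin_mod_hom[OF eM], folded g_def]
  have gB: "g c \<in> B" if "c \<in> K" for c
  proof -
    have c: "c \<in> carrier ?F" "?\<pi> c \<in> I" using that by (auto simp: K_def)
    have "lin MC n c (\<lambda>i. f (\<alpha> i)) \<in> PC"
      using MC.cg_mem[OF PC(1) PC(1) subset_refl MC.cg_sym[OF PC(1) cg1[OF c(1)]]] f(3) c(2) by blast
    then show ?thesis unfolding B g_def using lT[OF c(1)] by blast
  qed
  have gz: "g (a \<odot>\<^bsub>?F\<^esub> v) = \<zero>\<^bsub>MA\<^esub>" if "a \<in> I" "v \<in> carrier ?F" for a v
    using gh(3)[of a v] that Ir(1) IS MA.lin_in_sub[OF SA free_mod_Pi eS] by (simp add: g_def)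
  have "\<exists>b. b \<in> {..<n} \<rightarrow> B \<and> (\<forall>c\<in>K. cg MA {\<zero>\<^bsub>MA\<^esub>} (g c) (lin MA n c b))"
  proof (rule rel_inj_free[OF MA Bs zA _ injB K])
    show "{\<zero>\<^bsub>MA\<^esub>} \<subseteq> B" using MA.sub_zero[OF Bs] by simp
    show "I \<subseteq> carrier R" using Ir(1) by blast
    show "a \<odot>\<^bsub>?F\<^esub> v \<in> K" if "a \<in> I" "v \<in> carrier ?F" for a v
      unfolding K_def using that Ir(1) \<pi>(1)[of v] \<pi>(3)[of a v] Ir(7)[of _ a] by simp
    show "qhom R ?F K MA {\<zero>\<^bsub>MA\<^esub>} g"
      by (rule qhomI) (use F.sub_carr[OF K] gh in \<open>auto simp: MA.cg_singleton\<close>)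
    show "g (a \<odot>\<^bsub>?F\<^esub> v) \<in> {\<zero>\<^bsub>MA\<^esub>}" if "a \<in> I" "v \<in> carrier ?F" for a v using gz[OF that] by simp
    show "g ` K \<subseteq> B" using gB by blast
  qed
  then obtain \<beta> where \<beta>: "\<beta> \<in> {..<n} \<rightarrow> B" "\<And>c. c \<in> K \<Longrightarrow> lin MA n c e = lin MA n c \<beta>"
    by (auto simp: MA.cg_singleton g_def)
  have \<beta>M: "\<beta> \<in> {..<n} \<rightarrow> carrier MA" using \<beta>(1) MA.sub_carr[OF Bs] by blast
  define e' where "e' i = e i \<ominus>\<^bsub>MA\<^esub> \<beta> i" for i
  have e'S: "e' \<in> {..<n} \<rightarrow> SA"
  proof
    fix i assume "i \<in> {..<n}"
    then show "e' i \<in> SA" unfolding e'_def using eS \<beta>(1) BS by (intro SAr(5)) auto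
  qed
  have e'M: "e' \<in> {..<n} \<rightarrow> carrier MA" using e'S SAr(1) by blast
  have e'lin: "lin MA n c e' = lin MA n c e \<ominus>\<^bsub>MA\<^esub> lin MA n c \<beta>" if "c \<in> carrier ?F" for c
    by (rule MA.lin_minus_r[OF free_mod_Pi[OF that] eM \<beta>M]) (simp add: e'_def)
  note e'h = MA.lin_mod_hom[OF e'M]
  have e'K: "lin MA n c e' = \<zero>\<^bsub>MA\<^esub>" if "c \<in> K" for c
    using e'lin[of c] \<beta>(2)[OF that] F.sub_carr[OF K that] MA.lin_closed[OF free_mod_Pi \<beta>M]
    by (simp add: MA.M.minus_eq MA.M.r_neg)
  have wd: "lin MA n c e' = lin MA n c' e'"
    if "c \<in> carrier ?F" "c' \<in> carrier ?F" "?\<pi> c \<ominus>\<^bsub>reg_mod R\<^esub> ?\<pi> c' \<in> I" for c c'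
  proof -
    have "c \<ominus>\<^bsub>?F\<^esub> c' \<in> K" unfolding K_def using that \<pi>m(3)[of c c'] by simp
    then have "lin MA n c e' \<ominus>\<^bsub>MA\<^esub> lin MA n c' e' = \<zero>\<^bsub>MA\<^esub>"
      using e'K mod_hom_zero_minus(3)[OF F.module_axioms MA e'h that(1,2)] by simp
    then show ?thesis using MA.cg_singleton[of "lin MA n c e'" "lin MA n c' e'"]
      mod_homD(1)[OF e'h] that(1,2) by (simp add: cg_def)
  qed
  define h where "h x = lin MA n (SOME c. c \<in> carrier ?F \<and> ?\<pi> c = x) e'" for x
  have hc: "h (?\<pi> c) = lin MA n c e'" if c: "c \<in> carrier ?F" for c
  proof -
    let ?c = "SOME c'. c' \<in> carrier ?F \<and> ?\<pi> c' = ?\<pi> c"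
    have "?c \<in> carrier ?F \<and> ?\<pi> ?c = ?\<pi> c" by (rule someI[of _ c]) (use c in auto)
    then show ?thesis unfolding h_def using c \<pi>(1)[OF c] Ir(2)
      using G.M.r_neg[of "?\<pi> c"] by (intro wd) (auto simp: G.M.minus_eq)
  qed
  have Jc: "\<exists>c. c \<in> carrier ?F \<and> x = ?\<pi> c" if "x \<in> J" for x using that \<alpha>(2) by blast
  have "\<exists>m\<in>SA. \<forall>a\<in>J. cg MA {\<zero>\<^bsub>MA\<^esub>} (h a) (a \<odot>\<^bsub>MA\<^esub> m)"
  proof (rule injS[unfolded rel_inj_def, rule_format, of J h], intro conjI ballI)
    show "ideal J R" "I \<subseteq> J" by fact+
    have hS: "h x \<in> SA" if "x \<in> J" for x
      using Jc[OF that] hc MA.lin_in_sub[OF SA free_mod_Pi e'S] by metis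
    then show "h ` J \<subseteq> SA" by blast
    show "qhom R (reg_mod R) J MA {\<zero>\<^bsub>MA\<^esub>} h"
    proof (rule qhomI)
      show "h x \<in> carrier MA" if "x \<in> J" for x using hS[OF that] SAr(1) by blast
    next
      fix x y assume "x \<in> J" "y \<in> J"
      then obtain c c' where c: "c \<in> carrier ?F" "x = ?\<pi> c" "c' \<in> carrier ?F" "y = ?\<pi> c'" using Jc by metis
      have "h (x \<oplus>\<^bsub>reg_mod R\<^esub> y) = h x \<oplus>\<^bsub>MA\<^esub> h y"
        using hc[OF F.add.m_closed[OF c(1,3)]] \<pi>(2)[OF c(1,3)] mod_homD(2)[OF e'h c(1,3)] hc[OF c(1)] hc[OF c(3)] c(2,4)
        by simp
      then show "cg MA {\<zero>\<^bsub>MA\<^esub>} (h (x \<oplus>\<^bsub>reg_mod R\<^esub> y)) (h x \<oplus>\<^bsub>MA\<^esub> h y)"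
        using hS[OF \<open>x \<in> J\<close>] hS[OF \<open>y \<in> J\<close>] SAr(1) by (simp add: MA.cg_singleton)
    next
      fix a x assume a: "a \<in> carrier R" and "x \<in> J"
      then obtain c where c: "c \<in> carrier ?F" "x = ?\<pi> c" using Jc by metis
      have "h (a \<odot>\<^bsub>reg_mod R\<^esub> x) = a \<odot>\<^bsub>MA\<^esub> h x"
        using hc[OF F.smult_closed[OF a c(1)]] \<pi>(3)[OF a c(1)] mod_homD(3)[OF e'h a c(1)] hc[OF c(1)] c(2)
        by simp
      then show "cg MA {\<zero>\<^bsub>MA\<^esub>} (h (a \<odot>\<^bsub>reg_mod R\<^esub> x)) (a \<odot>\<^bsub>MA\<^esub> h x)"
        using hS[OF \<open>x \<in> J\<close>] a SAr(1) by (simp add: MA.cg_singleton)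
    qed
    fix a assume "a \<in> I"
    then obtain c where c: "c \<in> carrier ?F" "a = ?\<pi> c" using Jc J(2) by blast
    then show "h a \<in> {\<zero>\<^bsub>MA\<^esub>}" using hc[OF c(1)] e'K[of c] \<open>a \<in> I\<close> by (simp add: K_def)
  qed
  then obtain m where m: "m \<in> SA" "\<And>a. a \<in> J \<Longrightarrow> h a = a \<odot>\<^bsub>MA\<^esub> m" by (auto simp: MA.cg_singleton)
  obtain c0 where c0: "(m, c0) \<in> T" using total(1)[OF m(1)] by blast
  have c0S: "c0 \<in> SC" using T(1)[OF c0] by blast
  have "cg MC PC (f x) (x \<odot>\<^bsub>MC\<^esub> c0)" if x: "x \<in> J" for x
  proof -
    obtain c where c: "c \<in> carrier ?F" "x = ?\<pi> c" using Jc[OF x] by blast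
    let ?y = "lin MC n c (\<lambda>i. f (\<alpha> i))"
    have "lin MA n c \<beta> \<in> B" by (rule MA.lin_in_sub[OF Bs free_mod_Pi[OF c(1)] \<beta>(1)])
    then obtain p where p: "p \<in> PC" "(lin MA n c \<beta>, p) \<in> T" unfolding B by blast
    have "(lin MA n c e', ?y \<ominus>\<^bsub>MC\<^esub> p) \<in> T" unfolding e'lin[OF c(1)] by (rule Tminus[OF lT[OF c(1)] p(2)])
    moreover have "(lin MA n c e', x \<odot>\<^bsub>MC\<^esub> c0) \<in> T"
      using T(4)[OF Jr(1)[OF x] c0] m(2)[OF x] hc[OF c(1)] c(2) by simp
    ultimately have "(lin MA n c e' \<ominus>\<^bsub>MA\<^esub> lin MA n c e', (?y \<ominus>\<^bsub>MC\<^esub> p) \<ominus>\<^bsub>MC\<^esub> x \<odot>\<^bsub>MC\<^esub> c0) \<in> T" by (rule Tminus)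
    then have d: "(?y \<ominus>\<^bsub>MC\<^esub> p) \<ominus>\<^bsub>MC\<^esub> x \<odot>\<^bsub>MC\<^esub> c0 \<in> PC"
      using T0 mod_homD(1)[OF e'h c(1)] by (simp add: MA.M.minus_eq MA.M.r_neg)
    have yc: "?y \<in> carrier MC" using cg1[OF c(1)] by (simp add: cg_def)
    have xc: "x \<odot>\<^bsub>MC\<^esub> c0 \<in> carrier MC" using Jr(1)[OF x] c0S SCr(1) by simp
    have pc: "p \<in> carrier MC" using p PCr(1) by blast
    have "cg MC PC (?y \<ominus>\<^bsub>MC\<^esub> p) (x \<odot>\<^bsub>MC\<^esub> c0)" using d yc xc pc by (simp add: cg_def)
    moreover have "cg MC PC ?y (?y \<ominus>\<^bsub>MC\<^esub> p)"
      using MC.cg_minus[OF PC(1) MC.cg_refl[OF PC(1) yc] MC.cg_sym[OF PC(1) MC.cg_zero_iff[OF PC(1), THEN iffD2, OF p(1)]]]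
        yc pc by (simp add: MC.M.minus_eq MC.neg_zero)
    ultimately have "cg MC PC ?y (x \<odot>\<^bsub>MC\<^esub> c0)" using MC.cg_trans[OF PC(1)] by blast
    then show ?thesis using MC.cg_trans[OF PC(1) cg1[OF c(1)]] c(2) by simp
  qed
  then show "\<exists>m\<in>SC. \<forall>a\<in>J. cg MC PC (f a) (a \<odot>\<^bsub>MC\<^esub> m)" using c0S by blast
qed


section \<open>Regular sequences on maximal Cohen-Macaulay modules\<close>

text \<open>
  The last assumption expresses that \<open>R/(z\<^sub>0, \<dots>, z\<^bsub>d-1\<^esub>)\<close> has finite length, in the form that is
  used: each of its nonzero cyclic quotients has a nonzero socle.
\<close>

locale witness = noeth_local R \<mm> for R (structure) and \<mm> +
  fixes z :: "nat \<Rightarrow> 'a" and d :: nat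
  assumes z_mm: "i < d \<Longrightarrow> z i \<in> \<mm>"
    and z_reg: "i < d \<Longrightarrow> reg_on (reg_mod R) (z i) (msum (reg_mod R) z {\<zero>} i)"
    and dim: "krull_dim R = enat d"
    and socle: "ideal J R \<Longrightarrow> msum (reg_mod R) z {\<zero>} d \<subseteq> J \<Longrightarrow> J \<noteq> carrier R \<Longrightarrow>
      \<exists>a\<in>carrier R - J. \<forall>b\<in>\<mm>. b \<otimes> a \<in> J"
begin

abbreviation "II \<equiv> msum (reg_mod R) z {\<zero>}"

lemma z_carr: "i < d \<Longrightarrow> z i \<in> carrier R" using z_mm mm_carr by blast

lemma II_ideal: "i \<le> d \<Longrightarrow> ideal (II i) R"
  using module.msum_sub[OF reg_mod_module, of "{\<zero>}" i z] z_carr module.sub_zero_set[OF reg_mod_module]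
  by (simp add: submodule_reg_iff)

lemma II_mono: "i \<le> j \<Longrightarrow> j \<le> d \<Longrightarrow> II i \<subseteq> II j"
  using module.msum_mono[OF reg_mod_module module.sub_zero_set[OF reg_mod_module], of j z i] z_carr
  by simp

lemma II_SucE:
  assumes "b \<in> II (Suc i)"
  obtains c a where "c \<in> II i" "a \<in> carrier R" "b = c \<oplus> z i \<otimes> a"
  using assms by (auto simp: addm_def)

lemma z_in_II: "i < d \<Longrightarrow> z i \<in> II (Suc i)"
  using module.addm_mult[OF reg_mod_module, of "II i" "z i" \<one>] II_ideal[of i] z_carr[of i]
  by (simp add: submodule_reg_iff)

lemma II_le_mm: "i \<le> d \<Longrightarrow> II i \<subseteq> \<mm>"
proof (induction i)
  case 0 then show ?case using ideal_rules(2)[OF ideal_mm] by simp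
next
  case (Suc i)
  show ?case
  proof
    fix b assume "b \<in> II (Suc i)"
    then obtain c a where "c \<in> II i" "a \<in> carrier R" "b = c \<oplus> z i \<otimes> a" by (rule II_SucE)
    then show "b \<in> \<mm>" using Suc z_mm[of i] ideal_rules(3,7)[OF ideal_mm] by auto
  qed
qed

lemma II_smult:
  assumes "module R M" "submodule N R M" "\<And>b x. b \<in> II r \<Longrightarrow> x \<in> carrier M \<Longrightarrow> b \<odot>\<^bsub>M\<^esub> x \<in> N"
    "r + k \<le> d" "b \<in> II (r + k)" "x \<in> carrier M"
  shows "b \<odot>\<^bsub>M\<^esub> x \<in> msum M (\<lambda>j. z (r + j)) N k"
  using assms(4-)
proof (induction k arbitrary: b)
  case 0 then show ?case using assms(3) by simp
next
  case (Suc k)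
  interpret M: module R M by fact
  obtain c a where c: "c \<in> II (r + k)" "a \<in> carrier R" "b = c \<oplus> z (r + k) \<otimes> a"
    using Suc.prems(2) by (metis II_SucE add_Suc_right)
  have zc: "z (r + k) \<in> carrier R" using Suc.prems z_carr by simp
  have cc: "c \<in> carrier R" using ideal_rules(1)[OF II_ideal c(1)] Suc.prems by simp
  have "b \<odot>\<^bsub>M\<^esub> x = c \<odot>\<^bsub>M\<^esub> x \<oplus>\<^bsub>M\<^esub> z (r + k) \<odot>\<^bsub>M\<^esub> (a \<odot>\<^bsub>M\<^esub> x)"
    unfolding c(3) using cc zc c(2) Suc.prems by (simp add: M.smult_l_distr M.smult_assoc1)
  then show ?case using Suc c by (auto intro!: M.addmI[of "c \<odot>\<^bsub>M\<^esub> x" _ "a \<odot>\<^bsub>M\<^esub> x"])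
qed

lemma annq_II: "i \<le> d \<Longrightarrow> annq R (reg_mod R) (II i) = II i"
proof -
  assume i: "i \<le> d"
  note r = ideal_rules[OF II_ideal[OF i]]
  have "a \<in> II i" if "a \<in> annq R (reg_mod R) (II i)" for a
  proof -
    have a: "a \<in> carrier R" "\<forall>x\<in>carrier R. a \<otimes> x \<in> II i" using that by (simp_all add: annq_def)
    have "a \<otimes> \<one> \<in> II i" by (rule bspec[OF a(2) one_closed])
    then show ?thesis using a(1) by simp
  qed
  moreover have "a \<in> annq R (reg_mod R) (II i)" if "a \<in> II i" for a
    unfolding annq_def using r(1)[OF that] r(7)[OF _ that] by simp
  ultimately show ?thesis by blast
qed

text \<open>
  If \<open>z\<^sub>i\<close> were a zero divisor, an associated prime containing it would have a chain of \<open>d - i\<close>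
  primes above it by depth and a chain of \<open>i + 1\<close> primes below it since \<open>z\<close> is regular on the ring:
  too many for dimension \<open>d\<close>. The depth then drops by exactly one, whichever regular element is used.
\<close>

lemma depth_step:
  assumes M: "module R M" "acc_mod R M" and N: "submodule N R M"
    and IN: "\<And>b x. b \<in> II i \<Longrightarrow> x \<in> carrier M \<Longrightarrow> b \<odot>\<^bsub>M\<^esub> x \<in> N"
    and deep: "depth_ge M \<mm> (d - i) N" and i: "i < d"
  shows "reg_on M (z i) N" "depth_ge M \<mm> (d - Suc i) (addm M N (z i))"
proof -
  interpret M: nl_module R \<mm> M
    using M by (auto simp: nl_module_def nl_module_axioms_def noeth_local_axioms)
  show r: "reg_on M (z i) N" unfolding reg_on_def
  proof (intro ballI impI, rule ccontr)
    fix u assume u: "u \<in> carrier M" "z i \<odot>\<^bsub>M\<^esub> u \<in> N" "u \<notin> N"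
    obtain p where p: "maxann R M N p" "ann R M N u \<subseteq> p" using M.maxann_exists[OF N u(1,3)] by blast
    obtain v where v: "v \<in> carrier M" "v \<notin> N" "p = ann R M N v" using p(1) unfolding maxann_def by blast
    have pp: "primeideal p R" by (rule M.maxann_prime[OF N p(1)])
    note pr = ideal_rules[OF prime_rules(1)[OF pp]]
    obtain A where A: "A 0 = p" "\<forall>j\<le>d - i. primeideal (A j) R" "\<forall>j<d - i. A j \<subset> A (Suc j)"
      using M.dep_imp_prime_chain[OF N deep v(1,2) pp v(3)] by blast
    have "II i \<subseteq> p" unfolding v(3) ann_def using IN v(1) ideal_rules(1)[OF II_ideal[of i]] i by auto
    moreover have "z i \<in> p" using p(2) u z_carr[OF i] by (auto simp: ann_def)
    ultimately have "b \<in> p" if "b \<in> II (Suc i)" for b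
      using II_SucE[OF that] pr(3,7) by (metis subsetD)
    then have "II (Suc i) \<subseteq> p" by blast
    then have q: "annq R (reg_mod R) (II (Suc i)) \<subseteq> p" using annq_II i by (metis Suc_leI)
    obtain B where B: "B (Suc i) = p" "\<forall>j\<le>Suc i. primeideal (B j) R" "\<forall>j<Suc i. B j \<subset> B (Suc j)"
      using regular_imp_prime_chain[OF noetherian_ring_axioms reg_mod_module
        module.sub_zero_set[OF reg_mod_module], of "Suc i" z p] z_carr z_reg i q pp by auto
    define C where "C j = (if j \<le> Suc i then B j else A (j - Suc i))" for j
    have "\<forall>j\<le>Suc d. primeideal (C j) R" using A(2) B(2) i by (auto simp: C_def)
    moreover have "\<forall>j<Suc d. C j \<subset> C (Suc j)"
    proof (intro allI impI)
      fix j assume j: "j < Suc d"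
      consider "j < Suc i" | "j = Suc i" | "j > Suc i" by linarith
      then show "C j \<subset> C (Suc j)"
      proof cases
        case 1 then show ?thesis using B(3) by (simp add: C_def)
      next
        case 2 then show ?thesis using A(3)[rule_format, of 0] A(1) B(1) j by (simp add: C_def)
      next
        case 3
        then have "Suc (j - Suc i) = Suc j - Suc i" by simp
        then show ?thesis using A(3)[rule_format, of "j - Suc i"] j 3 by (simp add: C_def)
      qed
    qed
    ultimately have "enat (Suc d) \<le> krull_dim R" by (rule prime_chain_le_krull_dim)
    then show False by (simp add: dim)
  qed
  have "d - i = Suc (d - Suc i)" using i by simp
  then obtain w where w: "w \<in> \<mm>" "reg_on M w N" "depth_ge M \<mm> (d - Suc i) (addm M N w)"
    using deep by auto
  show "depth_ge M \<mm> (d - Suc i) (addm M N (z i))"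
    by (rule M.dep_exchange[OF N w(1,2) z_mm[OF i] r w(3)])
qed

text \<open>
  A sequence that is regular on the ring is regular on maximal Cohen-Macaulay modules. For \<open>r > 0\<close>
  the module \<open>M/N\<close> lives over the quotient of \<open>R\<close> by the first \<open>r\<close> members.
\<close>

lemma msum_regular:
  assumes M: "module R M" "acc_mod R M" and N: "submodule N R M"
    and IN: "\<And>b x. b \<in> II r \<Longrightarrow> x \<in> carrier M \<Longrightarrow> b \<odot>\<^bsub>M\<^esub> x \<in> N"
    and deep: "depth_ge M \<mm> (d - r) N"
  shows "r + k \<le> d \<Longrightarrow> depth_ge M \<mm> (d - (r + k)) (msum M (\<lambda>j. z (r + j)) N k)"
    "r + k < d \<Longrightarrow> reg_on M (z (r + k)) (msum M (\<lambda>j. z (r + j)) N k)"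
proof -
  interpret M: module R M by fact
  have sub: "submodule (msum M (\<lambda>j. z (r + j)) N k) R M" if "r + k \<le> d" for k
    using that z_carr by (intro M.msum_sub N) auto
  have 1: "depth_ge M \<mm> (d - (r + k)) (msum M (\<lambda>j. z (r + j)) N k)" if "r + k \<le> d" for k
    using that
  proof (induction k)
    case (Suc k)
    have "depth_ge M \<mm> (d - Suc (r + k)) (addm M (msum M (\<lambda>j. z (r + j)) N k) (z (r + k)))"
      by (rule depth_step(2)[OF M sub II_smult[OF M(1) N IN]]) (use Suc in auto)
    then show ?case by simp
  qed (use deep in simp)
  then show "r + k \<le> d \<Longrightarrow> depth_ge M \<mm> (d - (r + k)) (msum M (\<lambda>j. z (r + j)) N k)" .
  show "reg_on M (z (r + k)) (msum M (\<lambda>j. z (r + j)) N k)" if "r + k < d"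
    by (rule depth_step(1)[OF M sub II_smult[OF M(1) N IN] 1]) (use that in auto)
qed

end

section \<open>Reduction of a module of finite injective dimension modulo a regular sequence\<close>

abbreviation "colon R J a \<equiv> ann R (reg_mod R) J a"
abbreviation "idl_plus R J a \<equiv> addm (reg_mod R) J a"

text \<open>
  A module \<open>\<omega>\<close> of depth at least \<open>d\<close> with a finite injective resolution \<open>E\<close>. Injectivity enters only
  through Baer's condition.
\<close>

locale inj_res = witness R \<mm> z d for R :: "('a, 'm) ring_scheme" (structure) and \<mm> z d +
  fixes E :: "nat \<Rightarrow> ('a, 'e) module" and \<phi> :: "nat \<Rightarrow> 'e \<Rightarrow> 'e" and \<omega> :: "('a, 'b, 'n) module_scheme"
    and \<epsilon> :: "'b \<Rightarrow> 'e" and n :: nat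
  assumes E: "module R (E i)"
    and E_inj: "rel_inj R {\<zero>} (E i) (carrier (E i)) {\<zero>\<^bsub>E i\<^esub>}"
    and E_bound: "n < i \<Longrightarrow> carrier (E i) = {\<zero>\<^bsub>E i\<^esub>}"
    and omega: "module R \<omega>" and omega_acc: "acc_mod R \<omega>" and omega_dep: "depth_ge \<omega> \<mm> d {\<zero>\<^bsub>\<omega>\<^esub>}"
    and eps: "\<epsilon> \<in> mod_hom R \<omega> (E 0)" "inj_on \<epsilon> (carrier \<omega>)"
    and phi: "\<phi> i \<in> mod_hom R (E i) (E (Suc i))"
    and exact0: "\<epsilon> ` carrier \<omega> = {e \<in> carrier (E 0). \<phi> 0 e = \<zero>\<^bsub>E 1\<^esub>}"
    and exact: "\<phi> i ` carrier (E i) = {e \<in> carrier (E (Suc i)). \<phi> (Suc i) e = \<zero>\<^bsub>E (Suc (Suc i))\<^esub>}"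
begin

definition Z :: "nat \<Rightarrow> 'e set" where
  "Z i = {e \<in> carrier (E i). \<phi> i e = \<zero>\<^bsub>E (Suc i)\<^esub>}"

text \<open>\<open>Hom(R/J, E\<^sub>i)\<close>, so that the cohomology of \<open>killed i J\<close> in \<open>i\<close> is \<open>Ext\<^sup>i(R/J, \<omega>)\<close>.\<close>

definition killed :: "nat \<Rightarrow> 'a set \<Rightarrow> 'e set" where
  "killed i J = {e \<in> carrier (E i). \<forall>b\<in>J. b \<odot>\<^bsub>E i\<^esub> e = \<zero>\<^bsub>E i\<^esub>}"

text \<open>\<open>Ext\<^bsup>t+1\<^esup>(R/J, \<omega>) = 0\<close>.\<close>

definition ext_vanishes :: "nat \<Rightarrow> 'a set \<Rightarrow> bool" where
  "ext_vanishes t J \<longleftrightarrow> (\<forall>u\<in>Z (Suc t) \<inter> killed (Suc t) J. \<exists>e\<in>killed t J. \<phi> t e = u)"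

lemmas phiD = mod_homD[OF phi]
lemmas phi0 = mod_hom_zero_minus[OF E E phi]

lemma phi_phi: "e \<in> carrier (E i) \<Longrightarrow> \<phi> (Suc i) (\<phi> i e) = \<zero>\<^bsub>E (Suc (Suc i))\<^esub>"
  using exact[of i] by blast

lemma phi_Z: "e \<in> carrier (E i) \<Longrightarrow> \<phi> i e \<in> Z (Suc i)"
  unfolding Z_def using phi_phi phiD(1) by blast

lemma Z_phi: "u \<in> Z (Suc i) \<Longrightarrow> \<exists>e\<in>carrier (E i). \<phi> i e = u"
proof -
  assume "u \<in> Z (Suc i)"
  then have "u \<in> \<phi> i ` carrier (E i)" unfolding exact by (simp add: Z_def)
  then show ?thesis by blast
qed

lemma killed_carr: "e \<in> killed i J \<Longrightarrow> e \<in> carrier (E i)" by (simp add: killed_def)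
lemma Z_carr: "e \<in> Z i \<Longrightarrow> e \<in> carrier (E i)" by (simp add: Z_def)

lemma Z_sub: "submodule (Z i) R (E i)"
proof -
  interpret E: module R "E i" by (rule E)
  interpret E': module R "E (Suc i)" by (rule E)
  show ?thesis by (rule E.subI) (auto simp: Z_def phiD phi0)
qed

lemma killed_sub: "J \<subseteq> carrier R \<Longrightarrow> submodule (killed i J) R (E i)"
proof -
  interpret E: module R "E i" by (rule E)
  assume J: "J \<subseteq> carrier R"
  show ?thesis
  proof (rule E.subI)
    fix a x assume a: "a \<in> carrier R" "x \<in> killed i J"
    then have "b \<odot>\<^bsub>E i\<^esub> (a \<odot>\<^bsub>E i\<^esub> x) = \<zero>\<^bsub>E i\<^esub>" if "b \<in> J" for b
      using that J E.smult_comm[of b a x] by (auto simp: killed_def)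
    then show "a \<odot>\<^bsub>E i\<^esub> x \<in> killed i J" using a by (simp add: killed_def)
  qed (use J in \<open>auto simp: killed_def E.smult_r_distr\<close>)
qed

lemma phi_killed: "e \<in> killed i J \<Longrightarrow> J \<subseteq> carrier R \<Longrightarrow> \<phi> i e \<in> killed (Suc i) J"
proof -
  assume e: "e \<in> killed i J" and J: "J \<subseteq> carrier R"
  have ec: "e \<in> carrier (E i)" using e by (simp add: killed_def)
  have "b \<odot>\<^bsub>E (Suc i)\<^esub> \<phi> i e = \<zero>\<^bsub>E (Suc i)\<^esub>" if b: "b \<in> J" for b
  proof -
    have "b \<odot>\<^bsub>E i\<^esub> e = \<zero>\<^bsub>E i\<^esub>" using e b by (simp add: killed_def)
    then show ?thesis using phiD(3)[OF subsetD[OF J b] ec] phi0(1)[of i] by simp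
  qed
  then show ?thesis using phiD(1)[OF ec] by (simp add: killed_def)
qed

lemma plus_ideal: "ideal J R \<Longrightarrow> a \<in> carrier R \<Longrightarrow> ideal (idl_plus R J a) R"
  using module.addm_sub[OF reg_mod_module] by (simp add: submodule_reg_iff)
lemma colon_ideal: "ideal J R \<Longrightarrow> a \<in> carrier R \<Longrightarrow> ideal (colon R J a) R"
  using module.ann_ideal[OF reg_mod_module] by (simp add: submodule_reg_iff)
lemma J_le_plus: "ideal J R \<Longrightarrow> a \<in> carrier R \<Longrightarrow> J \<subseteq> idl_plus R J a"
  using module.addm_le[OF reg_mod_module] by (simp add: submodule_reg_iff)
lemma a_in_plus: "ideal J R \<Longrightarrow> a \<in> carrier R \<Longrightarrow> a \<in> idl_plus R J a"
  using module.addm_mult[OF reg_mod_module, of J a \<one>] by (simp add: submodule_reg_iff)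
lemma colon_iff: "r \<in> colon R J a \<longleftrightarrow> r \<in> carrier R \<and> r \<otimes> a \<in> J"
  by (simp add: ann_def)

lemma killed_plus_iff:
  assumes "ideal J R" "a \<in> carrier R"
  shows "e \<in> killed i (idl_plus R J a) \<longleftrightarrow> e \<in> killed i J \<and> a \<odot>\<^bsub>E i\<^esub> e = \<zero>\<^bsub>E i\<^esub>"
proof -
  interpret E: module R "E i" by (rule E)
  note Jr = ideal_rules[OF assms(1)]
  have "b \<odot>\<^bsub>E i\<^esub> e = \<zero>\<^bsub>E i\<^esub>" if e: "e \<in> killed i J" "a \<odot>\<^bsub>E i\<^esub> e = \<zero>\<^bsub>E i\<^esub>" and b: "b \<in> idl_plus R J a" for b
  proof -
    obtain c r where "c \<in> J" "r \<in> carrier R" "b = c \<oplus> a \<otimes> r" using b by (auto simp: addm_def)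
    moreover have "(a \<otimes> r) \<odot>\<^bsub>E i\<^esub> e = r \<odot>\<^bsub>E i\<^esub> (a \<odot>\<^bsub>E i\<^esub> e)" if "r \<in> carrier R" for r
      using e that assms(2) killed_carr by (metis E.smult_assoc1 m_comm)
    ultimately show ?thesis using e Jr(1) assms(2) killed_carr[OF e(1)]
      by (simp add: E.smult_l_distr killed_def)
  qed
  then show ?thesis using J_le_plus[OF assms] a_in_plus[OF assms] by (auto simp: killed_def)
qed

text \<open>
  Multiplication by \<open>a\<close> embeds \<open>R/(J : a)\<close> into \<open>R/J\<close>, and homomorphisms to an injective module
  extend along it.
\<close>

lemma E_divide:
  assumes J: "ideal J R" and a: "a \<in> carrier R" and g: "g \<in> killed i (colon R J a)"
  shows "\<exists>G\<in>killed i J. a \<odot>\<^bsub>E i\<^esub> G = g"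
proof -
  interpret E: module R "E i" by (rule E)
  note Jr = ideal_rules[OF J]
  have gc: "g \<in> carrier (E i)" using g by (simp add: killed_def)
  have wd: "r \<odot>\<^bsub>E i\<^esub> g = r' \<odot>\<^bsub>E i\<^esub> g"
    if "b \<in> J" "b' \<in> J" "r \<in> carrier R" "r' \<in> carrier R" "b \<oplus> a \<otimes> r = b' \<oplus> a \<otimes> r'" for b b' r r'
  proof -
    have "(r \<ominus> r') \<otimes> a = b' \<ominus> b"
    proof -
      have "a \<otimes> r = (b' \<oplus> a \<otimes> r') \<ominus> b"
        using that(5) that(1,3) a Jr(1) by (metis a_comm m_closed minus_eq r_neg1 a_inv_closed a_assoc that(2,4) a_closed)
      moreover have "(r \<ominus> r') \<otimes> a = a \<otimes> r \<ominus> a \<otimes> r'"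
        using that a by (simp add: minus_eq l_distr l_minus m_comm[of r a] m_comm[of r' a])
      moreover have "((b' \<oplus> a \<otimes> r') \<ominus> b) \<ominus> a \<otimes> r' = b' \<ominus> b"
        using that a Jr(1) by (simp add: minus_eq a_ac r_neg r_neg2)
      ultimately show ?thesis by simp
    qed
    then have "r \<ominus> r' \<in> colon R J a" using that Jr by (simp add: colon_iff)
    then have "(r \<ominus> r') \<odot>\<^bsub>E i\<^esub> g = \<zero>\<^bsub>E i\<^esub>" using g by (simp add: killed_def)
    then have "r \<odot>\<^bsub>E i\<^esub> g \<ominus>\<^bsub>E i\<^esub> r' \<odot>\<^bsub>E i\<^esub> g = \<zero>\<^bsub>E i\<^esub>" using that gc by (simp add: E.smult_l_minus2)
    then show ?thesis using E.cg_singleton[of "r \<odot>\<^bsub>E i\<^esub> g" "r' \<odot>\<^bsub>E i\<^esub> g"] that gc by (simp add: cg_def)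
  qed
  \<comment> \<open>the homomorphism \<open>b + r a \<mapsto> r g\<close> on \<open>J + Ra\<close>, well defined as \<open>J : a\<close> kills \<open>g\<close>\<close>
  define f where "f x = (SOME y. \<exists>b r. b \<in> J \<and> r \<in> carrier R \<and> x = b \<oplus> a \<otimes> r \<and> y = r \<odot>\<^bsub>E i\<^esub> g)" for x
  have f: "f (b \<oplus> a \<otimes> r) = r \<odot>\<^bsub>E i\<^esub> g" if br: "b \<in> J" "r \<in> carrier R" for b r
  proof -
    have "\<exists>b' r'. b' \<in> J \<and> r' \<in> carrier R \<and> b \<oplus> a \<otimes> r = b' \<oplus> a \<otimes> r' \<and> f (b \<oplus> a \<otimes> r) = r' \<odot>\<^bsub>E i\<^esub> g"
      unfolding f_def by (rule someI[of _ "r \<odot>\<^bsub>E i\<^esub> g"]) (use br in blast)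
    then show ?thesis using wd br by metis
  qed
  have plusE: "\<exists>b r. b \<in> J \<and> r \<in> carrier R \<and> x = b \<oplus> a \<otimes> r" if "x \<in> idl_plus R J a" for x
    using that by (auto simp: addm_def)
  have "\<exists>m\<in>carrier (E i). \<forall>x\<in>idl_plus R J a. cg (E i) {\<zero>\<^bsub>E i\<^esub>} (f x) (x \<odot>\<^bsub>E i\<^esub> m)"
  proof (rule E_inj[unfolded rel_inj_def, rule_format], intro conjI)
    show "ideal (idl_plus R J a) R" by (rule plus_ideal[OF J a])
    show "{\<zero>} \<subseteq> idl_plus R J a" using ideal_rules(2)[OF plus_ideal[OF J a]] by simp
    have fc: "f x \<in> carrier (E i)" if "x \<in> idl_plus R J a" for x using plusE[OF that] f gc by auto
    then show "f ` idl_plus R J a \<subseteq> carrier (E i)" by blast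
    show "qhom R (reg_mod R) (idl_plus R J a) (E i) {\<zero>\<^bsub>E i\<^esub>} f"
    proof (rule qhomI)
      show "f x \<in> carrier (E i)" if "x \<in> idl_plus R J a" for x by (rule fc[OF that])
    next
      fix x y assume "x \<in> idl_plus R J a" "y \<in> idl_plus R J a"
      then obtain b r b' r' where x: "b \<in> J" "r \<in> carrier R" "x = b \<oplus> a \<otimes> r"
        "b' \<in> J" "r' \<in> carrier R" "y = b' \<oplus> a \<otimes> r'" using plusE by metis
      have "x \<oplus> y = (b \<oplus> b') \<oplus> a \<otimes> (r \<oplus> r')" using x a Jr(1) by (simp add: r_distr a_ac)
      then have "f (x \<oplus> y) = f x \<oplus>\<^bsub>E i\<^esub> f y"
        using x f[of "b \<oplus> b'" "r \<oplus> r'"] f[OF x(1,2)] f[OF x(4,5)] Jr(3) gc by (simp add: E.smult_l_distr)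
      then show "cg (E i) {\<zero>\<^bsub>E i\<^esub>} (f (x \<oplus>\<^bsub>reg_mod R\<^esub> y)) (f x \<oplus>\<^bsub>E i\<^esub> f y)"
        using f[OF x(1,2)] f[OF x(4,5)] x gc by (simp add: E.cg_singleton)
    next
      fix s x assume s: "s \<in> carrier R" and "x \<in> idl_plus R J a"
      then obtain b r where x: "b \<in> J" "r \<in> carrier R" "x = b \<oplus> a \<otimes> r" using plusE by metis
      have "s \<otimes> x = s \<otimes> b \<oplus> a \<otimes> (s \<otimes> r)" using x a s Jr(1) by (simp add: r_distr m_ac)
      then have "f (s \<otimes> x) = s \<odot>\<^bsub>E i\<^esub> f x"
        using x f[of "s \<otimes> b" "s \<otimes> r"] f[OF x(1,2)] Jr(6) s gc by (simp add: E.smult_assoc1)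
      then show "cg (E i) {\<zero>\<^bsub>E i\<^esub>} (f (s \<odot>\<^bsub>reg_mod R\<^esub> x)) (s \<odot>\<^bsub>E i\<^esub> f x)"
        using f[OF x(1,2)] x s gc by (simp add: E.cg_singleton)
    qed
    show "\<forall>x\<in>{\<zero>}. f x \<in> {\<zero>\<^bsub>E i\<^esub>}" using f[of \<zero> \<zero>] Jr(2) a gc by simp
  qed
  then obtain m where m: "m \<in> carrier (E i)" "\<And>x. x \<in> idl_plus R J a \<Longrightarrow> f x = x \<odot>\<^bsub>E i\<^esub> m"
    by (auto simp: E.cg_singleton)
  have "f b = \<zero>\<^bsub>E i\<^esub>" if "b \<in> J" for b using f[OF that, of \<zero>] a gc Jr(1)[OF that] by simp
  then have "b \<odot>\<^bsub>E i\<^esub> m = \<zero>\<^bsub>E i\<^esub>" if "b \<in> J" for b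
    using m(2)[of b] that J_le_plus[OF J a] by auto
  then have "m \<in> killed i J" using m(1) by (simp add: killed_def)
  moreover have "f a = g" using f[of \<zero> \<one>] Jr(2) a gc by simp
  ultimately show ?thesis using m(2)[OF a_in_plus[OF J a]] by metis
qed

lemma killed_minus: "J \<subseteq> carrier R \<Longrightarrow> x \<in> killed i J \<Longrightarrow> y \<in> killed i J \<Longrightarrow> x \<ominus>\<^bsub>E i\<^esub> y \<in> killed i J"
  using module.sub_minus[OF E killed_sub] by blast
lemma killed_add: "J \<subseteq> carrier R \<Longrightarrow> x \<in> killed i J \<Longrightarrow> y \<in> killed i J \<Longrightarrow> x \<oplus>\<^bsub>E i\<^esub> y \<in> killed i J"
  using module.sub_add[OF E killed_sub] by blast
lemma mult_killed_colon:
  assumes J: "ideal J R" and a: "a \<in> carrier R" and e: "e \<in> killed i J"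
  shows "a \<odot>\<^bsub>E i\<^esub> e \<in> killed i (colon R J a)"
proof -
  interpret E: module R "E i" by (rule E)
  have "b \<odot>\<^bsub>E i\<^esub> (a \<odot>\<^bsub>E i\<^esub> e) = \<zero>\<^bsub>E i\<^esub>" if "b \<in> colon R J a" for b
    using that e a by (simp add: colon_iff killed_def flip: E.smult_assoc1)
  then show ?thesis using e a by (simp add: killed_def)
qed

text \<open>
  This and the next two lemmas are the long exact \<open>Ext\<close> sequence of
  \<open>0 \<rightarrow> R/(J : a) \<rightarrow> R/J \<rightarrow> R/(J + Ra) \<rightarrow> 0\<close>, in three pieces.
\<close>

lemma ext_vanishes_middle:
  assumes J: "ideal J R" and a: "a \<in> carrier R" and ext_vanishes: "ext_vanishes t (colon R J a)" "ext_vanishes t (idl_plus R J a)"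
  shows "ext_vanishes t J"
  unfolding ext_vanishes_def
proof
  interpret E: module R "E t" by (rule E)
  interpret E': module R "E (Suc t)" by (rule E)
  have Jc: "J \<subseteq> carrier R" using ideal_rules(1)[OF J] by blast
  fix u assume u: "u \<in> Z (Suc t) \<inter> killed (Suc t) J"
  have uc: "u \<in> carrier (E (Suc t))" using u Z_carr by blast
  have "a \<odot>\<^bsub>E (Suc t)\<^esub> u \<in> Z (Suc t) \<inter> killed (Suc t) (colon R J a)"
    using u mult_killed_colon[OF J a] E'.sub_smult[OF Z_sub a] by blast
  then obtain g where g: "g \<in> killed t (colon R J a)" "\<phi> t g = a \<odot>\<^bsub>E (Suc t)\<^esub> u" using ext_vanishes(1) unfolding ext_vanishes_def by blast
  obtain G where G: "G \<in> killed t J" "a \<odot>\<^bsub>E t\<^esub> G = g" using E_divide[OF J a g(1)] by blast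
  have Gc: "G \<in> carrier (E t)" using G killed_carr by blast
  let ?v = "u \<ominus>\<^bsub>E (Suc t)\<^esub> \<phi> t G"
  have "?v \<in> Z (Suc t)" using u phi_Z[OF Gc] E'.sub_minus[OF Z_sub] by blast
  moreover have "?v \<in> killed (Suc t) J" using killed_minus[OF Jc] u phi_killed[OF G(1) Jc] by blast
  moreover have "a \<odot>\<^bsub>E (Suc t)\<^esub> ?v = \<zero>\<^bsub>E (Suc t)\<^esub>"
    using uc Gc a g(2) G(2) phiD(1)[OF Gc] phiD(3)[OF a Gc]
    by (simp add: E'.smult_r_minus2 E'.minus_self)
  ultimately have "?v \<in> Z (Suc t) \<inter> killed (Suc t) (idl_plus R J a)" using killed_plus_iff[OF J a] by blast
  then obtain h where h: "h \<in> killed t (idl_plus R J a)" "\<phi> t h = ?v" using ext_vanishes(2) unfolding ext_vanishes_def by blast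
  have hK: "h \<in> killed t J" using h(1) killed_plus_iff[OF J a] by blast
  have "\<phi> t (h \<oplus>\<^bsub>E t\<^esub> G) = u"
    using phiD(2)[OF killed_carr[OF hK] Gc] h(2) uc phiD(1)[OF Gc] by (simp add: E'.add_minus_cancel)
  then show "\<exists>e\<in>killed t J. \<phi> t e = u" using killed_add[OF Jc hK G(1)] by blast
qed

lemma ext_vanishes_left:
  assumes J: "ideal J R" and a: "a \<in> carrier R" and ext_vanishes: "ext_vanishes t J" "ext_vanishes (Suc t) (idl_plus R J a)"
  shows "ext_vanishes t (colon R J a)"
  unfolding ext_vanishes_def
proof
  interpret E: module R "E t" by (rule E)
  interpret E': module R "E (Suc t)" by (rule E)
  interpret E'': module R "E (Suc (Suc t))" by (rule E)
  have Jc: "J \<subseteq> carrier R" using ideal_rules(1)[OF J] by blast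
  fix u assume u: "u \<in> Z (Suc t) \<inter> killed (Suc t) (colon R J a)"
  obtain F where F: "F \<in> killed (Suc t) J" "a \<odot>\<^bsub>E (Suc t)\<^esub> F = u" using E_divide[OF J a] u by blast
  have Fc: "F \<in> carrier (E (Suc t))" using F killed_carr by blast
  have "a \<odot>\<^bsub>E (Suc (Suc t))\<^esub> \<phi> (Suc t) F = \<zero>\<^bsub>E (Suc (Suc t))\<^esub>"
    using phiD(3)[OF a Fc] F(2) u by (simp add: Z_def)
  then have "\<phi> (Suc t) F \<in> Z (Suc (Suc t)) \<inter> killed (Suc (Suc t)) (idl_plus R J a)"
    using phi_Z[OF Fc] phi_killed[OF F(1) Jc] killed_plus_iff[OF J a] by blast
  then obtain h where h: "h \<in> killed (Suc t) (idl_plus R J a)" "\<phi> (Suc t) h = \<phi> (Suc t) F"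
    using ext_vanishes(2) unfolding ext_vanishes_def by blast
  have hK: "h \<in> killed (Suc t) J" "a \<odot>\<^bsub>E (Suc t)\<^esub> h = \<zero>\<^bsub>E (Suc t)\<^esub>" using h(1) killed_plus_iff[OF J a] by blast+
  have hc: "h \<in> carrier (E (Suc t))" using hK killed_carr by blast
  have "\<phi> (Suc t) (F \<ominus>\<^bsub>E (Suc t)\<^esub> h) = \<zero>\<^bsub>E (Suc (Suc t))\<^esub>"
    using phi0(3)[OF Fc hc] h(2) phiD(1)[OF Fc] by (simp add: E''.minus_self)
  then have "F \<ominus>\<^bsub>E (Suc t)\<^esub> h \<in> Z (Suc t) \<inter> killed (Suc t) J"
    using killed_minus[OF Jc F(1) hK(1)] Fc hc by (simp add: Z_def)
  then obtain e where e: "e \<in> killed t J" "\<phi> t e = F \<ominus>\<^bsub>E (Suc t)\<^esub> h" using ext_vanishes(1) unfolding ext_vanishes_def by blast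
  have "\<phi> t (a \<odot>\<^bsub>E t\<^esub> e) = u"
  proof -
    have "u \<in> carrier (E (Suc t))" using u Z_carr by blast
    then show ?thesis
      using phiD(3)[OF a killed_carr[OF e(1)]] e(2) F(2) hK(2) Fc hc a
      by (simp add: E'.smult_r_minus2 E'.minus_zero)
  qed
  then show "\<exists>e\<in>killed t (colon R J a). \<phi> t e = u" using mult_killed_colon[OF J a e(1)] by blast
qed

lemma ext_vanishes_right:
  assumes J: "ideal J R" and a: "a \<in> carrier R" and ext_vanishes: "ext_vanishes t (colon R J a)" "ext_vanishes (Suc t) J"
  shows "ext_vanishes (Suc t) (idl_plus R J a)"
  unfolding ext_vanishes_def
proof
  interpret E: module R "E t" by (rule E)
  interpret E': module R "E (Suc t)" by (rule E)
  interpret E'': module R "E (Suc (Suc t))" by (rule E)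
  have Jc: "J \<subseteq> carrier R" using ideal_rules(1)[OF J] by blast
  fix u assume u: "u \<in> Z (Suc (Suc t)) \<inter> killed (Suc (Suc t)) (idl_plus R J a)"
  then have uJ: "u \<in> Z (Suc (Suc t)) \<inter> killed (Suc (Suc t)) J" "a \<odot>\<^bsub>E (Suc (Suc t))\<^esub> u = \<zero>\<^bsub>E (Suc (Suc t))\<^esub>"
    using killed_plus_iff[OF J a] by blast+
  obtain g where g: "g \<in> killed (Suc t) J" "\<phi> (Suc t) g = u" using ext_vanishes(2) uJ(1) unfolding ext_vanishes_def by blast
  have gc: "g \<in> carrier (E (Suc t))" using g killed_carr by blast
  have "a \<odot>\<^bsub>E (Suc t)\<^esub> g \<in> Z (Suc t)" using phiD(3)[OF a gc] g(2) uJ(2) gc a by (simp add: Z_def)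
  then obtain h where h: "h \<in> killed t (colon R J a)" "\<phi> t h = a \<odot>\<^bsub>E (Suc t)\<^esub> g"
    using ext_vanishes(1) mult_killed_colon[OF J a g(1)] unfolding ext_vanishes_def by blast
  obtain H where H: "H \<in> killed t J" "a \<odot>\<^bsub>E t\<^esub> H = h" using E_divide[OF J a h(1)] by blast
  have Hc: "H \<in> carrier (E t)" using H killed_carr by blast
  let ?e = "g \<ominus>\<^bsub>E (Suc t)\<^esub> \<phi> t H"
  have "?e \<in> killed (Suc t) J" by (rule killed_minus[OF Jc g(1) phi_killed[OF H(1) Jc]])
  moreover have "a \<odot>\<^bsub>E (Suc t)\<^esub> ?e = \<zero>\<^bsub>E (Suc t)\<^esub>"
    using gc Hc a h(2) H(2) phiD(1)[OF Hc] phiD(3)[OF a Hc]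
    by (simp add: E'.smult_r_minus2 E'.minus_self)
  ultimately have "?e \<in> killed (Suc t) (idl_plus R J a)" using killed_plus_iff[OF J a] by blast
  moreover have "\<phi> (Suc t) ?e = u"
    using phi0(3)[OF gc phiD(1)[OF Hc]] g(2) phi_phi[OF Hc] phiD(1)[OF gc] by (simp add: E''.minus_zero)
  ultimately show "\<exists>e\<in>killed (Suc t) (idl_plus R J a). \<phi> (Suc t) e = u" by blast
qed

lemma colon_II: assumes "i < d" shows "colon R (II i) (z i) = II i"
proof -
  have i: "i \<le> d" using assms by simp
  note r = ideal_rules[OF II_ideal[OF i]]
  have "r \<otimes> z i \<in> II i \<longleftrightarrow> r \<in> II i" if "r \<in> carrier R" for r
    using z_reg[OF assms, unfolded reg_on_def, rule_format, of r] r(7)[OF z_carr[OF assms], of r]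
      m_comm[OF that z_carr[OF assms]] that by (simp only: reg_mod_simps) metis
  then show ?thesis using r(1) unfolding colon_iff set_eq_iff by blast
qed

text \<open>\<open>R/(z\<^sub>0, \<dots>, z\<^bsub>i-1\<^esub>)\<close> has projective dimension at most \<open>i\<close>: each \<open>z\<^sub>i\<close> adds one degree.\<close>

lemma ext_vanishes_II: "i \<le> d \<Longrightarrow> i \<le> t \<Longrightarrow> ext_vanishes t (II i)"
proof (induction i arbitrary: t)
  case 0
  show ?case unfolding ext_vanishes_def
  proof
    fix u assume u: "u \<in> Z (Suc t) \<inter> killed (Suc t) (II 0)"
    then obtain e where "e \<in> carrier (E t)" "\<phi> t e = u" using Z_phi by blast
    then show "\<exists>e\<in>killed t (II 0). \<phi> t e = u" using module.smult_l_null[OF E] by (auto simp: killed_def)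
  qed
next
  case (Suc i)
  obtain t' where t: "t = Suc t'" "i \<le> t'" using Suc.prems by (cases t) auto
  have i: "i < d" using Suc by simp
  show ?case unfolding t msum.simps
    by (rule ext_vanishes_right[OF II_ideal z_carr[OF i]]) (use Suc t i colon_II[OF i] in auto)
qed

text \<open>
  Bass's argument: the injective dimension is at most \<open>d\<close>, as far as modules of finite length can see.
  By descending induction on \<open>t\<close>, starting beyond the length of the resolution: \<open>R/\<mm>\<close> embeds into
  \<open>R/(z\<^sub>0, \<dots>, z\<^bsub>d-1\<^esub>)\<close>, whose higher \<open>Ext\<close> vanishes above degree \<open>d\<close>, and the cokernel is harmless
  by induction; this settles \<open>R/\<mm>\<close>, and noetherian induction splits off copies of \<open>R/\<mm>\<close> from \<open>R/J\<close>.
\<close>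

lemma ext_vanishes_finite_length:
  assumes "t \<ge> d" "ideal J R" "II d \<subseteq> J"
  shows "ext_vanishes t J"
proof -
  have "\<forall>J. ideal J R \<longrightarrow> II d \<subseteq> J \<longrightarrow> ext_vanishes t J" if "t \<ge> d" for t
    using that
  proof (induction "Suc n - t" arbitrary: t rule: less_induct)
    case (less t)
    show ?case
    proof (cases "t > n")
      case True
      have "ext_vanishes t J" if J: "ideal J R" for J
        unfolding ext_vanishes_def
      proof
        fix u assume "u \<in> Z (Suc t) \<inter> killed (Suc t) J"
        then have "u = \<zero>\<^bsub>E (Suc t)\<^esub>" using E_bound[of "Suc t"] True Z_carr by auto
        then show "\<exists>e\<in>killed t J. \<phi> t e = u"
          using phi0(1)[of t] module.sub_zero[OF E killed_sub] ideal_rules(1)[OF J] by blast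
      qed
      then show ?thesis by blast
    next
      case False
      have IH: "ext_vanishes (Suc t) J" if "ideal J R" "II d \<subseteq> J" for J
        using less.hyps[of "Suc t"] False less.prems that by auto
      have col: "colon R J a = \<mm>" if "ideal J R" "a \<in> carrier R - J" "\<forall>b\<in>\<mm>. b \<otimes> a \<in> J" for J a
      proof -
        have "colon R J a \<subseteq> \<mm>"
        proof (rule ideal_le_mm[OF colon_ideal])
          have "\<one> \<notin> colon R J a" using that(2) by (auto simp: colon_iff)
          then show "colon R J a \<noteq> carrier R" by auto
        qed (use that in auto)
        then show ?thesis using that mm_carr by (auto simp: colon_iff)
      qed
      have "II d \<noteq> carrier R" using II_le_mm[of d] one_notin by auto
      then obtain a where a: "a \<in> carrier R - II d" "\<forall>b\<in>\<mm>. b \<otimes> a \<in> II d"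
        using socle[OF II_ideal] by blast
      have Vmm: "ext_vanishes t \<mm>"
      proof -
        have "ext_vanishes t (colon R (II d) a)"
          using a ext_vanishes_II[of d t] less.prems J_le_plus[OF II_ideal, of d a]
          by (intro ext_vanishes_left IH plus_ideal II_ideal) auto
        then show ?thesis using col[OF II_ideal a] by simp
      qed
      show ?thesis
      proof (rule ccontr)
        let ?F = "{J. ideal J R \<and> II d \<subseteq> J \<and> \<not> ext_vanishes t J}"
        assume "\<not> (\<forall>J. ideal J R \<longrightarrow> II d \<subseteq> J \<longrightarrow> ext_vanishes t J)"
        then have "\<exists>S\<in>?F. \<forall>ext_graph\<in>?F. S \<subseteq> ext_graph \<longrightarrow> ext_graph = S"
          by (intro acc_mod_maximal[OF acc_reg_mod[OF noetherian_ring_axioms]])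
             (auto simp: submodule_reg_iff)
        then obtain J where JF: "J \<in> ?F" "\<forall>ext_graph\<in>?F. J \<subseteq> ext_graph \<longrightarrow> ext_graph = J" by (rule bexE)
        then have J: "ideal J R" "II d \<subseteq> J" "\<not> ext_vanishes t J"
          "\<And>ext_graph. ideal ext_graph R \<Longrightarrow> II d \<subseteq> ext_graph \<Longrightarrow> J \<subseteq> ext_graph \<Longrightarrow> ext_graph \<noteq> J \<Longrightarrow> ext_vanishes t ext_graph" by blast+
        show False
        proof (cases "J = carrier R")
          case True
          have "ext_vanishes t (carrier R)" unfolding ext_vanishes_def
          proof
            fix u assume "u \<in> Z (Suc t) \<inter> killed (Suc t) (carrier R)"
            then have "u = \<zero>\<^bsub>E (Suc t)\<^esub>" using module.smult_one[OF E, of u "Suc t"] by (auto simp: killed_def)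
            then show "\<exists>e\<in>killed t (carrier R). \<phi> t e = u"
              using phi0(1)[of t] module.sub_zero[OF E killed_sub] by blast
          qed
          then show False using J True by simp
        next
          case False
          then obtain b where b: "b \<in> carrier R - J" "\<forall>c\<in>\<mm>. c \<otimes> b \<in> J" using socle[OF J(1,2)] by blast
          then have bc: "b \<in> carrier R" by simp
          have "ext_vanishes t (idl_plus R J b)"
            using J_le_plus[OF J(1) bc] a_in_plus[OF J(1) bc] J(2) b by (intro J(4) plus_ideal J(1) bc) auto
          then have "ext_vanishes t J" using ext_vanishes_middle[OF J(1) bc] Vmm col[OF J(1) b] by simp
          then show False using J(3) by simp
        qed
      qed
    qed
  qed
  then show ?thesis using assms by blast
qed

text \<open>The cocycles for \<open>Ext\<^sup>i(R/I\<^sub>i, \<omega>)\<close>, where \<open>I\<^sub>i = (z\<^sub>0, \<dots>, z\<^bsub>i-1\<^esub>)\<close>.\<close>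

definition W :: "nat \<Rightarrow> 'e set" where "W i = Z i \<inter> killed i (II i)"

lemma II_carr: "i \<le> d \<Longrightarrow> II i \<subseteq> carrier R" using ideal_rules(1)[OF II_ideal] by blast

lemma W_sub: "i \<le> d \<Longrightarrow> submodule (W i) R (E i)"
proof -
  assume i: "i \<le> d"
  interpret E: module R "E i" by (rule E)
  show ?thesis unfolding W_def
    using E.sub_rules[OF Z_sub] E.sub_rules[OF killed_sub[OF II_carr[OF i]]]
    by (intro E.subI) auto
qed

text \<open>
  Extend a homomorphism from \<open>J\<close> to \<open>E\<^sub>d\<close>; since \<open>Ext\<^bsup>d+1\<^esup>(R/J, \<omega>) = 0\<close>, subtracting an
  element of \<open>E\<^sub>d\<close> killed by \<open>J\<close> makes the element found a cocycle.
\<close>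

lemma rel_inj_W: "rel_inj R (II d) (E d) (W d) {\<zero>\<^bsub>E d\<^esub>}"
  unfolding rel_inj_def
proof (intro allI impI, elim conjE)
  interpret E: module R "E d" by (rule E)
  interpret E': module R "E (Suc d)" by (rule E)
  fix J f assume J: "ideal J R" "II d \<subseteq> J" and f: "qhom R (reg_mod R) J (E d) {\<zero>\<^bsub>E d\<^esub>} f" "f ` J \<subseteq> W d"
    "\<forall>a\<in>II d. f a \<in> {\<zero>\<^bsub>E d\<^esub>}"
  note Jr = ideal_rules[OF J(1)]
  have Jc: "J \<subseteq> carrier R" using Jr by blast
  have f0: "f \<zero> \<in> {\<zero>\<^bsub>E d\<^esub>}" using f(3) ideal_rules(2)[OF II_ideal[of d]] by blast
  have "\<exists>m\<in>carrier (E d). \<forall>x\<in>J. cg (E d) {\<zero>\<^bsub>E d\<^esub>} (f x) (x \<odot>\<^bsub>E d\<^esub> m)"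
    by (rule E_inj[unfolded rel_inj_def, rule_format])
       (use J Jr f f0 qhomD(1)[OF f(1)] in auto)
  then obtain e where e: "e \<in> carrier (E d)" "\<And>x. x \<in> J \<Longrightarrow> f x = x \<odot>\<^bsub>E d\<^esub> e" by (auto simp: E.cg_singleton)
  have "b \<odot>\<^bsub>E (Suc d)\<^esub> \<phi> d e = \<zero>\<^bsub>E (Suc d)\<^esub>" if "b \<in> J" for b
  proof -
    have "f b \<in> Z d" using f(2) that by (auto simp: W_def)
    then show ?thesis using phiD(3)[OF subsetD[OF Jc that] e(1)] e(2)[OF that] by (simp add: Z_def)
  qed
  then have "\<phi> d e \<in> Z (Suc d) \<inter> killed (Suc d) J" using phi_Z[OF e(1)] phiD(1)[OF e(1)] by (simp add: killed_def)
  then obtain h where h: "h \<in> killed d J" "\<phi> d h = \<phi> d e"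
    using ext_vanishes_finite_length[OF order_refl J] unfolding ext_vanishes_def by blast
  let ?m = "e \<ominus>\<^bsub>E d\<^esub> h"
  have hc: "h \<in> carrier (E d)" using h killed_carr by blast
  have fm: "f a = a \<odot>\<^bsub>E d\<^esub> ?m" if "a \<in> J" for a
    using e(1) e(2)[OF that] hc h(1) that Jc by (auto simp: E.smult_r_minus2 killed_def E.minus_zero subset_iff)
  have "\<phi> d ?m = \<zero>\<^bsub>E (Suc d)\<^esub>"
    using phi0(3)[OF e(1) hc] h(2) phiD(1)[OF e(1)] by (simp add: E'.minus_self)
  moreover have "b \<odot>\<^bsub>E d\<^esub> ?m = \<zero>\<^bsub>E d\<^esub>" if "b \<in> II d" for b
    using fm[OF subsetD[OF J(2) that]] f(3) that by simp
  ultimately have "?m \<in> W d" unfolding W_def Z_def killed_def using e(1) hc by simp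
  then show "\<exists>m\<in>W d. \<forall>a\<in>J. cg (E d) {\<zero>\<^bsub>E d\<^esub>} (f a) (a \<odot>\<^bsub>E d\<^esub> m)"
    using fm qhomD(1)[OF f(1)] by (intro bexI[of _ ?m]) (auto simp: E.cg_singleton)
qed

abbreviation "OM i \<equiv> msum \<omega> z {\<zero>\<^bsub>\<omega>\<^esub>} i"

lemma OM_sub: "i \<le> d \<Longrightarrow> submodule (OM i) R \<omega>"
  using module.msum_sub[OF omega module.sub_zero_set[OF omega]] z_carr by auto

lemma OM_reg: "i < d \<Longrightarrow> reg_on \<omega> (z i) (OM i)"
  using msum_regular(2)[OF omega omega_acc module.sub_zero_set[OF omega], of 0 i] omega_dep
    module.smult_l_null[OF omega] by auto

lemma OM_smult: "i \<le> d \<Longrightarrow> b \<in> II i \<Longrightarrow> x \<in> carrier \<omega> \<Longrightarrow> b \<odot>\<^bsub>\<omega>\<^esub> x \<in> OM i"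
  using II_smult[OF omega module.sub_zero_set[OF omega], of 0 i] module.smult_l_null[OF omega] by auto

text \<open>
  The graph of the isomorphism \<open>Ext\<^sup>i(R/I\<^sub>i, \<omega>) \<cong> \<omega>/I\<^sub>i\<omega>\<close>, with cocycles from \<open>W i\<close> representing the
  classes on the left. One step is the connecting map of multiplication by \<open>z\<^sub>i\<close> on \<open>R/I\<^sub>i\<close>.
\<close>

primrec ext_graph :: "nat \<Rightarrow> ('e \<times> 'b) set" where
  "ext_graph 0 = {(\<epsilon> w, w) | w. w \<in> carrier \<omega>}"
| "ext_graph (Suc i) = {(\<phi> i e, w \<oplus>\<^bsub>\<omega>\<^esub> z i \<odot>\<^bsub>\<omega>\<^esub> w') | e w w'.
     e \<in> killed i (II i) \<and> (z i \<odot>\<^bsub>E i\<^esub> e, w) \<in> ext_graph i \<and> w' \<in> carrier \<omega>}"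

text \<open>The cocycles whose class is zero.\<close>

definition ext_null :: "nat \<Rightarrow> 'e set" where "ext_null i = {u. (u, \<zero>\<^bsub>\<omega>\<^esub>) \<in> ext_graph i}"

text \<open>
  The invariant that carries the construction from \<open>i\<close> to \<open>i + 1\<close>. Its last part, the injectivity of
  the cocycles of class zero, is what makes the quotient at \<open>i = d\<close> injective.
\<close>

definition graph_correct :: "nat \<Rightarrow> bool" where
  "graph_correct i \<longleftrightarrow> (\<forall>u w. (u, w) \<in> ext_graph i \<longrightarrow> u \<in> W i \<and> w \<in> carrier \<omega>) \<and>
     (\<forall>u w u' w'. (u, w) \<in> ext_graph i \<longrightarrow> (u', w') \<in> ext_graph i \<longrightarrow> (u \<oplus>\<^bsub>E i\<^esub> u', w \<oplus>\<^bsub>\<omega>\<^esub> w') \<in> ext_graph i) \<and>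
     (\<forall>r u w. r \<in> carrier R \<longrightarrow> (u, w) \<in> ext_graph i \<longrightarrow> (r \<odot>\<^bsub>E i\<^esub> u, r \<odot>\<^bsub>\<omega>\<^esub> w) \<in> ext_graph i) \<and>
     (\<forall>u\<in>W i. \<exists>w. (u, w) \<in> ext_graph i) \<and> (\<forall>w\<in>carrier \<omega>. \<exists>u. (u, w) \<in> ext_graph i) \<and>
     (\<forall>w. (\<zero>\<^bsub>E i\<^esub>, w) \<in> ext_graph i \<longleftrightarrow> w \<in> OM i) \<and>
     rel_inj R (II i) (E i) (ext_null i) {\<zero>\<^bsub>E i\<^esub>}"

lemma graph_correctD:
  assumes "graph_correct i"
  shows "(u, w) \<in> ext_graph i \<Longrightarrow> u \<in> W i" "(u, w) \<in> ext_graph i \<Longrightarrow> w \<in> carrier \<omega>"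
    "(u, w) \<in> ext_graph i \<Longrightarrow> (u', w') \<in> ext_graph i \<Longrightarrow> (u \<oplus>\<^bsub>E i\<^esub> u', w \<oplus>\<^bsub>\<omega>\<^esub> w') \<in> ext_graph i"
    "r \<in> carrier R \<Longrightarrow> (u, w) \<in> ext_graph i \<Longrightarrow> (r \<odot>\<^bsub>E i\<^esub> u, r \<odot>\<^bsub>\<omega>\<^esub> w) \<in> ext_graph i"
    "u \<in> W i \<Longrightarrow> \<exists>w. (u, w) \<in> ext_graph i" "w \<in> carrier \<omega> \<Longrightarrow> \<exists>u. (u, w) \<in> ext_graph i"
    "(\<zero>\<^bsub>E i\<^esub>, w) \<in> ext_graph i \<longleftrightarrow> w \<in> OM i"
    "rel_inj R (II i) (E i) (ext_null i) {\<zero>\<^bsub>E i\<^esub>}"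
  using assms unfolding graph_correct_def by blast+

lemma W_D: "u \<in> W i \<Longrightarrow> u \<in> carrier (E i)" "u \<in> W i \<Longrightarrow> u \<in> Z i" "u \<in> W i \<Longrightarrow> u \<in> killed i (II i)"
  by (auto simp: W_def Z_def)

lemma graph_correct_minus:
  assumes "graph_correct i" "(u, w) \<in> ext_graph i" "(u', w') \<in> ext_graph i"
  shows "(u \<ominus>\<^bsub>E i\<^esub> u', w \<ominus>\<^bsub>\<omega>\<^esub> w') \<in> ext_graph i"
proof -
  interpret E: module R "E i" by (rule E)
  interpret O: module R \<omega> by (rule omega)
  note g = graph_correctD[OF assms(1)]
  have "(\<ominus>\<^bsub>E i\<^esub> u', \<ominus>\<^bsub>\<omega>\<^esub> w') \<in> ext_graph i"
    using g(4)[of "\<ominus> \<one>", OF _ assms(3)] W_D(1)[OF g(1)[OF assms(3)]] g(2)[OF assms(3)]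
    by (simp add: E.smult_l_minus O.smult_l_minus)
  then show ?thesis using g(3)[OF assms(2)] by (simp add: E.M.minus_eq O.M.minus_eq)
qed

lemma graph_correct_0: "graph_correct 0"
proof -
  interpret E: module R "E 0" by (rule E)
  interpret O: module R \<omega> by (rule omega)
  note e = mod_homD[OF eps(1)] and e0 = mod_hom_zero_minus[OF omega E eps(1)]
  have W0: "W 0 = \<epsilon> ` carrier \<omega>"
    using exact0 E.smult_l_null by (auto simp: W_def Z_def killed_def)
  have einj: "\<epsilon> w = \<zero>\<^bsub>E 0\<^esub> \<longleftrightarrow> w = \<zero>\<^bsub>\<omega>\<^esub>" if "w \<in> carrier \<omega>" for w
    using inj_onD[OF eps(2), of w "\<zero>\<^bsub>\<omega>\<^esub>"] that e0(1) by auto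
  have Q0: "ext_null 0 = {\<zero>\<^bsub>E 0\<^esub>}" unfolding ext_null_def using e0(1) by auto
  show ?thesis unfolding graph_correct_def
  proof (intro conjI allI impI ballI)
    fix u w u' w' assume "(u, w) \<in> ext_graph 0" "(u', w') \<in> ext_graph 0"
    then show "(u \<oplus>\<^bsub>E 0\<^esub> u', w \<oplus>\<^bsub>\<omega>\<^esub> w') \<in> ext_graph 0" by (auto simp: e)
  next
    fix r u w assume "r \<in> carrier R" "(u, w) \<in> ext_graph 0"
    then show "(r \<odot>\<^bsub>E 0\<^esub> u, r \<odot>\<^bsub>\<omega>\<^esub> w) \<in> ext_graph 0" by (auto simp: e)
  next
    fix w show "((\<zero>\<^bsub>E 0\<^esub>, w) \<in> ext_graph 0) = (w \<in> OM 0)" using einj e0(1) by force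
  next
    show "rel_inj R (II 0) (E 0) (ext_null 0) {\<zero>\<^bsub>E 0\<^esub>}"
      unfolding rel_inj_def Q0
    proof (intro allI impI, elim conjE)
      fix J f assume J: "ideal J R" "f ` J \<subseteq> {\<zero>\<^bsub>E 0\<^esub>}"
      then have "cg (E 0) {\<zero>\<^bsub>E 0\<^esub>} (f a) (a \<odot>\<^bsub>E 0\<^esub> \<zero>\<^bsub>E 0\<^esub>)" if "a \<in> J" for a
        using that ideal_rules(1)[OF J(1)] by (auto simp: E.cg_singleton)
      then show "\<exists>m\<in>{\<zero>\<^bsub>E 0\<^esub>}. \<forall>a\<in>J. cg (E 0) {\<zero>\<^bsub>E 0\<^esub>} (f a) (a \<odot>\<^bsub>E 0\<^esub> m)" by blast
    qed
  qed (use W0 in auto)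
qed

text \<open>
  The cocycles of class zero form \<open>\<phi>\<^sub>i(Hom(R/I\<^sub>i\<^sub>+\<^sub>1, E\<^sub>i))\<close>. This module is injective over
  \<open>R/I\<^sub>i\<^sub>+\<^sub>1\<close>, as the quotient of \<open>Hom(R/I\<^sub>i\<^sub>+\<^sub>1, E\<^sub>i)\<close> by the elements of \<open>ext_null i\<close> that
  \<open>z\<^sub>i\<close> kills, which are injective because \<open>ext_null i\<close> is.
\<close>

lemma graph_correct_Suc:
  assumes g: "graph_correct i" and i: "i < d"
  shows "graph_correct (Suc i)"
proof -
  interpret E: module R "E i" by (rule E)
  interpret E': module R "E (Suc i)" by (rule E)
  interpret O: module R \<omega> by (rule omega)
  note G = graph_correctD[OF g] and gm = graph_correct_minus[OF g]
  have zc: "z i \<in> carrier R" using z_carr[OF i] .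
  have Ic: "II i \<subseteq> carrier R" "II (Suc i) \<subseteq> carrier R" using II_carr[of i] II_carr[of "Suc i"] i by (simp_all del: msum.simps)
  have Ii: "ideal (II i) R" "ideal (II (Suc i)) R" using II_ideal[of i] II_ideal[of "Suc i"] i by (simp_all del: msum.simps)
  note Or = O.sub_rules[OF OM_sub[of i]]
  have Wr: "submodule (W i) R (E i)" using W_sub i by simp
  have K': "e \<in> killed j (II (Suc i)) \<longleftrightarrow> e \<in> killed j (II i) \<and> z i \<odot>\<^bsub>E j\<^esub> e = \<zero>\<^bsub>E j\<^esub>" for e j
    using killed_plus_iff[OF Ii(1) zc] by simp
  have T00: "(\<zero>\<^bsub>E i\<^esub>, \<zero>\<^bsub>\<omega>\<^esub>) \<in> ext_graph i" using G(7) Or(2) i by simp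
  have TI: "(\<phi> i e, w \<oplus>\<^bsub>\<omega>\<^esub> z i \<odot>\<^bsub>\<omega>\<^esub> w') \<in> ext_graph (Suc i)"
    if "e \<in> killed i (II i)" "(z i \<odot>\<^bsub>E i\<^esub> e, w) \<in> ext_graph i" "w' \<in> carrier \<omega>" for e w w' using that by auto
  have TE: "\<exists>e w1 w'. u = \<phi> i e \<and> w = w1 \<oplus>\<^bsub>\<omega>\<^esub> z i \<odot>\<^bsub>\<omega>\<^esub> w' \<and> e \<in> killed i (II i) \<and>
     (z i \<odot>\<^bsub>E i\<^esub> e, w1) \<in> ext_graph i \<and> w' \<in> carrier \<omega>" if "(u, w) \<in> ext_graph (Suc i)" for u w
    using that unfolding ext_graph.simps by blast
  have zreg: "w \<in> OM i" if "w \<in> carrier \<omega>" "z i \<odot>\<^bsub>\<omega>\<^esub> w \<in> OM i" for w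
    using OM_reg[OF i] that unfolding reg_on_def by blast
  have Qs: "submodule (ext_null i) R (E i)"
  proof (rule E.subI)
    show "ext_null i \<subseteq> carrier (E i)" unfolding ext_null_def using G(1) W_D(1) by blast
    show "\<zero>\<^bsub>E i\<^esub> \<in> ext_null i" unfolding ext_null_def using T00 by simp
    show "a \<oplus>\<^bsub>E i\<^esub> b \<in> ext_null i" if "a \<in> ext_null i" "b \<in> ext_null i" for a b
      using that G(3)[of a "\<zero>\<^bsub>\<omega>\<^esub>" b "\<zero>\<^bsub>\<omega>\<^esub>"] unfolding ext_null_def by simp
    show "a \<odot>\<^bsub>E i\<^esub> x \<in> ext_null i" if "a \<in> carrier R" "x \<in> ext_null i" for a x
      using that G(4)[of a x "\<zero>\<^bsub>\<omega>\<^esub>"] unfolding ext_null_def by simp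
  qed
  have QW: "ext_null i \<subseteq> W i" unfolding ext_null_def using G(1) by blast
  \<comment> \<open>\<open>ext_null i\<close> is divisible by \<open>z i\<close>, being injective over \<open>R/I\<^sub>i\<close>\<close>
  have Qdiv: "\<exists>q'\<in>ext_null i. z i \<odot>\<^bsub>E i\<^esub> q' = q" if q: "q \<in> ext_null i" for q
  proof -
    have qK: "q \<in> killed i (colon R (II i) (z i))" using q QW W_D(3) colon_II[OF i] by auto
    obtain G0 where G0: "G0 \<in> killed i (II i)" "z i \<odot>\<^bsub>E i\<^esub> G0 = q" using E_divide[OF Ii(1) zc qK] by blast
    have G0c: "G0 \<in> carrier (E i)" using G0 killed_carr by blast
    let ?J = "II (Suc i)"
    have JQ: "b \<odot>\<^bsub>E i\<^esub> G0 \<in> ext_null i" if "b \<in> ?J" for b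
    proof -
      obtain c a where ca: "c \<in> II i" "a \<in> carrier R" "b = c \<oplus> z i \<otimes> a" using \<open>b \<in> ?J\<close> by (rule II_SucE)
      have "b \<odot>\<^bsub>E i\<^esub> G0 = a \<odot>\<^bsub>E i\<^esub> q"
        unfolding ca(3) using ca(1,2) Ic(1) G0 G0c zc E.smult_comm[of "z i" a G0]
        by (auto simp: E.smult_l_distr E.smult_assoc1 killed_def subset_iff)
      then show ?thesis using E.sub_smult[OF Qs ca(2) q] by simp
    qed
    have "\<exists>m\<in>ext_null i. \<forall>a\<in>?J. cg (E i) {\<zero>\<^bsub>E i\<^esub>} (a \<odot>\<^bsub>E i\<^esub> G0) (a \<odot>\<^bsub>E i\<^esub> m)"
    proof (rule G(8)[unfolded rel_inj_def, rule_format], intro conjI)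
      show "ideal ?J R" by (rule Ii(2))
      show "II i \<subseteq> ?J" using II_mono[of i "Suc i"] i by simp
      show "qhom R (reg_mod R) ?J (E i) {\<zero>\<^bsub>E i\<^esub>} (\<lambda>a. a \<odot>\<^bsub>E i\<^esub> G0)"
        by (rule qhomI) (use subsetD[OF Ic(2)] G0c in \<open>simp_all add: E.cg_singleton E.smult_l_distr E.smult_assoc1 del: msum.simps\<close>)
      show "(\<lambda>a. a \<odot>\<^bsub>E i\<^esub> G0) ` ?J \<subseteq> ext_null i" using JQ by blast
      show "\<forall>a\<in>II i. a \<odot>\<^bsub>E i\<^esub> G0 \<in> {\<zero>\<^bsub>E i\<^esub>}" using G0(1) by (simp add: killed_def)
    qed
    then obtain m where m: "m \<in> ext_null i" "\<And>a. a \<in> ?J \<Longrightarrow> a \<odot>\<^bsub>E i\<^esub> G0 = a \<odot>\<^bsub>E i\<^esub> m"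
      by (auto simp: E.cg_singleton simp del: msum.simps)
    then show ?thesis using m(2)[OF z_in_II[OF i]] G0(2) by metis
  qed
  let ?S = "killed i (II (Suc i))"
  have Ss: "submodule ?S R (E i)" by (rule killed_sub[OF Ic(2)])
  have SQ: "\<phi> i e \<in> ext_null (Suc i)" if e: "e \<in> ?S" for e
    using TI[of e "\<zero>\<^bsub>\<omega>\<^esub>" "\<zero>\<^bsub>\<omega>\<^esub>"] e K'[of e i] T00 zc unfolding ext_null_def by simp
  have QS: "\<exists>e\<in>?S. u = \<phi> i e" if u: "u \<in> ext_null (Suc i)" for u
  proof -
    obtain e w w' where e: "u = \<phi> i e" "\<zero>\<^bsub>\<omega>\<^esub> = w \<oplus>\<^bsub>\<omega>\<^esub> z i \<odot>\<^bsub>\<omega>\<^esub> w'" "e \<in> killed i (II i)"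
      "(z i \<odot>\<^bsub>E i\<^esub> e, w) \<in> ext_graph i" "w' \<in> carrier \<omega>" using TE u unfolding ext_null_def by blast
    obtain u' where u': "(u', w') \<in> ext_graph i" using G(6)[OF e(5)] by blast
    have ec: "e \<in> carrier (E i)" using e(3) killed_carr by blast
    have u'W: "u' \<in> W i" using G(1)[OF u'] .
    have u'c: "u' \<in> carrier (E i)" using W_D(1)[OF u'W] .
    have "(z i \<odot>\<^bsub>E i\<^esub> (e \<oplus>\<^bsub>E i\<^esub> u'), \<zero>\<^bsub>\<omega>\<^esub>) \<in> ext_graph i"
      using G(3)[OF e(4) G(4)[OF zc u']] e(2) ec u'c zc by (simp add: E.smult_r_distr)
    then obtain q where q: "q \<in> ext_null i" "z i \<odot>\<^bsub>E i\<^esub> q = z i \<odot>\<^bsub>E i\<^esub> (e \<oplus>\<^bsub>E i\<^esub> u')"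
      using Qdiv unfolding ext_null_def by blast
    have qW: "q \<in> W i" using q QW by blast
    have qc: "q \<in> carrier (E i)" using W_D(1)[OF qW] .
    let ?e = "(e \<oplus>\<^bsub>E i\<^esub> u') \<ominus>\<^bsub>E i\<^esub> q"
    have "?e \<in> killed i (II i)"
      using killed_minus[OF Ic(1) killed_add[OF Ic(1) e(3) W_D(3)[OF u'W]] W_D(3)[OF qW]] .
    moreover have "z i \<odot>\<^bsub>E i\<^esub> ?e = \<zero>\<^bsub>E i\<^esub>" using q(2) ec u'c qc zc
      by (simp only: E.smult_r_minus2 E.minus_self E.M.add.m_closed E.smult_closed)
    ultimately have "?e \<in> ?S" unfolding K' by blast
    moreover have "\<phi> i ?e = u"
    proof -
      have "\<phi> i u' = \<zero>\<^bsub>E (Suc i)\<^esub>" "\<phi> i q = \<zero>\<^bsub>E (Suc i)\<^esub>"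
        using W_D(2)[OF u'W] W_D(2)[OF qW] by (auto simp: Z_def)
      then show ?thesis using phi0(3)[of "e \<oplus>\<^bsub>E i\<^esub> u'" i q] phiD(2)[OF ec u'c] ec u'c qc e(1) phiD(1)[OF ec]
        by (simp add: E'.minus_zero)
    qed
    ultimately show ?thesis by blast
  qed
  have inj: "rel_inj R (II (Suc i)) (E (Suc i)) (ext_null (Suc i)) {\<zero>\<^bsub>E (Suc i)\<^esub>}"
  proof -
    have Q's: "submodule (ext_null (Suc i)) R (E (Suc i))"
    proof (rule E'.subI)
      note Sr = E.sub_rules[OF Ss]
      show "ext_null (Suc i) \<subseteq> carrier (E (Suc i))" using QS killed_carr phiD(1) by blast
      show "\<zero>\<^bsub>E (Suc i)\<^esub> \<in> ext_null (Suc i)" using SQ[OF Sr(2)] phi0(1)[of i] by simp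
      fix a b assume "a \<in> ext_null (Suc i)" "b \<in> ext_null (Suc i)"
      then obtain x y where "x \<in> ?S" "y \<in> ?S" "a = \<phi> i x" "b = \<phi> i y" using QS by blast
      then show "a \<oplus>\<^bsub>E (Suc i)\<^esub> b \<in> ext_null (Suc i)" using SQ[OF Sr(3)[of x y]] phiD(2)[of x i y] E.sub_carr[OF Ss] by (simp del: msum.simps)
    next
      note Sr = E.sub_rules[OF Ss]
      fix r b assume "r \<in> carrier R" "b \<in> ext_null (Suc i)"
      then obtain y where "y \<in> ?S" "b = \<phi> i y" "r \<in> carrier R" using QS by blast
      then show "r \<odot>\<^bsub>E (Suc i)\<^esub> b \<in> ext_null (Suc i)" using SQ[OF Sr(6)[of r y]] phiD(3)[of r y i] E.sub_carr[OF Ss] by (simp del: msum.simps)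
    qed
    define B where "B = {q \<in> ext_null i. z i \<odot>\<^bsub>E i\<^esub> q = \<zero>\<^bsub>E i\<^esub>}"
    define TT where "TT = {(e, \<phi> i e) | e. e \<in> ?S}"
    have TTi: "(a, c) \<in> TT \<longleftrightarrow> a \<in> ?S \<and> c = \<phi> i a" for a c unfolding TT_def by blast
    have Beq: "B = {a. \<exists>c\<in>{\<zero>\<^bsub>E (Suc i)\<^esub>}. (a, c) \<in> TT}"
    proof
      show "B \<subseteq> {a. \<exists>c\<in>{\<zero>\<^bsub>E (Suc i)\<^esub>}. (a, c) \<in> TT}"
      proof
        fix q assume "q \<in> B"
        then have q: "q \<in> ext_null i" "z i \<odot>\<^bsub>E i\<^esub> q = \<zero>\<^bsub>E i\<^esub>" by (auto simp: B_def)
        have "q \<in> W i" using q QW by blast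
        then have "q \<in> ?S" "\<phi> i q = \<zero>\<^bsub>E (Suc i)\<^esub>" using q(2) K' by (auto simp: W_def Z_def)
        then show "q \<in> {a. \<exists>c\<in>{\<zero>\<^bsub>E (Suc i)\<^esub>}. (a, c) \<in> TT}" unfolding TTi by simp
      qed
      show "{a. \<exists>c\<in>{\<zero>\<^bsub>E (Suc i)\<^esub>}. (a, c) \<in> TT} \<subseteq> B"
      proof
        fix e assume "e \<in> {a. \<exists>c\<in>{\<zero>\<^bsub>E (Suc i)\<^esub>}. (a, c) \<in> TT}"
        then have e: "e \<in> ?S" "\<phi> i e = \<zero>\<^bsub>E (Suc i)\<^esub>" unfolding TTi by simp_all
        then have e2: "e \<in> killed i (II i)" "z i \<odot>\<^bsub>E i\<^esub> e = \<zero>\<^bsub>E i\<^esub>" using K' by blast+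
        then have "e \<in> W i" using e(2) killed_carr by (auto simp: W_def Z_def)
        then obtain w where w: "(e, w) \<in> ext_graph i" using G(5) by blast
        have "(\<zero>\<^bsub>E i\<^esub>, z i \<odot>\<^bsub>\<omega>\<^esub> w) \<in> ext_graph i" using G(4)[OF zc w] e2(2) by simp
        then have "w \<in> OM i" using zreg[OF G(2)[OF w]] G(7) by blast
        then have "(\<zero>\<^bsub>E i\<^esub>, w) \<in> ext_graph i" using G(7) by blast
        then have "(e \<ominus>\<^bsub>E i\<^esub> \<zero>\<^bsub>E i\<^esub>, w \<ominus>\<^bsub>\<omega>\<^esub> w) \<in> ext_graph i" by (rule gm[OF w])
        then have "e \<in> ext_null i" unfolding ext_null_def
          using killed_carr[OF e(1)] G(2)[OF w] by (simp add: E.minus_zero O.minus_self)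
        then show "e \<in> B" using e2(2) by (simp add: B_def)
      qed
    qed
    have injB: "rel_inj R (II (Suc i)) (E i) B {\<zero>\<^bsub>E i\<^esub>}"
      unfolding rel_inj_def
    proof (intro allI impI, elim conjE)
      fix J f assume J: "ideal J R" "II (Suc i) \<subseteq> J" and f: "qhom R (reg_mod R) J (E i) {\<zero>\<^bsub>E i\<^esub>} f"
        "f ` J \<subseteq> B" "\<forall>a\<in>II (Suc i). f a \<in> {\<zero>\<^bsub>E i\<^esub>}"
      have sub: "II i \<subseteq> II (Suc i)" using II_mono[of i "Suc i"] i by simp
      have "\<exists>m\<in>ext_null i. \<forall>a\<in>J. cg (E i) {\<zero>\<^bsub>E i\<^esub>} (f a) (a \<odot>\<^bsub>E i\<^esub> m)"
      proof (rule G(8)[unfolded rel_inj_def, rule_format], intro conjI ballI)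
        show "II i \<subseteq> J" using sub J(2) by (rule subset_trans)
        show "f ` J \<subseteq> ext_null i" using f(2) unfolding B_def by blast
        show "f a \<in> {\<zero>\<^bsub>E i\<^esub>}" if "a \<in> II i" for a using f(3) subsetD[OF sub that] by blast
      qed (fact J(1), fact f(1))
      then obtain m where m: "m \<in> ext_null i" "\<forall>a\<in>J. cg (E i) {\<zero>\<^bsub>E i\<^esub>} (f a) (a \<odot>\<^bsub>E i\<^esub> m)" by (rule bexE)
      have zJ: "z i \<in> II (Suc i)" by (rule z_in_II[OF i])
      then have "f (z i) = z i \<odot>\<^bsub>E i\<^esub> m" using m(2) J(2) E.cg_singleton by blast
      then have "m \<in> B" using m(1) f(3) zJ by (auto simp: B_def simp del: msum.simps)
      then show "\<exists>m\<in>B. \<forall>a\<in>J. cg (E i) {\<zero>\<^bsub>E i\<^esub>} (f a) (a \<odot>\<^bsub>E i\<^esub> m)" using m(2) by blast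
    qed
    have injS: "rel_inj R (II (Suc i)) (E i) ?S {\<zero>\<^bsub>E i\<^esub>}"
      unfolding rel_inj_def
    proof (intro allI impI, elim conjE)
      fix J f assume J: "ideal J R" "II (Suc i) \<subseteq> J" and f: "qhom R (reg_mod R) J (E i) {\<zero>\<^bsub>E i\<^esub>} f"
        "f ` J \<subseteq> ?S" "\<forall>a\<in>II (Suc i). f a \<in> {\<zero>\<^bsub>E i\<^esub>}"
      have f0: "f \<zero> \<in> {\<zero>\<^bsub>E i\<^esub>}" using f(3) ideal_rules(2)[OF Ii(2)] by blast
      have "\<exists>m\<in>carrier (E i). \<forall>x\<in>J. cg (E i) {\<zero>\<^bsub>E i\<^esub>} (f x) (x \<odot>\<^bsub>E i\<^esub> m)"
        by (rule E_inj[unfolded rel_inj_def, rule_format])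
           (use J ideal_rules(2)[OF J(1)] f f0 qhomD(1)[OF f(1)] in auto)
      then obtain m where m: "m \<in> carrier (E i)" "\<forall>a\<in>J. cg (E i) {\<zero>\<^bsub>E i\<^esub>} (f a) (a \<odot>\<^bsub>E i\<^esub> m)" by blast
      have "b \<odot>\<^bsub>E i\<^esub> m = \<zero>\<^bsub>E i\<^esub>" if "b \<in> II (Suc i)" for b
        using m(2) f(3) that J(2) E.cg_singleton by (metis singletonD subsetD)
      then have "m \<in> ?S" unfolding killed_def using m(1) by blast
      then show "\<exists>m\<in>?S. \<forall>a\<in>J. cg (E i) {\<zero>\<^bsub>E i\<^esub>} (f a) (a \<odot>\<^bsub>E i\<^esub> m)" using m(2) by blast
    qed
    show ?thesis
    proof (rule rel_inj_quotient[OF E E noetherian_ring_axioms Ss Q's E'.sub_zero_set _ Ii(2), of TT B])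
      note Sr = E.sub_rules[OF Ss]
      show "{\<zero>\<^bsub>E (Suc i)\<^esub>} \<subseteq> ext_null (Suc i)" using E'.sub_zero[OF Q's] by simp
      show "a \<odot>\<^bsub>E i\<^esub> x = \<zero>\<^bsub>E i\<^esub>" if "a \<in> II (Suc i)" "x \<in> ?S" for a x using that unfolding killed_def by blast
      show "a \<in> ?S \<and> c \<in> ext_null (Suc i)" if "(a, c) \<in> TT" for a c using that SQ[of a] unfolding TTi by blast
      show "(\<zero>\<^bsub>E i\<^esub>, \<zero>\<^bsub>E (Suc i)\<^esub>) \<in> TT" using Sr(2) phi0(1)[of i] unfolding TTi by simp
      show "(a \<oplus>\<^bsub>E i\<^esub> a', c \<oplus>\<^bsub>E (Suc i)\<^esub> c') \<in> TT" if "(a, c) \<in> TT" "(a', c') \<in> TT" for a c a' c'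
        using that Sr(3)[of a a'] phiD(2)[of a i a'] E.sub_carr[OF Ss, of a] E.sub_carr[OF Ss, of a'] unfolding TTi by (simp del: msum.simps)
      show "(r \<odot>\<^bsub>E i\<^esub> a, r \<odot>\<^bsub>E (Suc i)\<^esub> c) \<in> TT" if "r \<in> carrier R" "(a, c) \<in> TT" for r a c
        using that Sr(6)[of r a] phiD(3)[of r a i] E.sub_carr[OF Ss, of a] unfolding TTi by (simp del: msum.simps)
      show "\<exists>c. (a, c) \<in> TT" if "a \<in> ?S" for a using that unfolding TTi by simp
      show "\<exists>a. (a, c) \<in> TT" if "c \<in> ext_null (Suc i)" for c using QS[OF that] unfolding TTi by blast
      show "c \<in> {\<zero>\<^bsub>E (Suc i)\<^esub>}" if "(\<zero>\<^bsub>E i\<^esub>, c) \<in> TT" for c using that phi0(1)[of i] unfolding TTi by simp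
    qed (rule Beq, rule injB, rule injS)
  qed
  show ?thesis unfolding graph_correct_def
  proof (intro conjI allI impI ballI)
    fix u w assume "(u, w) \<in> ext_graph (Suc i)"
    then obtain e w1 w' where e: "u = \<phi> i e" "w = w1 \<oplus>\<^bsub>\<omega>\<^esub> z i \<odot>\<^bsub>\<omega>\<^esub> w'" "e \<in> killed i (II i)"
      "(z i \<odot>\<^bsub>E i\<^esub> e, w1) \<in> ext_graph i" "w' \<in> carrier \<omega>" using TE by blast
    show "w \<in> carrier \<omega>" unfolding e(2) using G(2)[OF e(4)] zc e(5) by simp
    have ec: "e \<in> carrier (E i)" using e(3) killed_carr by blast
    have "z i \<odot>\<^bsub>E (Suc i)\<^esub> u = \<zero>\<^bsub>E (Suc i)\<^esub>"
      using W_D(2)[OF G(1)[OF e(4)]] phiD(3)[OF zc ec] e(1) by (simp add: Z_def)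
    then have "u \<in> killed (Suc i) (II (Suc i))" unfolding K' using phi_killed[OF e(3) Ic(1)] e(1) by simp
    then show "u \<in> W (Suc i)" unfolding W_def using phi_Z[OF ec] e(1) by simp
  next
    fix u w u' w' assume "(u, w) \<in> ext_graph (Suc i)" "(u', w') \<in> ext_graph (Suc i)"
    then obtain e w1 w2 e' w1' w2' where e: "u = \<phi> i e" "w = w1 \<oplus>\<^bsub>\<omega>\<^esub> z i \<odot>\<^bsub>\<omega>\<^esub> w2" "e \<in> killed i (II i)"
      "(z i \<odot>\<^bsub>E i\<^esub> e, w1) \<in> ext_graph i" "w2 \<in> carrier \<omega>"
      and e': "u' = \<phi> i e'" "w' = w1' \<oplus>\<^bsub>\<omega>\<^esub> z i \<odot>\<^bsub>\<omega>\<^esub> w2'" "e' \<in> killed i (II i)"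
      "(z i \<odot>\<^bsub>E i\<^esub> e', w1') \<in> ext_graph i" "w2' \<in> carrier \<omega>" using TE by meson
    have c: "e \<in> carrier (E i)" "e' \<in> carrier (E i)" "w1 \<in> carrier \<omega>" "w1' \<in> carrier \<omega>"
      using e e' killed_carr G(2) by auto
    have "(z i \<odot>\<^bsub>E i\<^esub> (e \<oplus>\<^bsub>E i\<^esub> e'), w1 \<oplus>\<^bsub>\<omega>\<^esub> w1') \<in> ext_graph i"
      using G(3)[OF e(4) e'(4)] c zc by (simp add: E.smult_r_distr)
    from TI[OF killed_add[OF Ic(1) e(3) e'(3)] this, of "w2 \<oplus>\<^bsub>\<omega>\<^esub> w2'"]
    show "(u \<oplus>\<^bsub>E (Suc i)\<^esub> u', w \<oplus>\<^bsub>\<omega>\<^esub> w') \<in> ext_graph (Suc i)"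
      using e(1,2,5) e'(1,2,5) c zc phiD(2)[OF c(1,2)] by (simp add: O.smult_r_distr O.M.a_ac del: ext_graph.simps)
  next
    fix r u w assume r: "r \<in> carrier R" and "(u, w) \<in> ext_graph (Suc i)"
    then obtain e w1 w2 where e: "u = \<phi> i e" "w = w1 \<oplus>\<^bsub>\<omega>\<^esub> z i \<odot>\<^bsub>\<omega>\<^esub> w2" "e \<in> killed i (II i)"
      "(z i \<odot>\<^bsub>E i\<^esub> e, w1) \<in> ext_graph i" "w2 \<in> carrier \<omega>" using TE by meson
    have c: "e \<in> carrier (E i)" "w1 \<in> carrier \<omega>" using e killed_carr G(2) by auto
    have "(z i \<odot>\<^bsub>E i\<^esub> (r \<odot>\<^bsub>E i\<^esub> e), r \<odot>\<^bsub>\<omega>\<^esub> w1) \<in> ext_graph i"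
      using G(4)[OF r e(4)] c zc r by (simp add: E.smult_comm[of r "z i"])
    from TI[OF E.sub_smult[OF killed_sub[OF Ic(1)] r e(3)] this, of "r \<odot>\<^bsub>\<omega>\<^esub> w2"]
    show "(r \<odot>\<^bsub>E (Suc i)\<^esub> u, r \<odot>\<^bsub>\<omega>\<^esub> w) \<in> ext_graph (Suc i)"
      using e(1,2,5) c zc r phiD(3)[OF r c(1)] by (simp add: O.smult_r_distr O.smult_comm[of r "z i"] del: ext_graph.simps)
  next
    fix u assume u: "u \<in> W (Suc i)"
    then have uK: "u \<in> killed (Suc i) (II i)" "z i \<odot>\<^bsub>E (Suc i)\<^esub> u = \<zero>\<^bsub>E (Suc i)\<^esub>"
      using W_D(3)[OF u] K' by blast+
    obtain e where e: "e \<in> killed i (II i)" "\<phi> i e = u"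
      using ext_vanishes_II[of i i] i W_D(2)[OF u] uK(1) unfolding ext_vanishes_def by auto
    have ec: "e \<in> carrier (E i)" using e killed_carr by blast
    have "z i \<odot>\<^bsub>E i\<^esub> e \<in> W i"
      unfolding W_def using E.sub_smult[OF killed_sub[OF Ic(1)] zc e(1)] phiD(3)[OF zc ec] e(2) uK(2) zc ec
      by (simp add: Z_def)
    then obtain w where "(z i \<odot>\<^bsub>E i\<^esub> e, w) \<in> ext_graph i" using G(5) by blast
    from TI[OF e(1) this O.M.zero_closed] show "\<exists>w. (u, w) \<in> ext_graph (Suc i)" using e(2) by blast
  next
    fix w assume w: "w \<in> carrier \<omega>"
    obtain u where u: "(u, w) \<in> ext_graph i" using G(6)[OF w] by blast
    have "u \<in> killed i (colon R (II i) (z i))" using W_D(3)[OF G(1)[OF u]] colon_II[OF i] by simp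
    then obtain e where e: "e \<in> killed i (II i)" "z i \<odot>\<^bsub>E i\<^esub> e = u" using E_divide[OF Ii(1) zc] by blast
    have "(\<phi> i e, w \<oplus>\<^bsub>\<omega>\<^esub> z i \<odot>\<^bsub>\<omega>\<^esub> \<zero>\<^bsub>\<omega>\<^esub>) \<in> ext_graph (Suc i)" by (rule TI) (use e u in auto)
    then show "\<exists>u. (u, w) \<in> ext_graph (Suc i)" using w zc by (auto simp del: ext_graph.simps)
  next
    fix w
    show "((\<zero>\<^bsub>E (Suc i)\<^esub>, w) \<in> ext_graph (Suc i)) = (w \<in> OM (Suc i))"
    proof
      assume "(\<zero>\<^bsub>E (Suc i)\<^esub>, w) \<in> ext_graph (Suc i)"
      then obtain e w1 w2 where e: "\<zero>\<^bsub>E (Suc i)\<^esub> = \<phi> i e" "w = w1 \<oplus>\<^bsub>\<omega>\<^esub> z i \<odot>\<^bsub>\<omega>\<^esub> w2" "e \<in> killed i (II i)"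
        "(z i \<odot>\<^bsub>E i\<^esub> e, w1) \<in> ext_graph i" "w2 \<in> carrier \<omega>" using TE by meson
      have ec: "e \<in> carrier (E i)" using e killed_carr by blast
      have "e \<in> W i" unfolding W_def Z_def using e(1,3) ec by simp
      then obtain v where v: "(e, v) \<in> ext_graph i" using G(5) by blast
      have vc: "v \<in> carrier \<omega>" "w1 \<in> carrier \<omega>" using G(2) v e(4) by auto
      have "(z i \<odot>\<^bsub>E i\<^esub> e \<ominus>\<^bsub>E i\<^esub> z i \<odot>\<^bsub>E i\<^esub> e, w1 \<ominus>\<^bsub>\<omega>\<^esub> z i \<odot>\<^bsub>\<omega>\<^esub> v) \<in> ext_graph i"
        by (rule gm[OF e(4) G(4)[OF zc v]])
      then have o: "w1 \<ominus>\<^bsub>\<omega>\<^esub> z i \<odot>\<^bsub>\<omega>\<^esub> v \<in> OM i" using G(7) zc ec by (simp add: E.minus_self)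
      have "w = (w1 \<ominus>\<^bsub>\<omega>\<^esub> z i \<odot>\<^bsub>\<omega>\<^esub> v) \<oplus>\<^bsub>\<omega>\<^esub> z i \<odot>\<^bsub>\<omega>\<^esub> (v \<oplus>\<^bsub>\<omega>\<^esub> w2)"
      proof -
        have "(w1 \<ominus>\<^bsub>\<omega>\<^esub> z i \<odot>\<^bsub>\<omega>\<^esub> v) \<oplus>\<^bsub>\<omega>\<^esub> z i \<odot>\<^bsub>\<omega>\<^esub> (v \<oplus>\<^bsub>\<omega>\<^esub> w2) =
          ((w1 \<ominus>\<^bsub>\<omega>\<^esub> z i \<odot>\<^bsub>\<omega>\<^esub> v) \<oplus>\<^bsub>\<omega>\<^esub> z i \<odot>\<^bsub>\<omega>\<^esub> v) \<oplus>\<^bsub>\<omega>\<^esub> z i \<odot>\<^bsub>\<omega>\<^esub> w2"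
          using vc e(5) zc by (simp add: O.smult_r_distr O.M.a_assoc)
        then show ?thesis using vc zc e(2) by (simp add: O.add_minus_cancel)
      qed
      then show "w \<in> OM (Suc i)" unfolding msum.simps using o vc e(5) by (intro O.addmI) auto
    next
      assume "w \<in> OM (Suc i)"
      then obtain v x where v: "v \<in> OM i" "x \<in> carrier \<omega>" "w = v \<oplus>\<^bsub>\<omega>\<^esub> z i \<odot>\<^bsub>\<omega>\<^esub> x"
        unfolding msum.simps by (rule O.addmE)
      have "(z i \<odot>\<^bsub>E i\<^esub> \<zero>\<^bsub>E i\<^esub>, v) \<in> ext_graph i" using G(7) v(1) zc by simp
      from TI[OF E.sub_zero[OF killed_sub[OF Ic(1)]] this v(2)]
      show "(\<zero>\<^bsub>E (Suc i)\<^esub>, w) \<in> ext_graph (Suc i)" using v(3) phi0(1)[of i] by (simp del: ext_graph.simps)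
    qed
  qed (rule inj)
qed

text \<open>
  The quotient of \<open>W d\<close> by the cocycles of class zero, both of which are injective over \<open>R/I\<^sub>d\<close>, is
  \<open>\<omega>/I\<^sub>d\<omega>\<close>.
\<close>

theorem omega_reduction_injective: "rel_inj R (II d) \<omega> (carrier \<omega>) (OM d)"
proof -
  interpret E: module R "E d" by (rule E)
  interpret O: module R \<omega> by (rule omega)
  have "graph_correct i" if "i \<le> d" for i using that by (induction i) (auto intro: graph_correct_0 graph_correct_Suc simp del: ext_graph.simps)
  then have g: "graph_correct d" by simp
  note G = graph_correctD[OF g]
  have OMs: "submodule (OM d) R \<omega>" using OM_sub by simp
  have "ext_null d = {a. \<exists>c\<in>OM d. (a, c) \<in> ext_graph d}"
  proof -
    have "(a, \<zero>\<^bsub>\<omega>\<^esub>) \<in> ext_graph d" if c: "c \<in> OM d" "(a, c) \<in> ext_graph d" for a c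
    proof -
      have "(\<zero>\<^bsub>E d\<^esub>, c) \<in> ext_graph d" using c(1) G(7) by blast
      from graph_correct_minus[OF g c(2) this] show ?thesis
        using W_D(1)[OF G(1)[OF c(2)]] G(2)[OF c(2)] by (simp add: E.minus_zero O.minus_self)
    qed
    then show ?thesis unfolding ext_null_def using O.sub_zero[OF OMs] by blast
  qed
  then show ?thesis
    by (intro rel_inj_quotient[OF E omega noetherian_ring_axioms W_sub O.carrier_is_submodule OMs _ II_ideal _ _ _ _ _ _ _ _ _ G(8) rel_inj_W])
       (use G W_D(3) O.sub_carr[OF OMs] O.sub_zero[OF OMs] in \<open>auto simp: killed_def\<close>)
qed

end


section \<open>Lifting surjections along the regular sequence\<close>

text \<open>
  A quotient \<open>R\<^sup>s/K\<close> that is zero or a maximal Cohen-Macaulay module over the ring \<open>R/I\<^sub>r\<close>, where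
  \<open>I\<^sub>r = (z\<^sub>0, \<dots>, z\<^bsub>r-1\<^esub>)\<close>. Working with submodules of \<open>R\<^sup>s\<close> serves \<open>r = 0\<close> and the quotient ring at
  the same time.
\<close>

locale presentation = inj_res R \<mm> z d E \<phi> \<omega> \<epsilon> n
  for R :: "('a, 'm) ring_scheme" (structure) and \<mm> z d and E :: "nat \<Rightarrow> ('a, 'e) module" and \<phi> and \<omega> :: "('a, 'b, 'n) module_scheme"
    and \<epsilon> and n +
  fixes s r :: nat and K :: "(nat \<Rightarrow> 'a) set"
  assumes K: "submodule K R (free_mod R s)"
    and r: "r \<le> d"
    and IK: "b \<in> II r \<Longrightarrow> v \<in> carrier (free_mod R s) \<Longrightarrow> b \<odot>\<^bsub>free_mod R s\<^esub> v \<in> K"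
    and K_dep: "depth_ge (free_mod R s) \<mm> (d - r) K"
begin

abbreviation "F \<equiv> free_mod R s"
abbreviation "N k \<equiv> msum F (\<lambda>j. z (r + j)) K k"

lemma F_mod: "module R F" by (rule free_mod_module)
lemma F_acc: "acc_mod R F" by (rule acc_free_mod[OF noetherian_ring_axioms])

lemma N_sub: "r + k \<le> d \<Longrightarrow> submodule (N k) R F"
  using z_carr by (intro module.msum_sub[OF F_mod K]) auto

lemma N_reg: "r + k < d \<Longrightarrow> reg_on F (z (r + k)) (N k)"
  by (rule msum_regular(2)[OF F_mod F_acc K IK K_dep])

lemma N_II: "r + k \<le> d \<Longrightarrow> b \<in> II (r + k) \<Longrightarrow> v \<in> carrier F \<Longrightarrow> b \<odot>\<^bsub>F\<^esub> v \<in> N k"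
  by (rule II_smult[OF F_mod K IK])

text \<open>
  The homomorphisms \<open>N\<^sub>k/IF \<rightarrow> \<omega>/I\<omega>\<close> with \<open>I = I\<^bsub>r+k\<^esub>\<close>; \<open>N\<^sub>k/IF\<close> is the relation module of \<open>F/N\<^sub>k\<close>
  over \<open>R/I\<close>.
\<close>

definition hom_class :: "nat \<Rightarrow> ((nat \<Rightarrow> 'a) \<Rightarrow> 'b) \<Rightarrow> bool" where
  "hom_class k f \<longleftrightarrow> qhom R F (N k) \<omega> (OM (r + k)) f \<and>
     (\<forall>b\<in>II (r + k). \<forall>v\<in>carrier F. f (b \<odot>\<^bsub>F\<^esub> v) \<in> OM (r + k))"

text \<open>The vanishing of \<open>Ext\<^sup>1(F/N\<^sub>k, \<omega>/I\<omega>)\<close> over \<open>R/I\<close>, where \<open>I = I\<^bsub>r+k\<^esub>\<close>.\<close>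

definition extends :: "nat \<Rightarrow> bool" where
  "extends k \<longleftrightarrow> (\<forall>f. hom_class k f \<longrightarrow>
     (\<exists>w. w \<in> {..<s} \<rightarrow> carrier \<omega> \<and> (\<forall>v\<in>N k. cg \<omega> (OM (r + k)) (f v) (lin \<omega> s v w))))"

lemma hom_classD:
  assumes "hom_class k f"
  shows "qhom R F (N k) \<omega> (OM (r + k)) f"
    "b \<in> II (r + k) \<Longrightarrow> v \<in> carrier F \<Longrightarrow> f (b \<odot>\<^bsub>F\<^esub> v) \<in> OM (r + k)"
  using assms unfolding hom_class_def by blast+

lemma extends_top: "extends (d - r)"
  unfolding extends_def
proof (intro allI impI)
  interpret O: module R \<omega> by (rule omega)
  fix f assume f: "hom_class (d - r) f"
  have d: "r + (d - r) = d" using r by simp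
  note fD = hom_classD[OF f, unfolded d]
  show "\<exists>w. w \<in> {..<s} \<rightarrow> carrier \<omega> \<and> (\<forall>v\<in>N (d - r). cg \<omega> (OM (r + (d - r))) (f v) (lin \<omega> s v w))"
    unfolding d
  proof (rule rel_inj_free[OF omega O.carrier_is_submodule OM_sub[OF order_refl] _ omega_reduction_injective])
    show "submodule (N (d - r)) R F" using N_sub d by simp
    show "a \<odot>\<^bsub>F\<^esub> v \<in> N (d - r)" if "a \<in> II d" "v \<in> carrier F" for a v
      using N_II[of "d - r" a v] that d by simp
    show "II d \<subseteq> carrier R" by (rule II_carr) simp
    show "OM d \<subseteq> carrier \<omega>" using O.sub_carr[OF OM_sub] by blast
    show "f ` N (d - r) \<subseteq> carrier \<omega>" using qhomD(1)[OF fD(1)] by blast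
  qed (use fD in auto)
qed

text \<open>
  As \<open>z\<^bsub>r+k\<^esub>\<close> is regular on \<open>F/N\<^sub>k\<close>, the map \<open>f\<close> induces one on \<open>N\<^sub>k\<^sub>+\<^sub>1 = N\<^sub>k + z\<^bsub>r+k\<^esub>F\<close> with values
  modulo \<open>z\<^bsub>r+k\<^esub>\<omega>\<close>. This extends to \<open>F\<close>, and on \<open>N\<^sub>k\<close> the difference is divisible by \<open>z\<^bsub>r+k\<^esub>\<close>.
\<close>

lemma extends_step_modulo:
  assumes k: "r + k < d" and ext: "extends (Suc k)" and f: "hom_class k f"
  shows "\<exists>g w. hom_class k g \<and> w \<in> {..<s} \<rightarrow> carrier \<omega> \<and>
    (\<forall>v\<in>N k. cg \<omega> (OM (r + k)) (f v) (lin \<omega> s v w \<oplus>\<^bsub>\<omega>\<^esub> z (r + k) \<odot>\<^bsub>\<omega>\<^esub> g v))"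
proof -
  interpret O: module R \<omega> by (rule omega)
  interpret F: module R F by (rule F_mod)
  define i where "i = r + k"
  have i: "i < d" using k by (simp add: i_def)
  define P where "P = OM i"
  define P' where "P' = OM (Suc i)"
  have P: "submodule P R \<omega>" unfolding P_def using OM_sub i by simp
  have P': "submodule P' R \<omega>" unfolding P'_def by (rule OM_sub) (use i in simp)
  have zc: "z i \<in> carrier R" using z_carr[OF i] .
  have P'_eq: "P' = addm \<omega> P (z i)" by (simp add: P'_def P_def)
  have PP': "P \<subseteq> P'" unfolding P'_eq by (rule O.addm_le[OF P zc])
  have zP': "z i \<odot>\<^bsub>\<omega>\<^esub> x \<in> P'" if "x \<in> carrier \<omega>" for x unfolding P'_eq by (rule O.addm_mult[OF P zc that])
  have Preg: "w \<in> P" if "w \<in> carrier \<omega>" "z i \<odot>\<^bsub>\<omega>\<^esub> w \<in> P" for w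
    using OM_reg[OF i] that unfolding reg_on_def P_def by blast
  have Nk: "submodule (N k) R F" using N_sub k by simp
  note Nr = F.sub_rules[OF Nk]
  have Nsuc: "N (Suc k) = addm F (N k) (z i)" by (simp add: i_def)
  have Nreg: "v \<in> N k" if "v \<in> carrier F" "z i \<odot>\<^bsub>F\<^esub> v \<in> N k" for v
    using N_reg[OF k] that unfolding reg_on_def i_def by blast
  note fD = hom_classD[OF f, folded i_def, folded P_def]
  have fc: "f v \<in> carrier \<omega>" if "v \<in> N k" for v by (rule qhomD(1)[OF fD(1) that])
  have zf: "z i \<odot>\<^bsub>\<omega>\<^esub> f v \<in> P'" if "v \<in> N k" for v by (rule zP'[OF fc[OF that]])
  \<comment> \<open>the map that \<open>f\<close> induces on \<open>N (Suc k)\<close>, ignoring the summand from \<open>z F\<close>\<close>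
  define f' where "f' x = f (SOME \<kappa>. \<kappa> \<in> N k \<and> (\<exists>v\<in>carrier F. x = \<kappa> \<oplus>\<^bsub>F\<^esub> z i \<odot>\<^bsub>F\<^esub> v))" for x
  have f': "cg \<omega> P' (f' (\<kappa> \<oplus>\<^bsub>F\<^esub> z i \<odot>\<^bsub>F\<^esub> v)) (f \<kappa>)" if \<kappa>: "\<kappa> \<in> N k" "v \<in> carrier F" for \<kappa> v
  proof -
    define \<kappa>' where "\<kappa>' = (SOME \<kappa>'. \<kappa>' \<in> N k \<and> (\<exists>v'\<in>carrier F. \<kappa> \<oplus>\<^bsub>F\<^esub> z i \<odot>\<^bsub>F\<^esub> v = \<kappa>' \<oplus>\<^bsub>F\<^esub> z i \<odot>\<^bsub>F\<^esub> v'))"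
    have "\<kappa>' \<in> N k \<and> (\<exists>v'\<in>carrier F. \<kappa> \<oplus>\<^bsub>F\<^esub> z i \<odot>\<^bsub>F\<^esub> v = \<kappa>' \<oplus>\<^bsub>F\<^esub> z i \<odot>\<^bsub>F\<^esub> v')"
      unfolding \<kappa>'_def by (rule someI[of _ \<kappa>]) (use \<kappa> in blast)
    then obtain v' where v': "\<kappa>' \<in> N k" "v' \<in> carrier F" "\<kappa> \<oplus>\<^bsub>F\<^esub> z i \<odot>\<^bsub>F\<^esub> v = \<kappa>' \<oplus>\<^bsub>F\<^esub> z i \<odot>\<^bsub>F\<^esub> v'" by blast
    have c: "\<kappa> \<in> carrier F" "\<kappa>' \<in> carrier F" using Nr(1) \<kappa>(1) v'(1) by auto
    have e: "z i \<odot>\<^bsub>F\<^esub> (v \<ominus>\<^bsub>F\<^esub> v') = \<kappa>' \<ominus>\<^bsub>F\<^esub> \<kappa>"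
    proof -
      have "z i \<odot>\<^bsub>F\<^esub> v = (\<kappa>' \<oplus>\<^bsub>F\<^esub> z i \<odot>\<^bsub>F\<^esub> v') \<ominus>\<^bsub>F\<^esub> \<kappa>"
        using c \<kappa>(2) zc by (simp flip: v'(3) add: F.M.a_comm[of \<kappa>] F.add_minus_cancel2)
      moreover have "((\<kappa>' \<oplus>\<^bsub>F\<^esub> z i \<odot>\<^bsub>F\<^esub> v') \<ominus>\<^bsub>F\<^esub> \<kappa>) \<ominus>\<^bsub>F\<^esub> z i \<odot>\<^bsub>F\<^esub> v' = \<kappa>' \<ominus>\<^bsub>F\<^esub> \<kappa>"
        using c v'(2) zc by (simp add: F.M.minus_eq F.M.a_ac F.M.r_neg F.M.r_neg2)
      ultimately show ?thesis using \<kappa>(2) v'(2) zc by (simp add: F.smult_r_minus2)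
    qed
    then have "z i \<odot>\<^bsub>F\<^esub> (v \<ominus>\<^bsub>F\<^esub> v') \<in> N k" using Nr(5)[OF v'(1) \<kappa>(1)] by simp
    then have vN: "v \<ominus>\<^bsub>F\<^esub> v' \<in> N k" using Nreg \<kappa>(2) v'(2) by simp
    have "cg \<omega> P (f (z i \<odot>\<^bsub>F\<^esub> (v \<ominus>\<^bsub>F\<^esub> v'))) (z i \<odot>\<^bsub>\<omega>\<^esub> f (v \<ominus>\<^bsub>F\<^esub> v'))"
      by (rule qhomD(3)[OF fD(1) zc vN])
    moreover have "cg \<omega> P (f (\<kappa>' \<ominus>\<^bsub>F\<^esub> \<kappa>)) (f \<kappa>' \<ominus>\<^bsub>\<omega>\<^esub> f \<kappa>)"
      by (rule qhom_minus[OF F_mod omega Nk P fD(1) v'(1) \<kappa>(1)])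
    ultimately have "cg \<omega> P (f \<kappa>' \<ominus>\<^bsub>\<omega>\<^esub> f \<kappa>) (z i \<odot>\<^bsub>\<omega>\<^esub> f (v \<ominus>\<^bsub>F\<^esub> v'))"
      unfolding e using O.cg_sym[OF P] O.cg_trans[OF P] by blast
    then have "f \<kappa>' \<ominus>\<^bsub>\<omega>\<^esub> f \<kappa> \<in> P'" by (rule O.cg_mem[OF P P' PP' _ zf[OF vN]])
    then show ?thesis using fc v'(1) \<kappa>(1) unfolding f'_def \<kappa>'_def[symmetric] by (simp add: cg_def)
  qed
  have f'0: "cg \<omega> P' (f' \<kappa>) (f \<kappa>)" if "\<kappa> \<in> N k" for \<kappa>
    using f'[OF that F.M.zero_closed] that Nr(1) zc by simp
  have dec: "\<exists>\<kappa> v. \<kappa> \<in> N k \<and> v \<in> carrier F \<and> x = \<kappa> \<oplus>\<^bsub>F\<^esub> z i \<odot>\<^bsub>F\<^esub> v" if "x \<in> N (Suc k)" for x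
    using that unfolding Nsuc addm_def by blast
  have "hom_class (Suc k) f'"
  proof -
    have "qhom R F (N (Suc k)) \<omega> P' f'"
    proof (rule qhomI)
      fix x assume "x \<in> N (Suc k)"
      then show "f' x \<in> carrier \<omega>" using dec[of x] f' unfolding cg_def by metis
    next
      fix x y assume "x \<in> N (Suc k)" "y \<in> N (Suc k)"
      then obtain \<kappa> v \<kappa>' v' where x: "\<kappa> \<in> N k" "v \<in> carrier F" "x = \<kappa> \<oplus>\<^bsub>F\<^esub> z i \<odot>\<^bsub>F\<^esub> v"
        and y: "\<kappa>' \<in> N k" "v' \<in> carrier F" "y = \<kappa>' \<oplus>\<^bsub>F\<^esub> z i \<odot>\<^bsub>F\<^esub> v'" using dec by meson
      have "x \<oplus>\<^bsub>F\<^esub> y = (\<kappa> \<oplus>\<^bsub>F\<^esub> \<kappa>') \<oplus>\<^bsub>F\<^esub> z i \<odot>\<^bsub>F\<^esub> (v \<oplus>\<^bsub>F\<^esub> v')"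
        using x y zc Nr(1) by (simp add: F.smult_r_distr F.M.a_ac)
      then have "cg \<omega> P' (f' (x \<oplus>\<^bsub>F\<^esub> y)) (f (\<kappa> \<oplus>\<^bsub>F\<^esub> \<kappa>'))"
        using f'[OF Nr(3)[OF x(1) y(1)], of "v \<oplus>\<^bsub>F\<^esub> v'"] x(2) y(2) by simp
      moreover have "cg \<omega> P' (f (\<kappa> \<oplus>\<^bsub>F\<^esub> \<kappa>')) (f \<kappa> \<oplus>\<^bsub>\<omega>\<^esub> f \<kappa>')"
        by (rule O.cg_mono[OF PP' qhomD(2)[OF fD(1) x(1) y(1)]])
      moreover have "cg \<omega> P' (f \<kappa> \<oplus>\<^bsub>\<omega>\<^esub> f \<kappa>') (f' x \<oplus>\<^bsub>\<omega>\<^esub> f' y)"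
        using O.cg_add[OF P' O.cg_sym[OF P' f'[OF x(1,2)]] O.cg_sym[OF P' f'[OF y(1,2)]]] x(3) y(3) by simp
      ultimately show "cg \<omega> P' (f' (x \<oplus>\<^bsub>F\<^esub> y)) (f' x \<oplus>\<^bsub>\<omega>\<^esub> f' y)" using O.cg_trans[OF P'] by blast
    next
      fix a x assume a: "a \<in> carrier R" and "x \<in> N (Suc k)"
      then obtain \<kappa> v where x: "\<kappa> \<in> N k" "v \<in> carrier F" "x = \<kappa> \<oplus>\<^bsub>F\<^esub> z i \<odot>\<^bsub>F\<^esub> v" using dec by meson
      have "a \<odot>\<^bsub>F\<^esub> x = (a \<odot>\<^bsub>F\<^esub> \<kappa>) \<oplus>\<^bsub>F\<^esub> z i \<odot>\<^bsub>F\<^esub> (a \<odot>\<^bsub>F\<^esub> v)"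
        using x zc Nr(1) a by (simp add: F.smult_r_distr F.smult_comm[of a "z i"])
      then have "cg \<omega> P' (f' (a \<odot>\<^bsub>F\<^esub> x)) (f (a \<odot>\<^bsub>F\<^esub> \<kappa>))"
        using f'[OF Nr(6)[OF a x(1)], of "a \<odot>\<^bsub>F\<^esub> v"] x(2) a by simp
      moreover have "cg \<omega> P' (f (a \<odot>\<^bsub>F\<^esub> \<kappa>)) (a \<odot>\<^bsub>\<omega>\<^esub> f \<kappa>)"
        by (rule O.cg_mono[OF PP' qhomD(3)[OF fD(1) a x(1)]])
      moreover have "cg \<omega> P' (a \<odot>\<^bsub>\<omega>\<^esub> f \<kappa>) (a \<odot>\<^bsub>\<omega>\<^esub> f' x)"
        using O.cg_smult[OF P' O.cg_sym[OF P' f'[OF x(1,2)]] a] x(3) by simp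
      ultimately show "cg \<omega> P' (f' (a \<odot>\<^bsub>F\<^esub> x)) (a \<odot>\<^bsub>\<omega>\<^esub> f' x)" using O.cg_trans[OF P'] by blast
    qed
    moreover have "f' (b \<odot>\<^bsub>F\<^esub> v) \<in> P'" if b: "b \<in> II (Suc i)" and v: "v \<in> carrier F" for b v
    proof -
      obtain c a where c: "c \<in> II i" "a \<in> carrier R" "b = c \<oplus> z i \<otimes> a" using b by (rule II_SucE)
      have cc: "c \<in> carrier R" using c(1) II_carr[of i] i by auto
      have cN: "c \<odot>\<^bsub>F\<^esub> v \<in> N k" using N_II[of k c v] c(1) v k by (simp add: i_def)
      have e: "b \<odot>\<^bsub>F\<^esub> v = c \<odot>\<^bsub>F\<^esub> v \<oplus>\<^bsub>F\<^esub> z i \<odot>\<^bsub>F\<^esub> (a \<odot>\<^bsub>F\<^esub> v)"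
        unfolding c(3) using cc c(2) zc v by (simp add: F.smult_l_distr F.smult_assoc1)
      have "cg \<omega> P' (f' (b \<odot>\<^bsub>F\<^esub> v)) (f (c \<odot>\<^bsub>F\<^esub> v))"
        unfolding e by (rule f'[OF cN]) (use c(2) v in simp)
      moreover have "f (c \<odot>\<^bsub>F\<^esub> v) \<in> P'" using fD(2)[OF c(1) v] PP' by blast
      ultimately show ?thesis using O.cg_mem[OF P' P' subset_refl] by blast
    qed
    moreover have "r + Suc k = Suc i" by (simp add: i_def)
    ultimately show ?thesis unfolding hom_class_def P'_def by (simp only: ball_simps) blast
  qed
  then obtain w where w: "w \<in> {..<s} \<rightarrow> carrier \<omega>" "\<And>v. v \<in> N (Suc k) \<Longrightarrow> cg \<omega> P' (f' v) (lin \<omega> s v w)"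
    using ext[unfolded extends_def, rule_format, of f'] unfolding P'_def i_def by auto
  note lh = mod_homD[OF O.lin_mod_hom[OF w(1)]]
  have Nle: "v \<in> N (Suc k)" if "v \<in> N k" for v unfolding Nsuc using F.addm_le[OF Nk zc] that by blast
  have "\<exists>x. x \<in> carrier \<omega> \<and> cg \<omega> P (f v) (lin \<omega> s v w \<oplus>\<^bsub>\<omega>\<^esub> z i \<odot>\<^bsub>\<omega>\<^esub> x)" if v: "v \<in> N k" for v
  proof -
    have "cg \<omega> P' (f v) (lin \<omega> s v w)"
      using O.cg_trans[OF P' O.cg_sym[OF P' f'0[OF v]] w(2)[OF Nle[OF v]]] .
    then have m: "f v \<ominus>\<^bsub>\<omega>\<^esub> lin \<omega> s v w \<in> addm \<omega> P (z i)" and lc: "lin \<omega> s v w \<in> carrier \<omega>"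
      by (auto simp: cg_def P'_eq)
    from m obtain p x where px: "p \<in> P" "x \<in> carrier \<omega>" "f v \<ominus>\<^bsub>\<omega>\<^esub> lin \<omega> s v w = p \<oplus>\<^bsub>\<omega>\<^esub> z i \<odot>\<^bsub>\<omega>\<^esub> x"
      by (rule O.addmE)
    have pc: "p \<in> carrier \<omega>" using px(1) O.sub_carr[OF P] by blast
    have "f v = p \<oplus>\<^bsub>\<omega>\<^esub> (lin \<omega> s v w \<oplus>\<^bsub>\<omega>\<^esub> z i \<odot>\<^bsub>\<omega>\<^esub> x)"
      using O.add_minus_cancel[OF fc[OF v] lc] px(2,3) pc lc zc by (simp add: O.M.a_ac)
    then have "f v \<ominus>\<^bsub>\<omega>\<^esub> (lin \<omega> s v w \<oplus>\<^bsub>\<omega>\<^esub> z i \<odot>\<^bsub>\<omega>\<^esub> x) = p"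
      using px(2) pc lc zc by (simp add: O.add_minus_cancel2)
    then show ?thesis using px lc zc fc[OF v] by (auto simp: cg_def)
  qed
  then obtain g where g: "\<And>v. v \<in> N k \<Longrightarrow> g v \<in> carrier \<omega>"
    "\<And>v. v \<in> N k \<Longrightarrow> cg \<omega> P (f v) (lin \<omega> s v w \<oplus>\<^bsub>\<omega>\<^esub> z i \<odot>\<^bsub>\<omega>\<^esub> g v)" by metis
  have lc: "lin \<omega> s v w \<in> carrier \<omega>" if "v \<in> N k" for v using lh(1) Nr(1)[OF that] by simp
  have zg: "cg \<omega> P (f v \<ominus>\<^bsub>\<omega>\<^esub> lin \<omega> s v w) (z i \<odot>\<^bsub>\<omega>\<^esub> g v)" if v: "v \<in> N k" for v
  proof -
    have "(lin \<omega> s v w \<oplus>\<^bsub>\<omega>\<^esub> z i \<odot>\<^bsub>\<omega>\<^esub> g v) \<ominus>\<^bsub>\<omega>\<^esub> lin \<omega> s v w = z i \<odot>\<^bsub>\<omega>\<^esub> g v"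
      using lc[OF v] g(1)[OF v] zc by (simp add: O.M.a_comm[of "lin \<omega> s v w"] O.add_minus_cancel2)
    then show ?thesis using O.cg_minus[OF P g(2)[OF v] O.cg_refl[OF P lc[OF v]]] by simp
  qed
  have cancel: "cg \<omega> P x y" if "x \<in> carrier \<omega>" "y \<in> carrier \<omega>" "cg \<omega> P (z i \<odot>\<^bsub>\<omega>\<^esub> x) (z i \<odot>\<^bsub>\<omega>\<^esub> y)" for x y
    using that Preg[of "x \<ominus>\<^bsub>\<omega>\<^esub> y"] zc by (simp add: cg_def O.smult_r_minus2)
  have "hom_class k g" unfolding hom_class_def i_def[symmetric] P_def[symmetric]
  proof (intro conjI ballI qhomI)
    show "g v \<in> carrier \<omega>" if "v \<in> N k" for v by (rule g(1)[OF that])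
  next
    fix x y assume xy: "x \<in> N k" "y \<in> N k"
    have sN: "x \<oplus>\<^bsub>F\<^esub> y \<in> N k" by (rule Nr(3)[OF xy])
    have c1: "cg \<omega> P (z i \<odot>\<^bsub>\<omega>\<^esub> g (x \<oplus>\<^bsub>F\<^esub> y)) (f (x \<oplus>\<^bsub>F\<^esub> y) \<ominus>\<^bsub>\<omega>\<^esub> lin \<omega> s (x \<oplus>\<^bsub>F\<^esub> y) w)"
      by (rule O.cg_sym[OF P zg[OF sN]])
    have c2: "cg \<omega> P (f (x \<oplus>\<^bsub>F\<^esub> y) \<ominus>\<^bsub>\<omega>\<^esub> lin \<omega> s (x \<oplus>\<^bsub>F\<^esub> y) w)
      ((f x \<oplus>\<^bsub>\<omega>\<^esub> f y) \<ominus>\<^bsub>\<omega>\<^esub> (lin \<omega> s x w \<oplus>\<^bsub>\<omega>\<^esub> lin \<omega> s y w))"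
      using qhomD(2)[OF fD(1) xy] O.cg_refl[OF P, of "lin \<omega> s x w \<oplus>\<^bsub>\<omega>\<^esub> lin \<omega> s y w"] lc xy
        lh(2)[of x y] Nr(1) by (intro O.cg_minus[OF P]) auto
    have c3: "(f x \<oplus>\<^bsub>\<omega>\<^esub> f y) \<ominus>\<^bsub>\<omega>\<^esub> (lin \<omega> s x w \<oplus>\<^bsub>\<omega>\<^esub> lin \<omega> s y w) =
       (f x \<ominus>\<^bsub>\<omega>\<^esub> lin \<omega> s x w) \<oplus>\<^bsub>\<omega>\<^esub> (f y \<ominus>\<^bsub>\<omega>\<^esub> lin \<omega> s y w)"
      using fc lc xy by (simp add: O.M.minus_eq O.M.minus_add O.M.a_ac)
    have c4: "cg \<omega> P ((f x \<ominus>\<^bsub>\<omega>\<^esub> lin \<omega> s x w) \<oplus>\<^bsub>\<omega>\<^esub> (f y \<ominus>\<^bsub>\<omega>\<^esub> lin \<omega> s y w)) (z i \<odot>\<^bsub>\<omega>\<^esub> (g x \<oplus>\<^bsub>\<omega>\<^esub> g y))"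
      using O.cg_add[OF P zg[OF xy(1)] zg[OF xy(2)]] zc g(1) xy by (simp add: O.smult_r_distr)
    have cc: "cg \<omega> P (z i \<odot>\<^bsub>\<omega>\<^esub> g (x \<oplus>\<^bsub>F\<^esub> y)) (z i \<odot>\<^bsub>\<omega>\<^esub> (g x \<oplus>\<^bsub>\<omega>\<^esub> g y))"
      by (rule O.cg_trans[OF P O.cg_trans[OF P c1 c2[unfolded c3]] c4])
    show "cg \<omega> P (g (x \<oplus>\<^bsub>F\<^esub> y)) (g x \<oplus>\<^bsub>\<omega>\<^esub> g y)"
      by (rule cancel[OF g(1)[OF sN] _ cc]) (simp add: g(1)[OF xy(1)] g(1)[OF xy(2)])
  next
    fix a x assume a: "a \<in> carrier R" and x: "x \<in> N k"
    have sN: "a \<odot>\<^bsub>F\<^esub> x \<in> N k" by (rule Nr(6)[OF a x])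
    have c1: "cg \<omega> P (z i \<odot>\<^bsub>\<omega>\<^esub> g (a \<odot>\<^bsub>F\<^esub> x)) (f (a \<odot>\<^bsub>F\<^esub> x) \<ominus>\<^bsub>\<omega>\<^esub> lin \<omega> s (a \<odot>\<^bsub>F\<^esub> x) w)"
      by (rule O.cg_sym[OF P zg[OF sN]])
    have c2: "cg \<omega> P (f (a \<odot>\<^bsub>F\<^esub> x) \<ominus>\<^bsub>\<omega>\<^esub> lin \<omega> s (a \<odot>\<^bsub>F\<^esub> x) w)
      (a \<odot>\<^bsub>\<omega>\<^esub> f x \<ominus>\<^bsub>\<omega>\<^esub> a \<odot>\<^bsub>\<omega>\<^esub> lin \<omega> s x w)"
      using qhomD(3)[OF fD(1) a x] O.cg_refl[OF P, of "a \<odot>\<^bsub>\<omega>\<^esub> lin \<omega> s x w"] lc[OF x] a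
        lh(3)[of a x] Nr(1)[OF x] by (intro O.cg_minus[OF P]) auto
    have c3: "a \<odot>\<^bsub>\<omega>\<^esub> f x \<ominus>\<^bsub>\<omega>\<^esub> a \<odot>\<^bsub>\<omega>\<^esub> lin \<omega> s x w = a \<odot>\<^bsub>\<omega>\<^esub> (f x \<ominus>\<^bsub>\<omega>\<^esub> lin \<omega> s x w)"
      using fc lc x a by (simp add: O.smult_r_minus2)
    have c4: "cg \<omega> P (a \<odot>\<^bsub>\<omega>\<^esub> (f x \<ominus>\<^bsub>\<omega>\<^esub> lin \<omega> s x w)) (z i \<odot>\<^bsub>\<omega>\<^esub> (a \<odot>\<^bsub>\<omega>\<^esub> g x))"
      using O.cg_smult[OF P zg[OF x] a] zc g(1) x a by (simp add: O.smult_comm[of a "z i"])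
    have cc: "cg \<omega> P (z i \<odot>\<^bsub>\<omega>\<^esub> g (a \<odot>\<^bsub>F\<^esub> x)) (z i \<odot>\<^bsub>\<omega>\<^esub> (a \<odot>\<^bsub>\<omega>\<^esub> g x))"
      by (rule O.cg_trans[OF P O.cg_trans[OF P c1 c2[unfolded c3]] c4])
    show "cg \<omega> P (g (a \<odot>\<^bsub>F\<^esub> x)) (a \<odot>\<^bsub>\<omega>\<^esub> g x)"
      by (rule cancel[OF g(1)[OF sN] _ cc]) (simp add: g(1)[OF x] a)
  next
    fix b v assume b: "b \<in> II i" and v: "v \<in> carrier F"
    have bc: "b \<in> carrier R" using b II_carr[of i] i by auto
    have bN: "b \<odot>\<^bsub>F\<^esub> v \<in> N k" using N_II[of k b v] b v k by (simp add: i_def)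
    have "lin \<omega> s (b \<odot>\<^bsub>F\<^esub> v) w \<in> P"
      using lh(3)[OF bc v] OM_smult[OF _ b lh(1)[OF v]] i by (simp add: P_def)
    then have "f (b \<odot>\<^bsub>F\<^esub> v) \<ominus>\<^bsub>\<omega>\<^esub> lin \<omega> s (b \<odot>\<^bsub>F\<^esub> v) w \<in> P" using fD(2)[OF b v] O.sub_minus[OF P] by blast
    then have "z i \<odot>\<^bsub>\<omega>\<^esub> g (b \<odot>\<^bsub>F\<^esub> v) \<in> P" using O.cg_mem[OF P P subset_refl O.cg_sym[OF P zg[OF bN]]] by blast
    then show "g (b \<odot>\<^bsub>F\<^esub> v) \<in> P" using Preg g(1)[OF bN] by blast
  qed
  then show ?thesis using g(2) w(1) unfolding P_def i_def by blast
qed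

text \<open>
  Iterating \<open>extends_step_modulo\<close> approximates \<open>f\<close> by maps that extend. Maps on \<open>N\<^sub>k\<close> are determined
  by their values at finitely many generators, so Nakayama's lemma in a power of \<open>\<omega>\<close> concludes.
\<close>

lemma extends_step:
  assumes k: "r + k < d" and ext: "extends (Suc k)"
  shows "extends k"
  unfolding extends_def
proof (intro allI impI)
  interpret O: module R \<omega> by (rule omega)
  interpret F: module R F by (rule F_mod)
  define P where "P = OM (r + k)"
  have P: "submodule P R \<omega>" unfolding P_def using OM_sub k by simp
  note Pr = O.sub_rules[OF P]
  have Nk: "submodule (N k) R F" using N_sub k by simp
  obtain m \<kappa> where \<kappa>: "\<kappa> \<in> {..<m} \<rightarrow> N k" "N k = {lin F m c \<kappa> | c. c \<in> carrier (free_mod R m)}"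
    using acc_mod_generators[OF F_mod F_acc Nk] by blast
  have \<kappa>F: "\<kappa> \<in> {..<m} \<rightarrow> carrier F" using \<kappa>(1) F.sub_carr[OF Nk] by blast
  have \<kappa>P: "\<kappa> l \<in> {..<s} \<rightarrow> carrier R" "\<kappa> l \<in> N k" "\<kappa> l \<in> carrier F" if "l < m" for l
    using \<kappa>(1) \<kappa>F that free_mod_Pi[of "\<kappa> l" R s] by auto
  let ?A = "pow_mod \<omega> m"
  interpret A: module R ?A by (rule O.pow_mod_module)
  have A_acc: "acc_mod R ?A" by (rule acc_mod_pow[OF omega omega_acc])
  define B where "B = {u \<in> carrier ?A. \<exists>w. w \<in> {..<s} \<rightarrow> carrier \<omega> \<and> (\<forall>l<m. cg \<omega> P (u l) (lin \<omega> s (\<kappa> l) w))}"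
  have B: "submodule B R ?A"
  proof (rule A.subI)
    show "B \<subseteq> carrier ?A" by (auto simp: B_def)
    have "lin \<omega> s (\<kappa> l) (\<lambda>_. \<zero>\<^bsub>\<omega>\<^esub>) = \<zero>\<^bsub>\<omega>\<^esub>" if "l < m" for l
      using O.lin_in_sub[OF O.sub_zero_set \<kappa>P(1)[OF that], of "\<lambda>_. \<zero>\<^bsub>\<omega>\<^esub>"] by simp
    then show "\<zero>\<^bsub>?A\<^esub> \<in> B" unfolding B_def using A.M.zero_closed
      by (intro CollectI conjI exI[of _ "\<lambda>_. \<zero>\<^bsub>\<omega>\<^esub>"]) (auto simp: pow_mod_def O.cg_refl[OF P])
  next
    fix a b assume "a \<in> B" "b \<in> B"
    then obtain w w' where w: "a \<in> carrier ?A" "w \<in> {..<s} \<rightarrow> carrier \<omega>" "\<forall>l<m. cg \<omega> P (a l) (lin \<omega> s (\<kappa> l) w)"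
      "b \<in> carrier ?A" "w' \<in> {..<s} \<rightarrow> carrier \<omega>" "\<forall>l<m. cg \<omega> P (b l) (lin \<omega> s (\<kappa> l) w')"
      unfolding B_def by blast
    have "cg \<omega> P ((a \<oplus>\<^bsub>?A\<^esub> b) l) (lin \<omega> s (\<kappa> l) (\<lambda>i. w i \<oplus>\<^bsub>\<omega>\<^esub> w' i))" if "l < m" for l
    proof -
      have "lin \<omega> s (\<kappa> l) (\<lambda>i. w i \<oplus>\<^bsub>\<omega>\<^esub> w' i) = lin \<omega> s (\<kappa> l) w \<oplus>\<^bsub>\<omega>\<^esub> lin \<omega> s (\<kappa> l) w'"
        by (rule O.lin_add_r[OF \<kappa>P(1)[OF that] w(2,5)]) simp
      then show ?thesis using O.cg_add[OF P] w(3,6) that by (simp add: pow_mod_def)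
    qed
    then show "a \<oplus>\<^bsub>?A\<^esub> b \<in> B" unfolding B_def using w A.add.m_closed[OF w(1,4)]
      by (intro CollectI conjI exI[of _ "\<lambda>i. w i \<oplus>\<^bsub>\<omega>\<^esub> w' i"]) auto
  next
    fix c a assume c: "c \<in> carrier R" and "a \<in> B"
    then obtain w where w: "a \<in> carrier ?A" "w \<in> {..<s} \<rightarrow> carrier \<omega>" "\<forall>l<m. cg \<omega> P (a l) (lin \<omega> s (\<kappa> l) w)"
      unfolding B_def by blast
    have "cg \<omega> P ((c \<odot>\<^bsub>?A\<^esub> a) l) (lin \<omega> s (\<kappa> l) (\<lambda>i. c \<odot>\<^bsub>\<omega>\<^esub> w i))" if "l < m" for l
    proof -
      have "lin \<omega> s (\<kappa> l) (\<lambda>i. c \<odot>\<^bsub>\<omega>\<^esub> w i) = c \<odot>\<^bsub>\<omega>\<^esub> lin \<omega> s (\<kappa> l) w"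
        by (rule O.lin_smult_r[OF \<kappa>P(1)[OF that] w(2) c]) simp
      then show ?thesis using O.cg_smult[OF P _ c] w(3) that by (simp add: pow_mod_def)
    qed
    then show "c \<odot>\<^bsub>?A\<^esub> a \<in> B" unfolding B_def using w c A.smult_closed[OF c w(1)]
      by (intro CollectI conjI exI[of _ "\<lambda>i. c \<odot>\<^bsub>\<omega>\<^esub> w i"]) auto
  qed
  fix f assume f: "hom_class k f"
  have "\<forall>f. \<exists>g. hom_class k f \<longrightarrow> hom_class k g \<and> (\<exists>w. w \<in> {..<s} \<rightarrow> carrier \<omega> \<and>
    (\<forall>v\<in>N k. cg \<omega> P (f v) (lin \<omega> s v w \<oplus>\<^bsub>\<omega>\<^esub> z (r + k) \<odot>\<^bsub>\<omega>\<^esub> g v)))"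
    using extends_step_modulo[OF k ext] unfolding P_def by blast
  then obtain nxt where nx: "\<And>f. hom_class k f \<Longrightarrow> hom_class k (nxt f)"
    "\<And>f. hom_class k f \<Longrightarrow> \<exists>w. w \<in> {..<s} \<rightarrow> carrier \<omega> \<and>
      (\<forall>v\<in>N k. cg \<omega> P (f v) (lin \<omega> s v w \<oplus>\<^bsub>\<omega>\<^esub> z (r + k) \<odot>\<^bsub>\<omega>\<^esub> nxt f v))" by metis
  define fs where "fs j = (nxt ^^ j) f" for j
  have fs: "hom_class k (fs j)" for j by (induction j) (simp_all add: fs_def f nx(1))
  have fsS: "fs (Suc j) = nxt (fs j)" for j by (simp add: fs_def)
  have fsc: "fs j v \<in> carrier \<omega>" if "v \<in> N k" for j v using qhomD(1)[OF hom_classD(1)[OF fs] that] .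
  define u where "u j = (\<lambda>l\<in>{..<m}. fs j (\<kappa> l))" for j
  have "u 0 \<in> B"
  proof (rule nakayama_sequence[OF A.module_axioms A_acc B z_mm[OF k]])
    show u: "u j \<in> carrier ?A" for j unfolding u_def pow_mod_def using fsc \<kappa>P(2) by auto
    fix j
    obtain w where w: "w \<in> {..<s} \<rightarrow> carrier \<omega>"
      "\<And>v. v \<in> N k \<Longrightarrow> cg \<omega> P (fs j v) (lin \<omega> s v w \<oplus>\<^bsub>\<omega>\<^esub> z (r + k) \<odot>\<^bsub>\<omega>\<^esub> fs (Suc j) v)"
      using nx(2)[OF fs[of j]] unfolding fsS by blast
    let ?v = "u j \<ominus>\<^bsub>?A\<^esub> z (r + k) \<odot>\<^bsub>?A\<^esub> u (Suc j)"
    have zk: "z (r + k) \<in> carrier R" using z_carr[OF k] .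
    have "cg \<omega> P (?v l) (lin \<omega> s (\<kappa> l) w)" if l: "l < m" for l
    proof -
      let ?x = "z (r + k) \<odot>\<^bsub>\<omega>\<^esub> fs (Suc j) (\<kappa> l)"
      have xc: "?x \<in> carrier \<omega>" using zk fsc[OF \<kappa>P(2)[OF l]] by simp
      have "(?v \<oplus>\<^bsub>?A\<^esub> z (r + k) \<odot>\<^bsub>?A\<^esub> u (Suc j)) l = u j l"
        using A.add_minus_cancel[OF u A.smult_closed[OF zk u], of j "Suc j"] by simp
      then have "?v l \<oplus>\<^bsub>\<omega>\<^esub> ?x = fs j (\<kappa> l)" using l by (simp add: pow_mod_def u_def)
      moreover have vc: "?v l \<in> carrier \<omega>"
      proof -
        have "?v \<in> carrier ?A" by (rule A.M.minus_closed[OF u A.smult_closed[OF zk u]])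
        then show ?thesis using l by (auto simp: pow_mod_def)
      qed
      ultimately have "?v l = fs j (\<kappa> l) \<ominus>\<^bsub>\<omega>\<^esub> ?x" using xc O.add_minus_cancel2 by metis
      moreover have lc: "lin \<omega> s (\<kappa> l) w \<in> carrier \<omega>" by (rule O.lin_closed[OF \<kappa>P(1)[OF l] w(1)])
      ultimately show ?thesis
        using O.cg_minus[OF P w(2)[OF \<kappa>P(2)[OF l]] O.cg_refl[OF P xc]] xc by (simp add: O.add_minus_cancel2)
    qed
    then show "?v \<in> B" unfolding B_def using w(1) A.M.minus_closed[OF u A.smult_closed[OF zk u]] by blast
  qed
  then obtain w where w: "w \<in> {..<s} \<rightarrow> carrier \<omega>" "\<And>l. l < m \<Longrightarrow> cg \<omega> P (f (\<kappa> l)) (lin \<omega> s (\<kappa> l) w)"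
    unfolding B_def u_def fs_def by auto
  have "cg \<omega> P (f v) (lin \<omega> s v w)" if v: "v \<in> N k" for v
  proof -
    obtain c where c: "c \<in> carrier (free_mod R m)" "v = lin F m c \<kappa>" using v \<kappa>(2) by blast
    have cP: "c \<in> {..<m} \<rightarrow> carrier R" by (rule free_mod_Pi[OF c(1)])
    have fk: "(\<lambda>l. f (\<kappa> l)) \<in> {..<m} \<rightarrow> carrier \<omega>" "(\<lambda>l. lin \<omega> s (\<kappa> l) w) \<in> {..<m} \<rightarrow> carrier \<omega>"
      using w(2) by (auto simp: cg_def)
    have c1: "cg \<omega> P (f v) (lin \<omega> m c (\<lambda>l. f (\<kappa> l)))"
      unfolding c(2) P_def by (rule qhom_lin[OF F_mod omega Nk _ hom_classD(1)[OF f] cP \<kappa>(1)]) (use P P_def in simp)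
    have c2: "cg \<omega> P (lin \<omega> m c (\<lambda>l. f (\<kappa> l))) (lin \<omega> m c (\<lambda>l. lin \<omega> s (\<kappa> l) w))"
    proof -
      have "lin \<omega> m c (\<lambda>l. f (\<kappa> l) \<ominus>\<^bsub>\<omega>\<^esub> lin \<omega> s (\<kappa> l) w) \<in> P"
        using w(2) by (intro O.lin_in_sub[OF P cP]) (auto simp: cg_def)
      then show ?thesis using O.lin_minus_r[OF cP fk, of "\<lambda>l. f (\<kappa> l) \<ominus>\<^bsub>\<omega>\<^esub> lin \<omega> s (\<kappa> l) w"]
        O.lin_closed[OF cP fk(1)] O.lin_closed[OF cP fk(2)] by (simp add: cg_def)
    qed
    have c3: "lin \<omega> m c (\<lambda>l. lin \<omega> s (\<kappa> l) w) = lin \<omega> s v w"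
      unfolding c(2) by (rule mod_hom_lin[OF F_mod omega O.lin_mod_hom[OF w(1)] cP \<kappa>F, symmetric])
    show ?thesis by (rule O.cg_trans[OF P c1 c2[unfolded c3]])
  qed
  then show "\<exists>w. w \<in> {..<s} \<rightarrow> carrier \<omega> \<and> (\<forall>v\<in>N k. cg \<omega> (OM (r + k)) (f v) (lin \<omega> s v w))"
    using w(1) unfolding P_def by blast
qed

lemma extends_all: "r + k \<le> d \<Longrightarrow> extends k"
proof (induction "d - (r + k)" arbitrary: k)
  case 0
  then have "k = d - r" using r by simp
  then show ?case using extends_top by simp
next
  case (Suc x)
  show ?case
  proof (rule extends_step)
    show "r + k < d" using Suc.hyps(2) by simp
    show "extends (Suc k)" by (rule Suc.hyps(1)) (use Suc.hyps(2) in auto)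
  qed
qed

lemma hom_OM:
  assumes h: "h \<in> mod_hom R \<omega> (reg_mod R)" and "i \<le> d" "x \<in> OM i"
  shows "h x \<in> II i"
  using assms(2,3)
proof (induction i arbitrary: x)
  case 0
  then show ?case using mod_hom_zero_minus(1)[OF omega reg_mod_module h] by simp
next
  case (Suc i)
  interpret O: module R \<omega> by (rule omega)
  obtain p y where py: "p \<in> OM i" "y \<in> carrier \<omega>" "x = p \<oplus>\<^bsub>\<omega>\<^esub> z i \<odot>\<^bsub>\<omega>\<^esub> y"
    using Suc.prems(2) unfolding msum.simps by (rule O.addmE)
  have pc: "p \<in> carrier \<omega>" using O.sub_carr[OF OM_sub[of i]] py(1) Suc.prems(1) by simp
  have zc: "z i \<in> carrier R" using z_carr[of i] Suc.prems(1) by simp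
  have hx: "h x = h p \<oplus>\<^bsub>reg_mod R\<^esub> z i \<odot>\<^bsub>reg_mod R\<^esub> h y"
    unfolding py(3) using mod_homD[OF h] pc py(2) zc by simp
  have hp: "h p \<in> II i" using Suc py(1) by simp
  show ?case unfolding msum.simps
    by (rule module.addmI[OF reg_mod_module hp _ hx]) (use mod_homD(1)[OF h py(2)] in simp)
qed

text \<open>
  A homomorphism \<open>F/N\<^sub>k\<^sub>+\<^sub>1 \<rightarrow> R/I\<^sub>i\<^sub>+\<^sub>1\<close>, where \<open>i = r + k\<close>, is on \<open>N\<^sub>k\<close> of the form \<open>z\<^sub>i c\<close>
  modulo \<open>I\<^sub>i\<close>. Since \<open>z\<^sub>i\<close> lies in the trace of \<open>\<omega>\<close>, it is a combination of values \<open>h(w)\<close> of maps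
  \<open>h : \<omega> \<rightarrow> \<mm>\<close>. Each \<open>c w\<close> extends to \<open>F \<rightarrow> \<omega>\<close> modulo \<open>I\<^sub>i\<omega>\<close>, and subtracting the images under the
  \<open>h\<close> yields a map that vanishes on \<open>N\<^sub>k\<close> modulo \<open>I\<^sub>i\<close> and agrees with the given one modulo \<open>\<mm>\<close>.
\<close>

lemma lift_surjection_step:
  assumes tr: "\<mm> \<subseteq> trace_ideal R \<omega>" and k: "r + k < d"
    and l: "l \<in> mod_hom R F (reg_mod R)" "\<And>v. v \<in> N (Suc k) \<Longrightarrow> l v \<in> II (r + Suc k)"
    and v0: "v0 \<in> carrier F" "l v0 \<notin> \<mm>"
  shows "\<exists>l'\<in>mod_hom R F (reg_mod R). (\<forall>v\<in>N k. l' v \<in> II (r + k)) \<and> l' v0 \<notin> \<mm>"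
proof -
  interpret O: module R \<omega> by (rule omega)
  interpret F: module R F by (rule F_mod)
  interpret G: module R "reg_mod R" by (rule reg_mod_module)
  define i where "i = r + k"
  have i: "i < d" using k by (simp add: i_def)
  define zz where "zz = z i"
  have zc: "zz \<in> carrier R" "zz \<in> \<mm>" using z_carr[OF i] z_mm[OF i] by (auto simp: zz_def)
  have Ii: "ideal (II i) R" using II_ideal i by simp
  note Ir = ideal_rules[OF Ii] and mr = ideal_rules[OF ideal_mm]
  have Is: "submodule (II i) R (reg_mod R)" using Ii by (simp add: submodule_reg_iff)
  have Nk: "submodule (N k) R F" using N_sub k by simp
  note Nr = F.sub_rules[OF Nk] and lD = mod_homD[OF l(1)]
  have Nle: "v \<in> N (Suc k)" if "v \<in> N k" for v
    using F.addm_le[OF Nk z_carr[OF k]] that by auto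
  have "\<forall>v\<in>N k. \<exists>c. c \<in> carrier R \<and> (\<exists>b\<in>II i. l v = b \<oplus> zz \<otimes> c)"
  proof
    fix v assume "v \<in> N k"
    then have "l v \<in> II (Suc i)" using l(2)[OF Nle] by (simp add: i_def)
    then show "\<exists>c. c \<in> carrier R \<and> (\<exists>b\<in>II i. l v = b \<oplus> zz \<otimes> c)" unfolding zz_def by (metis II_SucE)
  qed
  then obtain c where c: "\<And>v. v \<in> N k \<Longrightarrow> c v \<in> carrier R" "\<And>v. v \<in> N k \<Longrightarrow> \<exists>b\<in>II i. l v = b \<oplus> zz \<otimes> c v" by metis
  let ?cg = "cg (reg_mod R) (II i)"
  have lz: "?cg (l v) (zz \<otimes> c v)" if v: "v \<in> N k" for v
  proof -
    obtain b where b: "b \<in> II i" "l v = b \<oplus> zz \<otimes> c v" using c(2)[OF v] by blast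
    have "l v \<ominus>\<^bsub>reg_mod R\<^esub> zz \<otimes> c v = b"
      unfolding b(2) using G.add_minus_cancel2[of b "zz \<otimes> c v"] b(1) Ir(1) zc c(1)[OF v] by simp
    then show ?thesis using b(1) lD(1)[OF Nr(1)[OF v]] zc c(1)[OF v] by (simp add: cg_def)
  qed
  have cancel: "?cg x y" if "x \<in> carrier R" "y \<in> carrier R" "?cg (zz \<otimes> x) (zz \<otimes> y)" for x y
  proof -
    have "zz \<otimes> (x \<ominus>\<^bsub>reg_mod R\<^esub> y) \<in> II i"
      using that(3) G.smult_r_minus2[of zz x y] that(1,2) zc by (simp add: cg_def)
    then have "x \<ominus>\<^bsub>reg_mod R\<^esub> y \<in> II i"
      using z_reg[OF i] G.M.minus_closed[of x y] that(1,2) unfolding reg_on_def zz_def by simp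
    then show ?thesis using that by (simp add: cg_def)
  qed
  have cq: "qhom R F (N k) (reg_mod R) (II i) c"
  proof (rule qhomI)
    show "c v \<in> carrier (reg_mod R)" if "v \<in> N k" for v using c(1)[OF that] by simp
  next
    fix x y assume xy: "x \<in> N k" "y \<in> N k"
    have sN: "x \<oplus>\<^bsub>F\<^esub> y \<in> N k" by (rule Nr(3)[OF xy])
    have "?cg (zz \<otimes> c (x \<oplus>\<^bsub>F\<^esub> y)) (l (x \<oplus>\<^bsub>F\<^esub> y))" by (rule G.cg_sym[OF Is lz[OF sN]])
    moreover have "?cg (l (x \<oplus>\<^bsub>F\<^esub> y)) (zz \<otimes> (c x \<oplus> c y))"
      using G.cg_add[OF Is lz[OF xy(1)] lz[OF xy(2)]] lD(2)[OF Nr(1) Nr(1), OF xy] c(1) xy zc by (simp add: r_distr)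
    ultimately have "?cg (zz \<otimes> c (x \<oplus>\<^bsub>F\<^esub> y)) (zz \<otimes> (c x \<oplus> c y))" by (rule G.cg_trans[OF Is])
    then show "?cg (c (x \<oplus>\<^bsub>F\<^esub> y)) (c x \<oplus>\<^bsub>reg_mod R\<^esub> c y)" using c(1) sN xy by (simp add: cancel)
  next
    fix a x assume a: "a \<in> carrier R" and x: "x \<in> N k"
    have sN: "a \<odot>\<^bsub>F\<^esub> x \<in> N k" by (rule Nr(6)[OF a x])
    have "?cg (zz \<otimes> c (a \<odot>\<^bsub>F\<^esub> x)) (l (a \<odot>\<^bsub>F\<^esub> x))" by (rule G.cg_sym[OF Is lz[OF sN]])
    moreover have "?cg (l (a \<odot>\<^bsub>F\<^esub> x)) (zz \<otimes> (a \<otimes> c x))"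
      using G.cg_smult[OF Is lz[OF x] a] lD(3)[OF a Nr(1)[OF x]] c(1)[OF x] a zc by (simp add: m_lcomm)
    ultimately have "?cg (zz \<otimes> c (a \<odot>\<^bsub>F\<^esub> x)) (zz \<otimes> (a \<otimes> c x))" by (rule G.cg_trans[OF Is])
    then show "?cg (c (a \<odot>\<^bsub>F\<^esub> x)) (a \<odot>\<^bsub>reg_mod R\<^esub> c x)" using c(1) sN x a by (simp add: cancel)
  qed
  have cI: "c (b \<odot>\<^bsub>F\<^esub> v) \<in> II i" if b: "b \<in> II i" and v: "v \<in> carrier F" for b v
  proof -
    have bN: "b \<odot>\<^bsub>F\<^esub> v \<in> N k" using N_II[of k b v] b v k by (simp add: i_def)
    have "l (b \<odot>\<^bsub>F\<^esub> v) \<in> II i" using lD(3)[OF Ir(1)[OF b] v] lD(1)[OF v] b Ir(7) by simp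
    then have "zz \<otimes> c (b \<odot>\<^bsub>F\<^esub> v) \<in> II i" using G.cg_mem[OF Is Is subset_refl G.cg_sym[OF Is lz[OF bN]]] by blast
    then show ?thesis using z_reg[OF i] c(1)[OF bN] unfolding reg_on_def zz_def by simp
  qed
  \<comment> \<open>the ideal of those \<open>a\<close> for which \<open>a c\<close> extends to a map \<open>F \<rightarrow> \<mm>\<close> modulo \<open>I\<^sub>i\<close>\<close>
  define D where "D = {a \<in> carrier R. \<exists>\<mu>\<in>mod_hom R F (reg_mod R). (\<forall>v\<in>carrier F. \<mu> v \<in> \<mm>) \<and>
     (\<forall>v\<in>N k. ?cg (a \<otimes> c v) (\<mu> v))}"
  have D: "ideal D R"
  proof (rule idealI_ring)
    show "D \<subseteq> carrier R" by (auto simp: D_def)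
    have "(\<lambda>_. \<zero>) \<in> mod_hom R F (reg_mod R)" by (rule mod_homI) auto
    moreover have "?cg (\<zero> \<otimes> c v) \<zero>" if "v \<in> N k" for v
      using G.cg_refl[OF Is, of \<zero>] c(1)[OF that] by simp
    ultimately show "\<zero> \<in> D" unfolding D_def using mr(2) by (intro CollectI conjI bexI[of _ "\<lambda>_. \<zero>"]) auto
  next
    fix a b assume "a \<in> D" "b \<in> D"
    then obtain \<mu> \<nu> where \<mu>: "a \<in> carrier R" "\<mu> \<in> mod_hom R F (reg_mod R)" "\<forall>v\<in>carrier F. \<mu> v \<in> \<mm>"
      "\<forall>v\<in>N k. ?cg (a \<otimes> c v) (\<mu> v)" and \<nu>: "b \<in> carrier R" "\<nu> \<in> mod_hom R F (reg_mod R)"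
      "\<forall>v\<in>carrier F. \<nu> v \<in> \<mm>" "\<forall>v\<in>N k. ?cg (b \<otimes> c v) (\<nu> v)" unfolding D_def by blast
    note \<mu>D = mod_homD[OF \<mu>(2)] and \<nu>D = mod_homD[OF \<nu>(2)]
    have "(\<lambda>v. \<mu> v \<oplus> \<nu> v) \<in> mod_hom R F (reg_mod R)"
    proof (rule mod_homI)
      fix x y assume "x \<in> carrier F" "y \<in> carrier F"
      then show "\<mu> (x \<oplus>\<^bsub>F\<^esub> y) \<oplus> \<nu> (x \<oplus>\<^bsub>F\<^esub> y) = (\<mu> x \<oplus> \<nu> x) \<oplus>\<^bsub>reg_mod R\<^esub> (\<mu> y \<oplus> \<nu> y)"
        using \<mu>D(1,2) \<nu>D(1,2) by (simp add: a_ac)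
    next
      fix a x assume "a \<in> carrier R" "x \<in> carrier F"
      then show "\<mu> (a \<odot>\<^bsub>F\<^esub> x) \<oplus> \<nu> (a \<odot>\<^bsub>F\<^esub> x) = a \<odot>\<^bsub>reg_mod R\<^esub> (\<mu> x \<oplus> \<nu> x)"
        using \<mu>D(1,3) \<nu>D(1,3) by (simp add: r_distr)
    qed (use \<mu>D(1) \<nu>D(1) in simp)
    moreover have "?cg ((a \<oplus> b) \<otimes> c v) (\<mu> v \<oplus> \<nu> v)" if v: "v \<in> N k" for v
      using G.cg_add[OF Is \<mu>(4)[rule_format, OF v] \<nu>(4)[rule_format, OF v]] c(1)[OF v] \<mu>(1) \<nu>(1) by (simp add: l_distr)
    ultimately show "a \<oplus> b \<in> D" unfolding D_def using \<mu> \<nu> mr(3)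
      by (intro CollectI conjI bexI[of _ "\<lambda>v. \<mu> v \<oplus> \<nu> v"]) auto
  next
    fix t a assume t: "t \<in> carrier R" and "a \<in> D"
    then obtain \<mu> where \<mu>: "a \<in> carrier R" "\<mu> \<in> mod_hom R F (reg_mod R)" "\<forall>v\<in>carrier F. \<mu> v \<in> \<mm>"
      "\<forall>v\<in>N k. ?cg (a \<otimes> c v) (\<mu> v)" unfolding D_def by blast
    note \<mu>D = mod_homD[OF \<mu>(2)]
    have "(\<lambda>v. t \<otimes> \<mu> v) \<in> mod_hom R F (reg_mod R)"
      by (rule mod_homI) (use \<mu>D t in \<open>simp_all add: r_distr m_lcomm\<close>)
    moreover have "?cg ((t \<otimes> a) \<otimes> c v) (t \<otimes> \<mu> v)" if v: "v \<in> N k" for v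
      using G.cg_smult[OF Is \<mu>(4)[rule_format, OF v] t] c(1)[OF v] \<mu>(1) t by (simp add: m_assoc)
    ultimately show "t \<otimes> a \<in> D" unfolding D_def using \<mu> t mr(6)
      by (intro CollectI conjI bexI[of _ "\<lambda>v. t \<otimes> \<mu> v"]) auto
  qed
  have hD: "h w \<in> D" if h: "h \<in> mod_hom R \<omega> (reg_mod R)" "\<And>x. x \<in> carrier \<omega> \<Longrightarrow> h x \<in> \<mm>" and w: "w \<in> carrier \<omega>" for h w
  proof -
    note h' = mod_homD[OF h(1)]
    have OMs: "submodule (OM i) R \<omega>" using OM_sub i by simp
    have sm: "cg \<omega> (OM i) (x \<odot>\<^bsub>\<omega>\<^esub> w) (y \<odot>\<^bsub>\<omega>\<^esub> w)" if xy: "?cg x y" for x y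
    proof -
      have x: "x \<in> carrier R" "y \<in> carrier R" "x \<ominus> y \<in> II i" using xy by (auto simp: cg_def reg_mod_minus)
      have "(x \<ominus> y) \<odot>\<^bsub>\<omega>\<^esub> w \<in> OM i" using OM_smult[OF _ x(3) w] i by simp
      then show ?thesis using x(1,2) w by (simp add: cg_def O.smult_l_minus2)
    qed
    have "hom_class k (\<lambda>v. c v \<odot>\<^bsub>\<omega>\<^esub> w)" unfolding hom_class_def i_def[symmetric]
    proof (intro conjI ballI qhomI)
      show "c v \<odot>\<^bsub>\<omega>\<^esub> w \<in> carrier \<omega>" if "v \<in> N k" for v using c(1)[OF that] w by simp
    next
      fix x y assume xy: "x \<in> N k" "y \<in> N k"
      show "cg \<omega> (OM i) (c (x \<oplus>\<^bsub>F\<^esub> y) \<odot>\<^bsub>\<omega>\<^esub> w) (c x \<odot>\<^bsub>\<omega>\<^esub> w \<oplus>\<^bsub>\<omega>\<^esub> c y \<odot>\<^bsub>\<omega>\<^esub> w)"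
        using sm[OF qhomD(2)[OF cq xy]] c(1) xy w by (simp add: O.smult_l_distr)
    next
      fix a x assume ax: "a \<in> carrier R" "x \<in> N k"
      show "cg \<omega> (OM i) (c (a \<odot>\<^bsub>F\<^esub> x) \<odot>\<^bsub>\<omega>\<^esub> w) (a \<odot>\<^bsub>\<omega>\<^esub> (c x \<odot>\<^bsub>\<omega>\<^esub> w))"
        using sm[OF qhomD(3)[OF cq ax]] c(1) ax w by (simp add: O.smult_assoc1)
    next
      fix b v assume "b \<in> II i" "v \<in> carrier F"
      then show "c (b \<odot>\<^bsub>F\<^esub> v) \<odot>\<^bsub>\<omega>\<^esub> w \<in> OM i" using OM_smult[OF _ cI w] i by simp
    qed
    then obtain y where y: "y \<in> {..<s} \<rightarrow> carrier \<omega>" "\<And>v. v \<in> N k \<Longrightarrow> cg \<omega> (OM i) (c v \<odot>\<^bsub>\<omega>\<^esub> w) (lin \<omega> s v y)"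
      using extends_all[of k, unfolded extends_def, rule_format] k unfolding i_def by (metis less_imp_le)
    note yh = mod_homD[OF O.lin_mod_hom[OF y(1)]]
    let ?\<mu> = "\<lambda>v. h (lin \<omega> s v y)"
    have "?\<mu> \<in> mod_hom R F (reg_mod R)"
      by (rule mod_homI) (use h' yh in simp_all)
    moreover have "\<forall>v\<in>carrier F. ?\<mu> v \<in> \<mm>" using h(2) yh(1) by blast
    moreover have "?cg (h w \<otimes> c v) (?\<mu> v)" if v: "v \<in> N k" for v
    proof -
      have cgv: "cg \<omega> (OM i) (c v \<odot>\<^bsub>\<omega>\<^esub> w) (lin \<omega> s v y)" by (rule y(2)[OF v])
      then have cc: "c v \<odot>\<^bsub>\<omega>\<^esub> w \<in> carrier \<omega>" "lin \<omega> s v y \<in> carrier \<omega>"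
        "(c v \<odot>\<^bsub>\<omega>\<^esub> w) \<ominus>\<^bsub>\<omega>\<^esub> lin \<omega> s v y \<in> OM i" by (auto simp: cg_def)
      have "h ((c v \<odot>\<^bsub>\<omega>\<^esub> w) \<ominus>\<^bsub>\<omega>\<^esub> lin \<omega> s v y) \<in> II i" using hom_OM[OF h(1) _ cc(3)] i by simp
      then have "?cg (h (c v \<odot>\<^bsub>\<omega>\<^esub> w)) (?\<mu> v)"
        using mod_hom_zero_minus(3)[OF omega G.module_axioms h(1) cc(1,2)] h'(1)[OF cc(1)] h'(1)[OF cc(2)]
        by (simp add: cg_def)
      then show ?thesis using h'(3)[OF c(1)[OF v] w] h'(1)[OF w] c(1)[OF v] by (simp add: m_comm)
    qed
    ultimately show ?thesis unfolding D_def using h'(1)[OF w] by auto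
  qed
  have zD: "zz \<in> D"
  proof (cases "\<forall>h\<in>mod_hom R \<omega> (reg_mod R). \<forall>x\<in>carrier \<omega>. h x \<in> \<mm>")
    case True
    then have "(\<Union>f\<in>mod_hom R \<omega> (reg_mod R). f ` carrier \<omega>) \<subseteq> D" using hD by blast
    then have "trace_ideal R \<omega> \<subseteq> D" unfolding trace_ideal_def by (rule genideal_minimal[OF D])
    then show ?thesis using tr zc(2) by blast
  next
    case False
    then obtain h w where h: "h \<in> mod_hom R \<omega> (reg_mod R)" "w \<in> carrier \<omega>" "h w \<notin> \<mm>" by blast
    \<comment> \<open>after scaling by a unit, \<open>z h\<close> has values in \<open>\<mm>\<close> and takes the value \<open>z\<close>\<close>
    note h' = mod_homD[OF h(1)]
    obtain u where u: "u \<in> carrier R" "u \<otimes> h w = \<one>" using unit_iff[OF _ h(3)] h'(1)[OF h(2)] by auto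
    have "(\<lambda>x. (zz \<otimes> u) \<otimes> h x) \<in> mod_hom R \<omega> (reg_mod R)"
      by (rule mod_homI) (use h' u(1) zc(1) in \<open>simp_all add: r_distr m_lcomm\<close>)
    moreover have "(zz \<otimes> u) \<otimes> h x \<in> \<mm>" if "x \<in> carrier \<omega>" for x
      using mr(7)[OF _ zc(2), of "u \<otimes> h x"] h'(1)[OF that] u(1) zc(1) by (simp add: m_assoc)
    ultimately have "(zz \<otimes> u) \<otimes> h w \<in> D" using h(2) by (rule hD)
    then show ?thesis using u zc(1) h'(1)[OF h(2)] by (simp add: m_assoc)
  qed
  then obtain \<mu> where \<mu>: "\<mu> \<in> mod_hom R F (reg_mod R)" "\<forall>v\<in>carrier F. \<mu> v \<in> \<mm>"
     "\<forall>v\<in>N k. ?cg (zz \<otimes> c v) (\<mu> v)" unfolding D_def by blast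
  note \<mu>D = mod_homD[OF \<mu>(1)]
  let ?l = "\<lambda>v. l v \<ominus> \<mu> v"
  have "?l \<in> mod_hom R F (reg_mod R)"
  proof (rule mod_homI)
    fix x y assume "x \<in> carrier F" "y \<in> carrier F"
    then show "l (x \<oplus>\<^bsub>F\<^esub> y) \<ominus> \<mu> (x \<oplus>\<^bsub>F\<^esub> y) = (l x \<ominus> \<mu> x) \<oplus>\<^bsub>reg_mod R\<^esub> (l y \<ominus> \<mu> y)"
      using \<mu>D(1,2) lD(1,2) by (simp add: minus_eq minus_add a_ac)
  next
    fix a x assume "a \<in> carrier R" "x \<in> carrier F"
    then show "l (a \<odot>\<^bsub>F\<^esub> x) \<ominus> \<mu> (a \<odot>\<^bsub>F\<^esub> x) = a \<odot>\<^bsub>reg_mod R\<^esub> (l x \<ominus> \<mu> x)"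
      using \<mu>D(1,3) lD(1,3) by (simp add: minus_eq r_distr r_minus)
  qed (use \<mu>D(1) lD(1) in simp)
  moreover have "?l v \<in> II i" if v: "v \<in> N k" for v
  proof -
    have "?cg (l v) (\<mu> v)" using G.cg_trans[OF Is lz[OF v]] \<mu>(3) v by blast
    then show ?thesis using reg_mod_minus by (auto simp: cg_def)
  qed
  moreover have "?l v0 \<notin> \<mm>"
  proof
    assume "?l v0 \<in> \<mm>"
    then have "?l v0 \<oplus> \<mu> v0 \<in> \<mm>" using \<mu>(2) v0(1) mr(3) by blast
    moreover have "?l v0 \<oplus> \<mu> v0 = l v0" using \<mu>D(1)[OF v0(1)] lD(1)[OF v0(1)] by (simp add: minus_eq a_assoc l_neg)
    ultimately show False using v0(2) by simp
  qed
  ultimately show ?thesis unfolding i_def[symmetric] by (intro bexI[of _ ?l] conjI ballI)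
qed

text \<open>
  Over a local ring a homomorphism to a cyclic quotient is onto as soon as one value lies outside
  \<open>\<mm>\<close>. The members \<open>z\<^bsub>r+k-1\<^esub>, \<dots>, z\<^sub>r\<close> are removed one at a time.
\<close>

theorem lift_surjection:
  assumes tr: "\<mm> \<subseteq> trace_ideal R \<omega>" and k: "r + k \<le> d"
    and l: "l \<in> mod_hom R F (reg_mod R)" "\<And>v. v \<in> K \<Longrightarrow> l v \<in> II (r + k)"
    and v0: "v0 \<in> carrier F" "l v0 \<notin> \<mm>"
  shows "\<exists>l'\<in>mod_hom R F (reg_mod R). (\<forall>v\<in>K. l' v \<in> II r) \<and> l' v0 \<notin> \<mm>"
proof -
  interpret F: module R F by (rule F_mod)
  note lD = mod_homD[OF l(1)]
  have "l v \<in> II (r + k)" if "j \<le> k" "v \<in> N j" for j v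
    using that
  proof (induction j arbitrary: v)
    case 0 then show ?case using l(2) by simp
  next
    case (Suc j)
    have i: "ideal (II (r + k)) R" using II_ideal k by simp
    have zc: "z (r + j) \<in> carrier R" using z_carr Suc.prems k by simp
    obtain p x where px: "p \<in> N j" "x \<in> carrier F" "v = p \<oplus>\<^bsub>F\<^esub> z (r + j) \<odot>\<^bsub>F\<^esub> x"
      using Suc.prems(2) unfolding msum.simps by (rule F.addmE)
    have pc: "p \<in> carrier F" using F.sub_carr[OF N_sub px(1)] Suc.prems k by simp
    have "z (r + j) \<in> II (r + k)"
      using z_in_II[of "r + j"] II_mono[of "Suc (r + j)" "r + k"] Suc.prems k by (auto simp del: msum.simps)
    then have "z (r + j) \<otimes> l x \<in> II (r + k)" using ideal_rules(7)[OF i] lD(1)[OF px(2)] by simp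
    moreover have "l p \<in> II (r + k)" using Suc px(1) by simp
    moreover have "l v = l p \<oplus> z (r + j) \<otimes> l x"
      unfolding px(3) using lD(2)[OF pc, of "z (r + j) \<odot>\<^bsub>F\<^esub> x"] lD(3)[OF zc px(2)] px(2) zc by simp
    ultimately show ?case using ideal_rules(3)[OF i] by simp
  qed
  then have "\<exists>l'\<in>mod_hom R F (reg_mod R). (\<forall>v\<in>N k. l' v \<in> II (r + k)) \<and> l' v0 \<notin> \<mm>"
    using l(1) v0(2) by blast
  then show ?thesis using k
  proof (induction k)
    case (Suc k)
    then obtain l' where "l' \<in> mod_hom R F (reg_mod R)" "\<And>v. v \<in> N (Suc k) \<Longrightarrow> l' v \<in> II (r + Suc k)" "l' v0 \<notin> \<mm>"
      by blast
    then have "\<exists>l'\<in>mod_hom R F (reg_mod R). (\<forall>v\<in>N k. l' v \<in> II (r + k)) \<and> l' v0 \<notin> \<mm>"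
      using Suc.prems(2) v0(1) by (intro lift_surjection_step[OF tr]) auto
    then show ?case using Suc by simp
  qed simp
qed

end


section \<open>Quotient modules and regular sequences as lists\<close>

lemma quot_mod_simps:
  "carrier (quot_mod M N) = {N +>\<^bsub>M\<^esub> x | x. x \<in> carrier M}" "zero (quot_mod M N) = N"
  "add (quot_mod M N) = set_add M" "smult (quot_mod M N) = (\<lambda>a X. \<Union>x\<in>X. N +>\<^bsub>M\<^esub> (a \<odot>\<^bsub>M\<^esub> x))"
  by (auto simp: quot_mod_def A_RCOSETS_def')

lemma quot_mod_carrierE:
  assumes "X \<in> carrier (quot_mod M N)"
  obtains x where "x \<in> carrier M" "X = N +>\<^bsub>M\<^esub> x"
  using assms by (auto simp: quot_mod_simps)

lemma quot_mod_carrierI: "x \<in> carrier M \<Longrightarrow> N +>\<^bsub>M\<^esub> x \<in> carrier (quot_mod M N)"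
  by (auto simp: quot_mod_simps)

context module
begin

lemma coset_mem_iff:
  assumes "submodule N R M" "x \<in> carrier M"
  shows "y \<in> N +>\<^bsub>M\<^esub> x \<longleftrightarrow> y \<in> carrier M \<and> y \<ominus>\<^bsub>M\<^esub> x \<in> N"
proof -
  note Nr = sub_rules[OF assms(1)]
  have "y \<ominus>\<^bsub>M\<^esub> x \<in> N" if "n \<in> N" "y = n \<oplus>\<^bsub>M\<^esub> x" for n
    using that Nr(1) assms(2) by (simp add: add_minus_cancel2)
  moreover have "\<exists>n\<in>N. y = n \<oplus>\<^bsub>M\<^esub> x" if "y \<in> carrier M" "y \<ominus>\<^bsub>M\<^esub> x \<in> N"
    using that assms(2) by (intro bexI[of _ "y \<ominus>\<^bsub>M\<^esub> x"]) (simp_all add: add_minus_cancel)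
  ultimately show ?thesis using Nr(1) assms(2) by (auto simp: a_r_coset_def')
qed

lemma coset_eq_iff:
  assumes N: "submodule N R M" and x: "x \<in> carrier M" "y \<in> carrier M"
  shows "N +>\<^bsub>M\<^esub> x = N +>\<^bsub>M\<^esub> y \<longleftrightarrow> x \<ominus>\<^bsub>M\<^esub> y \<in> N"
proof
  assume "N +>\<^bsub>M\<^esub> x = N +>\<^bsub>M\<^esub> y"
  moreover have "x \<in> N +>\<^bsub>M\<^esub> x" using coset_mem_iff[OF N x(1)] x sub_zero[OF N] by (simp add: minus_self)
  ultimately show "x \<ominus>\<^bsub>M\<^esub> y \<in> N" using coset_mem_iff[OF N x(2)] by simp
next
  assume "x \<ominus>\<^bsub>M\<^esub> y \<in> N"
  then have c: "cg M N x y" using x by (simp add: cg_def)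
  have "cg M N w x \<longleftrightarrow> cg M N w y" for w using cg_trans[OF N] cg_sym[OF N] c by blast
  then show "N +>\<^bsub>M\<^esub> x = N +>\<^bsub>M\<^esub> y" using coset_mem_iff[OF N] x by (auto simp: cg_def)
qed

lemma coset_add:
  assumes N: "submodule N R M" and x: "x \<in> carrier M" "y \<in> carrier M"
  shows "set_add M (N +>\<^bsub>M\<^esub> x) (N +>\<^bsub>M\<^esub> y) = N +>\<^bsub>M\<^esub> (x \<oplus>\<^bsub>M\<^esub> y)"
proof -
  have "abelian_subgroup N M"
    using N by (intro abelian_subgroupI3 additive_subgroupI) (auto simp: submodule_def M.abelian_group_axioms)
  then show ?thesis using x by (rule abelian_subgroup.a_rcos_sum)
qed

lemma coset_smult:
  assumes N: "submodule N R M" and x: "x \<in> carrier M" and a: "a \<in> carrier R"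
  shows "(\<Union>u\<in>N +>\<^bsub>M\<^esub> x. N +>\<^bsub>M\<^esub> (a \<odot>\<^bsub>M\<^esub> u)) = N +>\<^bsub>M\<^esub> (a \<odot>\<^bsub>M\<^esub> x)"
proof -
  have "N +>\<^bsub>M\<^esub> (a \<odot>\<^bsub>M\<^esub> u) = N +>\<^bsub>M\<^esub> (a \<odot>\<^bsub>M\<^esub> x)" if "u \<in> N +>\<^bsub>M\<^esub> x" for u
  proof -
    have u: "u \<in> carrier M" "u \<ominus>\<^bsub>M\<^esub> x \<in> N" using that coset_mem_iff[OF N x] by auto
    then show ?thesis using coset_eq_iff[OF N] sub_smult[OF N a u(2)] x a by (simp add: smult_r_minus2)
  qed
  moreover have "x \<in> N +>\<^bsub>M\<^esub> x" using coset_mem_iff[OF N x] x sub_zero[OF N] by (simp add: minus_self)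
  ultimately show ?thesis by blast
qed

lemma coset_zero: "submodule N R M \<Longrightarrow> N = N +>\<^bsub>M\<^esub> \<zero>\<^bsub>M\<^esub>"
  using coset_mem_iff[of N "\<zero>\<^bsub>M\<^esub>"] sub_carr[of N] by (auto simp: minus_zero)

lemma quot_mod_module:
  assumes N: "submodule N R M"
  shows "module R (quot_mod M N)"
proof (rule moduleI)
  let ?Q = "quot_mod M N"
  have add: "(N +>\<^bsub>M\<^esub> x) \<oplus>\<^bsub>?Q\<^esub> (N +>\<^bsub>M\<^esub> y) = N +>\<^bsub>M\<^esub> (x \<oplus>\<^bsub>M\<^esub> y)" if "x \<in> carrier M" "y \<in> carrier M" for x y
    using coset_add[OF N that] by (simp add: quot_mod_simps)
  have sm: "a \<odot>\<^bsub>?Q\<^esub> (N +>\<^bsub>M\<^esub> x) = N +>\<^bsub>M\<^esub> (a \<odot>\<^bsub>M\<^esub> x)" if "x \<in> carrier M" "a \<in> carrier R" for a x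
    using coset_smult[OF N that] by (simp add: quot_mod_simps)
  have z: "\<zero>\<^bsub>?Q\<^esub> = N +>\<^bsub>M\<^esub> \<zero>\<^bsub>M\<^esub>" using coset_zero[OF N] by (simp add: quot_mod_simps)
  note I = quot_mod_carrierI[of _ M N]
  show "cring R" by (rule R.is_cring)
  show "abelian_group ?Q"
  proof (rule abelian_groupI)
    show "\<zero>\<^bsub>?Q\<^esub> \<in> carrier ?Q" unfolding z by (rule I) simp
  next
    fix X Y assume "X \<in> carrier ?Q" "Y \<in> carrier ?Q"
    then show "X \<oplus>\<^bsub>?Q\<^esub> Y \<in> carrier ?Q" by (auto elim!: quot_mod_carrierE simp: add intro!: I)
  next
    fix X Y Z assume "X \<in> carrier ?Q" "Y \<in> carrier ?Q" "Z \<in> carrier ?Q"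
    then show "X \<oplus>\<^bsub>?Q\<^esub> Y \<oplus>\<^bsub>?Q\<^esub> Z = X \<oplus>\<^bsub>?Q\<^esub> (Y \<oplus>\<^bsub>?Q\<^esub> Z)"
      by (auto elim!: quot_mod_carrierE simp: add M.a_assoc)
  next
    fix X Y assume "X \<in> carrier ?Q" "Y \<in> carrier ?Q"
    then show "X \<oplus>\<^bsub>?Q\<^esub> Y = Y \<oplus>\<^bsub>?Q\<^esub> X" by (auto elim!: quot_mod_carrierE simp: add M.a_comm)
  next
    fix X assume "X \<in> carrier ?Q"
    then show "\<zero>\<^bsub>?Q\<^esub> \<oplus>\<^bsub>?Q\<^esub> X = X" by (auto elim!: quot_mod_carrierE simp: z add)
  next
    fix X assume "X \<in> carrier ?Q"
    then obtain x where x: "x \<in> carrier M" "X = N +>\<^bsub>M\<^esub> x" by (rule quot_mod_carrierE)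
    then show "\<exists>Y\<in>carrier ?Q. Y \<oplus>\<^bsub>?Q\<^esub> X = \<zero>\<^bsub>?Q\<^esub>"
      by (intro bexI[of _ "N +>\<^bsub>M\<^esub> (\<ominus>\<^bsub>M\<^esub> x)"]) (auto simp: z add M.l_neg intro!: I)
  qed
  show "a \<odot>\<^bsub>?Q\<^esub> X \<in> carrier ?Q" if "a \<in> carrier R" "X \<in> carrier ?Q" for a X
    using that by (auto elim!: quot_mod_carrierE simp: sm intro!: I)
  show "(a \<oplus> b) \<odot>\<^bsub>?Q\<^esub> X = a \<odot>\<^bsub>?Q\<^esub> X \<oplus>\<^bsub>?Q\<^esub> b \<odot>\<^bsub>?Q\<^esub> X" if "a \<in> carrier R" "b \<in> carrier R" "X \<in> carrier ?Q" for a b X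
    using that by (auto elim!: quot_mod_carrierE simp: sm add smult_l_distr)
  show "a \<odot>\<^bsub>?Q\<^esub> (X \<oplus>\<^bsub>?Q\<^esub> Y) = a \<odot>\<^bsub>?Q\<^esub> X \<oplus>\<^bsub>?Q\<^esub> a \<odot>\<^bsub>?Q\<^esub> Y"
    if "a \<in> carrier R" "X \<in> carrier ?Q" "Y \<in> carrier ?Q" for a X Y
    using that by (auto elim!: quot_mod_carrierE simp: sm add smult_r_distr)
  show "(a \<otimes> b) \<odot>\<^bsub>?Q\<^esub> X = a \<odot>\<^bsub>?Q\<^esub> (b \<odot>\<^bsub>?Q\<^esub> X)" if "a \<in> carrier R" "b \<in> carrier R" "X \<in> carrier ?Q" for a b X
    using that by (auto elim!: quot_mod_carrierE simp: sm smult_assoc1)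
  show "\<one> \<odot>\<^bsub>?Q\<^esub> X = X" if "X \<in> carrier ?Q" for X
    using that by (auto elim!: quot_mod_carrierE simp: sm)
qed

lemma quot_proj_hom: "submodule N R M \<Longrightarrow> (\<lambda>x. N +>\<^bsub>M\<^esub> x) \<in> mod_hom R M (quot_mod M N)"
  by (rule mod_homI) (auto simp: quot_mod_simps coset_add coset_smult)

lemma quot_proj_zero_iff:
  "submodule N R M \<Longrightarrow> x \<in> carrier M \<Longrightarrow> N +>\<^bsub>M\<^esub> x = \<zero>\<^bsub>quot_mod M N\<^esub> \<longleftrightarrow> x \<in> N"
  using coset_eq_iff[of N x "\<zero>\<^bsub>M\<^esub>"] coset_zero[of N] by (simp add: quot_mod_simps minus_zero)

lemma nonzerodivisor_quot_iff:
  assumes N: "submodule N R M" and a: "a \<in> carrier R"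
  shows "nonzerodivisor_on (quot_mod M N) a \<longleftrightarrow> reg_on M a N"
proof -
  note h = mod_homD[OF quot_proj_hom[OF N]]
  have "a \<odot>\<^bsub>quot_mod M N\<^esub> (N +>\<^bsub>M\<^esub> x) = \<zero>\<^bsub>quot_mod M N\<^esub> \<longleftrightarrow> a \<odot>\<^bsub>M\<^esub> x \<in> N" if "x \<in> carrier M" for x
    using h(3)[OF a that] quot_proj_zero_iff[OF N, of "a \<odot>\<^bsub>M\<^esub> x"] that a by simp
  then show ?thesis
    unfolding nonzerodivisor_on_def reg_on_def using quot_proj_zero_iff[OF N] quot_mod_carrierI[of _ M N]
    by (metis quot_mod_carrierE)
qed

text \<open>
  This turns the iterated quotients in the definition of regular sequences into pairs of \<open>M\<close> and a
  submodule.
\<close>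

lemma ideal_smult_eq_msum:
  assumes "set xs \<subseteq> carrier R" "i \<le> length xs"
  shows "ideal_smult R (genideal R (set (take i xs))) M = msum M ((!) xs) {\<zero>\<^bsub>M\<^esub>} i"
proof
  have xc: "xs ! j \<in> carrier R" if "j < i" for j using assms that by (meson less_le_trans nth_mem subsetD)
  have sub: "submodule (msum M ((!) xs) {\<zero>\<^bsub>M\<^esub>} j) R M" if "j \<le> i" for j
    using xc that by (intro msum_sub sub_zero_set) auto
  let ?I = "genideal R (set (take i xs))"
  have tc: "set (take i xs) \<subseteq> carrier R" using assms(1) set_take_subset[of i xs] by blast
  have Iid: "ideal ?I R" by (rule R.genideal_ideal[OF tc])
  show "ideal_smult R ?I M \<subseteq> msum M ((!) xs) {\<zero>\<^bsub>M\<^esub>} i"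
  proof -
    have "set (take i xs) \<subseteq> annq R M (msum M ((!) xs) {\<zero>\<^bsub>M\<^esub>} i)"
    proof
      fix a assume "a \<in> set (take i xs)"
      then obtain j where j: "j < i" "a = xs ! j" using assms(2) by (auto simp: in_set_conv_nth)
      have "a \<odot>\<^bsub>M\<^esub> x \<in> msum M ((!) xs) {\<zero>\<^bsub>M\<^esub>} i" if x: "x \<in> carrier M" for x
      proof -
        have "a \<odot>\<^bsub>M\<^esub> x \<in> msum M ((!) xs) {\<zero>\<^bsub>M\<^esub>} (Suc j)"
          unfolding msum.simps j(2) using addm_mult[OF sub xc x, of j j] j(1) by simp
        then show ?thesis using msum_mono[OF sub_zero_set, of i "(!) xs" "Suc j"] xc j(1) by auto
      qed
      then show "a \<in> annq R M (msum M ((!) xs) {\<zero>\<^bsub>M\<^esub>} i)" using xc[OF j(1)] j(2) by (simp add: annq_def)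
    qed
    then have "?I \<subseteq> annq R M (msum M ((!) xs) {\<zero>\<^bsub>M\<^esub>} i)"
      by (intro R.genideal_minimal annq_ideal sub) auto
    then show ?thesis unfolding ideal_smult_def mod_span_def annq_def using sub[of i] by blast
  qed
  have aI: "a \<odot>\<^bsub>M\<^esub> x \<in> ideal_smult R ?I M" if "a \<in> ?I" "x \<in> carrier M" for a x
    unfolding ideal_smult_def mod_span_def using that by blast
  have sI: "submodule (ideal_smult R ?I M) R M"
  proof -
    have car: "carrier M \<in> {N. submodule N R M \<and> {a \<odot>\<^bsub>M\<^esub> x |a x. a \<in> ?I \<and> x \<in> carrier M} \<subseteq> N}"
      using carrier_is_submodule ideal.Icarr[OF Iid] by auto
    show ?thesis unfolding ideal_smult_def mod_span_def
      by (rule subI) (use car in \<open>auto intro: sub_rules\<close>)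
  qed
  have "msum M ((!) xs) {\<zero>\<^bsub>M\<^esub>} j \<subseteq> ideal_smult R ?I M" if "j \<le> i" for j
    using that
  proof (induction j)
    case 0 then show ?case using sub_zero[OF sI] by simp
  next
    case (Suc j)
    have "xs ! j \<in> set (take i xs)" using Suc.prems assms(2) by (auto simp: in_set_conv_nth intro!: exI[of _ j])
    then have "xs ! j \<in> ?I" using R.genideal_self[OF tc] by blast
    then show ?case unfolding msum.simps using Suc aI by (intro addm_minimal[OF sI]) auto
  qed
  then show "msum M ((!) xs) {\<zero>\<^bsub>M\<^esub>} i \<subseteq> ideal_smult R ?I M" by simp
qed

lemma regular_seq_iff:
  "regular_seq R M xs \<longleftrightarrow> set xs \<subseteq> carrier R \<and>
     (\<forall>i<length xs. reg_on M (xs ! i) (msum M ((!) xs) {\<zero>\<^bsub>M\<^esub>} i)) \<and>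
     msum M ((!) xs) {\<zero>\<^bsub>M\<^esub>} (length xs) \<noteq> carrier M"
proof (cases "set xs \<subseteq> carrier R")
  case True
  have "nonzerodivisor_on (quot_mod M (ideal_smult R (genideal R (set (take i xs))) M)) (xs ! i) \<longleftrightarrow>
     reg_on M (xs ! i) (msum M ((!) xs) {\<zero>\<^bsub>M\<^esub>} i)" if i: "i < length xs" for i
  proof -
    have xi: "xs ! j \<in> carrier R" if "j < length xs" for j using True that by (meson nth_mem subsetD)
    have "submodule (msum M ((!) xs) {\<zero>\<^bsub>M\<^esub>} i) R M" using xi i by (intro msum_sub sub_zero_set) auto
    then show ?thesis using nonzerodivisor_quot_iff xi[OF i] ideal_smult_eq_msum[OF True, of i] i by simp
  qed
  then show ?thesis unfolding regular_seq_def using ideal_smult_eq_msum[OF True, of "length xs"] by simp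
qed (simp add: regular_seq_def)

end

lemma (in cring) genideal_eq_msum:
  assumes "set xs \<subseteq> carrier R"
  shows "genideal R (set xs) = msum (reg_mod R) ((!) xs) {\<zero>} (length xs)"
proof -
  interpret G: module R "reg_mod R" by (rule reg_mod_module)
  have I: "ideal (genideal R (set xs)) R" by (rule genideal_ideal[OF assms])
  have "ideal_smult R (genideal R (set xs)) (reg_mod R) = genideal R (set xs)"
  proof
    have "submodule (genideal R (set xs)) R (reg_mod R)" using I by (simp add: submodule_reg_iff)
    then show "ideal_smult R (genideal R (set xs)) (reg_mod R) \<subseteq> genideal R (set xs)"
      unfolding ideal_smult_def mod_span_def using ideal_rules(7)[OF I] by auto
    show "genideal R (set xs) \<subseteq> ideal_smult R (genideal R (set xs)) (reg_mod R)"
    proof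
      fix a assume a: "a \<in> genideal R (set xs)"
      then have "a \<odot>\<^bsub>reg_mod R\<^esub> \<one> \<in> ideal_smult R (genideal R (set xs)) (reg_mod R)"
        unfolding ideal_smult_def mod_span_def by (auto simp del: reg_mod_simps(4))
      then show "a \<in> ideal_smult R (genideal R (set xs)) (reg_mod R)" using ideal_rules(1)[OF I a] by simp
    qed
  qed
  then show ?thesis using G.ideal_smult_eq_msum[OF assms, of "length xs"] by simp
qed

lemma msum_shift: "msum M w N (Suc i) = msum M (\<lambda>j. w (Suc j)) (addm M N (w 0)) i"
  by (induction i) auto

lemma msum_add: "msum M w N (r + k) = msum M (\<lambda>j. w (r + j)) (msum M w N r) k"
  by (induction k) auto

lemma msum_cong: "(\<And>j. j < i \<Longrightarrow> w j = w' j) \<Longrightarrow> msum M w N i = msum M w' N i"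
  by (induction i) auto

lemma depI:
  assumes "\<And>i. i < t \<Longrightarrow> w i \<in> m" "\<And>i. i < t \<Longrightarrow> reg_on M (w i) (msum M w N i)"
  shows "depth_ge M m t N"
  using assms
proof (induction t arbitrary: N w)
  case (Suc t)
  have "depth_ge M m t (addm M N (w 0))"
  proof (rule Suc.IH)
    show "w (Suc i) \<in> m" if "i < t" for i using Suc.prems(1) that by simp
    show "reg_on M (w (Suc i)) (msum M (\<lambda>j. w (Suc j)) (addm M N (w 0)) i)" if "i < t" for i
      using Suc.prems(2)[of "Suc i"] that unfolding msum_shift by simp
  qed
  then show ?case using Suc.prems(1,2)[of 0] by auto
qed simp

context noeth_local
begin

text \<open>The annihilator of \<open>M/(xs)M\<close> is a proper ideal, so \<open>regular_imp_prime_chain\<close> applies to \<open>\<mm>\<close>.\<close>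

lemma regular_seq_le_krull_dim:
  assumes M: "module R M" and xs: "regular_seq R M xs"
  shows "enat (length xs) \<le> krull_dim R"
proof -
  interpret M: module R M by fact
  note r = xs[unfolded M.regular_seq_iff]
  have xc: "xs ! i \<in> carrier R" if "i < length xs" for i using r that by (meson nth_mem subsetD)
  have s: "submodule (msum M ((!) xs) {\<zero>\<^bsub>M\<^esub>} (length xs)) R M"
    using xc by (intro M.msum_sub M.sub_zero_set) auto
  have le: "annq R M (msum M ((!) xs) {\<zero>\<^bsub>M\<^esub>} (length xs)) \<subseteq> \<mm>"
  proof (rule ideal_le_mm[OF M.annq_ideal[OF s]])
    have "\<one> \<notin> annq R M (msum M ((!) xs) {\<zero>\<^bsub>M\<^esub>} (length xs))"
      using r M.sub_carr[OF s] by (auto simp: annq_def)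
    then show "annq R M (msum M ((!) xs) {\<zero>\<^bsub>M\<^esub>} (length xs)) \<noteq> carrier R" by auto
  qed
  have "\<exists>P. P (length xs) = \<mm> \<and> (\<forall>i\<le>length xs. primeideal (P i) R) \<and>
      (\<forall>i<length xs. P i \<subset> P (Suc i)) \<and> annq R M {\<zero>\<^bsub>M\<^esub>} \<subseteq> P 0"
    by (rule regular_imp_prime_chain[OF noetherian_ring_axioms M M.sub_zero_set xc _ maximalideal_prime[OF max]])
       (use r le in auto)
  then obtain P where "\<forall>i\<le>length xs. primeideal (P i) R" "\<forall>i<length xs. P i \<subset> P (Suc i)" by (elim exE conjE)
  then show ?thesis by (rule prime_chain_le_krull_dim)
qed

lemma depth_le_krull_dim: "module R M \<Longrightarrow> depth_mod R M \<le> krull_dim R"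
  unfolding depth_mod_def by (rule Sup_least) (use regular_seq_le_krull_dim in blast)

lemma regular_seq_imp_dep:
  assumes "module R M" "regular_seq R M xs" "set xs \<subseteq> \<mm>"
  shows "depth_ge M \<mm> (length xs) {\<zero>\<^bsub>M\<^esub>}"
  using assms module.regular_seq_iff[OF assms(1)]
  by (intro depI[of _ "(!) xs"]) (auto simp: subset_iff)

end

lemma Sup_enat_attained:
  assumes "Sup A = enat d" "d > 0"
  shows "enat d \<in> A"
proof (cases "finite A")
  case True
  moreover have "A \<noteq> {}" using assms by (auto simp: zero_enat_def bot_enat_def)
  ultimately show ?thesis using assms by (metis Max_in Sup_enat_def)
next
  case False
  then have "Sup A = \<infinity>" by (auto simp: Sup_enat_def)
  then show ?thesis using assms by simp
qed

lemma local_ring_noeth_local: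
  assumes "local_ring R"
  shows "noeth_local R (max_ideal R)"
proof -
  have u: "\<exists>!m. maximalideal m R" using assms by (simp add: local_ring_def)
  have m: "maximalideal (max_ideal R) R" unfolding max_ideal_def by (rule theI'[OF u])
  show ?thesis
    using assms m u by (auto simp: noeth_local_def noeth_local_axioms_def local_ring_def)
qed

lemma (in noeth_local) max_ideal_eq: "max_ideal R = \<mm>"
  unfolding max_ideal_def by (rule the_equality, rule max, erule uniq)

lemma (in noeth_local) maximal_cm_dep:
  assumes "maximal_cm R M" "krull_dim R = enat d"
  shows "depth_ge M \<mm> d {\<zero>\<^bsub>M\<^esub>}"
proof (cases "d = 0")
  case False
  have M: "module R M" using assms by (simp add: maximal_cm_def fin_gen_mod_def)
  have "Sup {enat (length xs) | xs. set xs \<subseteq> max_ideal R \<and> regular_seq R M xs} = enat d"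
    using assms by (simp add: maximal_cm_def depth_mod_def)
  from Sup_enat_attained[OF this] False obtain xs where
    "length xs = d" "set xs \<subseteq> \<mm>" "regular_seq R M xs" by (auto simp: max_ideal_eq)
  then show ?thesis using regular_seq_imp_dep[OF M] by blast
qed simp

lemma (in noeth_local) maximal_cmI:
  assumes "fin_gen_mod R M" "regular_seq R M xs" "set xs \<subseteq> \<mm>" "krull_dim R = enat (length xs)"
  shows "maximal_cm R M"
proof -
  have M: "module R M" using assms(1) by (simp add: fin_gen_mod_def)
  interpret M: module R M by fact
  have xc: "xs ! i \<in> carrier R" if "i < length xs" for i
    using assms(3) that mm_carr by (meson nth_mem subsetD)
  have s: "submodule (msum M ((!) xs) {\<zero>\<^bsub>M\<^esub>} (length xs)) R M"
    using xc by (intro M.msum_sub M.sub_zero_set) auto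
  have "carrier M \<noteq> {\<zero>\<^bsub>M\<^esub>}"
    using assms(2) M.sub_zero[OF s] M.sub_carr[OF s] unfolding M.regular_seq_iff by (metis empty_subsetI insert_subset subsetI subset_antisym)
  moreover have "depth_mod R M = krull_dim R"
  proof (rule antisym[OF depth_le_krull_dim[OF M]])
    show "krull_dim R \<le> depth_mod R M"
      unfolding assms(4) depth_mod_def max_ideal_eq by (rule Sup_upper) (use assms in blast)
  qed
  ultimately show ?thesis using assms(1) by (simp add: maximal_cm_def)
qed

section \<open>Injective modules and free summands\<close>

lemma injective_mod_rel_inj:
  assumes "injective_mod R E"
  shows "rel_inj R {\<zero>\<^bsub>R\<^esub>} E (carrier E) {\<zero>\<^bsub>E\<^esub>}"
  unfolding rel_inj_def
proof (intro allI impI, elim conjE)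
  interpret E: module R E using assms by (simp add: injective_mod_def)
  interpret G: module R "reg_mod R" by (rule E.R.reg_mod_module)
  fix J f assume J: "ideal J R" and f: "qhom R (reg_mod R) J E {\<zero>\<^bsub>E\<^esub>} f"
  let ?A = "(reg_mod R)\<lparr>carrier := J\<rparr>"
  have s: "submodule J R (reg_mod R)" using J by (simp add: E.R.submodule_reg_iff)
  have A: "module R ?A" by (rule submodule.submodule_is_module[OF s G.module_axioms])
  have Jc: "J \<subseteq> carrier R" using ideal.Icarr[OF J] by blast
  have i: "(\<lambda>x. x) \<in> mod_hom R ?A (reg_mod R)" using Jc by (intro mod_homI) auto
  have fh: "f \<in> mod_hom R ?A E"
    using qhomD[OF f] by (intro mod_homI) (auto simp: E.cg_singleton)
  obtain h where h: "h \<in> mod_hom R (reg_mod R) E" "\<forall>x\<in>carrier ?A. h x = f x"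
    using assms[unfolded injective_mod_def, THEN conjunct2, rule_format, OF A G.module_axioms i _ fh] by auto
  have "f a = a \<odot>\<^bsub>E\<^esub> h \<one>\<^bsub>R\<^esub>" if "a \<in> J" for a
    using h(2) mod_homD(3)[OF h(1), of a "\<one>\<^bsub>R\<^esub>"] that Jc by auto
  then show "\<exists>m\<in>carrier E. \<forall>a\<in>J. cg E {\<zero>\<^bsub>E\<^esub>} (f a) (a \<odot>\<^bsub>E\<^esub> m)"
    using mod_homD(1)[OF h(1), of "\<one>\<^bsub>R\<^esub>"] qhomD(1)[OF f] by (intro bexI[of _ "h \<one>\<^bsub>R\<^esub>"]) (auto simp: E.cg_singleton)
qed

text \<open>A surjection onto \<open>R\<close> splits; conversely, project to the free summand and take a coordinate.\<close>

lemma has_free_summand_iff: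
  assumes X: "module R X"
  shows "has_free_summand R X \<longleftrightarrow> (\<exists>f\<in>mod_hom R X (reg_mod R). \<exists>x\<in>carrier X. f x = \<one>\<^bsub>R\<^esub>)"
proof
  interpret X: module R X by fact
  interpret G: module R "reg_mod R" by (rule X.R.reg_mod_module)
  assume "has_free_summand R X"
  then obtain Y Z n where YZ: "submodule Y R X" "submodule Z R X" "Y \<inter> Z = {\<zero>\<^bsub>X\<^esub>}" "set_add X Y Z = carrier X"
     "n > 0" "mod_iso R (X\<lparr>carrier := Z\<rparr>) (free_mod R n)" unfolding has_free_summand_def by blast
  obtain g where g: "g \<in> mod_hom R (X\<lparr>carrier := Z\<rparr>) (free_mod R n)" "bij_betw g Z (carrier (free_mod R n))"
    using YZ(6) unfolding mod_iso_def by auto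
  note gD = mod_homD[OF g(1), simplified]
  note Yr = X.sub_rules[OF YZ(1)] and Zr = X.sub_rules[OF YZ(2)]
  have dec: "\<exists>y z. y \<in> Y \<and> z \<in> Z \<and> x = y \<oplus>\<^bsub>X\<^esub> z" if "x \<in> carrier X" for x
    using that unfolding YZ(4)[symmetric] set_add_def' by blast
  have uniq: "z = z'" if yz: "y \<in> Y" "z \<in> Z" "y' \<in> Y" "z' \<in> Z" "y \<oplus>\<^bsub>X\<^esub> z = y' \<oplus>\<^bsub>X\<^esub> z'" for y z y' z'
  proof -
    have c: "y \<in> carrier X" "y' \<in> carrier X" "z \<in> carrier X" "z' \<in> carrier X" using yz Yr(1) Zr(1) by auto
    have "z = (y' \<oplus>\<^bsub>X\<^esub> z') \<ominus>\<^bsub>X\<^esub> y" using yz(5) c X.add_minus_cancel2[of z y] by (metis X.M.a_comm)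
    also have "\<dots> = (y' \<ominus>\<^bsub>X\<^esub> y) \<oplus>\<^bsub>X\<^esub> z'" using c by (simp add: X.M.minus_eq X.M.a_ac)
    finally have "z \<ominus>\<^bsub>X\<^esub> z' = ((y' \<ominus>\<^bsub>X\<^esub> y) \<oplus>\<^bsub>X\<^esub> z') \<ominus>\<^bsub>X\<^esub> z'" by simp
    also have "\<dots> = y' \<ominus>\<^bsub>X\<^esub> y" using c by (intro X.add_minus_cancel2) auto
    finally have "z \<ominus>\<^bsub>X\<^esub> z' = y' \<ominus>\<^bsub>X\<^esub> y" .
    then have "z \<ominus>\<^bsub>X\<^esub> z' \<in> Y \<inter> Z" using Yr(5)[OF yz(3,1)] Zr(5)[OF yz(2,4)] by simp
    then have "z \<ominus>\<^bsub>X\<^esub> z' = \<zero>\<^bsub>X\<^esub>" using YZ(3) by simp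
    then show ?thesis using X.cg_singleton[of z z'] c by (simp add: cg_def)
  qed
  define p where "p x = (SOME z. z \<in> Z \<and> (\<exists>y\<in>Y. x = y \<oplus>\<^bsub>X\<^esub> z))" for x
  have p: "p (y \<oplus>\<^bsub>X\<^esub> z) = z" if "y \<in> Y" "z \<in> Z" for y z
  proof -
    have "p (y \<oplus>\<^bsub>X\<^esub> z) \<in> Z \<and> (\<exists>y'\<in>Y. y \<oplus>\<^bsub>X\<^esub> z = y' \<oplus>\<^bsub>X\<^esub> p (y \<oplus>\<^bsub>X\<^esub> z))"
      unfolding p_def by (rule someI[of _ z]) (use that in blast)
    then show ?thesis using uniq that by metis
  qed
  have gp: "(\<lambda>x. g (p x) 0) \<in> mod_hom R X (reg_mod R)"
  proof (rule mod_homI)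
    fix x assume "x \<in> carrier X"
    then obtain y z where "y \<in> Y" "z \<in> Z" "x = y \<oplus>\<^bsub>X\<^esub> z" using dec by blast
    then have "g (p x) \<in> carrier (free_mod R n)" using p gD(1) by simp
    then show "g (p x) 0 \<in> carrier (reg_mod R)" using YZ(5) by (auto simp: free_mod_def)
  next
    fix x x' assume "x \<in> carrier X" "x' \<in> carrier X"
    then obtain y z y' z' where 1: "y \<in> Y" "z \<in> Z" "x = y \<oplus>\<^bsub>X\<^esub> z" "y' \<in> Y" "z' \<in> Z" "x' = y' \<oplus>\<^bsub>X\<^esub> z'" using dec by metis
    have "x \<oplus>\<^bsub>X\<^esub> x' = (y \<oplus>\<^bsub>X\<^esub> y') \<oplus>\<^bsub>X\<^esub> (z \<oplus>\<^bsub>X\<^esub> z')" using 1 Yr(1) Zr(1) by (simp add: X.M.a_ac)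
    then have "p (x \<oplus>\<^bsub>X\<^esub> x') = z \<oplus>\<^bsub>X\<^esub> z'" using p[OF Yr(3)[OF 1(1,4)] Zr(3)[OF 1(2,5)]] by simp
    then show "g (p (x \<oplus>\<^bsub>X\<^esub> x')) 0 = g (p x) 0 \<oplus>\<^bsub>reg_mod R\<^esub> g (p x') 0"
      using 1 p gD(2) YZ(5) by (simp add: free_mod_apply)
  next
    fix a x assume a: "a \<in> carrier R" "x \<in> carrier X"
    then obtain y z where 1: "y \<in> Y" "z \<in> Z" "x = y \<oplus>\<^bsub>X\<^esub> z" using dec by metis
    have "a \<odot>\<^bsub>X\<^esub> x = a \<odot>\<^bsub>X\<^esub> y \<oplus>\<^bsub>X\<^esub> a \<odot>\<^bsub>X\<^esub> z" using 1 Yr(1) Zr(1) a by (simp add: X.smult_r_distr)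
    then have "p (a \<odot>\<^bsub>X\<^esub> x) = a \<odot>\<^bsub>X\<^esub> z" using p[OF Yr(6)[OF a(1) 1(1)] Zr(6)[OF a(1) 1(2)]] by simp
    then show "g (p (a \<odot>\<^bsub>X\<^esub> x)) 0 = a \<odot>\<^bsub>reg_mod R\<^esub> g (p x) 0"
      using 1 p gD(3) a YZ(5) by (simp add: free_mod_apply)
  qed
  have "unitv R n 0 \<in> g ` Z" using g(2) X.unitv_carrier[of n 0] unfolding bij_betw_def by simp
  then obtain z where z: "z \<in> Z" "g z = unitv R n 0" by (metis imageE)
  have "p z = z" using p[OF Yr(2) z(1)] Zr(1)[OF z(1)] by simp
  then have "g (p z) 0 = \<one>\<^bsub>R\<^esub>" using z YZ(5) by (simp add: unitv_def)
  then show "\<exists>f\<in>mod_hom R X (reg_mod R). \<exists>x\<in>carrier X. f x = \<one>\<^bsub>R\<^esub>"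
    using Zr(1)[OF z(1)] by (intro bexI[OF _ gp] bexI[of _ z])
next
  interpret X: module R X by fact
  interpret G: module R "reg_mod R" by (rule X.R.reg_mod_module)
  assume "\<exists>f\<in>mod_hom R X (reg_mod R). \<exists>x\<in>carrier X. f x = \<one>\<^bsub>R\<^esub>"
  then obtain f x where f: "f \<in> mod_hom R X (reg_mod R)" and x: "x \<in> carrier X" "f x = \<one>\<^bsub>R\<^esub>" by blast
  note fD = mod_homD[OF f] and f0 = mod_hom_zero_minus[OF X G.module_axioms f]
  define Y where "Y = {y \<in> carrier X. f y \<in> {\<zero>\<^bsub>R\<^esub>}}"
  define Z where "Z = {a \<odot>\<^bsub>X\<^esub> x | a. a \<in> carrier R}"
  have Y: "submodule Y R X" unfolding Y_def
    by (rule vimage_submodule[OF X G.module_axioms f]) (use G.sub_zero_set in simp)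
  have Z: "submodule Z R X"
  proof (rule X.subI)
    show "Z \<subseteq> carrier X" using x by (auto simp: Z_def)
    show "\<zero>\<^bsub>X\<^esub> \<in> Z" unfolding Z_def using x by (intro CollectI exI[of _ "\<zero>\<^bsub>R\<^esub>"]) simp
  next
    fix a b assume "a \<in> Z" "b \<in> Z"
    then obtain s t where "a = s \<odot>\<^bsub>X\<^esub> x" "b = t \<odot>\<^bsub>X\<^esub> x" "s \<in> carrier R" "t \<in> carrier R" by (auto simp: Z_def)
    then show "a \<oplus>\<^bsub>X\<^esub> b \<in> Z" unfolding Z_def using x
      by (intro CollectI exI[of _ "s \<oplus>\<^bsub>R\<^esub> t"]) (simp add: X.smult_l_distr)
  next
    fix a b assume "a \<in> carrier R" "b \<in> Z"
    then obtain t where "b = t \<odot>\<^bsub>X\<^esub> x" "a \<in> carrier R" "t \<in> carrier R" by (auto simp: Z_def)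
    then show "a \<odot>\<^bsub>X\<^esub> b \<in> Z" unfolding Z_def using x
      by (intro CollectI exI[of _ "a \<otimes>\<^bsub>R\<^esub> t"]) (simp add: X.smult_assoc1)
  qed
  have fa: "f (a \<odot>\<^bsub>X\<^esub> x) = a" if "a \<in> carrier R" for a using fD(3)[OF that x(1)] x(2) that by simp
  note Zr = X.sub_rules[OF Z]
  have "Y \<inter> Z = {\<zero>\<^bsub>X\<^esub>}"
    using X.sub_zero[OF Y] Zr(2) fa x by (auto simp: Y_def Z_def)
  moreover have "set_add X Y Z = carrier X"
  proof
    show "set_add X Y Z \<subseteq> carrier X" using X.sub_carr[OF Y] Zr(1) by (auto simp: set_add_def')
    show "carrier X \<subseteq> set_add X Y Z"
    proof
      fix u assume u: "u \<in> carrier X"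
      have fu: "f u \<in> carrier R" using fD(1)[OF u] by simp
      let ?z = "f u \<odot>\<^bsub>X\<^esub> x"
      have "?z \<in> Z" using fu by (auto simp: Z_def)
      moreover have "u \<ominus>\<^bsub>X\<^esub> ?z \<in> Y" using u fu x f0(3)[OF u, of ?z] fa[OF fu] G.minus_self[of "f u"] by (simp add: Y_def)
      moreover have "u = (u \<ominus>\<^bsub>X\<^esub> ?z) \<oplus>\<^bsub>X\<^esub> ?z" using u fu x by (simp add: X.add_minus_cancel)
      ultimately show "u \<in> set_add X Y Z" unfolding set_add_def' by blast
    qed
  qed
  moreover have "mod_iso R (X\<lparr>carrier := Z\<rparr>) (free_mod R 1)"
  proof -
    let ?g = "\<lambda>u. \<lambda>i\<in>{..<1::nat}. f u"
    have "?g \<in> mod_hom R (X\<lparr>carrier := Z\<rparr>) (free_mod R 1)"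
      by (rule mod_homI) (use fD Zr(1) in \<open>auto simp: free_mod_def intro!: ext\<close>)
    moreover have "bij_betw ?g Z (carrier (free_mod R 1))"
    proof (rule bij_betwI[where g = "\<lambda>v. v 0 \<odot>\<^bsub>X\<^esub> x"])
      show "?g \<in> Z \<rightarrow> carrier (free_mod R 1)" using fD(1) Zr(1) by (auto simp: free_mod_def)
      show "(\<lambda>v. v 0 \<odot>\<^bsub>X\<^esub> x) \<in> carrier (free_mod R 1) \<rightarrow> Z" by (auto simp: free_mod_def Z_def PiE_iff)
      show "?g u 0 \<odot>\<^bsub>X\<^esub> x = u" if "u \<in> Z" for u using that fa by (auto simp: Z_def)
      show "?g (v 0 \<odot>\<^bsub>X\<^esub> x) = v" if "v \<in> carrier (free_mod R 1)" for v
      proof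
        fix i show "?g (v 0 \<odot>\<^bsub>X\<^esub> x) i = v i" using that fa[of "v 0"]
          by (cases "i = 0") (auto simp: free_mod_def PiE_iff extensional_def)
      qed
    qed
    ultimately show ?thesis unfolding mod_iso_def by auto
  qed
  ultimately show "has_free_summand R X" unfolding has_free_summand_def using Y Z by blast
qed


section \<open>Change of rings along a quotient map\<close>

definition semilinear :: "('a, 'm) ring_scheme \<Rightarrow> ('a \<Rightarrow> 'a2) \<Rightarrow> ('a, 'b, 'k) module_scheme \<Rightarrow>
    ('a2, 'c, 'l) module_scheme \<Rightarrow> ('b \<Rightarrow> 'c) \<Rightarrow> bool" where
  "semilinear R \<pi> M X h \<longleftrightarrow> (\<forall>x\<in>carrier M. h x \<in> carrier X) \<and>
     (\<forall>x\<in>carrier M. \<forall>y\<in>carrier M. h (x \<oplus>\<^bsub>M\<^esub> y) = h x \<oplus>\<^bsub>X\<^esub> h y) \<and>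
     (\<forall>a\<in>carrier R. \<forall>x\<in>carrier M. h (a \<odot>\<^bsub>M\<^esub> x) = \<pi> a \<odot>\<^bsub>X\<^esub> h x)"

lemma semilinearI:
  assumes "\<And>x. x \<in> carrier M \<Longrightarrow> h x \<in> carrier X"
    "\<And>x y. x \<in> carrier M \<Longrightarrow> y \<in> carrier M \<Longrightarrow> h (x \<oplus>\<^bsub>M\<^esub> y) = h x \<oplus>\<^bsub>X\<^esub> h y"
    "\<And>a x. a \<in> carrier R \<Longrightarrow> x \<in> carrier M \<Longrightarrow> h (a \<odot>\<^bsub>M\<^esub> x) = \<pi> a \<odot>\<^bsub>X\<^esub> h x"
  shows "semilinear R \<pi> M X h"
  using assms by (simp add: semilinear_def)

lemma semilinearD:
  assumes "semilinear R \<pi> M X h"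
  shows "x \<in> carrier M \<Longrightarrow> h x \<in> carrier X"
    "x \<in> carrier M \<Longrightarrow> y \<in> carrier M \<Longrightarrow> h (x \<oplus>\<^bsub>M\<^esub> y) = h x \<oplus>\<^bsub>X\<^esub> h y"
    "a \<in> carrier R \<Longrightarrow> x \<in> carrier M \<Longrightarrow> h (a \<odot>\<^bsub>M\<^esub> x) = \<pi> a \<odot>\<^bsub>X\<^esub> h x"
  using assms by (simp_all add: semilinear_def)

locale semi_map = M: module R M + X: module S X
  for R :: "('a, 'm) ring_scheme" and M :: "('a, 'b, 'k) module_scheme"
    and S :: "('a2, 'm2) ring_scheme" and X :: "('a2, 'c, 'l) module_scheme" +
  fixes \<pi> :: "'a \<Rightarrow> 'a2" and h :: "'b \<Rightarrow> 'c"
  assumes pi: "\<pi> \<in> ring_hom R S" and semilinear: "semilinear R \<pi> M X h"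
begin

lemmas hD = semilinearD[OF semilinear]

lemma piD: "a \<in> carrier R \<Longrightarrow> \<pi> a \<in> carrier S" using ring_hom_closed[OF pi] .

lemma h_zero: "h \<zero>\<^bsub>M\<^esub> = \<zero>\<^bsub>X\<^esub>"
proof -
  have "h \<zero>\<^bsub>M\<^esub> = h \<zero>\<^bsub>M\<^esub> \<oplus>\<^bsub>X\<^esub> h \<zero>\<^bsub>M\<^esub>" using hD(2)[of "\<zero>\<^bsub>M\<^esub>" "\<zero>\<^bsub>M\<^esub>"] by simp
  then show ?thesis using hD(1)[of "\<zero>\<^bsub>M\<^esub>"] X.M.add.l_cancel_one[of "h \<zero>\<^bsub>M\<^esub>" "h \<zero>\<^bsub>M\<^esub>"] by simp
qed

lemma h_minus: "x \<in> carrier M \<Longrightarrow> y \<in> carrier M \<Longrightarrow> h (x \<ominus>\<^bsub>M\<^esub> y) = h x \<ominus>\<^bsub>X\<^esub> h y"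
  using hD(2)[of "x \<ominus>\<^bsub>M\<^esub> y" y] hD(1) M.add_minus_cancel[of x y] X.add_minus_cancel2[of "h (x \<ominus>\<^bsub>M\<^esub> y)" "h y"]
  by simp

definition ker :: "'b set" where "ker = {x \<in> carrier M. h x = \<zero>\<^bsub>X\<^esub>}"

lemma vimage_sub:
  assumes "submodule N S X" shows "submodule {x \<in> carrier M. h x \<in> N} R M"
  by (rule M.subI) (use hD piD h_zero X.sub_rules[OF assms] in auto)

lemma ker_sub: "submodule ker R M"
  using vimage_sub[OF X.sub_zero_set] by (simp add: ker_def)

lemma h_eq_iff: "x \<in> carrier M \<Longrightarrow> y \<in> carrier M \<Longrightarrow> h x = h y \<longleftrightarrow> x \<ominus>\<^bsub>M\<^esub> y \<in> ker"
  using h_minus[of x y] hD(1) X.cg_singleton[of "h x" "h y"] by (auto simp: ker_def cg_def X.minus_self)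

lemma mem_image_iff:
  assumes "submodule N R M" "ker \<subseteq> N" "x \<in> carrier M"
  shows "h x \<in> h ` N \<longleftrightarrow> x \<in> N"
proof
  assume "h x \<in> h ` N"
  then obtain y where y: "y \<in> N" "h x = h y" by blast
  then have "x \<ominus>\<^bsub>M\<^esub> y \<in> N" using h_eq_iff[of x y] assms M.sub_carr[OF assms(1)] by blast
  then have "(x \<ominus>\<^bsub>M\<^esub> y) \<oplus>\<^bsub>M\<^esub> y \<in> N" using M.sub_add[OF assms(1)] y by blast
  then show "x \<in> N" using M.add_minus_cancel[OF assms(3) M.sub_carr[OF assms(1) y(1)]] by simp
qed simp

lemma image_ker: "h ` ker = {\<zero>\<^bsub>X\<^esub>}"
  using M.sub_zero[OF ker_sub] h_zero by (auto simp: ker_def)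

end

locale semi_onto = semi_map R M S X \<pi> h for R M S X \<pi> h +
  assumes onto: "h ` carrier M = carrier X"
begin

lemma addm_image:
  assumes "N \<subseteq> carrier M" "a \<in> carrier R"
  shows "h ` addm M N a = addm X (h ` N) (\<pi> a)"
proof
  have 1: "h (n \<oplus>\<^bsub>M\<^esub> a \<odot>\<^bsub>M\<^esub> x) = h n \<oplus>\<^bsub>X\<^esub> \<pi> a \<odot>\<^bsub>X\<^esub> h x" if "n \<in> N" "x \<in> carrier M" for n x
    using that assms hD(2)[of n "a \<odot>\<^bsub>M\<^esub> x"] hD(3)[OF assms(2) that(2)] by auto
  then show "h ` addm M N a \<subseteq> addm X (h ` N) (\<pi> a)" unfolding addm_def using hD(1) by blast
  show "addm X (h ` N) (\<pi> a) \<subseteq> h ` addm M N a"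
  proof
    fix u assume "u \<in> addm X (h ` N) (\<pi> a)"
    then obtain n y where u: "n \<in> N" "y \<in> carrier X" "u = h n \<oplus>\<^bsub>X\<^esub> \<pi> a \<odot>\<^bsub>X\<^esub> y" unfolding addm_def by blast
    then obtain x where x: "x \<in> carrier M" "y = h x" using onto by (metis imageE)
    have "u = h (n \<oplus>\<^bsub>M\<^esub> a \<odot>\<^bsub>M\<^esub> x)" using 1[OF u(1) x(1)] u(3) x(2) by simp
    then show "u \<in> h ` addm M N a" using M.addmI[OF u(1) x(1) refl] by blast
  qed
qed

lemma msum_image:
  assumes "submodule N R M" "\<And>j. j < i \<Longrightarrow> w j \<in> carrier R"
  shows "h ` msum M w N i = msum X (\<lambda>j. \<pi> (w j)) (h ` N) i"
  using assms(2)
proof (induction i)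
  case (Suc i)
  have "msum M w N i \<subseteq> carrier M" using M.sub_carr[OF M.msum_sub[OF assms(1), of i w]] Suc.prems by auto
  then show ?case using addm_image[of "msum M w N i" "w i"] Suc by simp
qed simp

lemma reg_iff:
  assumes "submodule N R M" "ker \<subseteq> N" "a \<in> carrier R"
  shows "reg_on X (\<pi> a) (h ` N) \<longleftrightarrow> reg_on M a N"
proof -
  have "\<pi> a \<odot>\<^bsub>X\<^esub> h x \<in> h ` N \<longleftrightarrow> a \<odot>\<^bsub>M\<^esub> x \<in> N" if "x \<in> carrier M" for x
    using mem_image_iff[OF assms(1,2), of "a \<odot>\<^bsub>M\<^esub> x"] hD(3)[OF assms(3) that] assms(3) that by simp
  then show ?thesis
    unfolding reg_on_def onto[symmetric] using mem_image_iff[OF assms(1,2)] by auto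
qed

lemma dep_pullback:
  assumes "submodule N R M" "ker \<subseteq> N" "m \<subseteq> carrier R" "depth_ge X (\<pi> ` m) t (h ` N)"
  shows "depth_ge M m t N"
  using assms
proof (induction t arbitrary: N)
  case (Suc t)
  obtain a where a: "a \<in> m" "reg_on X (\<pi> a) (h ` N)" "depth_ge X (\<pi> ` m) t (addm X (h ` N) (\<pi> a))"
    using Suc.prems(4) by auto
  have ac: "a \<in> carrier R" using a Suc.prems(3) by blast
  have "N \<subseteq> carrier M" using M.sub_carr[OF Suc.prems(1)] by blast
  then have "depth_ge X (\<pi> ` m) t (h ` addm M N a)" using a(3) addm_image ac by simp
  then have "depth_ge M m t (addm M N a)"
    using Suc.prems(2) M.addm_le[OF Suc.prems(1) ac]
    by (intro Suc.IH[OF M.addm_sub[OF Suc.prems(1) ac] _ Suc.prems(3)]) blast+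
  then show ?case using a reg_iff[OF Suc.prems(1,2) ac] by auto
qed simp

text \<open>The homomorphism theorem, across a change of rings.\<close>

lemma factor:
  assumes Y: "module S Y" and g: "semilinear R \<pi> M Y g" and kg: "\<And>x. x \<in> ker \<Longrightarrow> g x = \<zero>\<^bsub>Y\<^esub>"
    and pi_onto: "\<pi> ` carrier R = carrier S"
  shows "\<exists>\<psi>\<in>mod_hom S X Y. \<forall>x\<in>carrier M. \<psi> (h x) = g x"
proof -
  interpret g: semi_map R M S Y \<pi> g
    by (intro semi_map.intro semi_map_axioms.intro M.module_axioms Y pi g)
  define \<psi> where "\<psi> y = g (SOME x. x \<in> carrier M \<and> h x = y)" for y
  have \<psi>: "\<psi> (h x) = g x" if x: "x \<in> carrier M" for x
  proof -
    let ?x = "SOME x'. x' \<in> carrier M \<and> h x' = h x"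
    have s: "?x \<in> carrier M \<and> h ?x = h x" by (rule someI[of _ x]) (use x in simp)
    then have "?x \<ominus>\<^bsub>M\<^esub> x \<in> ker" using h_eq_iff[of ?x x] x by blast
    then have "?x \<ominus>\<^bsub>M\<^esub> x \<in> g.ker" using kg s x by (simp add: g.ker_def)
    then show ?thesis unfolding \<psi>_def using g.h_eq_iff[of ?x x] s x by blast
  qed
  have "\<psi> \<in> mod_hom S X Y"
  proof (rule mod_homI)
    fix y assume "y \<in> carrier X"
    then obtain x where "x \<in> carrier M" "y = h x" using onto by (metis imageE)
    then show "\<psi> y \<in> carrier Y" using \<psi> g.hD(1) by simp
  next
    fix y y' assume "y \<in> carrier X" "y' \<in> carrier X"
    then obtain x x' where x: "x \<in> carrier M" "y = h x" "x' \<in> carrier M" "y' = h x'" using onto by (metis imageE)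
    then show "\<psi> (y \<oplus>\<^bsub>X\<^esub> y') = \<psi> y \<oplus>\<^bsub>Y\<^esub> \<psi> y'" using \<psi>[of "x \<oplus>\<^bsub>M\<^esub> x'"] hD(2)[of x x'] g.hD(2)[of x x'] \<psi> by simp
  next
    fix s y assume "s \<in> carrier S" "y \<in> carrier X"
    then obtain a x where x: "a \<in> carrier R" "s = \<pi> a" "x \<in> carrier M" "y = h x" using onto pi_onto by (metis imageE)
    then show "\<psi> (s \<odot>\<^bsub>X\<^esub> y) = s \<odot>\<^bsub>Y\<^esub> \<psi> y" using \<psi>[of "a \<odot>\<^bsub>M\<^esub> x"] hD(3)[of a x] g.hD(3)[of a x] \<psi> by simp
  qed
  then show ?thesis using \<psi> by blast
qed

end

section \<open>Powers of the maximal ideal\<close>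

lemma ideal_pow_simps:
  "\<one>\<^bsub>ideals_set R\<^esub> = carrier R" "A \<otimes>\<^bsub>ideals_set R\<^esub> B = ideal_prod R A B"
  "ideal_pow R J 0 = carrier R" "ideal_pow R J (Suc n) = ideal_prod R (ideal_pow R J n) J"
  by (simp_all add: nat_pow_def ideals_set_def)

lemma (in cring) ideal_pow_ideal: "ideal J R \<Longrightarrow> ideal (ideal_pow R J n) R"
  by (induction n) (simp_all add: ideal_pow_simps oneideal ideal_prod_is_ideal)

lemma (in cring) ideal_pow_le: "ideal J R \<Longrightarrow> n \<ge> 1 \<Longrightarrow> ideal_pow R J n \<subseteq> J"
  using ideal_prod_inter[OF ideal_pow_ideal, of J J "n - 1"] by (cases n) (auto simp: ideal_pow_simps)

lemma (in cring) nat_pow_in_ideal_pow: "ideal J R \<Longrightarrow> a \<in> J \<Longrightarrow> a [^] (n::nat) \<in> ideal_pow R J n"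
proof (induction n)
  case 0 then show ?case by (simp add: ideal_pow_simps)
next
  case (Suc n)
  then show ?case using ideal_prod.prod[of "a [^] n" "ideal_pow R J n" a J R] by (simp add: ideal_pow_simps)
qed

context noeth_local
begin

text \<open>Any element outside \<open>J\<close> of the last power of \<open>\<mm>\<close> not contained in \<open>J\<close>.\<close>

lemma socle_of_power:
  assumes "ideal J R" "ideal_pow R \<mm> g \<subseteq> J" "J \<noteq> carrier R"
  shows "\<exists>a\<in>carrier R - J. \<forall>b\<in>\<mm>. b \<otimes> a \<in> J"
proof -
  define k where "k = (LEAST k. ideal_pow R \<mm> k \<subseteq> J)"
  have k: "ideal_pow R \<mm> k \<subseteq> J" unfolding k_def by (rule LeastI) (rule assms(2))
  have "k \<noteq> 0" using k assms(3) ideal_rules(1)[OF assms(1)] by (auto simp: ideal_pow_simps)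
  then obtain k' where k': "k = Suc k'" by (cases k) auto
  have "\<not> ideal_pow R \<mm> k' \<subseteq> J" using not_less_Least[of k' "\<lambda>k. ideal_pow R \<mm> k \<subseteq> J"] k' by (simp add: k_def)
  then obtain a where a: "a \<in> ideal_pow R \<mm> k'" "a \<notin> J" by blast
  have ac: "a \<in> carrier R" using a(1) ideal_rules(1)[OF ideal_pow_ideal[OF ideal_mm]] by blast
  have "b \<otimes> a \<in> J" if "b \<in> \<mm>" for b
  proof -
    have "a \<otimes> b \<in> ideal_pow R \<mm> k" unfolding k' ideal_pow_simps by (rule ideal_prod.prod[OF a(1) that])
    then show ?thesis using k m_comm[OF ac mm_carr[OF that]] by auto
  qed
  then show ?thesis using a ac by blast
qed

lemma system_of_parametersI:
  assumes "set ys \<subseteq> \<mm>" "enat (length ys) = krull_dim R" "ideal_pow R \<mm> n \<subseteq> genideal R (set ys)"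
  shows "system_of_parameters R ys"
proof -
  let ?I = "genideal R (set ys)"
  have I: "?I \<subseteq> \<mm>" by (rule genideal_minimal[OF ideal_mm assms(1)])
  have pm: "primeideal \<mm> R" by (rule maximalideal_prime[OF max])
  have pw: "a \<in> \<mm>" if "a \<in> carrier R" "a [^] (k::nat) \<in> \<mm>" for a k
    using that
  proof (induction k)
    case (Suc k) then show ?case using prime_rules(3)[OF pm, of "a [^] k" a] by auto
  qed (use one_notin in simp)
  have "{a \<in> carrier R. \<exists>n::nat. a [^] n \<in> ?I} = \<mm>"
    using pw I nat_pow_in_ideal_pow[OF ideal_mm, of _ n] assms(3) mm_carr by blast
  then show ?thesis unfolding system_of_parameters_def max_ideal_eq using assms by simp
qed

end

section \<open>The quotient of a local ring by a proper ideal\<close>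

locale local_quot = noeth_local R \<mm> for R :: "('a, 'm) ring_scheme" (structure) and \<mm> +
  fixes I :: "'a set"
  assumes I: "ideal I R" "I \<subseteq> \<mm>"
begin

abbreviation "S \<equiv> R Quot I"
abbreviation "\<pi> \<equiv> (\<lambda>a. I +> a)"

lemma S_cring: "cring S" using ideal.quotient_is_cring[OF I(1) is_cring] .
lemma S_ring: "ring S" using S_cring by (rule cring.axioms(1))
lemma pi_hom: "\<pi> \<in> ring_hom R S" using ideal.rcos_ring_hom[OF I(1)] .
lemma pi_onto: "\<pi> ` carrier R = carrier S" by (auto simp: FactRing_def A_RCOSETS_def')

interpretation SS: cring S by (rule S_cring)
interpretation G: module R "reg_mod R" by (rule reg_mod_module)

lemma I_sub: "submodule I R (reg_mod R)" using I(1) by (simp add: submodule_reg_iff)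

lemma pi_eq_iff: "a \<in> carrier R \<Longrightarrow> b \<in> carrier R \<Longrightarrow> \<pi> a = \<pi> b \<longleftrightarrow> a \<ominus> b \<in> I"
  using G.coset_eq_iff[OF I_sub, of a b] by (simp add: reg_mod_minus a_r_coset_def')

lemma pi_semi: "semilinear R \<pi> (reg_mod R) (reg_mod S) \<pi>"
  by (rule semilinearI) (use ring_hom_closed[OF pi_hom] ring_hom_add[OF pi_hom] ring_hom_mult[OF pi_hom] in simp_all)

sublocale pi: semi_onto R "reg_mod R" S "reg_mod S" "\<pi>" "\<pi>"
  by (intro semi_onto.intro semi_map.intro semi_map_axioms.intro semi_onto_axioms.intro
      reg_mod_module SS.reg_mod_module pi_hom pi_semi) (simp add: pi_onto)

lemma pi_zero_iff: "a \<in> carrier R \<Longrightarrow> \<pi> a = \<zero>\<^bsub>S\<^esub> \<longleftrightarrow> a \<in> I"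
  using pi_eq_iff[of a \<zero>] pi.h_zero by (simp add: minus_eq)

lemma pi_ker: "pi.ker = I"
  using pi_zero_iff ideal_rules(1)[OF I(1)] by (auto simp: pi.ker_def)

lemma pi_one: "\<pi> \<one> = \<one>\<^bsub>S\<^esub>" using ring_hom_one[OF pi_hom] .

lemma vimage_ideal: "ideal J S \<Longrightarrow> ideal {a \<in> carrier R. \<pi> a \<in> J} R"
  using pi.vimage_sub[of J] by (simp add: submodule_reg_iff SS.submodule_reg_iff)

lemma image_vimage: "ideal J S \<Longrightarrow> \<pi> ` {a \<in> carrier R. \<pi> a \<in> J} = J"
proof -
  assume J: "ideal J S"
  have "y \<in> \<pi> ` {a \<in> carrier R. \<pi> a \<in> J}" if y: "y \<in> J" for y
  proof -
    have "y \<in> \<pi> ` carrier R" using SS.ideal_rules(1)[OF J y] by (simp only: pi_onto)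
    then obtain a where "a \<in> carrier R" "y = \<pi> a" by (rule imageE) simp
    then show ?thesis using y by (intro image_eqI[of _ _ a]) simp_all
  qed
  moreover have "\<pi> ` {a \<in> carrier R. \<pi> a \<in> J} \<subseteq> J" by (rule image_subsetI) simp
  ultimately show ?thesis by blast
qed

lemma image_ideal:
  assumes J: "ideal J R"
  shows "ideal (\<pi> ` J) S"
proof (rule SS.idealI_ring)
  note Jr = ideal_rules[OF J]
  show "\<pi> ` J \<subseteq> carrier S" using Jr(1) ring_hom_closed[OF pi_hom] by blast
  show "\<zero>\<^bsub>S\<^esub> \<in> \<pi> ` J" using Jr(2) pi.h_zero by (metis image_eqI reg_mod_simps(2))
  show "a \<oplus>\<^bsub>S\<^esub> b \<in> \<pi> ` J" if "a \<in> \<pi> ` J" "b \<in> \<pi> ` J" for a b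
  proof -
    from that obtain x y where "x \<in> J" "y \<in> J" "a = \<pi> x" "b = \<pi> y" by blast
    then show ?thesis using Jr(1,3) ring_hom_add[OF pi_hom, of x y] by (intro image_eqI[of _ _ "x \<oplus> y"]) auto
  qed
  show "a \<otimes>\<^bsub>S\<^esub> b \<in> \<pi> ` J" if "a \<in> carrier S" "b \<in> \<pi> ` J" for a b
  proof -
    from that obtain x y where "x \<in> carrier R" "y \<in> J" "a = \<pi> x" "b = \<pi> y" using pi_onto by (metis imageE)
    then show ?thesis using Jr(1,6) ring_hom_mult[OF pi_hom, of x y] by (intro image_eqI[of _ _ "x \<otimes> y"]) auto
  qed
qed

lemma mem_image_ideal_iff:
  assumes "ideal J R" "I \<subseteq> J" "a \<in> carrier R" shows "\<pi> a \<in> \<pi> ` J \<longleftrightarrow> a \<in> J"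
  using pi.mem_image_iff[of J a] assms by (simp add: pi_ker submodule_reg_iff)

lemma I_le_vimage:
  assumes "ideal J S" shows "I \<subseteq> {a \<in> carrier R. \<pi> a \<in> J}"
proof
  fix a assume a: "a \<in> I"
  then have "a \<in> carrier R" "\<pi> a = \<zero>\<^bsub>S\<^esub>" using ideal_rules(1)[OF I(1)] pi_zero_iff by auto
  then show "a \<in> {a \<in> carrier R. \<pi> a \<in> J}" using SS.ideal_rules(2)[OF assms] by simp
qed

lemma S_noetherian: "noetherian_ring S"
proof (rule SS.noetherian_ringI)
  fix J assume J: "ideal J S"
  let ?V = "{a \<in> carrier R. \<pi> a \<in> J}"
  obtain A where A: "A \<subseteq> carrier R" "finite A" "?V = genideal R A" using finetely_gen[OF vimage_ideal[OF J]] by blast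
  have AS: "\<pi> ` A \<subseteq> carrier S" using A(1) ring_hom_closed[OF pi_hom] by blast
  let ?G = "genideal S (\<pi> ` A)"
  have G: "ideal ?G S" by (rule SS.genideal_ideal[OF AS])
  have "A \<subseteq> ?V" unfolding A(3) by (rule genideal_self[OF A(1)])
  then have 1: "?G \<subseteq> J" by (intro SS.genideal_minimal[OF J] image_subsetI) blast
  have "genideal R A \<subseteq> {a \<in> carrier R. \<pi> a \<in> ?G}"
  proof (rule genideal_minimal[OF vimage_ideal[OF G]], rule subsetI)
    fix a assume a: "a \<in> A"
    then show "a \<in> {a \<in> carrier R. \<pi> a \<in> ?G}" using subsetD[OF A(1) a] subsetD[OF SS.genideal_self[OF AS] imageI[OF a]] by simp
  qed
  then have "\<pi> ` ?V \<subseteq> ?G" unfolding A(3) by blast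
  then have "J \<subseteq> ?G" by (simp only: image_vimage[OF J])
  with 1 have "J = ?G" by simp
  then show "\<exists>A\<subseteq>carrier S. finite A \<and> J = genideal S A" using A(2) AS by blast
qed

lemma S_proper_ideal:
  assumes J: "ideal J S" "J \<noteq> carrier S" shows "J \<subseteq> \<pi> ` \<mm>"
proof -
  let ?V = "{a \<in> carrier R. \<pi> a \<in> J}"
  have "?V \<noteq> carrier R" using image_vimage[OF J(1)] J(2) pi_onto by auto
  then have "?V \<subseteq> \<mm>" by (rule ideal_le_mm[OF vimage_ideal[OF J(1)]])
  then show ?thesis using image_vimage[OF J(1)] by blast
qed

lemma S_noeth_local: "noeth_local S (\<pi> ` \<mm>)"
proof -
  have id: "ideal (\<pi> ` \<mm>) S" by (rule image_ideal[OF ideal_mm])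
  have "\<pi> \<one> \<notin> \<pi> ` \<mm>" using mem_image_ideal_iff[OF ideal_mm I(2)] one_notin by simp
  then have ne: "\<pi> ` \<mm> \<noteq> carrier S" using ring_hom_closed[OF pi_hom one_closed] by metis
  have max: "maximalideal (\<pi> ` \<mm>) S"
  proof (rule maximalidealI[OF id])
    show "carrier S \<noteq> \<pi> ` \<mm>" using ne by simp
    fix J assume "ideal J S" "\<pi> ` \<mm> \<subseteq> J" "J \<subseteq> carrier S"
    then show "J = \<pi> ` \<mm> \<or> J = carrier S" using S_proper_ideal[of J] by blast
  qed
  have uq: "n = \<pi> ` \<mm>" if n: "maximalideal n S" for n
  proof -
    have n1: "ideal n S" "n \<noteq> carrier S"
      using maximalideal.axioms(1)[OF n] maximalideal.I_notcarr[OF n] by auto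
    then have "n \<subseteq> \<pi> ` \<mm>" by (rule S_proper_ideal)
    moreover have "\<pi> ` \<mm> \<subseteq> carrier S" using SS.ideal_rules(1)[OF id] by (rule subsetI)
    ultimately have "\<pi> ` \<mm> = n \<or> \<pi> ` \<mm> = carrier S" using maximalideal.I_maximal[OF n id] by simp
    then show ?thesis using ne by simp
  qed
  show ?thesis by (intro noeth_local.intro noeth_local_axioms.intro S_cring S_noetherian max) (rule uq)
qed

lemma vimage_prime:
  assumes P: "primeideal P S" shows "primeideal {a \<in> carrier R. \<pi> a \<in> P} R"
proof (rule primeidealI)
  note p = SS.prime_rules[OF P]
  show "ideal {a \<in> carrier R. \<pi> a \<in> P} R" by (rule vimage_ideal[OF p(1)])
  show "cring R" by (rule is_cring)
  have "\<one> \<notin> {a \<in> carrier R. \<pi> a \<in> P}" using p(2) pi_one by simp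
  then show "carrier R \<noteq> {a \<in> carrier R. \<pi> a \<in> P}" using one_closed by metis
  fix a b assume "a \<in> carrier R" "b \<in> carrier R" "a \<otimes> b \<in> {a \<in> carrier R. \<pi> a \<in> P}"
  then show "a \<in> {a \<in> carrier R. \<pi> a \<in> P} \<or> b \<in> {a \<in> carrier R. \<pi> a \<in> P}"
    using p(3)[of "\<pi> a" "\<pi> b"] ring_hom_mult[OF pi_hom, of a b] ring_hom_closed[OF pi_hom] by auto
qed

lemma image_ideal_prod:
  assumes "ideal A R" "ideal B R"
  shows "\<pi> ` (ideal_prod R A B) = ideal_prod S (\<pi> ` A) (\<pi> ` B)"
proof
  have c: "x \<in> carrier R" if "x \<in> A \<or> x \<in> B" for x using that ideal_rules(1) assms by blast
  have pc: "ideal_prod R A B \<subseteq> carrier R" by (rule ideal_prod_in_carrier[OF assms])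
  show "\<pi> ` (ideal_prod R A B) \<subseteq> ideal_prod S (\<pi> ` A) (\<pi> ` B)"
  proof (rule image_subsetI)
    fix x assume "x \<in> ideal_prod R A B"
    then show "\<pi> x \<in> ideal_prod S (\<pi> ` A) (\<pi> ` B)"
    proof induction
      case (prod i j)
      then show ?case using c ring_hom_mult[OF pi_hom, of i j] ideal_prod.prod[of "\<pi> i" "\<pi> ` A" "\<pi> j" "\<pi> ` B" S] by simp
    next
      case (sum s t)
      then show ?case using subsetD[OF pc sum.hyps(1)] subsetD[OF pc sum.hyps(2)] ring_hom_add[OF pi_hom, of s t]
          ideal_prod.sum[of "\<pi> s" S "\<pi> ` A" "\<pi> ` B" "\<pi> t"] by simp
    qed
  qed
  show "ideal_prod S (\<pi> ` A) (\<pi> ` B) \<subseteq> \<pi> ` (ideal_prod R A B)"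
  proof
    fix x assume "x \<in> ideal_prod S (\<pi> ` A) (\<pi> ` B)"
    then show "x \<in> \<pi> ` (ideal_prod R A B)"
    proof induction
      case (prod i j)
      then obtain a b where "a \<in> A" "b \<in> B" "i = \<pi> a" "j = \<pi> b" by blast
      then show ?case using c ring_hom_mult[OF pi_hom, of a b] ideal_prod.prod[of a A b B R]
        by (intro image_eqI[of _ _ "a \<otimes> b"]) auto
    next
      case (sum s t)
      then obtain a b where "a \<in> ideal_prod R A B" "b \<in> ideal_prod R A B" "s = \<pi> a" "t = \<pi> b" by blast
      then show ?case using pc ring_hom_add[OF pi_hom, of a b] ideal_prod.sum[of a R A B b]
        by (intro image_eqI[of _ _ "a \<oplus> b"]) auto
    qed
  qed
qed

lemma image_ideal_pow: "\<pi> ` (ideal_pow R \<mm> n) = ideal_pow S (\<pi> ` \<mm>) n"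
  by (induction n) (simp_all add: ideal_pow_simps pi_onto image_ideal_prod ideal_pow_ideal ideal_mm)

end

section \<open>Dimension and Loewy length modulo part of a witness\<close>

locale witness_quot = witness R \<mm> "(!) (xs @ ys)" "length (xs @ ys)" + local_quot R \<mm> "genideal R (set xs)"
  for R :: "('a, 'm) ring_scheme" (structure) and \<mm> and xs ys :: "'a list" +
  assumes power: "ideal_pow R \<mm> (gen_loewy_length R) \<subseteq> genideal R (set (xs @ ys))"
    and gll_pos: "gen_loewy_length R \<ge> 1"
begin

abbreviation "z \<equiv> (!) (xs @ ys)"
abbreviation "d \<equiv> length (xs @ ys)"
abbreviation "r \<equiv> length xs"
abbreviation "g \<equiv> gen_loewy_length R"

sublocale SS: noeth_local S "\<pi> ` \<mm>" by (rule S_noeth_local)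

lemma xys_mm: "set (xs @ ys) \<subseteq> \<mm>"
  using z_mm by (auto simp: in_set_conv_nth simp del: set_append)

lemma xys_carr: "set (xs @ ys) \<subseteq> carrier R" using xys_mm mm_carr by blast

lemma I_eq: "genideal R (set xs) = II r"
  using genideal_eq_msum[of xs] xys_carr msum_cong[of r "(!) xs" z "reg_mod R" "{\<zero>}"] by (simp add: nth_append)

lemma II_d_eq: "genideal R (set (xs @ ys)) = II d"
  by (rule genideal_eq_msum[OF xys_carr])

lemma ys_regular_S: "regular_seq S (reg_mod S) (map \<pi> ys)"
proof -
  have ysc: "set ys \<subseteq> carrier R" using xys_carr by auto
  have sub: "submodule (II i) R (reg_mod R)" if "i \<le> d" for i using II_ideal[OF that] by (simp add: submodule_reg_iff)
  have zys: "z (r + j) = ys ! j" for j by (simp add: nth_append)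
  have im: "msum (reg_mod S) ((!) (map \<pi> ys)) {\<zero>\<^bsub>reg_mod S\<^esub>} i = \<pi> ` II (r + i)" if i: "i \<le> length ys" for i
  proof -
    have "\<pi> ` II (r + i) = \<pi> ` msum (reg_mod R) (\<lambda>j. z (r + j)) (II r) i" by (simp add: msum_add)
    also have "\<dots> = msum (reg_mod S) (\<lambda>j. \<pi> (z (r + j))) (\<pi> ` II r) i"
      using i by (intro pi.msum_image sub z_carr) auto
    also have "\<pi> ` II r = {\<zero>\<^bsub>reg_mod S\<^esub>}" unfolding I_eq[symmetric] using pi.image_ker by (simp only: pi_ker)
    also have "msum (reg_mod S) (\<lambda>j. \<pi> (z (r + j))) {\<zero>\<^bsub>reg_mod S\<^esub>} i = msum (reg_mod S) ((!) (map \<pi> ys)) {\<zero>\<^bsub>reg_mod S\<^esub>} i"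
      using i by (intro msum_cong) (simp add: zys)
    finally show ?thesis by simp
  qed
  show ?thesis unfolding module.regular_seq_iff[OF cring.reg_mod_module[OF S_cring]]
  proof (intro conjI allI impI)
    show "set (map \<pi> ys) \<subseteq> carrier S" using ysc pi_onto by auto
    fix i assume "i < length (map \<pi> ys)"
    then have i: "i < length ys" by simp
    have le: "pi.ker \<subseteq> II (r + i)" unfolding pi_ker unfolding I_eq using II_mono[of r "r + i"] i by simp
    have "reg_on (reg_mod S) (\<pi> (z (r + i))) (\<pi> ` II (r + i))"
      using pi.reg_iff[OF sub le z_carr[of "r + i"]] z_reg[of "r + i"] i by (simp add: zys)
    then show "reg_on (reg_mod S) (map \<pi> ys ! i) (msum (reg_mod S) ((!) (map \<pi> ys)) {\<zero>\<^bsub>reg_mod S\<^esub>} i)"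
      using im[of i] i by (simp add: zys)
  next
    have "\<pi> ` II d \<noteq> carrier S"
    proof -
      have "\<pi> ` II d \<subseteq> \<pi> ` \<mm>" using II_le_mm[of d] by blast
      then show ?thesis using SS.one_notin ring.ring_simprules(6)[OF S_ring] by blast
    qed
    then show "msum (reg_mod S) ((!) (map \<pi> ys)) {\<zero>\<^bsub>reg_mod S\<^esub>} (length (map \<pi> ys)) \<noteq> carrier (reg_mod S)"
      using im[of "length ys"] by simp
  qed
qed

text \<open>
  A chain of primes of \<open>S\<close> pulls back to one of \<open>R\<close> above the ideal of \<open>xs\<close>, and the regular sequence
  \<open>xs\<close> adds \<open>r\<close> primes below it. The images of \<open>ys\<close> give the other inequality.
\<close>

lemma krull_dim_S: "krull_dim S = enat (length ys)"
proof (rule antisym)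
  show "enat (length ys) \<le> krull_dim S"
    using SS.regular_seq_le_krull_dim[OF cring.reg_mod_module[OF S_cring] ys_regular_S] by simp
  show "krull_dim S \<le> enat (length ys)"
    unfolding krull_dim_def[of S]
  proof (rule Sup_least, safe)
    fix n and P :: "nat \<Rightarrow> 'a set set"
    assume P: "\<forall>i\<le>n. primeideal (P i) S" "\<forall>i<n. P i \<subset> P (Suc i)"
    define A where "A i = {a \<in> carrier R. \<pi> a \<in> P i}" for i
    have Pid: "ideal (P i) S" if "i \<le> n" for i using P(1) that cring.prime_rules(1)[OF S_cring] by blast
    have Ap: "primeideal (A i) R" if "i \<le> n" for i unfolding A_def using P(1) that vimage_prime by blast
    have As: "A i \<subset> A (Suc i)" if "i < n" for i
    proof
      show "A i \<subseteq> A (Suc i)" using P(2) that by (auto simp: A_def)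
      have "\<pi> ` A i = P i" "\<pi> ` A (Suc i) = P (Suc i)"
        unfolding A_def using that by (intro image_vimage Pid; simp)+
      then show "A i \<noteq> A (Suc i)" using P(2) that by (metis psubset_eq)
    qed
    have "II r \<subseteq> A 0" unfolding A_def I_eq[symmetric] by (rule I_le_vimage[OF Pid]) simp
    then have "annq R (reg_mod R) (II r) \<subseteq> A 0" by (simp add: annq_II)
    then have "\<exists>B. B r = A 0 \<and> (\<forall>i\<le>r. primeideal (B i) R) \<and> (\<forall>i<r. B i \<subset> B (Suc i)) \<and> annq R (reg_mod R) {\<zero>} \<subseteq> B 0"
      using module.sub_zero_set[OF reg_mod_module] z_carr z_reg Ap[of 0]
      by (intro regular_imp_prime_chain[OF noetherian_ring_axioms reg_mod_module]) auto
    then obtain B where B: "B r = A 0" "\<forall>i\<le>r. primeideal (B i) R" "\<forall>i<r. B i \<subset> B (Suc i)" by blast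
    define C where "C j = (if j \<le> r then B j else A (j - r))" for j
    have "\<forall>j\<le>r + n. primeideal (C j) R" using Ap B(2) by (auto simp: C_def)
    moreover have "\<forall>j<r + n. C j \<subset> C (Suc j)"
    proof (intro allI impI)
      fix j assume j: "j < r + n"
      consider "j < r" | "j = r" | "j > r" by linarith
      then show "C j \<subset> C (Suc j)"
      proof cases
        case 1 then show ?thesis using B(3) by (simp add: C_def)
      next
        case 2 then show ?thesis using As[of 0] B(1) j by (simp add: C_def)
      next
        case 3
        then have "Suc (j - r) = Suc j - r" by simp
        then show ?thesis using As[of "j - r"] j 3 by (simp add: C_def)
      qed
    qed
    ultimately have "enat (r + n) \<le> krull_dim R" by (rule prime_chain_le_krull_dim)
    then show "enat n \<le> enat (length ys)" by (simp add: dim)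
  qed
qed

lemma genideal_S:
  assumes us: "set us \<subseteq> carrier R"
  shows "genideal S (set (map \<pi> us)) = \<pi> ` genideal R (set (xs @ us))"
proof
  have xc: "set xs \<subseteq> carrier R" using xys_carr by simp
  have xu: "set (xs @ us) \<subseteq> carrier R" using us xc by simp
  have id: "ideal (genideal R (set (xs @ us))) R" by (rule genideal_ideal[OF xu])
  have pus: "set (map \<pi> us) \<subseteq> carrier S" using us pi_onto by auto
  have idS: "ideal (genideal S (set (map \<pi> us))) S" by (rule ring.genideal_ideal[OF S_ring pus])
  show "genideal S (set (map \<pi> us)) \<subseteq> \<pi> ` genideal R (set (xs @ us))"
    using genideal_self[OF xu] by (intro ring.genideal_minimal[OF S_ring image_ideal[OF id]]) auto
  have "set (xs @ us) \<subseteq> {a \<in> carrier R. \<pi> a \<in> genideal S (set (map \<pi> us))}"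
    using xu ring.genideal_self[OF S_ring pus] I_le_vimage[OF idS] genideal_self[OF xc] by auto
  then have "genideal R (set (xs @ us)) \<subseteq> {a \<in> carrier R. \<pi> a \<in> genideal S (set (map \<pi> us))}"
    by (rule genideal_minimal[OF vimage_ideal[OF idS]])
  then show "\<pi> ` genideal R (set (xs @ us)) \<subseteq> genideal S (set (map \<pi> us))" by blast
qed

text \<open>
  The images of \<open>ys\<close> show \<open>\<le>\<close>. A system of parameters of \<open>S\<close>, lifted to \<open>R\<close> and appended to
  \<open>xs\<close>, is a system of parameters of \<open>R\<close> whose ideal contains the same power of \<open>\<mm>\<close>; this shows \<open>\<ge>\<close>.
\<close>

lemma gen_loewy_length_S: "gen_loewy_length S = g"
  unfolding gen_loewy_length_def[of S] SS.max_ideal_eq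
proof (rule Least_equality)
  have ysm: "set (map \<pi> ys) \<subseteq> \<pi> ` \<mm>" using xys_mm by auto
  have pw: "ideal_pow S (\<pi> ` \<mm>) g \<subseteq> genideal S (set (map \<pi> ys))"
  proof -
    have "set ys \<subseteq> carrier R" using xys_carr by simp
    then have "genideal S (set (map \<pi> ys)) = \<pi> ` genideal R (set (xs @ ys))" by (rule genideal_S)
    then show ?thesis unfolding image_ideal_pow[symmetric] using image_mono[OF power] by (simp only:)
  qed
  show "1 \<le> g \<and> (\<exists>us. system_of_parameters S us \<and> ideal_pow S (\<pi> ` \<mm>) g \<subseteq> genideal S (set us))"
    using SS.system_of_parametersI[OF ysm _ pw] krull_dim_S pw gll_pos by (intro conjI exI[of _ "map \<pi> ys"]) simp_all
next
  fix n assume "1 \<le> n \<and> (\<exists>us. system_of_parameters S us \<and> ideal_pow S (\<pi> ` \<mm>) n \<subseteq> genideal S (set us))"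
  then obtain vs where n: "1 \<le> n" and vs: "system_of_parameters S vs" "ideal_pow S (\<pi> ` \<mm>) n \<subseteq> genideal S (set vs)" by blast
  have vsm: "set vs \<subseteq> \<pi> ` \<mm>" "length vs = length ys"
    using vs(1) krull_dim_S by (auto simp: system_of_parameters_def SS.max_ideal_eq)
  have "\<exists>us. set us \<subseteq> \<mm> \<and> vs = map \<pi> us" using vsm(1)
  proof (induction vs)
    case (Cons v vs)
    then obtain u us where "set us \<subseteq> \<mm>" "vs = map \<pi> us" "u \<in> \<mm>" "v = \<pi> u" by auto
    then show ?case by (intro exI[of _ "u # us"]) auto
  qed simp
  then obtain us where us: "set us \<subseteq> \<mm>" "vs = map \<pi> us" by blast
  have usc: "set us \<subseteq> carrier R" using us mm_carr by blast
  have xuc: "set (xs @ us) \<subseteq> carrier R" using usc xys_carr by simp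
  have id: "ideal (genideal R (set (xs @ us))) R" by (rule genideal_ideal[OF xuc])
  have Ile: "genideal R (set xs) \<subseteq> genideal R (set (xs @ us))"
    using xuc genideal_self[OF xuc] by (intro genideal_minimal[OF id]) auto
  have pw: "ideal_pow R \<mm> n \<subseteq> genideal R (set (xs @ us))"
  proof
    fix a assume a: "a \<in> ideal_pow R \<mm> n"
    have ac: "a \<in> carrier R" using ideal_rules(1)[OF ideal_pow_ideal[OF ideal_mm] a] .
    have "\<pi> a \<in> \<pi> ` genideal R (set (xs @ us))"
      using a vs(2) unfolding image_ideal_pow[symmetric] us(2) genideal_S[OF usc] by blast
    then show "a \<in> genideal R (set (xs @ us))" using mem_image_ideal_iff[OF id Ile ac] by simp
  qed
  have "system_of_parameters R (xs @ us)"
    using us xys_mm vsm dim by (intro system_of_parametersI[OF _ _ pw]) auto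
  then have "1 \<le> n \<and> (\<exists>us. system_of_parameters R us \<and> ideal_pow R (max_ideal R) n \<subseteq> genideal R (set us))"
    using n pw unfolding max_ideal_eq by blast
  then show "g \<le> n" unfolding gen_loewy_length_def by (rule Least_le)
qed

end


section \<open>Auslander's invariant of cyclic modules\<close>

context noeth_local
begin

lemma unit_value_free_summand:
  assumes X: "module R X" and f: "f \<in> mod_hom R X (reg_mod R)" and x: "x \<in> carrier X" "f x \<notin> \<mm>"
  shows "has_free_summand R X"
proof -
  interpret X: module R X by fact
  obtain u where u: "u \<in> carrier R" "u \<otimes> f x = \<one>" using unit_iff[OF _ x(2)] mod_homD(1)[OF f x(1)] by auto
  have "f (u \<odot>\<^bsub>X\<^esub> x) = \<one>" using mod_homD(3)[OF f u(1) x(1)] u(2) by simp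
  then show ?thesis unfolding has_free_summand_iff[OF X] using f X.smult_closed[OF u(1) x(1)] by blast
qed

definition delta_zero_witness :: "'a set \<Rightarrow> ('a, (nat \<Rightarrow> 'a) set) module \<Rightarrow> bool" where
  "delta_zero_witness J X \<longleftrightarrow> module R X \<and> (carrier X = {\<zero>\<^bsub>X\<^esub>} \<or> maximal_cm R X) \<and> \<not> has_free_summand R X \<and>
     (\<exists>f\<in>mod_hom R X (quot_mod (reg_mod R) J). f ` carrier X = carrier (quot_mod (reg_mod R) J))"

text \<open>\<open>R \<rightarrow> R/J\<close> with \<open>X = 0\<close> shows \<open>\<delta>(R/J) \<le> 1\<close>, and for \<open>\<delta>(R/J) = 0\<close> the summand \<open>R\<^sup>0\<close> drops out.\<close>

lemma delta_cyclic:
  assumes J: "ideal J R"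
  shows "auslander_delta R (quot_mod (reg_mod R) J) = 0 \<longleftrightarrow> (\<exists>X. delta_zero_witness J X)"
    "auslander_delta R (quot_mod (reg_mod R) J) \<le> 1"
proof -
  interpret G: module R "reg_mod R" by (rule reg_mod_module)
  have Js: "submodule J R (reg_mod R)" using J by (simp add: submodule_reg_iff)
  let ?Q = "quot_mod (reg_mod R) J"
  let ?q = "\<lambda>x. J +>\<^bsub>reg_mod R\<^esub> x"
  note q = mod_homD[OF G.quot_proj_hom[OF Js]]
  define P where "P n \<longleftrightarrow> (\<exists>X :: ('a, (nat \<Rightarrow> 'a) set) module.
     module R X \<and> (carrier X = {\<zero>\<^bsub>X\<^esub>} \<or> maximal_cm R X) \<and> \<not> has_free_summand R X \<and>
     (\<exists>f\<in>mod_hom R (dsum_mod X (free_mod R n)) ?Q.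
        f ` carrier (dsum_mod X (free_mod R n)) = carrier ?Q))" for n
  have delta: "auslander_delta R ?Q = (LEAST n. P n)" by (simp add: auslander_delta_def P_def)
  have P1: "P 1"
  proof -
    let ?X = "\<lparr>carrier = {{}}, monoid.mult = (\<lambda>x y. {}), one = {}, zero = {}, add = (\<lambda>x y. {}),
      smult = (\<lambda>a x. {})\<rparr> :: ('a, (nat \<Rightarrow> 'a) set) module"
    have X: "module R ?X"
    proof (rule moduleI)
      show "abelian_group ?X" by (rule abelian_groupI) auto
    qed (auto simp: is_cring)
    have "\<not> has_free_summand R ?X"
    proof
      assume "has_free_summand R ?X"
      then obtain f x where f: "f \<in> mod_hom R ?X (reg_mod R)" "x \<in> carrier ?X" "f x = \<one>"
        unfolding has_free_summand_iff[OF X] by blast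
      then have "f \<zero>\<^bsub>?X\<^esub> = \<one>" by simp
      then have "\<one> = \<zero>" using mod_hom_zero_minus(1)[OF X G.module_axioms f(1)] by simp
      then show False using one_notin ideal_rules(2)[OF ideal_mm] by simp
    qed
    moreover have "(\<lambda>(x, v). ?q (v 0)) \<in> mod_hom R (dsum_mod ?X (free_mod R 1)) ?Q"
    proof (rule mod_homI)
      fix x assume "x \<in> carrier (dsum_mod ?X (free_mod R 1))"
      then obtain v where "x = ({}, v)" "v \<in> carrier (free_mod R 1)" by (auto simp: dsum_mod_def)
      then show "(case x of (x, v) \<Rightarrow> ?q (v 0)) \<in> carrier ?Q" using q(1)[of "v 0"] by (auto simp: free_mod_def)
    next
      fix x y assume "x \<in> carrier (dsum_mod ?X (free_mod R 1))" "y \<in> carrier (dsum_mod ?X (free_mod R 1))"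
      then obtain v w where "x = ({}, v)" "v \<in> carrier (free_mod R 1)" "y = ({}, w)" "w \<in> carrier (free_mod R 1)"
        by (auto simp: dsum_mod_def)
      moreover from this have "v 0 \<in> carrier R" "w 0 \<in> carrier R" by (auto simp: free_mod_def)
      ultimately show "(case x \<oplus>\<^bsub>dsum_mod ?X (free_mod R 1)\<^esub> y of (x, v) \<Rightarrow> ?q (v 0)) =
          (case x of (x, v) \<Rightarrow> ?q (v 0)) \<oplus>\<^bsub>?Q\<^esub> (case y of (x, v) \<Rightarrow> ?q (v 0))"
        using q(2)[of "v 0" "w 0"] by (simp add: dsum_mod_def free_mod_apply)
    next
      fix a x assume "a \<in> carrier R" "x \<in> carrier (dsum_mod ?X (free_mod R 1))"
      then obtain v where "x = ({}, v)" "v \<in> carrier (free_mod R 1)" "a \<in> carrier R" by (auto simp: dsum_mod_def)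
      moreover from this have "v 0 \<in> carrier R" by (auto simp: free_mod_def)
      ultimately show "(case a \<odot>\<^bsub>dsum_mod ?X (free_mod R 1)\<^esub> x of (x, v) \<Rightarrow> ?q (v 0)) =
          a \<odot>\<^bsub>?Q\<^esub> (case x of (x, v) \<Rightarrow> ?q (v 0))"
        using q(3)[of a "v 0"] by (simp add: dsum_mod_def free_mod_apply)
    qed
    moreover have "(\<lambda>(x, v). ?q (v 0)) ` carrier (dsum_mod ?X (free_mod R 1)) = carrier ?Q"
    proof
      show "(\<lambda>(x, v). ?q (v 0)) ` carrier (dsum_mod ?X (free_mod R 1)) \<subseteq> carrier ?Q"
        using mod_homD(1)[OF calculation(2)] by blast
      show "carrier ?Q \<subseteq> (\<lambda>(x, v). ?q (v 0)) ` carrier (dsum_mod ?X (free_mod R 1))"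
      proof
        fix y assume "y \<in> carrier ?Q"
        then obtain a where a: "a \<in> carrier R" "y = ?q a" by (auto elim: quot_mod_carrierE)
        have "({}, \<lambda>i\<in>{..<1}. a) \<in> carrier (dsum_mod ?X (free_mod R 1))" using a by (simp add: dsum_mod_def free_mod_def)
        then show "y \<in> (\<lambda>(x, v). ?q (v 0)) ` carrier (dsum_mod ?X (free_mod R 1))"
          using a(2) by (intro image_eqI[of _ _ "({}, \<lambda>i\<in>{..<1}. a)"]) auto
      qed
    qed
    ultimately show ?thesis unfolding P_def using X by (intro exI[of _ ?X] conjI) (auto intro!: bexI[of _ "\<lambda>(x, v). ?q (v 0)"])
  qed
  then show "auslander_delta R ?Q \<le> 1" unfolding delta by (rule Least_le)
  have F0: "carrier (free_mod R 0) = {\<lambda>i. undefined}" "\<zero>\<^bsub>free_mod R 0\<^esub> = (\<lambda>i. undefined)"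
     "x \<oplus>\<^bsub>free_mod R 0\<^esub> y = (\<lambda>i. undefined)" "a \<odot>\<^bsub>free_mod R 0\<^esub> x = (\<lambda>i. undefined)" for a x y
    by (simp_all add: free_mod_def restrict_def)
  have P0: "P 0 \<longleftrightarrow> (\<exists>X. delta_zero_witness J X)"
  proof
    assume "P 0"
    then obtain X :: "('a, (nat \<Rightarrow> 'a) set) module" and f where X: "module R X" "carrier X = {\<zero>\<^bsub>X\<^esub>} \<or> maximal_cm R X"
      "\<not> has_free_summand R X" "f \<in> mod_hom R (dsum_mod X (free_mod R 0)) ?Q"
      "f ` carrier (dsum_mod X (free_mod R 0)) = carrier ?Q" unfolding P_def by blast
    note fD = mod_homD[OF X(4)]
    let ?f = "\<lambda>x. f (x, \<lambda>i. undefined)"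
    have "?f \<in> mod_hom R X ?Q"
    proof (rule mod_homI)
      show "?f x \<in> carrier ?Q" if "x \<in> carrier X" for x using fD(1)[of "(x, \<lambda>i. undefined)"] that by (simp add: dsum_mod_def F0)
      show "?f (x \<oplus>\<^bsub>X\<^esub> y) = ?f x \<oplus>\<^bsub>?Q\<^esub> ?f y" if "x \<in> carrier X" "y \<in> carrier X" for x y
        using fD(2)[of "(x, \<lambda>i. undefined)" "(y, \<lambda>i. undefined)"] that by (simp add: dsum_mod_def F0)
      show "?f (a \<odot>\<^bsub>X\<^esub> x) = a \<odot>\<^bsub>?Q\<^esub> ?f x" if "a \<in> carrier R" "x \<in> carrier X" for a x
        using fD(3)[of a "(x, \<lambda>i. undefined)"] that by (simp add: dsum_mod_def F0)
    qed
    moreover have "?f ` carrier X = carrier ?Q" unfolding X(5)[symmetric] by (auto simp: dsum_mod_def F0)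
    ultimately show "\<exists>X. delta_zero_witness J X" unfolding delta_zero_witness_def using X(1-3) by blast
  next
    assume "\<exists>X. delta_zero_witness J X"
    then obtain X where X0: "delta_zero_witness J X" by (rule exE)
    then obtain f where X: "module R X" "carrier X = {\<zero>\<^bsub>X\<^esub>} \<or> maximal_cm R X"
      "\<not> has_free_summand R X" "f \<in> mod_hom R X ?Q" "f ` carrier X = carrier ?Q"
      by (auto simp: delta_zero_witness_def)
    note fD = mod_homD[OF X(4)]
    have "(\<lambda>x. f (fst x)) \<in> mod_hom R (dsum_mod X (free_mod R 0)) ?Q"
      by (rule mod_homI) (use fD in \<open>simp_all add: dsum_mod_def mem_Times_iff split_beta\<close>)
    moreover have "(\<lambda>x. f (fst x)) ` carrier (dsum_mod X (free_mod R 0)) = carrier ?Q"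
      unfolding X(5)[symmetric] by (simp add: dsum_mod_def F0 image_def)
    ultimately show "P 0" unfolding P_def using X(1-3) by (intro exI[of _ X] conjI bexI) assumption+
  qed
  have "(LEAST n. P n) = 0 \<longleftrightarrow> P 0"
  proof
    assume "(LEAST n. P n) = 0"
    then show "P 0" using LeastI[of P 1] P1 by simp
  next
    assume "P 0" then show "(LEAST n. P n) = 0" using Least_le[of P 0] by simp
  qed
  then show "auslander_delta R ?Q = 0 \<longleftrightarrow> (\<exists>X. delta_zero_witness J X)" unfolding delta P0 .
qed

lemma delta_zero_witnessD:
  assumes J: "ideal J R" "J \<subseteq> \<mm>" and X: "delta_zero_witness J X"
  shows "maximal_cm R X"
proof -
  interpret G: module R "reg_mod R" by (rule reg_mod_module)
  have Js: "submodule J R (reg_mod R)" using J by (simp add: submodule_reg_iff)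
  let ?Q = "quot_mod (reg_mod R) J"
  have XM: "module R X" using X by (simp add: delta_zero_witness_def)
  obtain f where f: "f \<in> mod_hom R X ?Q" "f ` carrier X = carrier ?Q" using X by (auto simp: delta_zero_witness_def)
  have "carrier X \<noteq> {\<zero>\<^bsub>X\<^esub>}"
  proof
    assume "carrier X = {\<zero>\<^bsub>X\<^esub>}"
    then have "carrier ?Q = {\<zero>\<^bsub>?Q\<^esub>}"
      using f(2) mod_hom_zero_minus(1)[OF XM G.quot_mod_module[OF Js] f(1)] by simp
    then have "J +>\<^bsub>reg_mod R\<^esub> \<one> = \<zero>\<^bsub>?Q\<^esub>" using quot_mod_carrierI[of \<one> "reg_mod R" J] by simp
    then show False using G.quot_proj_zero_iff[OF Js, of \<one>] J(2) one_notin by auto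
  qed
  then show ?thesis using X by (simp add: delta_zero_witness_def)
qed

end

section \<open>Lifting maps across a change of rings\<close>

context semi_map
begin

lemma h_lin:
  assumes "v \<in> {..<k} \<rightarrow> carrier R" "b \<in> {..<k} \<rightarrow> carrier M"
  shows "h (lin M k v b) = lin X k (\<lambda>i. \<pi> (v i)) (\<lambda>i. h (b i))"
  using assms
proof (induction k)
  case 0 then show ?case by (simp add: M.lin_0 X.lin_0 h_zero)
next
  case (Suc k)
  have 1: "v k \<in> carrier R" "b k \<in> carrier M" "v \<in> {..<k} \<rightarrow> carrier R" "b \<in> {..<k} \<rightarrow> carrier M"
    using Suc.prems by auto
  have "lin X (Suc k) (\<lambda>i. \<pi> (v i)) (\<lambda>i. h (b i)) = \<pi> (v k) \<odot>\<^bsub>X\<^esub> h (b k) \<oplus>\<^bsub>X\<^esub> lin X k (\<lambda>i. \<pi> (v i)) (\<lambda>i. h (b i))"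
    using Suc.prems piD hD(1) by (intro X.lin_Suc) auto
  moreover have "lin M (Suc k) v b = v k \<odot>\<^bsub>M\<^esub> b k \<oplus>\<^bsub>M\<^esub> lin M k v b"
    using Suc.prems by (intro M.lin_Suc) auto
  ultimately show ?case
    using 1 Suc.IH M.lin_closed[OF 1(3,4)] hD by simp
qed

end

lemma (in semi_onto) image_sub:
  assumes N: "submodule N R M" and po: "\<pi> ` carrier R = carrier S"
  shows "submodule (h ` N) S X"
proof (rule X.subI)
  note Nr = M.sub_rules[OF N]
  show "h ` N \<subseteq> carrier X" using Nr(1) hD(1) by blast
  show "\<zero>\<^bsub>X\<^esub> \<in> h ` N" using Nr(2) h_zero by (metis imageI)
  show "a \<oplus>\<^bsub>X\<^esub> b \<in> h ` N" if "a \<in> h ` N" "b \<in> h ` N" for a b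
  proof -
    from that obtain x y where "x \<in> N" "y \<in> N" "a = h x" "b = h y" by blast
    then show ?thesis using Nr(1)[of x] Nr(1)[of y] Nr(3)[of x y] hD(2)[of x y]
      by (intro image_eqI[of _ _ "x \<oplus>\<^bsub>M\<^esub> y"]) simp_all
  qed
  show "a \<odot>\<^bsub>X\<^esub> b \<in> h ` N" if "a \<in> carrier S" "b \<in> h ` N" for a b
  proof -
    from that obtain x y where "x \<in> carrier R" "y \<in> N" "a = \<pi> x" "b = h y" using po by (metis imageE)
    then show ?thesis using Nr(1)[of y] Nr(6)[of x y] hD(3)[of x y] by (intro image_eqI[of _ _ "x \<odot>\<^bsub>M\<^esub> y"]) simp_all
  qed
qed

text \<open>\<open>N k\<close> is generated by \<open>K\<close> and multiples of the \<open>z\<^bsub>r+j\<^esub>\<close>.\<close>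

lemma (in presentation) hom_N_in_ideal:
  assumes l: "l \<in> mod_hom R F (reg_mod R)" and A: "ideal A R" and K_A: "\<And>v. v \<in> K \<Longrightarrow> l v \<in> A"
    and zA: "\<And>j. j < k \<Longrightarrow> z (r + j) \<in> A" and k: "r + k \<le> d" and v: "v \<in> N k"
  shows "l v \<in> A"
  using zA k v
proof (induction k arbitrary: v)
  case 0 then show ?case using K_A by simp
next
  case (Suc k)
  interpret F: module R F by (rule F_mod)
  note lD = mod_homD[OF l]
  have zc: "z (r + k) \<in> carrier R" using z_carr Suc.prems by simp
  obtain p x where px: "p \<in> N k" "x \<in> carrier F" "v = p \<oplus>\<^bsub>F\<^esub> z (r + k) \<odot>\<^bsub>F\<^esub> x"
    using Suc.prems(3) unfolding msum.simps by (rule F.addmE)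
  have pc: "p \<in> carrier F" using F.sub_carr[OF N_sub px(1)] Suc.prems by simp
  have "z (r + k) \<otimes> l x \<in> A" using ideal_rules(7)[OF A] lD(1)[OF px(2)] Suc.prems(1) by simp
  moreover have "l p \<in> A" using Suc px(1) by simp
  moreover have "l v = l p \<oplus> z (r + k) \<otimes> l x"
    unfolding px(3) using lD(2)[OF pc, of "z (r + k) \<odot>\<^bsub>F\<^esub> x"] lD(3)[OF zc px(2)] px(2) zc by simp
  ultimately show ?case using ideal_rules(3)[OF A] by simp
qed

lemma (in cring) id_ring_hom: "(\<lambda>a. a) \<in> ring_hom R R"
  by (rule ring_hom_memI) auto

text \<open>Free modules are projective, also across a change of rings.\<close>

lemma lift_to_ring:
  assumes S: "cring R" "cring S" and pi: "semilinear R \<pi> (reg_mod R) Y q" "\<pi> \<in> ring_hom R S"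
    and Y: "module S Y" and onto: "q ` carrier R = carrier Y" and g: "semilinear R \<pi> (free_mod R s) Y g"
  shows "\<exists>l\<in>mod_hom R (free_mod R s) (reg_mod R). \<forall>v\<in>carrier (free_mod R s). q (l v) = g v"
proof -
  interpret R: cring R by fact
  interpret G: module R "reg_mod R" by (rule R.reg_mod_module)
  interpret F: module R "free_mod R s" by (rule R.free_mod_module)
  interpret q: semi_map R "reg_mod R" S Y \<pi> q
    by (intro semi_map.intro semi_map_axioms.intro G.module_axioms Y pi)
  interpret g: semi_map R "free_mod R s" S Y \<pi> g
    by (intro semi_map.intro semi_map_axioms.intro F.module_axioms Y pi g)
  have "\<forall>i. \<exists>t. t \<in> carrier R \<and> q t = g (unitv R s i)"
    using onto g.hD(1) G.unitv_carrier by (metis imageE)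
  then obtain t where t: "\<And>i. t i \<in> carrier R" "\<And>i. q (t i) = g (unitv R s i)" by metis
  have tP: "t \<in> {..<s} \<rightarrow> carrier (reg_mod R)" using t by simp
  have "q (lin (reg_mod R) s v t) = g v" if v: "v \<in> carrier (free_mod R s)" for v
  proof -
    have "q (lin (reg_mod R) s v t) = lin Y s (\<lambda>i. \<pi> (v i)) (\<lambda>i. g (unitv R s i))"
      using q.h_lin[OF free_mod_Pi[OF v] tP] t(2) by simp
    also have "\<dots> = g (lin (free_mod R s) s v (unitv R s))"
      by (rule g.h_lin[symmetric]) (use free_mod_Pi[OF v] G.unitv_carrier in auto)
    also have "\<dots> = g v" using R.lin_reg_unit[OF v] by simp
    finally show ?thesis .
  qed
  then show ?thesis by (intro bexI[OF _ G.lin_mod_hom[OF tP]]) simp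
qed


section \<open>The index of the quotient\<close>

locale index_reduction = witness_quot R \<mm> xs ys +
  inj_res R \<mm> "(!) (xs @ ys)" "length (xs @ ys)" E \<phi> \<omega> \<epsilon> n
  for R :: "('a, 'm) ring_scheme" (structure) and \<mm> and xs ys :: "'a list"
    and E :: "nat \<Rightarrow> ('a, 'e) module" and \<phi> and \<omega> :: "('a, 'b, 'n) module_scheme" and \<epsilon> and n +
  assumes tr: "\<mm> \<subseteq> trace_ideal R \<omega>"
begin

abbreviation "JS k \<equiv> ideal_pow S (\<pi> ` \<mm>) k"

lemma reg_S: "module S (reg_mod S)" by (rule cring.reg_mod_module[OF S_cring])
lemma JS_ideal: "ideal (JS k) S" by (rule cring.ideal_pow_ideal[OF S_cring SS.ideal_mm])
lemma JS_sub: "submodule (JS k) S (reg_mod S)" using JS_ideal by (simp add: cring.submodule_reg_iff[OF S_cring])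
lemma JS_module: "module S (quot_mod (reg_mod S) (JS k))" by (rule module.quot_mod_module[OF reg_S JS_sub])

text \<open>The composite \<open>R \<rightarrow> S \<rightarrow> S/\<mm>\<^sup>kS\<close>.\<close>

abbreviation "qS k a \<equiv> JS k +>\<^bsub>reg_mod S\<^esub> (\<pi> a)"

lemma pi_carr: "a \<in> carrier R \<Longrightarrow> \<pi> a \<in> carrier S" by (rule ring_hom_closed[OF pi_hom])

lemma qS_semi: "semilinear R \<pi> (reg_mod R) (quot_mod (reg_mod S) (JS k)) (qS k)"
proof -
  note q = mod_homD[OF module.quot_proj_hom[OF reg_S JS_sub]]
  show ?thesis
    by (rule semilinearI)
      (use q pi_carr ring_hom_add[OF pi_hom] ring_hom_mult[OF pi_hom] in simp_all)
qed

lemma qS_onto: "qS k ` carrier R = carrier (quot_mod (reg_mod S) (JS k))"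
proof -
  have "qS k ` carrier R = (\<lambda>s. JS k +>\<^bsub>reg_mod S\<^esub> s) ` (\<pi> ` carrier R)" by (simp add: image_image)
  then show ?thesis unfolding pi_onto by (auto simp: quot_mod_simps)
qed

lemma qS_eq_iff: "a \<in> carrier R \<Longrightarrow> b \<in> carrier R \<Longrightarrow> qS k a = qS k b \<longleftrightarrow> \<pi> (a \<ominus> b) \<in> JS k"
  using module.coset_eq_iff[OF reg_S JS_sub, of "\<pi> a" "\<pi> b" k] pi_carr pi.h_minus[of a b]
  by (simp add: reg_mod_minus)

lemma qS_zero_iff: "a \<in> carrier R \<Longrightarrow> qS k a = \<zero>\<^bsub>quot_mod (reg_mod S) (JS k)\<^esub> \<longleftrightarrow> \<pi> a \<in> JS k"
  using module.quot_proj_zero_iff[OF reg_S JS_sub, of "\<pi> a" k] pi_carr by simp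

lemma z_shift: "z (r + j) = ys ! j" by (simp add: nth_append)

lemma pi_mem_mm: "a \<in> carrier R \<Longrightarrow> \<pi> a \<in> \<pi> ` \<mm> \<longleftrightarrow> a \<in> \<mm>"
  by (rule mem_image_ideal_iff[OF ideal_mm I(2)])

lemma pi_JS_mm: "a \<in> carrier R \<Longrightarrow> k \<ge> 1 \<Longrightarrow> \<pi> a \<in> JS k \<Longrightarrow> a \<in> \<mm>"
  using cring.ideal_pow_le[OF S_cring SS.ideal_mm, of k] pi_mem_mm by blast

lemma not_mm_if_minus_one: "a \<in> carrier R \<Longrightarrow> a \<ominus> \<one> \<in> \<mm> \<Longrightarrow> a \<notin> \<mm>"
proof
  assume a: "a \<in> carrier R" "a \<ominus> \<one> \<in> \<mm>" "a \<in> \<mm>"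
  have "a \<ominus> (a \<ominus> \<one>) \<in> \<mm>" by (rule ideal_rules(5)[OF ideal_mm a(3,2)])
  moreover have "a \<ominus> (a \<ominus> \<one>) = \<one>" using a(1) by (simp add: minus_eq minus_add r_neg2)
  ultimately show False using one_notin by simp
qed

text \<open>
  A maximal Cohen-Macaulay \<open>S\<close>-module \<open>X\<close> that maps onto \<open>S/\<mm>\<^sup>gS\<close> also maps onto
  \<open>R/(xs, ys)\<close>, as \<open>\<mm>\<^sup>g \<subseteq> (xs, ys)\<close>. The surjection lifts to \<open>S\<close>, so \<open>X\<close> has a free summand.
\<close>

lemma no_delta_zero_witness_g: "\<not> SS.delta_zero_witness (JS g) X"
proof
  assume X: "SS.delta_zero_witness (JS g) X"
  let ?Q = "quot_mod (reg_mod S) (JS g)"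
  have Jm: "JS g \<subseteq> \<pi> ` \<mm>" by (rule cring.ideal_pow_le[OF S_cring SS.ideal_mm gll_pos])
  have mcm: "maximal_cm S X" by (rule SS.delta_zero_witnessD[OF JS_ideal Jm X])
  have nf: "\<not> has_free_summand S X" using X by (simp add: SS.delta_zero_witness_def)
  obtain f where f: "f \<in> mod_hom S X ?Q" "f ` carrier X = carrier ?Q"
    using X by (auto simp: SS.delta_zero_witness_def)
  have fg: "fin_gen_mod S X" using mcm by (simp add: maximal_cm_def)
  then have XM: "module S X" by (simp add: fin_gen_mod_def)
  interpret X: module S X by (rule XM)
  note fD = mod_homD[OF f(1)]
  obtain s b where b: "b \<in> {..<s} \<rightarrow> carrier X" "carrier X = {lin X s c b | c. c \<in> carrier (free_mod S s)}"
    using fin_gen_mod_generators[OF fg] by blast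
  let ?F = "free_mod R s"
  define h where "h v = lin X s (\<lambda>i. \<pi> (v i)) b" for v
  have piP: "(\<lambda>i. \<pi> (v i)) \<in> {..<s} \<rightarrow> carrier S" if "v \<in> carrier ?F" for v
    using free_mod_Pi[OF that] pi_carr by blast
  have hs: "semilinear R \<pi> ?F X h"
  proof (rule semilinearI)
    show "h v \<in> carrier X" if "v \<in> carrier ?F" for v unfolding h_def by (rule X.lin_closed[OF piP[OF that] b(1)])
  next
    fix v w assume vw: "v \<in> carrier ?F" "w \<in> carrier ?F"
    show "h (v \<oplus>\<^bsub>?F\<^esub> w) = h v \<oplus>\<^bsub>X\<^esub> h w" unfolding h_def
    proof (rule X.lin_add[OF piP[OF vw(1)] piP[OF vw(2)] b(1)])
      fix i assume "i < s"
      then show "\<pi> ((v \<oplus>\<^bsub>?F\<^esub> w) i) = \<pi> (v i) \<oplus>\<^bsub>S\<^esub> \<pi> (w i)"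
        using ring_hom_add[OF pi_hom, of "v i" "w i"] free_mod_Pi[OF vw(1)] free_mod_Pi[OF vw(2)]
        by (auto simp: free_mod_apply Pi_iff)
    qed
  next
    fix a v assume av: "a \<in> carrier R" "v \<in> carrier ?F"
    show "h (a \<odot>\<^bsub>?F\<^esub> v) = \<pi> a \<odot>\<^bsub>X\<^esub> h v" unfolding h_def
    proof (rule X.lin_smult[OF piP[OF av(2)] b(1) pi_carr[OF av(1)]])
      fix i assume "i < s"
      then show "\<pi> ((a \<odot>\<^bsub>?F\<^esub> v) i) = \<pi> a \<otimes>\<^bsub>S\<^esub> \<pi> (v i)"
        using ring_hom_mult[OF pi_hom, of a "v i"] av(1) free_mod_Pi[OF av(2)] by (auto simp: free_mod_apply Pi_iff)
    qed
  qed
  have ho: "h ` carrier ?F = carrier X"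
  proof
    show "h ` carrier ?F \<subseteq> carrier X" using semilinearD(1)[OF hs] by blast
    show "carrier X \<subseteq> h ` carrier ?F"
    proof
      fix y assume "y \<in> carrier X"
      then obtain c where c: "c \<in> carrier (free_mod S s)" "y = lin X s c b" using b(2) by blast
      have "\<forall>i. \<exists>a. i < s \<longrightarrow> a \<in> carrier R \<and> \<pi> a = c i"
      proof
        fix i show "\<exists>a. i < s \<longrightarrow> a \<in> carrier R \<and> \<pi> a = c i"
        proof (cases "i < s")
          case True
          then have "c i \<in> \<pi> ` carrier R" using free_mod_Pi[OF c(1)] unfolding pi_onto by auto
          then show ?thesis by auto
        qed simp
      qed
      then obtain a where a: "\<And>i. i < s \<Longrightarrow> a i \<in> carrier R \<and> \<pi> (a i) = c i" by metis
      let ?v = "\<lambda>i\<in>{..<s}. a i"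
      have v: "?v \<in> carrier ?F" using a by (simp add: free_mod_def)
      have "h ?v = y" unfolding h_def c(2)
        by (rule X.lin_cong[OF piP[OF v] b(1)]) (use a in auto)
      then show "y \<in> h ` carrier ?F" using v by blast
    qed
  qed
  interpret h: semi_onto R ?F S X \<pi> h
    by (intro semi_onto.intro semi_map.intro semi_map_axioms.intro semi_onto_axioms.intro
        free_mod_module XM pi_hom hs ho)
  let ?K = "h.ker"
  have "depth_ge X (\<pi> ` \<mm>) (length ys) (h ` ?K)"
    using SS.maximal_cm_dep[OF mcm krull_dim_S] by (simp add: h.image_ker)
  then have Kdep: "depth_ge ?F \<mm> (d - r) ?K"
    using h.dep_pullback[OF h.ker_sub subset_refl, of \<mm> "length ys"] mm_carr by auto
  have IK: "a \<odot>\<^bsub>?F\<^esub> v \<in> ?K" if a: "a \<in> II r" and v: "v \<in> carrier ?F" for a v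
  proof -
    have ac: "a \<in> carrier R" using a II_carr[of r] by auto
    have "\<pi> a = \<zero>\<^bsub>S\<^esub>" using pi_zero_iff[OF ac] a unfolding I_eq by simp
    then have "h (a \<odot>\<^bsub>?F\<^esub> v) = \<zero>\<^bsub>X\<^esub>" using h.hD(3)[OF ac v] h.hD(1)[OF v] by simp
    then show ?thesis using module.smult_closed[OF free_mod_module ac v] by (simp add: h.ker_def)
  qed
  interpret P: presentation R \<mm> z d E \<phi> \<omega> \<epsilon> n s r ?K
    by (intro presentation.intro presentation_axioms.intro inj_res_axioms h.ker_sub IK Kdep) simp
  have fh: "semilinear R \<pi> ?F ?Q (\<lambda>v. f (h v))"
    by (rule semilinearI) (use fD h.hD pi_carr in simp_all)
  obtain l where l: "l \<in> mod_hom R ?F (reg_mod R)" "\<And>v. v \<in> carrier ?F \<Longrightarrow> qS g (l v) = f (h v)"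
    using lift_to_ring[OF is_cring S_cring qS_semi pi_hom JS_module qS_onto fh] by blast
  have lc: "l v \<in> carrier R" if "v \<in> carrier ?F" for v using mod_homD(1)[OF l(1) that] by simp
  have lK: "l v \<in> II (r + length ys)" if v: "v \<in> ?K" for v
  proof -
    have vF: "v \<in> carrier ?F" "h v = \<zero>\<^bsub>X\<^esub>" using v by (auto simp: h.ker_def)
    have "qS g (l v) = \<zero>\<^bsub>?Q\<^esub>" using l(2)[OF vF(1)] vF(2) mod_hom_zero_minus(1)[OF XM JS_module f(1)] by simp
    then have "\<pi> (l v) \<in> \<pi> ` ideal_pow R \<mm> g" using qS_zero_iff[OF lc[OF vF(1)]] by (simp add: image_ideal_pow)
    then have "\<pi> (l v) \<in> \<pi> ` II d" using power unfolding II_d_eq by blast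
    moreover have "genideal R (set xs) \<subseteq> II d" unfolding I_eq using II_mono[of r d] by simp
    ultimately show ?thesis using mem_image_ideal_iff[OF II_ideal[of d] _ lc[OF vF(1)]] by simp
  qed
  have "qS g \<one> \<in> f ` (h ` carrier ?F)" unfolding ho f(2) using qS_onto by blast
  then obtain v0 where v0: "v0 \<in> carrier ?F" "qS g (l v0) = qS g \<one>" using l(2) by auto
  then have "\<pi> (l v0 \<ominus> \<one>) \<in> JS g" using qS_eq_iff[OF lc[OF v0(1)] one_closed] by simp
  then have "l v0 \<ominus> \<one> \<in> \<mm>" using pi_JS_mm[OF _ gll_pos] lc[OF v0(1)] by simp
  then have u0: "l v0 \<notin> \<mm>" using not_mm_if_minus_one lc[OF v0(1)] by blast
  obtain l' where l': "l' \<in> mod_hom R ?F (reg_mod R)" "\<forall>v\<in>?K. l' v \<in> II r" "l' v0 \<notin> \<mm>"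
    using P.lift_surjection[OF tr _ l(1) lK v0(1) u0] by auto
  have pl': "semilinear R \<pi> ?F (reg_mod S) (\<lambda>v. \<pi> (l' v))"
    by (rule semilinearI) (use mod_homD[OF l'(1)] pi_carr ring_hom_add[OF pi_hom] ring_hom_mult[OF pi_hom] in simp_all)
  have "\<pi> (l' v) = \<zero>\<^bsub>reg_mod S\<^esub>" if v: "v \<in> ?K" for v
  proof -
    have "l' v \<in> genideal R (set xs)" using l'(2) v unfolding I_eq by blast
    then show ?thesis using pi_zero_iff[of "l' v"] ideal_rules(1)[OF I(1)] by simp
  qed
  then obtain \<psi> where \<psi>: "\<psi> \<in> mod_hom S X (reg_mod S)" "\<forall>v\<in>carrier ?F. \<psi> (h v) = \<pi> (l' v)"
    using h.factor[OF reg_S pl' _ pi_onto] by blast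
  have "\<psi> (h v0) \<notin> \<pi> ` \<mm>" using \<psi>(2) v0(1) pi_mem_mm l'(3) mod_homD(1)[OF l'(1) v0(1)] by simp
  then have "has_free_summand S X" by (rule SS.unit_value_free_summand[OF XM \<psi>(1) h.hD(1)[OF v0(1)]])
  then show False using nf by simp
qed

text \<open>
  Reduction modulo \<open>xs\<close> preserves surjections onto \<open>R/\<mm>\<^sup>k\<close> and maximal Cohen-Macaulay modules. It
  creates no free summand, since a surjection from \<open>X/(xs)X\<close> onto \<open>S\<close> lifts to one from \<open>X\<close> onto \<open>R\<close>.
  The reduction is built as a quotient of \<open>S\<^sup>s\<close>, so that its elements are sets of functions from
  natural numbers to \<open>S\<close>, as in the definition of \<open>\<delta>\<close>.
\<close>

lemma delta_zero_witness_reduction: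
  assumes k: "k \<ge> 1" and X: "delta_zero_witness (ideal_pow R \<mm> k) X"
  shows "\<exists>Y. SS.delta_zero_witness (JS k) Y"
proof -
  define J where "J = ideal_pow R \<mm> k"
  have J: "ideal J R" "J \<subseteq> \<mm>" unfolding J_def by (rule ideal_pow_ideal[OF ideal_mm], rule ideal_pow_le[OF ideal_mm k])
  have GM: "module R (reg_mod R)" by (rule reg_mod_module)
  have Js: "submodule J R (reg_mod R)" using J by (simp add: submodule_reg_iff)
  let ?Q = "quot_mod (reg_mod R) J"
  have QM: "module R ?Q" by (rule module.quot_mod_module[OF GM Js])
  have mcm: "maximal_cm R X" using delta_zero_witnessD[OF J] X by (simp add: J_def)
  have nf: "\<not> has_free_summand R X" using X by (simp add: delta_zero_witness_def)
  obtain f where f: "f \<in> mod_hom R X ?Q" "f ` carrier X = carrier ?Q"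
    using X by (auto simp: delta_zero_witness_def J_def)
  have fg: "fin_gen_mod R X" using mcm by (simp add: maximal_cm_def)
  then have XM: "module R X" by (simp add: fin_gen_mod_def)
  interpret X: module R X by (rule XM)
  obtain s b where b: "b \<in> {..<s} \<rightarrow> carrier X" "carrier X = {lin X s c b | c. c \<in> carrier (free_mod R s)}"
    using fin_gen_mod_generators[OF fg] by blast
  let ?F = "free_mod R s"
  define e where "e v = lin X s v b" for v
  have eh: "e \<in> mod_hom R ?F X" using X.lin_mod_hom[OF b(1)] by (simp add: e_def[abs_def])
  have eo: "e ` carrier ?F = carrier X" using b(2) by (auto simp: e_def)
  have es: "semilinear R (\<lambda>a. a) ?F X e" by (rule semilinearI) (use mod_homD[OF eh] in simp_all)
  interpret e: semi_onto R ?F R X "\<lambda>a. a" e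
    by (intro semi_onto.intro semi_map.intro semi_map_axioms.intro semi_onto_axioms.intro
        free_mod_module XM id_ring_hom es eo)
  let ?K = "e.ker"
  have Kdep: "depth_ge ?F \<mm> (d - 0) ?K"
    using e.dep_pullback[OF e.ker_sub subset_refl, of \<mm> d] maximal_cm_dep[OF mcm dim] mm_carr
    by (auto simp: e.image_ker)
  have IK: "a \<odot>\<^bsub>?F\<^esub> v \<in> ?K" if a: "a \<in> II 0" and v: "v \<in> carrier ?F" for a v
    using a module.smult_l_null[OF free_mod_module v] module.sub_zero[OF free_mod_module e.ker_sub] by simp
  interpret P: presentation R \<mm> z d E \<phi> \<omega> \<epsilon> n s 0 ?K
    by (intro presentation.intro presentation_axioms.intro inj_res_axioms e.ker_sub IK Kdep) simp
  let ?N = "msum ?F z ?K"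
  have N_sub: "submodule (?N j) R ?F" if "j \<le> d" for j using P.N_sub[of j] that by simp
  have N_reg: "reg_on ?F (z j) (?N j)" if "j < d" for j using P.N_reg[of j] that by simp
  have fe: "semilinear R (\<lambda>a. a) ?F ?Q (\<lambda>v. f (e v))"
    by (rule semilinearI) (use mod_homD[OF f(1)] e.hD in simp_all)
  have qs: "semilinear R (\<lambda>a. a) (reg_mod R) ?Q (\<lambda>a. J +>\<^bsub>reg_mod R\<^esub> a)"
    by (rule semilinearI) (use mod_homD[OF module.quot_proj_hom[OF GM Js]] in simp_all)
  have qo: "(\<lambda>a. J +>\<^bsub>reg_mod R\<^esub> a) ` carrier R = carrier ?Q" by (auto simp: quot_mod_simps)
  obtain l where l: "l \<in> mod_hom R ?F (reg_mod R)" "\<And>v. v \<in> carrier ?F \<Longrightarrow> J +>\<^bsub>reg_mod R\<^esub> l v = f (e v)"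
    using lift_to_ring[OF is_cring is_cring qs id_ring_hom QM qo fe] by blast
  have lc: "l v \<in> carrier R" if "v \<in> carrier ?F" for v using mod_homD(1)[OF l(1) that] by simp
  have lK: "l v \<in> J" if v: "v \<in> ?K" for v
  proof -
    have vF: "v \<in> carrier ?F" "e v = \<zero>\<^bsub>X\<^esub>" using v by (auto simp: e.ker_def)
    have "J +>\<^bsub>reg_mod R\<^esub> l v = \<zero>\<^bsub>?Q\<^esub>" using l(2)[OF vF(1)] vF(2) mod_hom_zero_minus(1)[OF XM QM f(1)] by simp
    then show ?thesis using module.quot_proj_zero_iff[OF GM Js, of "l v"] lc[OF vF(1)] by simp
  qed
  have l_onto: "\<exists>v\<in>carrier ?F. l v \<ominus> a \<in> J" if a: "a \<in> carrier R" for a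
  proof -
    have "J +>\<^bsub>reg_mod R\<^esub> a \<in> f ` (e ` carrier ?F)" unfolding eo f(2) using qo a by blast
    then obtain v where v: "v \<in> carrier ?F" "J +>\<^bsub>reg_mod R\<^esub> l v = J +>\<^bsub>reg_mod R\<^esub> a" using l(2) by auto
    then have "l v \<ominus> a \<in> J" using module.coset_eq_iff[OF GM Js, of "l v" a] lc[OF v(1)] a by (simp add: reg_mod_minus)
    then show ?thesis using v(1) by blast
  qed
  obtain v0 where v0: "v0 \<in> carrier ?F" "l v0 \<ominus> \<one> \<in> J" using l_onto[OF one_closed] by blast
  have u0: "l v0 \<notin> \<mm>" using not_mm_if_minus_one lc[OF v0(1)] v0(2) J(2) by blast
  \<comment> \<open>the reduction, as a quotient of \<open>S\<^sup>s\<close>\<close>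
  let ?FS = "free_mod S s"
  interpret FS: module S ?FS by (rule cring.free_mod_module[OF S_cring])
  define hb where "hb v = (\<lambda>i\<in>{..<s}. \<pi> (v i))" for v
  have hbs: "semilinear R \<pi> ?F ?FS hb"
    by (rule semilinearI) (use pi_carr ring_hom_add[OF pi_hom] ring_hom_mult[OF pi_hom] in
       \<open>auto simp: hb_def free_mod_def PiE_iff intro!: ext\<close>)
  have hbo: "hb ` carrier ?F = carrier ?FS"
  proof
    show "hb ` carrier ?F \<subseteq> carrier ?FS" using semilinearD(1)[OF hbs] by blast
    show "carrier ?FS \<subseteq> hb ` carrier ?F"
    proof
      fix c assume c: "c \<in> carrier ?FS"
      have "\<forall>i. \<exists>a. i < s \<longrightarrow> a \<in> carrier R \<and> \<pi> a = c i"
      proof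
        fix i show "\<exists>a. i < s \<longrightarrow> a \<in> carrier R \<and> \<pi> a = c i"
        proof (cases "i < s")
          case True
          then have "c i \<in> \<pi> ` carrier R" using free_mod_Pi[OF c] unfolding pi_onto by auto
          then show ?thesis by auto
        qed simp
      qed
      then obtain a where a: "\<And>i. i < s \<Longrightarrow> a i \<in> carrier R \<and> \<pi> (a i) = c i" by metis
      let ?v = "\<lambda>i\<in>{..<s}. a i"
      have v: "?v \<in> carrier ?F" using a by (simp add: free_mod_def)
      have "hb ?v = c"
      proof
        fix i show "hb ?v i = c i" using a[of i] c by (cases "i < s") (auto simp: hb_def free_mod_def PiE_iff extensional_def)
      qed
      then show "c \<in> hb ` carrier ?F" using v by blast
    qed
  qed
  interpret hb: semi_onto R ?F S ?FS \<pi> hb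
    by (intro semi_onto.intro semi_map.intro semi_map_axioms.intro semi_onto_axioms.intro
        free_mod_module FS.module_axioms pi_hom hbs hbo)
  have Nr: "submodule (?N r) R ?F" using N_sub[of r] by simp
  define KS where "KS = hb ` ?N r"
  have KS: "submodule KS S ?FS" unfolding KS_def by (rule hb.image_sub[OF Nr pi_onto])
  define Y where "Y = quot_mod ?FS KS"
  have YM: "module S Y" unfolding Y_def by (rule FS.quot_mod_module[OF KS])
  interpret Y: module S Y by (rule YM)
  define h where "h v = KS +>\<^bsub>?FS\<^esub> hb v" for v
  note pY = mod_homD[OF FS.quot_proj_hom[OF KS], folded Y_def]
  have hs: "semilinear R \<pi> ?F Y h"
    by (rule semilinearI) (use pY hb.hD pi_carr in \<open>simp_all add: h_def\<close>)
  have ho: "h ` carrier ?F = carrier Y"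
  proof -
    have "h ` carrier ?F = (\<lambda>c. KS +>\<^bsub>?FS\<^esub> c) ` carrier ?FS" by (simp add: hbo[symmetric] image_image h_def)
    then show ?thesis unfolding Y_def by (auto simp: quot_mod_simps)
  qed
  interpret h: semi_onto R ?F S Y \<pi> h
    by (intro semi_onto.intro semi_map.intro semi_map_axioms.intro semi_onto_axioms.intro
        free_mod_module YM pi_hom hs ho)
  have hbker: "hb.ker \<subseteq> ?N r"
  proof
    fix v assume v: "v \<in> hb.ker"
    then have vF: "v \<in> carrier ?F" "hb v = \<zero>\<^bsub>?FS\<^esub>" by (auto simp: hb.ker_def)
    have vi: "v i \<in> carrier R" "\<pi> (v i) = \<zero>\<^bsub>S\<^esub>" if "i < s" for i
    proof -
      show "v i \<in> carrier R" using free_mod_Pi[OF vF(1)] that by auto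
      have "hb v i = \<zero>\<^bsub>?FS\<^esub> i" using vF(2) by simp
      then show "\<pi> (v i) = \<zero>\<^bsub>S\<^esub>" using that by (simp add: hb_def free_mod_apply)
    qed
    have viN: "v i \<odot>\<^bsub>?F\<^esub> unitv R s i \<in> ?N r" if "i < s" for i
    proof -
      have "v i \<in> II r" using pi_zero_iff[OF vi(1)[OF that]] vi(2)[OF that] unfolding I_eq by simp
      then show ?thesis using P.N_II[of r "v i" "unitv R s i"] module.unitv_carrier[OF GM] by simp
    qed
    have uF: "unitv R s \<in> {..<s} \<rightarrow> carrier ?F" using module.unitv_carrier[OF GM] by blast
    have FM: "module R ?F" by (rule free_mod_module)
    have "lin ?F s v (unitv R s) = lin ?F s (\<lambda>_. \<one>) (\<lambda>l. v l \<odot>\<^bsub>?F\<^esub> unitv R s l)"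
      unfolding lin_def
      by (rule abelian_monoid.finsum_cong'[OF abelian_group.axioms(1)[OF module.axioms(2)[OF FM]]])
        (use vi(1) module.unitv_carrier[OF GM] module.smult_closed[OF FM] module.smult_one[OF FM] in auto)
    also have "\<dots> \<in> ?N r"
      using viN by (intro module.lin_in_sub[OF FM Nr]) auto
    finally show "v \<in> ?N r" using lin_reg_unit[OF vF(1)] by simp
  qed
  have hker: "h.ker = ?N r"
  proof -
    have "h v = \<zero>\<^bsub>Y\<^esub> \<longleftrightarrow> v \<in> ?N r" if "v \<in> carrier ?F" for v
      unfolding h_def Y_def FS.quot_proj_zero_iff[OF KS hb.hD(1)[OF that]]
      unfolding KS_def by (rule hb.mem_image_iff[OF Nr hbker that])
    then show ?thesis using module.sub_carr[OF free_mod_module Nr] by (auto simp: h.ker_def)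
  qed
  have im: "msum Y ((!) (map \<pi> ys)) {\<zero>\<^bsub>Y\<^esub>} i = h ` ?N (r + i)" if i: "i \<le> length ys" for i
  proof -
    have "h ` ?N (r + i) = h ` msum ?F (\<lambda>j. z (r + j)) (?N r) i" by (simp only: msum_add)
    also have "\<dots> = msum Y (\<lambda>j. \<pi> (z (r + j))) (h ` ?N r) i"
      using i by (intro h.msum_image Nr z_carr) auto
    also have "h ` ?N r = {\<zero>\<^bsub>Y\<^esub>}" unfolding hker[symmetric] by (rule h.image_ker)
    also have "msum Y (\<lambda>j. \<pi> (z (r + j))) {\<zero>\<^bsub>Y\<^esub>} i = msum Y ((!) (map \<pi> ys)) {\<zero>\<^bsub>Y\<^esub>} i"
      using i by (intro msum_cong) (simp add: z_shift)
    finally show ?thesis by simp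
  qed
  have ysc: "set ys \<subseteq> carrier R" using xys_carr by simp
  have kerN: "h.ker \<subseteq> ?N (r + i)" if "i \<le> length ys" for i
    unfolding hker using module.msum_mono[OF free_mod_module e.ker_sub, of "r + i" z r] z_carr that by simp
  have hom_N: "l v \<in> A" if "ideal A R" "J \<subseteq> A" "\<And>j. j < i \<Longrightarrow> z j \<in> A" "i \<le> d" "v \<in> ?N i" for A i v
    using P.hom_N_in_ideal[OF l(1) that(1), of i v] lK that by auto
  have rs: "regular_seq S Y (map \<pi> ys)" unfolding Y.regular_seq_iff
  proof (intro conjI allI impI)
    show "set (map \<pi> ys) \<subseteq> carrier S" using ysc pi_carr by auto
    fix i assume "i < length (map \<pi> ys)"
    then have i: "i < length ys" by simp
    have "reg_on Y (\<pi> (z (r + i))) (h ` ?N (r + i))"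
      using h.reg_iff[OF N_sub[of "r + i"] kerN[of i] z_carr[of "r + i"]] N_reg[of "r + i"] i by simp
    then show "reg_on Y (map \<pi> ys ! i) (msum Y ((!) (map \<pi> ys)) {\<zero>\<^bsub>Y\<^esub>} i)"
      using im[of i] i by (simp add: z_shift)
  next
    \<comment> \<open>the reduction by the full sequence is nonzero, as \<open>l\<close> maps \<open>N d\<close> into \<open>\<mm>\<close>\<close>
    have "v0 \<notin> ?N d" using hom_N[OF ideal_mm J(2), of d v0] z_mm u0 by auto
    then have "h v0 \<notin> h ` ?N d" using h.mem_image_iff[OF N_sub[of d] _ v0(1)] kerN[of "length ys"] by simp
    then show "msum Y ((!) (map \<pi> ys)) {\<zero>\<^bsub>Y\<^esub>} (length (map \<pi> ys)) \<noteq> carrier Y"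
      using im[of "length ys"] h.hD(1)[OF v0(1)] by auto
  qed
  have fgY: "fin_gen_mod S Y"
  proof (rule fin_gen_modI[OF YM])
    show "(\<lambda>i. KS +>\<^bsub>?FS\<^esub> unitv S s i) \<in> {..<s} \<rightarrow> carrier Y"
      using pY(1) FS.unitv_carrier by blast
    show "carrier Y \<subseteq> {lin Y s c (\<lambda>i. KS +>\<^bsub>?FS\<^esub> unitv S s i) | c. c \<in> carrier ?FS}"
    proof
      fix y assume "y \<in> carrier Y"
      then obtain c where c: "c \<in> carrier ?FS" "y = KS +>\<^bsub>?FS\<^esub> c" unfolding Y_def by (rule quot_mod_carrierE)
      have "KS +>\<^bsub>?FS\<^esub> (lin ?FS s c (unitv S s)) = lin Y s c (\<lambda>i. KS +>\<^bsub>?FS\<^esub> unitv S s i)"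
        using FS.unitv_carrier free_mod_Pi[OF c(1)]
        by (intro mod_hom_lin[OF FS.module_axioms YM FS.quot_proj_hom[OF KS, folded Y_def]]) auto
      then show "y \<in> {lin Y s c (\<lambda>i. KS +>\<^bsub>?FS\<^esub> unitv S s i) | c. c \<in> carrier ?FS}"
        using c cring.lin_reg_unit[OF S_cring c(1)] by auto
    qed
  qed
  have mcmY: "maximal_cm S Y"
  proof (rule SS.maximal_cmI[OF fgY rs])
    show "set (map \<pi> ys) \<subseteq> \<pi> ` \<mm>" using xys_mm by auto
    show "krull_dim S = enat (length (map \<pi> ys))" using krull_dim_S by simp
  qed
  have nfY: "\<not> has_free_summand S Y"
  proof
    assume "has_free_summand S Y"
    then obtain \<psi> y where \<psi>: "\<psi> \<in> mod_hom S Y (reg_mod S)" "y \<in> carrier Y" "\<psi> y = \<one>\<^bsub>S\<^esub>"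
      unfolding has_free_summand_iff[OF YM] by blast
    have ph: "semilinear R \<pi> ?F (reg_mod S) (\<lambda>v. \<psi> (h v))"
      by (rule semilinearI) (use mod_homD[OF \<psi>(1)] h.hD pi_carr in simp_all)
    have po: "\<pi> ` carrier R = carrier (reg_mod S)" using pi_onto by simp
    obtain l1 where l1: "l1 \<in> mod_hom R ?F (reg_mod R)" "\<And>v. v \<in> carrier ?F \<Longrightarrow> \<pi> (l1 v) = \<psi> (h v)"
      using lift_to_ring[OF is_cring S_cring pi_semi pi_hom reg_S po ph] by blast
    have l1c: "l1 v \<in> carrier R" if "v \<in> carrier ?F" for v using mod_homD(1)[OF l1(1) that] by simp
    obtain v1 where v1: "v1 \<in> carrier ?F" "h v1 = y" using ho \<psi>(2) by (metis imageE)
    have l1K: "l1 v \<in> II (0 + r)" if v: "v \<in> ?K" for v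
    proof -
      have vF: "v \<in> carrier ?F" using v by (simp add: e.ker_def)
      have "?K \<subseteq> ?N r" using module.msum_mono[OF free_mod_module e.ker_sub, of r z 0] z_carr by simp
      then have "h v = \<zero>\<^bsub>Y\<^esub>" using v hker by (auto simp: h.ker_def)
      then have "\<pi> (l1 v) = \<zero>\<^bsub>S\<^esub>" using l1(2)[OF vF] mod_hom_zero_minus(1)[OF YM reg_S \<psi>(1)] by simp
      then show ?thesis using pi_zero_iff[OF l1c[OF vF]] unfolding I_eq by simp
    qed
    have "\<pi> (l1 v1) \<notin> \<pi> ` \<mm>" using l1(2)[OF v1(1)] v1(2) \<psi>(3) SS.one_notin by simp
    then have u1: "l1 v1 \<notin> \<mm>" by blast
    obtain l' where l': "l' \<in> mod_hom R ?F (reg_mod R)" "\<forall>v\<in>?K. l' v \<in> II 0" "l' v1 \<notin> \<mm>"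
      using P.lift_surjection[OF tr _ l1(1) l1K v1(1) u1] by auto
    have l's: "semilinear R (\<lambda>a. a) ?F (reg_mod R) l'" by (rule semilinearI) (use mod_homD[OF l'(1)] in simp_all)
    obtain \<chi> where \<chi>: "\<chi> \<in> mod_hom R X (reg_mod R)" "\<forall>v\<in>carrier ?F. \<chi> (e v) = l' v"
      using e.factor[OF reg_mod_module l's] l'(2) by auto
    have "has_free_summand R X"
      by (rule unit_value_free_summand[OF XM \<chi>(1) e.hD(1)[OF v1(1)]]) (use \<chi>(2) v1(1) l'(3) in simp)
    then show False using nf by simp
  qed
  let ?QS = "quot_mod (reg_mod S) (JS k)"
  have gs: "semilinear R \<pi> ?F ?QS (\<lambda>v. qS k (l v))"
    by (rule semilinearI) (use mod_homD[OF l(1)] semilinearD[OF qS_semi] in simp_all)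
  have piJ: "\<pi> a \<in> JS k" if "a \<in> J" for a using that by (simp add: image_ideal_pow[symmetric] J_def)
  have gker: "qS k (l v) = \<zero>\<^bsub>?QS\<^esub>" if v: "v \<in> h.ker" for v
  proof -
    have vF: "v \<in> carrier ?F" using v by (simp add: h.ker_def)
    have "l v \<in> {a \<in> carrier R. \<pi> a \<in> JS k}"
    proof (rule hom_N[where i = r, OF vimage_ideal[OF JS_ideal[of k]]])
      show "J \<subseteq> {a \<in> carrier R. \<pi> a \<in> JS k}" using piJ ideal_rules(1)[OF J(1)] by blast
      show "v \<in> ?N r" using v unfolding hker .
      fix j assume j: "j < r"
      have "z j \<in> genideal R (set xs)"
        using genideal_self[of "set xs"] xys_carr j by (auto simp: nth_append)
      then show "z j \<in> {a \<in> carrier R. \<pi> a \<in> JS k}" using I_le_vimage[OF JS_ideal] by blast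
    qed simp
    then show ?thesis using qS_zero_iff[OF lc[OF vF]] by simp
  qed
  obtain \<psi> where \<psi>: "\<psi> \<in> mod_hom S Y ?QS" "\<forall>v\<in>carrier ?F. \<psi> (h v) = qS k (l v)"
    using h.factor[OF JS_module gs gker pi_onto] by blast
  have "\<psi> ` carrier Y = carrier ?QS"
  proof
    show "\<psi> ` carrier Y \<subseteq> carrier ?QS" using mod_homD(1)[OF \<psi>(1)] by blast
    show "carrier ?QS \<subseteq> \<psi> ` carrier Y"
    proof
      fix y assume "y \<in> carrier ?QS"
      then have "y \<in> qS k ` carrier R" by (simp only: qS_onto)
      then obtain a where a: "y = qS k a" "a \<in> carrier R" by (rule imageE)
      obtain v where v: "v \<in> carrier ?F" "l v \<ominus> a \<in> J" using l_onto[OF a(2)] by (elim bexE) (rule that)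
      have "qS k (l v) = qS k a" by (rule iffD2[OF qS_eq_iff[OF lc[OF v(1)] a(2)] piJ[OF v(2)]])
      then have "y = \<psi> (h v)" using bspec[OF \<psi>(2) v(1)] a(1) by simp
      then show "y \<in> \<psi> ` carrier Y" using h.hD(1)[OF v(1)] by (rule image_eqI)
    qed
  qed
  then have "SS.delta_zero_witness (JS k) Y"
    unfolding SS.delta_zero_witness_def using YM mcmY nfY \<psi>(1) by (intro conjI disjI2 bexI)
  then show ?thesis by blast
qed

text \<open>
  \<open>\<delta>(S/\<mm>\<^sup>gS) = 1\<close> by \<open>no_delta_zero_witness_g\<close>. For \<open>1 \<le> k < g\<close>, \<open>\<delta>(R/\<mm>\<^sup>k) = 0\<close> as the index of \<open>R\<close> is
  \<open>g\<close>, and this passes to \<open>S\<close> by \<open>delta_zero_witness_reduction\<close>.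
\<close>

lemma auslander_index_S:
  assumes "auslander_index R = enat g"
  shows "auslander_index S = enat g"
proof -
  let ?D = "\<lambda>k. auslander_delta S (quot_mod (reg_mod S) (JS k))"
  have ds: "?D k = 0 \<longleftrightarrow> (\<exists>X. SS.delta_zero_witness (JS k) X)" "?D k \<le> 1" for k
    by (rule SS.delta_cyclic[OF JS_ideal])+
  let ?A = "{enat k | k. k \<ge> 1 \<and> ?D k = 1}"
  have "?D g = 1" using ds[of g] no_delta_zero_witness_g by (metis le_neq_implies_less less_one)
  then have gA: "enat g \<in> ?A" using gll_pos by blast
  have "enat g \<le> a" if "a \<in> ?A" for a
  proof -
    obtain k where k: "a = enat k" "k \<ge> 1" "?D k = 1" using \<open>a \<in> ?A\<close> by blast
    show ?thesis
    proof (rule ccontr)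
      assume "\<not> enat g \<le> a"
      then have kg: "k < g" using k(1) by simp
      have "auslander_delta R (quot_mod (reg_mod R) (ideal_pow R \<mm> k)) \<noteq> 1"
      proof
        assume "auslander_delta R (quot_mod (reg_mod R) (ideal_pow R \<mm> k)) = 1"
        then have "auslander_index R \<le> enat k"
          unfolding auslander_index_def max_ideal_eq by (intro Inf_lower) (use k(2) in blast)
        then show False using assms kg by simp
      qed
      then have "auslander_delta R (quot_mod (reg_mod R) (ideal_pow R \<mm> k)) = 0"
        using delta_cyclic(2)[OF ideal_pow_ideal[OF ideal_mm], of k] by linarith
      then obtain X where "delta_zero_witness (ideal_pow R \<mm> k) X"
        unfolding delta_cyclic(1)[OF ideal_pow_ideal[OF ideal_mm]] by blast
      then have "?D k = 0" unfolding ds(1) by (rule delta_zero_witness_reduction[OF k(2)])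
      then show False using k(3) by simp
    qed
  qed
  then have "Inf ?A = enat g" using gA by (intro antisym Inf_lower Inf_greatest) auto
  then show ?thesis unfolding auslander_index_def SS.max_ideal_eq by simp
qed

end

theorem proposition2p19:
  fixes R :: "('a, 'm) ring_scheme"
    and \<omega> :: "('a, 'b, 'n) module_scheme"
    and xs :: "'a list"
  assumes "cohen_macaulay_local R"
    and "canonical_module TYPE('e) R \<omega>"
    and "max_ideal R \<subseteq> trace_ideal R \<omega>"
    and "set xs \<subseteq> max_ideal R"
    and "regular_seq R (reg_mod R) xs"
    and "part_of_gll_witness R xs"
    and "auslander_index R = enat (gen_loewy_length R)"
  shows "auslander_index R = auslander_index (R Quot (genideal R (set xs))) \<and>
    auslander_index (R Quot (genideal R (set xs))) =
      enat (gen_loewy_length (R Quot (genideal R (set xs))))"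
proof -
  define \<mm> where "\<mm> = max_ideal R"
  have "local_ring R" using assms(1) by (simp add: cohen_macaulay_local_def)
  then interpret R: noeth_local R \<mm> unfolding \<mm>_def by (rule local_ring_noeth_local)
  interpret G: module R "reg_mod R" by (rule R.reg_mod_module)
  obtain ys where "gll_witness R (xs @ ys)" using assms(6) by (auto simp: part_of_gll_witness_def)
  then have w: "set (xs @ ys) \<subseteq> \<mm>" "regular_seq R (reg_mod R) (xs @ ys)"
      "enat (length (xs @ ys)) = krull_dim R"
      "ideal_pow R \<mm> (gen_loewy_length R) \<subseteq> genideal R (set (xs @ ys))"
    unfolding gll_witness_def \<mm>_def by blast+
  let ?z = "(!) (xs @ ys)" and ?d = "length (xs @ ys)"
  have wc: "set (xs @ ys) \<subseteq> carrier R" using w(1) R.mm_carr by blast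
  have Im: "genideal R (set (xs @ ys)) \<subseteq> \<mm>" by (rule R.genideal_minimal[OF R.ideal_mm w(1)])
  have Ieq: "genideal R (set (xs @ ys)) = msum (reg_mod R) ?z {\<zero>\<^bsub>R\<^esub>} ?d" by (rule R.genideal_eq_msum[OF wc])
  interpret W: witness R \<mm> ?z ?d
  proof
    fix i assume i: "i < ?d"
    then show "?z i \<in> \<mm>" using w(1) by (meson nth_mem subsetD)
    show "reg_on (reg_mod R) (?z i) (msum (reg_mod R) ?z {\<zero>\<^bsub>R\<^esub>} i)"
      using w(2) i unfolding G.regular_seq_iff by simp
  next
    show "krull_dim R = enat ?d" using w(3) by simp
  next
    fix J assume J: "ideal J R" "msum (reg_mod R) ?z {\<zero>\<^bsub>R\<^esub>} ?d \<subseteq> J" "J \<noteq> carrier R"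
    then have "ideal_pow R \<mm> (gen_loewy_length R) \<subseteq> J" using w(4) Ieq by simp
    then show "\<exists>a\<in>carrier R - J. \<forall>b\<in>\<mm>. b \<otimes>\<^bsub>R\<^esub> a \<in> J" by (rule R.socle_of_power[OF J(1) _ J(3)])
  qed
  have gpos: "gen_loewy_length R \<ge> 1"
  proof (rule ccontr)
    assume "\<not> gen_loewy_length R \<ge> 1"
    then have g0: "gen_loewy_length R = 0" by simp
    have "carrier R \<subseteq> \<mm>" using subset_trans[OF w(4) Im] unfolding g0 ideal_pow_simps .
    then show False using R.one_notin by auto
  qed
  have mcm: "maximal_cm R \<omega>" "finite_inj_dim TYPE('e) R \<omega>" using assms(2) by (auto simp: canonical_module_def)
  have fg: "fin_gen_mod R \<omega>" using mcm(1) by (simp add: maximal_cm_def)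
  obtain n and E :: "nat \<Rightarrow> ('a, 'e) module" and \<phi> :: "nat \<Rightarrow> 'e \<Rightarrow> 'e" and \<epsilon> :: "'b \<Rightarrow> 'e" where
    E0: "(\<forall>i. injective_mod R (E i)) \<and> (\<forall>i>n. carrier (E i) = {\<zero>\<^bsub>E i\<^esub>}) \<and>
        \<epsilon> \<in> mod_hom R \<omega> (E 0) \<and> inj_on \<epsilon> (carrier \<omega>) \<and>
        (\<forall>i. \<phi> i \<in> mod_hom R (E i) (E (Suc i))) \<and>
        \<epsilon> ` carrier \<omega> = a_kernel (E 0) (E 1) (\<phi> 0) \<and>
        (\<forall>i. \<phi> i ` carrier (E i) = a_kernel (E (Suc i)) (E (Suc (Suc i))) (\<phi> (Suc i)))"
    using mcm(2) unfolding finite_inj_dim_def by (elim exE) (rule that, assumption)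
  have E: "injective_mod R (E i)" "n < i \<Longrightarrow> carrier (E i) = {\<zero>\<^bsub>E i\<^esub>}"
       "\<epsilon> \<in> mod_hom R \<omega> (E 0)" "inj_on \<epsilon> (carrier \<omega>)" "\<phi> i \<in> mod_hom R (E i) (E (Suc i))"
       "\<epsilon> ` carrier \<omega> = a_kernel (E 0) (E 1) (\<phi> 0)"
       "\<phi> i ` carrier (E i) = a_kernel (E (Suc i)) (E (Suc (Suc i))) (\<phi> (Suc i))" for i
    by (simp_all only: E0)
  interpret N: inj_res R \<mm> ?z ?d E \<phi> \<omega> \<epsilon> n
  proof (rule inj_res.intro, rule W.witness_axioms, rule inj_res_axioms.intro)
    show "module R (E i)" for i using E(1)[of i] by (simp add: injective_mod_def)
    show "rel_inj R {\<zero>\<^bsub>R\<^esub>} (E i) (carrier (E i)) {\<zero>\<^bsub>E i\<^esub>}" for i by (rule injective_mod_rel_inj[OF E(1)])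
    show "module R \<omega>" using fg by (simp add: fin_gen_mod_def)
    show "acc_mod R \<omega>" by (rule fin_gen_mod_acc[OF R.noetherian_ring_axioms fg])
    show "depth_ge \<omega> \<mm> ?d {\<zero>\<^bsub>\<omega>\<^esub>}" by (rule R.maximal_cm_dep[OF mcm(1)]) (use w(3) in simp)
    show "\<epsilon> ` carrier \<omega> = {e \<in> carrier (E 0). \<phi> 0 e = \<zero>\<^bsub>E 1\<^esub>}" using E(6) by (simp add: a_kernel_def')
    show "\<phi> i ` carrier (E i) = {e \<in> carrier (E (Suc i)). \<phi> (Suc i) e = \<zero>\<^bsub>E (Suc (Suc i))\<^esub>}" for i
      using E(7)[of i] by (simp add: a_kernel_def')
  qed (fact E)+
  have xc: "set xs \<subseteq> carrier R" "set xs \<subseteq> \<mm>" using wc w(1) by auto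
  interpret X: index_reduction R \<mm> xs ys E \<phi> \<omega> \<epsilon> n
  proof (intro index_reduction.intro witness_quot.intro witness_quot_axioms.intro index_reduction_axioms.intro
      local_quot.intro local_quot_axioms.intro)
    show "ideal (genideal R (set xs)) R" by (rule R.genideal_ideal[OF xc(1)])
    show "genideal R (set xs) \<subseteq> \<mm>" by (rule R.genideal_minimal[OF R.ideal_mm xc(2)])
    show "\<mm> \<subseteq> trace_ideal R \<omega>" using assms(3) by (simp add: \<mm>_def)
  qed (fact W.witness_axioms R.noeth_local_axioms N.inj_res_axioms w(4) gpos)+
  show ?thesis using X.auslander_index_S[OF assms(7)] X.gen_loewy_length_S assms(7) by simp
qed

end
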